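(* Let $H$ be a quasi-Hopf algebra and $(\mathbb A,\lambda,\rho,\Phi_\lambda,\Phi_\rho,\Phi_{\lambda,\rho})$ an $H$-bicomodule algebra, with $\Phi_{\lambda,\rho}=\Theta^1\otimes\Theta^2\otimes\Theta^3$. Then the left $H\otimes H^{op}$-comodule algebras $\mathbb A_1=(\mathbb A,\lambda_1,\Phi_{\lambda_1})$ and $\mathbb A_2=(\mathbb A,\lambda_2,\Phi_{\lambda_2})$ are twist equivalent. More exactly, for the element $$U=(\Theta^1\otimes S^{-1}(\Theta^3))\otimes\Theta^2\in(H\otimes H^{op})\otimes\mathbb A$$ one has $$\lambda_2(u)=U\lambda_1(u)U^{-1}\quad\text{for all }u\in\mathbb A,$$ $$\Phi_{\lambda_2}=(1\otimes U)(id\otimes\lambda_1)(U)\,\Phi_{\lambda_1}\,(\Delta\otimes id)(U^{-1}),$$ where $1$, $id$ and $\Delta$ refer to $H\otimes H^{op}$ in the first tensor factors (and $\Delta$ is the comultiplication of $H\otimes H^{op}$).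
   Context: All algebras and spaces are over a field $k$, $\otimes=\otimes_k$; summation is understood. A quasi-bialgebra $(H,\Delta,\varepsilon,\Phi)$: a unital associative algebra $H$, algebra maps $\Delta:H\to H\otimes H$ ($\Delta(h)=h_1\otimes h_2$), $\varepsilon:H\to k$, and an invertible $\Phi=X^1\otimes X^2\otimes X^3\in H^{\otimes3}$, $\Phi^{-1}=x^1\otimes x^2\otimes x^3$, with $(id\otimes\Delta)(\Delta(h))=\Phi(\Delta\otimes id)(\Delta(h))\Phi^{-1}$, $(id\otimes\varepsilon)\Delta=id=(\varepsilon\otimes id)\Delta$, $(1\otimes\Phi)(id\otimes\Delta\otimes id)(\Phi)(\Phi\otimes1)=(id\otimes id\otimes\Delta)(\Phi)(\Delta\otimes id\otimes id)(\Phi)$, $(id\otimes\varepsilon\otimes id)(\Phi)=1\otimes1$. A quasi-Hopf algebra is a quasi-bialgebra with an algebra anti-automorphism $S$ (so $S$ is bijective) and $\alpha,\beta\in H$ such that $S(h_1)\alpha h_2=\varepsilon(h)\alpha$, $h_1\beta S(h_2)=\varepsilon(h)\beta$, $X^1\beta S(X^2)\alpha X^3=1$, $S(x^1)\alpha x^2\beta S(x^3)=1$; by rescaling one assumes $\varepsilon(\alpha)=\varepsilon(\beta)=1$ and $\varepsilon\circ S=\varepsilon$. $H^{op}$ ($H$ with opposite multiplication, same $\Delta,\varepsilon$) is a quasi-bialgebra with reassociator $\Phi^{-1}$, and $H\otimes H^{op}$ is a quasi-bialgebra with componentwise structure and reassociator $(X^1\otimes x^1)\otimes(X^2\otimes x^2)\otimes(X^3\otimes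 x^3)$. Drinfeld twist: $f=f^1\otimes f^2=(S\otimes S)(\Delta^{cop}(x^1))\,\gamma\,\Delta(x^2\beta S(x^3))\in H\otimes H$, where $\Delta^{cop}(h)=h_2\otimes h_1$, $\gamma=S(A^2)\alpha A^3\otimes S(A^1)\alpha A^4$, $A^1\otimes A^2\otimes A^3\otimes A^4=(\Phi\otimes1)(\Delta\otimes id\otimes id)(\Phi^{-1})$; it is invertible, $f^{-1}=g^1\otimes g^2$. A right $H$-comodule algebra: a unital associative algebra $\mathfrak A$, an algebra map $\rho:\mathfrak A\to\mathfrak A\otimes H$, $\rho(a)=a_{\langle0\rangle}\otimes a_{\langle1\rangle}$, and an invertible $\Phi_\rho\in\mathfrak A\otimes H\otimes H$, $\Phi_\rho^{-1}=\tilde x^1_\rho\otimes\tilde x^2_\rho\otimes\tilde x^3_\rho$, with $\Phi_\rho(\rho\otimes id)(\rho(a))=(id\otimes\Delta)(\rho(a))\Phi_\rho$, $(1\otimes\Phi)(id\otimes\Delta\otimes id)(\Phi_\rho)(\Phi_\rho\otimes1)=(id\otimes id\otimes\Delta)(\Phi_\rho)(\rho\otimes id\otimes id)(\Phi_\rho)$, $(id\otimes\varepsilon)\rho=id$, $(id\otimes\varepsilon\otimes id)(\Phi_\rho)=(id\otimes id\otimes\varepsilon)(\Phi_\rho)=1\otimes1$. A left $H$-comodule algebra (over any quasi-bialgebra $H$): a unital associative algebra $\mathfrak B$, an algebra map $\lambda:\mathfrak B\to H\otimes\mathfrak B$, $\lambda(b)=b_{[-1]}\otimes b_{[0]}$,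 and an invertible $\Phi_\lambda=\tilde X^1_\lambda\otimes\tilde X^2_\lambda\otimes\tilde X^3_\lambda\in H\otimes H\otimes\mathfrak B$ with $(id\otimes\lambda)(\lambda(b))\Phi_\lambda=\Phi_\lambda(\Delta\otimes id)(\lambda(b))$, $(1\otimes\Phi_\lambda)(id\otimes\Delta\otimes id)(\Phi_\lambda)(\Phi\otimes1)=(id\otimes id\otimes\lambda)(\Phi_\lambda)(\Delta\otimes id\otimes id)(\Phi_\lambda)$, $(\varepsilon\otimes id)\lambda=id$, $(id\otimes\varepsilon\otimes id)(\Phi_\lambda)=(\varepsilon\otimes id\otimes id)(\Phi_\lambda)=1\otimes1$. An $H$-bicomodule algebra $(\mathbb A,\lambda,\rho,\Phi_\lambda,\Phi_\rho,\Phi_{\lambda,\rho})$: $(\mathbb A,\lambda,\Phi_\lambda)$ is a left and $(\mathbb A,\rho,\Phi_\rho)$ a right $H$-comodule algebra, and $\Phi_{\lambda,\rho}=\Theta^1\otimes\Theta^2\otimes\Theta^3\in H\otimes\mathbb A\otimes H$ is invertible, $\Phi_{\lambda,\rho}^{-1}=\theta^1\otimes\theta^2\otimes\theta^3$, with $\Phi_{\lambda,\rho}(\lambda\otimes id)(\rho(u))=(id\otimes\rho)(\lambda(u))\Phi_{\lambda,\rho}$, $(1\otimes\Phi_{\lambda,\rho})(id\otimes\lambda\otimes id)(\Phi_{\lambda,\rho})(\Phi_\lambda\otimes1)=(id\otimes id\otimes\rho)(\Phi_\lambda)(\Delta\otimes id\otimes id)(\Phi_{\lambda,\rho})$, $(1\otimes\Phi_\rho)(id\otimes\rho\otimes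 id)(\Phi_{\lambda,\rho})(\Phi_{\lambda,\rho}\otimes1)=(id\otimes id\otimes\Delta)(\Phi_{\lambda,\rho})(\lambda\otimes id\otimes id)(\Phi_\rho)$. Iterated indices mean successive application of $\lambda,\rho,\Delta$. The two left $H\otimes H^{op}$-comodule algebra structures on the algebra $\mathbb A$: $\lambda_1(u)=(u_{\langle0\rangle_{[-1]}}\otimes S^{-1}(u_{\langle1\rangle}))\otimes u_{\langle0\rangle_{[0]}}$, $\Phi_{\lambda_1}=(\Theta^1\tilde X^1_\lambda(\tilde x^1_\rho)_{[-1]_1}\otimes S^{-1}(\tilde x^3_\rho g^2))\otimes(\Theta^2_{[-1]}\tilde X^2_\lambda(\tilde x^1_\rho)_{[-1]_2}\otimes S^{-1}(\Theta^3\tilde x^2_\rho g^1))\otimes\Theta^2_{[0]}\tilde X^3_\lambda(\tilde x^1_\rho)_{[0]}$; $\lambda_2(u)=(u_{[-1]}\otimes S^{-1}(u_{[0]_{\langle1\rangle}}))\otimes u_{[0]_{\langle0\rangle}}$, $\Phi_{\lambda_2}=(\tilde X^1_\lambda\otimes S^{-1}(\theta^3\tilde x^3_\rho(\tilde X^3_\lambda)_{\langle1\rangle_2}g^2))\otimes(\theta^1\tilde X^2_\lambda\otimes S^{-1}(\theta^2_{\langle1\rangle}\tilde x^2_\rho(\tilde X^3_\lambda)_{\langle1\rangle_1}g^1))\otimes\theta^2_{\langle0\rangle}\tilde x^1_\rho(\tilde X^3_\lambda)_{\langle0\rangle}$. (Products inside the argument of $S^{-1}$ are products in $H$.) Twist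 equivalence: for a quasi-bialgebra $K$, two left $K$-comodule algebra structures $(\lambda,\Phi_\lambda)$, $(\lambda',\Phi_{\lambda'})$ on the same algebra $\mathfrak B$ are twist equivalent if there is an invertible $U\in K\otimes\mathfrak B$ with $(\varepsilon\otimes id)(U)=1_{\mathfrak B}$, $\lambda'(b)=U\lambda(b)U^{-1}$ for all $b$, and $\Phi_{\lambda'}=(1_K\otimes U)(id_K\otimes\lambda)(U)\Phi_\lambda(\Delta\otimes id_{\mathfrak B})(U^{-1})$. *)

theory Defs
  imports "HOL-Algebra.Module" "HOL-Algebra.RingHom" "HOL-Library.FuncSet"
begin

section \<open>Algebras and linear maps over a field\<close>

text \<open>
  The library locale \<^locale>\<open>algebra\<close> is about commutative algebras only.
  The zero algebra is not excluded.
\<close>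

locale assoc_algebra = field k + module k A + ring A
  for k :: "('k, 'c) ring_scheme" (structure) and A :: "('k, 'a, 'm) module_scheme" (structure) +
  assumes smult_mult_left:
    "\<lbrakk>c \<in> carrier k; x \<in> carrier A; y \<in> carrier A\<rbrakk> \<Longrightarrow>
      (c \<odot>\<^bsub>A\<^esub> x) \<otimes>\<^bsub>A\<^esub> y = c \<odot>\<^bsub>A\<^esub> (x \<otimes>\<^bsub>A\<^esub> y)"
  and smult_mult_right:
    "\<lbrakk>c \<in> carrier k; x \<in> carrier A; y \<in> carrier A\<rbrakk> \<Longrightarrow>
      x \<otimes>\<^bsub>A\<^esub> (c \<odot>\<^bsub>A\<^esub> y) = c \<odot>\<^bsub>A\<^esub> (x \<otimes>\<^bsub>A\<^esub> y)"

definition linear_maps ::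
  "('k, 'c) ring_scheme \<Rightarrow> ('k, 'v, 'm) module_scheme \<Rightarrow> ('k, 'w, 'n) module_scheme \<Rightarrow> ('v \<Rightarrow> 'w) set"
  where
  "linear_maps k V W = {f \<in> carrier V \<rightarrow> carrier W.
     (\<forall>x\<in>carrier V. \<forall>y\<in>carrier V. f (x \<oplus>\<^bsub>V\<^esub> y) = f x \<oplus>\<^bsub>W\<^esub> f y) \<and>
     (\<forall>c\<in>carrier k. \<forall>x\<in>carrier V. f (c \<odot>\<^bsub>V\<^esub> x) = c \<odot>\<^bsub>W\<^esub> f x)}"

definition algebra_maps ::
  "('k, 'c) ring_scheme \<Rightarrow> ('k, 'a, 'm) module_scheme \<Rightarrow> ('k, 'b, 'n) module_scheme \<Rightarrow> ('a \<Rightarrow> 'b) set"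
  where
  "algebra_maps k A B = linear_maps k A B \<inter> ring_hom A B"

definition base_algebra :: "('k, 'c) ring_scheme \<Rightarrow> ('k, 'k) module" where
  "base_algebra k = \<lparr>carrier = carrier k, mult = mult k, one = \<one>\<^bsub>k\<^esub>, zero = \<zero>\<^bsub>k\<^esub>,
     add = add k, smult = mult k\<rparr>"

section \<open>Tensor products over a field\<close>

text \<open>
  \<open>V \<otimes>\<^sub>k W\<close> is the free \<open>k\<close>-module on \<open>carrier V \<times> carrier W\<close>, modulo the submodule generated
  by the bilinearity relations; its elements are cosets.
\<close>

type_synonym ('k, 'v, 'w) tens = "('v \<times> 'w \<Rightarrow> 'k) set"

text \<open>The multiplicative fields are irrelevant here, as only the module structure is used.\<close>

definition free_module :: "('k, 'c) ring_scheme \<Rightarrow> 's set \<Rightarrow> ('k, 's \<Rightarrow> 'k) module" where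
  "free_module k S = \<lparr>
     carrier = {f. range f \<subseteq> carrier k \<and> finite {s. f s \<noteq> \<zero>\<^bsub>k\<^esub>} \<and> {s. f s \<noteq> \<zero>\<^bsub>k\<^esub>} \<subseteq> S},
     mult = undefined, one = undefined,
     zero = (\<lambda>_. \<zero>\<^bsub>k\<^esub>),
     add = (\<lambda>f g s. f s \<oplus>\<^bsub>k\<^esub> g s),
     smult = (\<lambda>c f s. c \<otimes>\<^bsub>k\<^esub> f s)\<rparr>"

definition basis_vector :: "('k, 'c) ring_scheme \<Rightarrow> 's \<Rightarrow> 's \<Rightarrow> 'k" where
  "basis_vector k s = (\<lambda>t. if t = s then \<one>\<^bsub>k\<^esub> else \<zero>\<^bsub>k\<^esub>)"

definition bilinear_relations ::
  "('k, 'c) ring_scheme \<Rightarrow> ('k, 'v, 'm) module_scheme \<Rightarrow> ('k, 'w, 'n) module_scheme \<Rightarrow> ('v \<times> 'w \<Rightarrow> 'k) set"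
  where
  "bilinear_relations k V W =
    (let F = free_module k (carrier V \<times> carrier W); \<delta> = basis_vector k in
      {\<delta> (v \<oplus>\<^bsub>V\<^esub> v', w) \<ominus>\<^bsub>F\<^esub> (\<delta> (v, w) \<oplus>\<^bsub>F\<^esub> \<delta> (v', w)) | v v' w.
         v \<in> carrier V \<and> v' \<in> carrier V \<and> w \<in> carrier W} \<union>
      {\<delta> (v, w \<oplus>\<^bsub>W\<^esub> w') \<ominus>\<^bsub>F\<^esub> (\<delta> (v, w) \<oplus>\<^bsub>F\<^esub> \<delta> (v, w')) | v w w'.
         v \<in> carrier V \<and> w \<in> carrier W \<and> w' \<in> carrier W} \<union>
      {\<delta> (c \<odot>\<^bsub>V\<^esub> v, w) \<ominus>\<^bsub>F\<^esub> c \<odot>\<^bsub>F\<^esub> \<delta> (v, w) | c v w.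
         c \<in> carrier k \<and> v \<in> carrier V \<and> w \<in> carrier W} \<union>
      {\<delta> (v, c \<odot>\<^bsub>W\<^esub> w) \<ominus>\<^bsub>F\<^esub> c \<odot>\<^bsub>F\<^esub> \<delta> (v, w) | c v w.
         c \<in> carrier k \<and> v \<in> carrier V \<and> w \<in> carrier W})"

definition bilinear_null ::
  "('k, 'c) ring_scheme \<Rightarrow> ('k, 'v, 'm) module_scheme \<Rightarrow> ('k, 'w, 'n) module_scheme \<Rightarrow> ('v \<times> 'w \<Rightarrow> 'k) set"
  where
  "bilinear_null k V W = \<Inter>{N. submodule N k (free_module k (carrier V \<times> carrier W)) \<and>
     bilinear_relations k V W \<subseteq> N}"

definition tensor_space ::
  "('k, 'c) ring_scheme \<Rightarrow> ('k, 'v, 'm) module_scheme \<Rightarrow> ('k, 'w, 'n) module_scheme \<Rightarrow>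
   ('k, ('k, 'v, 'w) tens) module"
  where
  "tensor_space k V W =
    (let F = free_module k (carrier V \<times> carrier W); N = bilinear_null k V W in
     \<lparr>carrier = a_rcosets\<^bsub>F\<^esub> N,
      mult = undefined, one = undefined,
      zero = N,
      add = set_add F,
      smult = (\<lambda>c X. \<Union>x\<in>X. N +>\<^bsub>F\<^esub> (c \<odot>\<^bsub>F\<^esub> x))\<rparr>)"

text \<open>\<open>pure k V W v w\<close> is \<open>v \<otimes> w\<close>.\<close>

definition pure ::
  "('k, 'c) ring_scheme \<Rightarrow> ('k, 'v, 'm) module_scheme \<Rightarrow> ('k, 'w, 'n) module_scheme \<Rightarrow>
   'v \<Rightarrow> 'w \<Rightarrow> ('k, 'v, 'w) tens"
  where
  "pure k V W v w =
     bilinear_null k V W +>\<^bsub>free_module k (carrier V \<times> carrier W)\<^esub> basis_vector k (v, w)"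

text \<open>
  Summation notation: if \<open>x = x\<^sup>1 \<otimes> x\<^sup>2 \<in> V \<otimes> W\<close> and \<open>b\<close> is bilinear into \<open>T\<close>, then
  \<open>tsum k V W T x b\<close> is \<open>b x\<^sup>1 x\<^sup>2\<close>, i.e. the value at \<open>x\<close> of the linear map induced by \<open>b\<close>.
\<close>

definition tsum ::
  "('k, 'c) ring_scheme \<Rightarrow> ('k, 'v, 'm) module_scheme \<Rightarrow> ('k, 'w, 'n) module_scheme \<Rightarrow>
   ('k, 't, 'p) module_scheme \<Rightarrow> ('k, 'v, 'w) tens \<Rightarrow> ('v \<Rightarrow> 'w \<Rightarrow> 't) \<Rightarrow> 't"
  where
  "tsum k V W T x b =
    (THE h. h \<in> linear_maps k (tensor_space k V W) T \<and>
            h \<in> extensional (carrier (tensor_space k V W)) \<and>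
            (\<forall>v\<in>carrier V. \<forall>w\<in>carrier W. h (pure k V W v w) = b v w)) x"

definition tensor ::
  "('k, 'a, 'm) module_scheme \<Rightarrow> ('k, 'c) ring_scheme \<Rightarrow> ('k, 'b, 'n) module_scheme \<Rightarrow>
   ('k, ('k, 'a, 'b) tens) module"  (\<open>(_ \<boxtimes>\<^bsub>_\<^esub> _)\<close> [66, 0, 65] 65)
  where
  "A \<boxtimes>\<^bsub>k\<^esub> B = (tensor_space k A B)\<lparr>
     mult := (\<lambda>x y. tsum k A B (tensor_space k A B) x (\<lambda>a b.
               tsum k A B (tensor_space k A B) y (\<lambda>a' b'.
                 pure k A B (a \<otimes>\<^bsub>A\<^esub> a') (b \<otimes>\<^bsub>B\<^esub> b')))),
     one := pure k A B \<one>\<^bsub>A\<^esub> \<one>\<^bsub>B\<^esub>\<rparr>"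

text \<open>
  Multiple tensor products are nested to the right: \<open>A \<boxtimes> B \<boxtimes> C = A \<boxtimes> (B \<boxtimes> C)\<close>, the
  canonical identifications \<open>(A \<otimes> B) \<otimes> C = A \<otimes> (B \<otimes> C)\<close> being made explicit by \<open>assoc\<close>.
\<close>

definition pure3 ::
  "('k, 'c) ring_scheme \<Rightarrow> ('k, 'v1, 'm1) module_scheme \<Rightarrow> ('k, 'v2, 'm2) module_scheme \<Rightarrow>
   ('k, 'v3, 'm3) module_scheme \<Rightarrow> 'v1 \<Rightarrow> 'v2 \<Rightarrow> 'v3 \<Rightarrow> ('k, 'v1, ('k, 'v2, 'v3) tens) tens"
  where
  "pure3 k A B C a b c = pure k A (B \<boxtimes>\<^bsub>k\<^esub> C) a (pure k B C b c)"

definition pure4 ::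
  "('k, 'c) ring_scheme \<Rightarrow> ('k, 'v1, 'm1) module_scheme \<Rightarrow> ('k, 'v2, 'm2) module_scheme \<Rightarrow>
   ('k, 'v3, 'm3) module_scheme \<Rightarrow> ('k, 'v4, 'm4) module_scheme \<Rightarrow>
   'v1 \<Rightarrow> 'v2 \<Rightarrow> 'v3 \<Rightarrow> 'v4 \<Rightarrow> ('k, 'v1, ('k, 'v2, ('k, 'v3, 'v4) tens) tens) tens"
  where
  "pure4 k A B C D a b c d = pure k A (B \<boxtimes>\<^bsub>k\<^esub> C \<boxtimes>\<^bsub>k\<^esub> D) a (pure3 k B C D b c d)"

definition tsum3 ::
  "('k, 'c) ring_scheme \<Rightarrow> ('k, 'v1, 'm1) module_scheme \<Rightarrow> ('k, 'v2, 'm2) module_scheme \<Rightarrow>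
   ('k, 'v3, 'm3) module_scheme \<Rightarrow> ('k, 't, 'p) module_scheme \<Rightarrow>
   ('k, 'v1, ('k, 'v2, 'v3) tens) tens \<Rightarrow> ('v1 \<Rightarrow> 'v2 \<Rightarrow> 'v3 \<Rightarrow> 't) \<Rightarrow> 't"
  where
  "tsum3 k A B C T x g = tsum k A (B \<boxtimes>\<^bsub>k\<^esub> C) T x (\<lambda>a y. tsum k B C T y (\<lambda>b c. g a b c))"

definition tsum4 ::
  "('k, 'c) ring_scheme \<Rightarrow> ('k, 'v1, 'm1) module_scheme \<Rightarrow> ('k, 'v2, 'm2) module_scheme \<Rightarrow>
   ('k, 'v3, 'm3) module_scheme \<Rightarrow> ('k, 'v4, 'm4) module_scheme \<Rightarrow> ('k, 't, 'p) module_scheme \<Rightarrow>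
   ('k, 'v1, ('k, 'v2, ('k, 'v3, 'v4) tens) tens) tens \<Rightarrow>
   ('v1 \<Rightarrow> 'v2 \<Rightarrow> 'v3 \<Rightarrow> 'v4 \<Rightarrow> 't) \<Rightarrow> 't"
  where
  "tsum4 k A B C D T x g =
     tsum k A (B \<boxtimes>\<^bsub>k\<^esub> C \<boxtimes>\<^bsub>k\<^esub> D) T x (\<lambda>a y. tsum3 k B C D T y (\<lambda>b c d. g a b c d))"

definition assoc ::
  "('k, 'c) ring_scheme \<Rightarrow> ('k, 'v1, 'm1) module_scheme \<Rightarrow> ('k, 'v2, 'm2) module_scheme \<Rightarrow>
   ('k, 'v3, 'm3) module_scheme \<Rightarrow>
   ('k, ('k, 'v1, 'v2) tens, 'v3) tens \<Rightarrow> ('k, 'v1, ('k, 'v2, 'v3) tens) tens"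
  where
  "assoc k A B C z =
     tsum k (A \<boxtimes>\<^bsub>k\<^esub> B) C (A \<boxtimes>\<^bsub>k\<^esub> B \<boxtimes>\<^bsub>k\<^esub> C) z (\<lambda>x c.
       tsum k A B (A \<boxtimes>\<^bsub>k\<^esub> B \<boxtimes>\<^bsub>k\<^esub> C) x (\<lambda>a b. pure3 k A B C a b c))"

definition tensor_map ::
  "('k, 'c) ring_scheme \<Rightarrow> ('k, 'v, 'm) module_scheme \<Rightarrow> ('k, 'w, 'n) module_scheme \<Rightarrow>
   ('k, 'v', 'm') module_scheme \<Rightarrow> ('k, 'w', 'n') module_scheme \<Rightarrow>
   ('v \<Rightarrow> 'v') \<Rightarrow> ('w \<Rightarrow> 'w') \<Rightarrow> ('k, 'v, 'w) tens \<Rightarrow> ('k, 'v', 'w') tens"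
  where
  "tensor_map k V W V' W' f g x =
     tsum k V W (V' \<boxtimes>\<^bsub>k\<^esub> W') x (\<lambda>v w. pure k V' W' (f v) (g w))"

text \<open>\<open>id \<otimes> g : A \<otimes> B \<rightarrow> A \<otimes> B'\<close>\<close>

definition map_right ::
  "('k, 'c) ring_scheme \<Rightarrow> ('k, 'v, 'm) module_scheme \<Rightarrow> ('k, 'w, 'n) module_scheme \<Rightarrow>
   ('k, 'w', 'n') module_scheme \<Rightarrow> ('w \<Rightarrow> 'w') \<Rightarrow> ('k, 'v, 'w) tens \<Rightarrow> ('k, 'v, 'w') tens"
  where
  "map_right k A B B' g = tensor_map k A B A B' (\<lambda>a. a) g"

text \<open>\<open>f \<otimes> id : A \<otimes> B \<rightarrow> A\<^sub>1 \<otimes> A\<^sub>2 \<otimes> B\<close> for \<open>f : A \<rightarrow> A\<^sub>1 \<otimes> A\<^sub>2\<close>; here \<open>B\<close> may itself be a tensor product.\<close>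

definition expand_left ::
  "('k, 'c) ring_scheme \<Rightarrow> ('k, 'v, 'm) module_scheme \<Rightarrow> ('k, 'w, 'n) module_scheme \<Rightarrow>
   ('k, 'v1, 'm1) module_scheme \<Rightarrow> ('k, 'v2, 'm2) module_scheme \<Rightarrow>
   ('v \<Rightarrow> ('k, 'v1, 'v2) tens) \<Rightarrow> ('k, 'v, 'w) tens \<Rightarrow> ('k, 'v1, ('k, 'v2, 'w) tens) tens"
  where
  "expand_left k A B A1 A2 f x =
     assoc k A1 A2 B (tensor_map k A B (A1 \<boxtimes>\<^bsub>k\<^esub> A2) B f (\<lambda>b. b) x)"

text \<open>\<open>x \<otimes> 1\<^sub>D \<in> A \<otimes> B \<otimes> C \<otimes> D\<close> for \<open>x \<in> A \<otimes> B \<otimes> C\<close>\<close>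

definition append_one ::
  "('k, 'c) ring_scheme \<Rightarrow> ('k, 'v1, 'm1) module_scheme \<Rightarrow> ('k, 'v2, 'm2) module_scheme \<Rightarrow>
   ('k, 'v3, 'm3) module_scheme \<Rightarrow> ('k, 'v4, 'm4) module_scheme \<Rightarrow>
   ('k, 'v1, ('k, 'v2, 'v3) tens) tens \<Rightarrow> ('k, 'v1, ('k, 'v2, ('k, 'v3, 'v4) tens) tens) tens"
  where
  "append_one k A B C D x =
     tsum3 k A B C (A \<boxtimes>\<^bsub>k\<^esub> B \<boxtimes>\<^bsub>k\<^esub> C \<boxtimes>\<^bsub>k\<^esub> D) x (\<lambda>a b c. pure4 k A B C D a b c \<one>\<^bsub>D\<^esub>)"

text \<open>\<open>e \<otimes> id : A \<otimes> B \<rightarrow> B\<close> and \<open>id \<otimes> e : A \<otimes> B \<rightarrow> A\<close> for a functional \<open>e\<close>\<close>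

definition contract_left ::
  "('k, 'c) ring_scheme \<Rightarrow> ('k, 'v, 'm) module_scheme \<Rightarrow> ('k, 'w, 'n) module_scheme \<Rightarrow>
   ('v \<Rightarrow> 'k) \<Rightarrow> ('k, 'v, 'w) tens \<Rightarrow> 'w"
  where
  "contract_left k A B e x = tsum k A B B x (\<lambda>a b. e a \<odot>\<^bsub>B\<^esub> b)"

definition contract_right ::
  "('k, 'c) ring_scheme \<Rightarrow> ('k, 'v, 'm) module_scheme \<Rightarrow> ('k, 'w, 'n) module_scheme \<Rightarrow>
   ('w \<Rightarrow> 'k) \<Rightarrow> ('k, 'v, 'w) tens \<Rightarrow> 'v"
  where
  "contract_right k A B e x = tsum k A B A x (\<lambda>a b. e b \<odot>\<^bsub>A\<^esub> a)"

section \<open>Quasi-bialgebras and quasi-Hopf algebras\<close>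

record ('k, 'h) qbialg = "('k, 'h) module" +
  comult :: "'h \<Rightarrow> ('k, 'h, 'h) tens"
  counit :: "'h \<Rightarrow> 'k"
  reassoc :: "('k, 'h, ('k, 'h, 'h) tens) tens"

locale quasi_bialgebra = assoc_algebra k H
  for k :: "('k, 'c) ring_scheme" (structure) and H :: "('k, 'h, 'm) qbialg_scheme" (structure) +
  assumes comult_algebra_map: "comult H \<in> algebra_maps k H (H \<boxtimes>\<^bsub>k\<^esub> H)"
  and counit_algebra_map: "counit H \<in> algebra_maps k H (base_algebra k)"
  and reassoc_unit: "reassoc H \<in> Units (H \<boxtimes>\<^bsub>k\<^esub> H \<boxtimes>\<^bsub>k\<^esub> H)"
  and quasi_coassoc: "h \<in> carrier H \<Longrightarrow>
    map_right k H H (H \<boxtimes>\<^bsub>k\<^esub> H) (comult H) (comult H h) =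
    reassoc H \<otimes>\<^bsub>H \<boxtimes>\<^bsub>k\<^esub> H \<boxtimes>\<^bsub>k\<^esub> H\<^esub> expand_left k H H H H (comult H) (comult H h)
      \<otimes>\<^bsub>H \<boxtimes>\<^bsub>k\<^esub> H \<boxtimes>\<^bsub>k\<^esub> H\<^esub> inv\<^bsub>H \<boxtimes>\<^bsub>k\<^esub> H \<boxtimes>\<^bsub>k\<^esub> H\<^esub> reassoc H"
  and counit_right: "h \<in> carrier H \<Longrightarrow> contract_right k H H (counit H) (comult H h) = h"
  and counit_left: "h \<in> carrier H \<Longrightarrow> contract_left k H H (counit H) (comult H h) = h"
  and pentagon:
    "pure k H (H \<boxtimes>\<^bsub>k\<^esub> H \<boxtimes>\<^bsub>k\<^esub> H) \<one>\<^bsub>H\<^esub> (reassoc H)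
       \<otimes>\<^bsub>H \<boxtimes>\<^bsub>k\<^esub> H \<boxtimes>\<^bsub>k\<^esub> H \<boxtimes>\<^bsub>k\<^esub> H\<^esub>
     map_right k H (H \<boxtimes>\<^bsub>k\<^esub> H) (H \<boxtimes>\<^bsub>k\<^esub> H \<boxtimes>\<^bsub>k\<^esub> H) (expand_left k H H H H (comult H)) (reassoc H)
       \<otimes>\<^bsub>H \<boxtimes>\<^bsub>k\<^esub> H \<boxtimes>\<^bsub>k\<^esub> H \<boxtimes>\<^bsub>k\<^esub> H\<^esub>
     append_one k H H H H (reassoc H) =
     map_right k H (H \<boxtimes>\<^bsub>k\<^esub> H) (H \<boxtimes>\<^bsub>k\<^esub> H \<boxtimes>\<^bsub>k\<^esub> H)
       (map_right k H H (H \<boxtimes>\<^bsub>k\<^esub> H) (comult H)) (reassoc H)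
       \<otimes>\<^bsub>H \<boxtimes>\<^bsub>k\<^esub> H \<boxtimes>\<^bsub>k\<^esub> H \<boxtimes>\<^bsub>k\<^esub> H\<^esub>
     expand_left k H (H \<boxtimes>\<^bsub>k\<^esub> H) H H (comult H) (reassoc H)"
  and reassoc_counit:
    "map_right k H (H \<boxtimes>\<^bsub>k\<^esub> H) H (contract_left k H H (counit H)) (reassoc H) =
     \<one>\<^bsub>H \<boxtimes>\<^bsub>k\<^esub> H\<^esub>"

definition op_qbialg :: "('k, 'c) ring_scheme \<Rightarrow> ('k, 'h, 'm) qbialg_scheme \<Rightarrow> ('k, 'h, 'm) qbialg_scheme"
  where
  "op_qbialg k H = H\<lparr>mult := (\<lambda>x y. y \<otimes>\<^bsub>H\<^esub> x), reassoc := inv\<^bsub>H \<boxtimes>\<^bsub>k\<^esub> H \<boxtimes>\<^bsub>k\<^esub> H\<^esub> reassoc H\<rparr>"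

definition tensor_qbialg ::
  "('k, 'c) ring_scheme \<Rightarrow> ('k, 'h, 'm) qbialg_scheme \<Rightarrow> ('k, 'l, 'n) qbialg_scheme \<Rightarrow>
   ('k, ('k, 'h, 'l) tens) qbialg"
  where
  "tensor_qbialg k H L =
    (let K = H \<boxtimes>\<^bsub>k\<^esub> L; p = pure k H L in
     module.extend K (qbialg.fields
       (\<lambda>x. tsum k H L (K \<boxtimes>\<^bsub>k\<^esub> K) x (\<lambda>h l.
          tsum k H H (K \<boxtimes>\<^bsub>k\<^esub> K) (comult H h) (\<lambda>h1 h2.
          tsum k L L (K \<boxtimes>\<^bsub>k\<^esub> K) (comult L l) (\<lambda>l1 l2.
            pure k K K (p h1 l1) (p h2 l2)))))
       (\<lambda>x. tsum k H L (base_algebra k) x (\<lambda>h l. counit H h \<otimes>\<^bsub>k\<^esub> counit L l))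
       (tsum3 k H H H (K \<boxtimes>\<^bsub>k\<^esub> K \<boxtimes>\<^bsub>k\<^esub> K) (reassoc H) (\<lambda>X1 X2 X3.
          tsum3 k L L L (K \<boxtimes>\<^bsub>k\<^esub> K \<boxtimes>\<^bsub>k\<^esub> K) (reassoc L) (\<lambda>Y1 Y2 Y3.
            pure3 k K K K (p X1 Y1) (p X2 Y2) (p X3 Y3))))))"

text \<open>The quasi-bialgebra \<open>H \<otimes> H\<^sup>o\<^sup>p\<close>.\<close>

definition env_qbialg ::
  "('k, 'c) ring_scheme \<Rightarrow> ('k, 'h, 'm) qbialg_scheme \<Rightarrow> ('k, ('k, 'h, 'h) tens) qbialg"
  where
  "env_qbialg k H = tensor_qbialg k H (op_qbialg k H)"

record ('k, 'h) qhopf = "('k, 'h) qbialg" +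
  antipode :: "'h \<Rightarrow> 'h"
  alpha :: 'h
  beta :: 'h

locale quasi_hopf_algebra = quasi_bialgebra k H
  for k :: "('k, 'c) ring_scheme" (structure) and H :: "('k, 'h, 'm) qhopf_scheme" (structure) +
  assumes antipode_anti: "antipode H \<in> algebra_maps k H (op_qbialg k H)"
  and antipode_bij: "bij_betw (antipode H) (carrier H) (carrier H)"
  and alpha_closed: "alpha H \<in> carrier H"
  and beta_closed: "beta H \<in> carrier H"
  and antipode_alpha: "h \<in> carrier H \<Longrightarrow>
    tsum k H H H (comult H h) (\<lambda>h1 h2. antipode H h1 \<otimes>\<^bsub>H\<^esub> alpha H \<otimes>\<^bsub>H\<^esub> h2) =
    counit H h \<odot>\<^bsub>H\<^esub> alpha H"
  and antipode_beta: "h \<in> carrier H \<Longrightarrow>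
    tsum k H H H (comult H h) (\<lambda>h1 h2. h1 \<otimes>\<^bsub>H\<^esub> beta H \<otimes>\<^bsub>H\<^esub> antipode H h2) =
    counit H h \<odot>\<^bsub>H\<^esub> beta H"
  and reassoc_antipode:
    "tsum3 k H H H H (reassoc H) (\<lambda>X1 X2 X3.
       X1 \<otimes>\<^bsub>H\<^esub> beta H \<otimes>\<^bsub>H\<^esub> antipode H X2 \<otimes>\<^bsub>H\<^esub> alpha H \<otimes>\<^bsub>H\<^esub> X3) = \<one>\<^bsub>H\<^esub>"
  and reassoc_inv_antipode:
    "tsum3 k H H H H (inv\<^bsub>H \<boxtimes>\<^bsub>k\<^esub> H \<boxtimes>\<^bsub>k\<^esub> H\<^esub> reassoc H) (\<lambda>x1 x2 x3.
       antipode H x1 \<otimes>\<^bsub>H\<^esub> alpha H \<otimes>\<^bsub>H\<^esub> x2 \<otimes>\<^bsub>H\<^esub> beta H \<otimes>\<^bsub>H\<^esub> antipode H x3) = \<one>\<^bsub>H\<^esub>"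
  and counit_alpha: "counit H (alpha H) = \<one>\<^bsub>k\<^esub>"
  and counit_beta: "counit H (beta H) = \<one>\<^bsub>k\<^esub>"
  and counit_antipode: "h \<in> carrier H \<Longrightarrow> counit H (antipode H h) = counit H h"

definition antipode_inv :: "('k, 'h, 'm) qhopf_scheme \<Rightarrow> 'h \<Rightarrow> 'h" where
  "antipode_inv H = inv_into (carrier H) (antipode H)"

text \<open>The element \<open>\<gamma>\<close> and the Drinfeld twist \<open>f\<close>, both in \<open>H \<otimes> H\<close>.\<close>

definition drinfeld_gamma ::
  "('k, 'c) ring_scheme \<Rightarrow> ('k, 'h, 'm) qhopf_scheme \<Rightarrow> ('k, 'h, 'h) tens"
  where
  "drinfeld_gamma k H =
     tsum4 k H H H H (H \<boxtimes>\<^bsub>k\<^esub> H)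
       (append_one k H H H H (reassoc H) \<otimes>\<^bsub>H \<boxtimes>\<^bsub>k\<^esub> H \<boxtimes>\<^bsub>k\<^esub> H \<boxtimes>\<^bsub>k\<^esub> H\<^esub>
        expand_left k H (H \<boxtimes>\<^bsub>k\<^esub> H) H H (comult H) (inv\<^bsub>H \<boxtimes>\<^bsub>k\<^esub> H \<boxtimes>\<^bsub>k\<^esub> H\<^esub> reassoc H))
       (\<lambda>A1 A2 A3 A4. pure k H H (antipode H A2 \<otimes>\<^bsub>H\<^esub> alpha H \<otimes>\<^bsub>H\<^esub> A3)
                                (antipode H A1 \<otimes>\<^bsub>H\<^esub> alpha H \<otimes>\<^bsub>H\<^esub> A4))"

definition drinfeld_twist ::
  "('k, 'c) ring_scheme \<Rightarrow> ('k, 'h, 'm) qhopf_scheme \<Rightarrow> ('k, 'h, 'h) tens"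
  where
  "drinfeld_twist k H =
     tsum3 k H H H (H \<boxtimes>\<^bsub>k\<^esub> H) (inv\<^bsub>H \<boxtimes>\<^bsub>k\<^esub> H \<boxtimes>\<^bsub>k\<^esub> H\<^esub> reassoc H) (\<lambda>x1 x2 x3.
       tsum k H H (H \<boxtimes>\<^bsub>k\<^esub> H) (comult H x1) (\<lambda>h1 h2. pure k H H (antipode H h2) (antipode H h1))
         \<otimes>\<^bsub>H \<boxtimes>\<^bsub>k\<^esub> H\<^esub> drinfeld_gamma k H
         \<otimes>\<^bsub>H \<boxtimes>\<^bsub>k\<^esub> H\<^esub> comult H (x2 \<otimes>\<^bsub>H\<^esub> beta H \<otimes>\<^bsub>H\<^esub> antipode H x3))"

section \<open>Comodule algebras and bicomodule algebras\<close>

locale right_comodule_algebra = quasi_bialgebra k H + A: assoc_algebra k A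
  for k :: "('k, 'c) ring_scheme" (structure) and H :: "('k, 'h, 'm) qbialg_scheme" (structure)
    and A :: "('k, 'a, 'n) module_scheme" (structure)
    and \<rho> :: "'a \<Rightarrow> ('k, 'a, 'h) tens"
    and \<Phi>\<rho> :: "('k, 'a, ('k, 'h, 'h) tens) tens" +
  assumes coact_algebra_map: "\<rho> \<in> algebra_maps k A (A \<boxtimes>\<^bsub>k\<^esub> H)"
  and reassoc_unit: "\<Phi>\<rho> \<in> Units (A \<boxtimes>\<^bsub>k\<^esub> H \<boxtimes>\<^bsub>k\<^esub> H)"
  and quasi_coassoc: "a \<in> carrier A \<Longrightarrow>
    \<Phi>\<rho> \<otimes>\<^bsub>A \<boxtimes>\<^bsub>k\<^esub> H \<boxtimes>\<^bsub>k\<^esub> H\<^esub> expand_left k A H A H \<rho> (\<rho> a) =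
    map_right k A H (H \<boxtimes>\<^bsub>k\<^esub> H) (comult H) (\<rho> a) \<otimes>\<^bsub>A \<boxtimes>\<^bsub>k\<^esub> H \<boxtimes>\<^bsub>k\<^esub> H\<^esub> \<Phi>\<rho>"
  and pentagon:
    "pure k A (H \<boxtimes>\<^bsub>k\<^esub> H \<boxtimes>\<^bsub>k\<^esub> H) \<one>\<^bsub>A\<^esub> (reassoc H)
       \<otimes>\<^bsub>A \<boxtimes>\<^bsub>k\<^esub> H \<boxtimes>\<^bsub>k\<^esub> H \<boxtimes>\<^bsub>k\<^esub> H\<^esub>
     map_right k A (H \<boxtimes>\<^bsub>k\<^esub> H) (H \<boxtimes>\<^bsub>k\<^esub> H \<boxtimes>\<^bsub>k\<^esub> H) (expand_left k H H H H (comult H)) \<Phi>\<rho>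
       \<otimes>\<^bsub>A \<boxtimes>\<^bsub>k\<^esub> H \<boxtimes>\<^bsub>k\<^esub> H \<boxtimes>\<^bsub>k\<^esub> H\<^esub>
     append_one k A H H H \<Phi>\<rho> =
     map_right k A (H \<boxtimes>\<^bsub>k\<^esub> H) (H \<boxtimes>\<^bsub>k\<^esub> H \<boxtimes>\<^bsub>k\<^esub> H)
       (map_right k H H (H \<boxtimes>\<^bsub>k\<^esub> H) (comult H)) \<Phi>\<rho>
       \<otimes>\<^bsub>A \<boxtimes>\<^bsub>k\<^esub> H \<boxtimes>\<^bsub>k\<^esub> H \<boxtimes>\<^bsub>k\<^esub> H\<^esub>
     expand_left k A (H \<boxtimes>\<^bsub>k\<^esub> H) A H \<rho> \<Phi>\<rho>"
  and coact_counit: "a \<in> carrier A \<Longrightarrow> contract_right k A H (counit H) (\<rho> a) = a"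
  and reassoc_counit_mid:
    "map_right k A (H \<boxtimes>\<^bsub>k\<^esub> H) H (contract_left k H H (counit H)) \<Phi>\<rho> = \<one>\<^bsub>A \<boxtimes>\<^bsub>k\<^esub> H\<^esub>"
  and reassoc_counit_right:
    "map_right k A (H \<boxtimes>\<^bsub>k\<^esub> H) H (contract_right k H H (counit H)) \<Phi>\<rho> = \<one>\<^bsub>A \<boxtimes>\<^bsub>k\<^esub> H\<^esub>"

locale left_comodule_algebra = quasi_bialgebra k H + B: assoc_algebra k B
  for k :: "('k, 'c) ring_scheme" (structure) and H :: "('k, 'h, 'm) qbialg_scheme" (structure)
    and B :: "('k, 'b, 'n) module_scheme" (structure)
    and lam :: "'b \<Rightarrow> ('k, 'h, 'b) tens"
    and \<Phi>l :: "('k, 'h, ('k, 'h, 'b) tens) tens" +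
  assumes coact_algebra_map: "lam \<in> algebra_maps k B (H \<boxtimes>\<^bsub>k\<^esub> B)"
  and reassoc_unit: "\<Phi>l \<in> Units (H \<boxtimes>\<^bsub>k\<^esub> H \<boxtimes>\<^bsub>k\<^esub> B)"
  and quasi_coassoc: "b \<in> carrier B \<Longrightarrow>
    map_right k H B (H \<boxtimes>\<^bsub>k\<^esub> B) lam (lam b) \<otimes>\<^bsub>H \<boxtimes>\<^bsub>k\<^esub> H \<boxtimes>\<^bsub>k\<^esub> B\<^esub> \<Phi>l =
    \<Phi>l \<otimes>\<^bsub>H \<boxtimes>\<^bsub>k\<^esub> H \<boxtimes>\<^bsub>k\<^esub> B\<^esub> expand_left k H B H H (comult H) (lam b)"
  and pentagon:
    "pure k H (H \<boxtimes>\<^bsub>k\<^esub> H \<boxtimes>\<^bsub>k\<^esub> B) \<one>\<^bsub>H\<^esub> \<Phi>l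
       \<otimes>\<^bsub>H \<boxtimes>\<^bsub>k\<^esub> H \<boxtimes>\<^bsub>k\<^esub> H \<boxtimes>\<^bsub>k\<^esub> B\<^esub>
     map_right k H (H \<boxtimes>\<^bsub>k\<^esub> B) (H \<boxtimes>\<^bsub>k\<^esub> H \<boxtimes>\<^bsub>k\<^esub> B) (expand_left k H B H H (comult H)) \<Phi>l
       \<otimes>\<^bsub>H \<boxtimes>\<^bsub>k\<^esub> H \<boxtimes>\<^bsub>k\<^esub> H \<boxtimes>\<^bsub>k\<^esub> B\<^esub>
     append_one k H H H B (reassoc H) =
     map_right k H (H \<boxtimes>\<^bsub>k\<^esub> B) (H \<boxtimes>\<^bsub>k\<^esub> H \<boxtimes>\<^bsub>k\<^esub> B) (map_right k H B (H \<boxtimes>\<^bsub>k\<^esub> B) lam) \<Phi>l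
       \<otimes>\<^bsub>H \<boxtimes>\<^bsub>k\<^esub> H \<boxtimes>\<^bsub>k\<^esub> H \<boxtimes>\<^bsub>k\<^esub> B\<^esub>
     expand_left k H (H \<boxtimes>\<^bsub>k\<^esub> B) H H (comult H) \<Phi>l"
  and coact_counit: "b \<in> carrier B \<Longrightarrow> contract_left k H B (counit H) (lam b) = b"
  and reassoc_counit_mid:
    "map_right k H (H \<boxtimes>\<^bsub>k\<^esub> B) B (contract_left k H B (counit H)) \<Phi>l = \<one>\<^bsub>H \<boxtimes>\<^bsub>k\<^esub> B\<^esub>"
  and reassoc_counit_left:
    "contract_left k H (H \<boxtimes>\<^bsub>k\<^esub> B) (counit H) \<Phi>l = \<one>\<^bsub>H \<boxtimes>\<^bsub>k\<^esub> B\<^esub>"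

locale bicomodule_algebra =
  left: left_comodule_algebra k H A lam \<Phi>l + right: right_comodule_algebra k H A \<rho> \<Phi>\<rho>
  for k :: "('k, 'c) ring_scheme" (structure) and H :: "('k, 'h, 'm) qbialg_scheme" (structure)
    and A :: "('k, 'a, 'n) module_scheme" (structure)
    and lam :: "'a \<Rightarrow> ('k, 'h, 'a) tens" and \<rho> :: "'a \<Rightarrow> ('k, 'a, 'h) tens"
    and \<Phi>l :: "('k, 'h, ('k, 'h, 'a) tens) tens"
    and \<Phi>\<rho> :: "('k, 'a, ('k, 'h, 'h) tens) tens"
    and \<Phi>l\<rho> :: "('k, 'h, ('k, 'a, 'h) tens) tens" +
  assumes mixed_unit: "\<Phi>l\<rho> \<in> Units (H \<boxtimes>\<^bsub>k\<^esub> A \<boxtimes>\<^bsub>k\<^esub> H)"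
  and mixed_coassoc: "u \<in> carrier A \<Longrightarrow>
    \<Phi>l\<rho> \<otimes>\<^bsub>H \<boxtimes>\<^bsub>k\<^esub> A \<boxtimes>\<^bsub>k\<^esub> H\<^esub> expand_left k A H H A lam (\<rho> u) =
    map_right k H A (A \<boxtimes>\<^bsub>k\<^esub> H) \<rho> (lam u) \<otimes>\<^bsub>H \<boxtimes>\<^bsub>k\<^esub> A \<boxtimes>\<^bsub>k\<^esub> H\<^esub> \<Phi>l\<rho>"
  and mixed_pentagon_left:
    "pure k H (H \<boxtimes>\<^bsub>k\<^esub> A \<boxtimes>\<^bsub>k\<^esub> H) \<one>\<^bsub>H\<^esub> \<Phi>l\<rho>
       \<otimes>\<^bsub>H \<boxtimes>\<^bsub>k\<^esub> H \<boxtimes>\<^bsub>k\<^esub> A \<boxtimes>\<^bsub>k\<^esub> H\<^esub>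
     map_right k H (A \<boxtimes>\<^bsub>k\<^esub> H) (H \<boxtimes>\<^bsub>k\<^esub> A \<boxtimes>\<^bsub>k\<^esub> H) (expand_left k A H H A lam) \<Phi>l\<rho>
       \<otimes>\<^bsub>H \<boxtimes>\<^bsub>k\<^esub> H \<boxtimes>\<^bsub>k\<^esub> A \<boxtimes>\<^bsub>k\<^esub> H\<^esub>
     append_one k H H A H \<Phi>l =
     map_right k H (H \<boxtimes>\<^bsub>k\<^esub> A) (H \<boxtimes>\<^bsub>k\<^esub> A \<boxtimes>\<^bsub>k\<^esub> H) (map_right k H A (A \<boxtimes>\<^bsub>k\<^esub> H) \<rho>) \<Phi>l
       \<otimes>\<^bsub>H \<boxtimes>\<^bsub>k\<^esub> H \<boxtimes>\<^bsub>k\<^esub> A \<boxtimes>\<^bsub>k\<^esub> H\<^esub>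
     expand_left k H (A \<boxtimes>\<^bsub>k\<^esub> H) H H (comult H) \<Phi>l\<rho>"
  and mixed_pentagon_right:
    "pure k H (A \<boxtimes>\<^bsub>k\<^esub> H \<boxtimes>\<^bsub>k\<^esub> H) \<one>\<^bsub>H\<^esub> \<Phi>\<rho>
       \<otimes>\<^bsub>H \<boxtimes>\<^bsub>k\<^esub> A \<boxtimes>\<^bsub>k\<^esub> H \<boxtimes>\<^bsub>k\<^esub> H\<^esub>
     map_right k H (A \<boxtimes>\<^bsub>k\<^esub> H) (A \<boxtimes>\<^bsub>k\<^esub> H \<boxtimes>\<^bsub>k\<^esub> H) (expand_left k A H A H \<rho>) \<Phi>l\<rho>
       \<otimes>\<^bsub>H \<boxtimes>\<^bsub>k\<^esub> A \<boxtimes>\<^bsub>k\<^esub> H \<boxtimes>\<^bsub>k\<^esub> H\<^esub>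
     append_one k H A H H \<Phi>l\<rho> =
     map_right k H (A \<boxtimes>\<^bsub>k\<^esub> H) (A \<boxtimes>\<^bsub>k\<^esub> H \<boxtimes>\<^bsub>k\<^esub> H)
       (map_right k A H (H \<boxtimes>\<^bsub>k\<^esub> H) (comult H)) \<Phi>l\<rho>
       \<otimes>\<^bsub>H \<boxtimes>\<^bsub>k\<^esub> A \<boxtimes>\<^bsub>k\<^esub> H \<boxtimes>\<^bsub>k\<^esub> H\<^esub>
     expand_left k A (H \<boxtimes>\<^bsub>k\<^esub> H) H A lam \<Phi>\<rho>"

section \<open>The two structures over \<open>H \<otimes> H\<^sup>o\<^sup>p\<close>\<close>

text \<open>\<open>env_pure k H h h'\<close> is \<open>h \<otimes> h' \<in> H \<otimes> H\<^sup>o\<^sup>p\<close>.\<close>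

definition env_pure ::
  "('k, 'c) ring_scheme \<Rightarrow> ('k, 'h, 'm) qbialg_scheme \<Rightarrow> 'h \<Rightarrow> 'h \<Rightarrow> ('k, 'h, 'h) tens"
  where
  "env_pure k H = pure k H (op_qbialg k H)"

definition lambda1 ::
  "('k, 'c) ring_scheme \<Rightarrow> ('k, 'h, 'm) qhopf_scheme \<Rightarrow> ('k, 'a, 'n) module_scheme \<Rightarrow>
   ('a \<Rightarrow> ('k, 'h, 'a) tens) \<Rightarrow> ('a \<Rightarrow> ('k, 'a, 'h) tens) \<Rightarrow>
   'a \<Rightarrow> ('k, ('k, 'h, 'h) tens, 'a) tens"
  where
  "lambda1 k H A lam \<rho> u =
    (let K = env_qbialg k H; T = K \<boxtimes>\<^bsub>k\<^esub> A in
     tsum k A H T (\<rho> u) (\<lambda>u0 u1.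
     tsum k H A T (lam u0) (\<lambda>m z.
       pure k K A (env_pure k H m (antipode_inv H u1)) z)))"

definition lambda2 ::
  "('k, 'c) ring_scheme \<Rightarrow> ('k, 'h, 'm) qhopf_scheme \<Rightarrow> ('k, 'a, 'n) module_scheme \<Rightarrow>
   ('a \<Rightarrow> ('k, 'h, 'a) tens) \<Rightarrow> ('a \<Rightarrow> ('k, 'a, 'h) tens) \<Rightarrow>
   'a \<Rightarrow> ('k, ('k, 'h, 'h) tens, 'a) tens"
  where
  "lambda2 k H A lam \<rho> u =
    (let K = env_qbialg k H; T = K \<boxtimes>\<^bsub>k\<^esub> A in
     tsum k H A T (lam u) (\<lambda>m u0.
     tsum k A H T (\<rho> u0) (\<lambda>z p.
       pure k K A (env_pure k H m (antipode_inv H p)) z)))"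

definition Phi_lambda1 ::
  "('k, 'c) ring_scheme \<Rightarrow> ('k, 'h, 'm) qhopf_scheme \<Rightarrow> ('k, 'a, 'n) module_scheme \<Rightarrow>
   ('a \<Rightarrow> ('k, 'h, 'a) tens) \<Rightarrow>
   ('k, 'h, ('k, 'h, 'a) tens) tens \<Rightarrow> ('k, 'a, ('k, 'h, 'h) tens) tens \<Rightarrow>
   ('k, 'h, ('k, 'a, 'h) tens) tens \<Rightarrow>
   ('k, ('k, 'h, 'h) tens, ('k, ('k, 'h, 'h) tens, 'a) tens) tens"
  where
  "Phi_lambda1 k H A lam \<Phi>l \<Phi>\<rho> \<Phi>l\<rho> =
    (let K = env_qbialg k H; T = K \<boxtimes>\<^bsub>k\<^esub> K \<boxtimes>\<^bsub>k\<^esub> A in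
     tsum3 k H A H T \<Phi>l\<rho> (\<lambda>\<Theta>1 \<Theta>2 \<Theta>3.
     tsum k H A T (lam \<Theta>2) (\<lambda>\<Theta>2m \<Theta>2z.
     tsum3 k H H A T \<Phi>l (\<lambda>X1 X2 X3.
     tsum3 k A H H T (inv\<^bsub>A \<boxtimes>\<^bsub>k\<^esub> H \<boxtimes>\<^bsub>k\<^esub> H\<^esub> \<Phi>\<rho>) (\<lambda>x1 x2 x3.
     tsum k H A T (lam x1) (\<lambda>x1m x1z.
     tsum k H H T (comult H x1m) (\<lambda>x1m1 x1m2.
     tsum k H H T (inv\<^bsub>H \<boxtimes>\<^bsub>k\<^esub> H\<^esub> drinfeld_twist k H) (\<lambda>g1 g2.
       pure3 k K K A
         (env_pure k H (\<Theta>1 \<otimes>\<^bsub>H\<^esub> X1 \<otimes>\<^bsub>H\<^esub> x1m1) (antipode_inv H (x3 \<otimes>\<^bsub>H\<^esub> g2)))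
         (env_pure k H (\<Theta>2m \<otimes>\<^bsub>H\<^esub> X2 \<otimes>\<^bsub>H\<^esub> x1m2)
           (antipode_inv H (\<Theta>3 \<otimes>\<^bsub>H\<^esub> x2 \<otimes>\<^bsub>H\<^esub> g1)))
         (\<Theta>2z \<otimes>\<^bsub>A\<^esub> X3 \<otimes>\<^bsub>A\<^esub> x1z)))))))))"

definition Phi_lambda2 ::
  "('k, 'c) ring_scheme \<Rightarrow> ('k, 'h, 'm) qhopf_scheme \<Rightarrow> ('k, 'a, 'n) module_scheme \<Rightarrow>
   ('a \<Rightarrow> ('k, 'a, 'h) tens) \<Rightarrow>
   ('k, 'h, ('k, 'h, 'a) tens) tens \<Rightarrow> ('k, 'a, ('k, 'h, 'h) tens) tens \<Rightarrow>
   ('k, 'h, ('k, 'a, 'h) tens) tens \<Rightarrow>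
   ('k, ('k, 'h, 'h) tens, ('k, ('k, 'h, 'h) tens, 'a) tens) tens"
  where
  "Phi_lambda2 k H A \<rho> \<Phi>l \<Phi>\<rho> \<Phi>l\<rho> =
    (let K = env_qbialg k H; T = K \<boxtimes>\<^bsub>k\<^esub> K \<boxtimes>\<^bsub>k\<^esub> A in
     tsum3 k H H A T \<Phi>l (\<lambda>X1 X2 X3.
     tsum k A H T (\<rho> X3) (\<lambda>X3z X3p.
     tsum k H H T (comult H X3p) (\<lambda>X3p1 X3p2.
     tsum3 k H A H T (inv\<^bsub>H \<boxtimes>\<^bsub>k\<^esub> A \<boxtimes>\<^bsub>k\<^esub> H\<^esub> \<Phi>l\<rho>) (\<lambda>\<theta>1 \<theta>2 \<theta>3.
     tsum k A H T (\<rho> \<theta>2) (\<lambda>\<theta>2z \<theta>2p.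
     tsum3 k A H H T (inv\<^bsub>A \<boxtimes>\<^bsub>k\<^esub> H \<boxtimes>\<^bsub>k\<^esub> H\<^esub> \<Phi>\<rho>) (\<lambda>x1 x2 x3.
     tsum k H H T (inv\<^bsub>H \<boxtimes>\<^bsub>k\<^esub> H\<^esub> drinfeld_twist k H) (\<lambda>g1 g2.
       pure3 k K K A
         (env_pure k H X1
           (antipode_inv H (\<theta>3 \<otimes>\<^bsub>H\<^esub> x3 \<otimes>\<^bsub>H\<^esub> X3p2 \<otimes>\<^bsub>H\<^esub> g2)))
         (env_pure k H (\<theta>1 \<otimes>\<^bsub>H\<^esub> X2)
           (antipode_inv H (\<theta>2p \<otimes>\<^bsub>H\<^esub> x2 \<otimes>\<^bsub>H\<^esub> X3p1 \<otimes>\<^bsub>H\<^esub> g1)))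
         (\<theta>2z \<otimes>\<^bsub>A\<^esub> x1 \<otimes>\<^bsub>A\<^esub> X3z)))))))))"

section \<open>Twist equivalence\<close>

definition twists_to ::
  "('k, 'c) ring_scheme \<Rightarrow> ('k, 'h, 'm) qbialg_scheme \<Rightarrow> ('k, 'b, 'n) module_scheme \<Rightarrow>
   ('k, 'h, 'b) tens \<Rightarrow>
   ('b \<Rightarrow> ('k, 'h, 'b) tens) \<Rightarrow> ('k, 'h, ('k, 'h, 'b) tens) tens \<Rightarrow>
   ('b \<Rightarrow> ('k, 'h, 'b) tens) \<Rightarrow> ('k, 'h, ('k, 'h, 'b) tens) tens \<Rightarrow> bool"
  where
  "twists_to k K B U lam \<Phi>l lam' \<Phi>l' \<longleftrightarrow>
     U \<in> Units (K \<boxtimes>\<^bsub>k\<^esub> B) \<and>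
     contract_left k K B (counit K) U = \<one>\<^bsub>B\<^esub> \<and>
     (\<forall>b\<in>carrier B. lam' b = U \<otimes>\<^bsub>K \<boxtimes>\<^bsub>k\<^esub> B\<^esub> lam b \<otimes>\<^bsub>K \<boxtimes>\<^bsub>k\<^esub> B\<^esub> inv\<^bsub>K \<boxtimes>\<^bsub>k\<^esub> B\<^esub> U) \<and>
     \<Phi>l' = pure k K (K \<boxtimes>\<^bsub>k\<^esub> B) \<one>\<^bsub>K\<^esub> U
       \<otimes>\<^bsub>K \<boxtimes>\<^bsub>k\<^esub> K \<boxtimes>\<^bsub>k\<^esub> B\<^esub> map_right k K B (K \<boxtimes>\<^bsub>k\<^esub> B) lam U
       \<otimes>\<^bsub>K \<boxtimes>\<^bsub>k\<^esub> K \<boxtimes>\<^bsub>k\<^esub> B\<^esub> \<Phi>l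
       \<otimes>\<^bsub>K \<boxtimes>\<^bsub>k\<^esub> K \<boxtimes>\<^bsub>k\<^esub> B\<^esub> expand_left k K B K K (comult K) (inv\<^bsub>K \<boxtimes>\<^bsub>k\<^esub> B\<^esub> U)"

text \<open>
  The relation is stated for arbitrary pairs of structure data; it is meant for pairs that satisfy
  \<^locale>\<open>left_comodule_algebra\<close>.
\<close>

definition twist_equivalent ::
  "('k, 'c) ring_scheme \<Rightarrow> ('k, 'h, 'm) qbialg_scheme \<Rightarrow> ('k, 'b, 'n) module_scheme \<Rightarrow>
   ('b \<Rightarrow> ('k, 'h, 'b) tens) \<Rightarrow> ('k, 'h, ('k, 'h, 'b) tens) tens \<Rightarrow>
   ('b \<Rightarrow> ('k, 'h, 'b) tens) \<Rightarrow> ('k, 'h, ('k, 'h, 'b) tens) tens \<Rightarrow> bool"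
  where
  "twist_equivalent k K B lam \<Phi>l lam' \<Phi>l' \<longleftrightarrow> (\<exists>U. twists_to k K B U lam \<Phi>l lam' \<Phi>l')"

definition bicomodule_twist ::
  "('k, 'c) ring_scheme \<Rightarrow> ('k, 'h, 'm) qhopf_scheme \<Rightarrow> ('k, 'a, 'n) module_scheme \<Rightarrow>
   ('k, 'h, ('k, 'a, 'h) tens) tens \<Rightarrow> ('k, ('k, 'h, 'h) tens, 'a) tens"
  where
  "bicomodule_twist k H A \<Phi>l\<rho> =
    (let K = env_qbialg k H in
     tsum3 k H A H (K \<boxtimes>\<^bsub>k\<^esub> A) \<Phi>l\<rho> (\<lambda>\<Theta>1 \<Theta>2 \<Theta>3.
       pure k K A (env_pure k H \<Theta>1 (antipode_inv H \<Theta>3)) \<Theta>2))"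

end

theory Submission
  imports Defs
begin

text \<open>
  An identity in a tensor product is read off in an arbitrary algebra \<open>T\<close> along pairwise commuting algebra maps
  into \<open>T\<close>, one for each tensor factor. Comultiplication then becomes a convolution of algebra maps, the
  coactions become actions on algebra maps \<open>A \<rightarrow> T\<close>, and the axioms become equations between products in \<open>T\<close>.

  Antipodes along an algebra map \<open>H \<rightarrow> T\<close> are unique up to conjugation by a unit. The maps \<open>\<Delta> \<circ> S\<close> and
  \<open>(S \<otimes> S) \<circ> \<Delta>\<^sup>c\<^sup>o\<^sup>p\<close> are both antipodes along \<open>\<Delta>\<close>, the second one by means of \<open>\<gamma>\<close>, and the unit that relates them is
  the Drinfeld twist \<open>f\<close>. Hence \<open>f\<close> is invertible and \<open>f \<Delta>(S h) f\<^sup>-\<^sup>1 = (S \<otimes> S)(\<Delta>\<^sup>c\<^sup>o\<^sup>p(h))\<close>.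

  Mixed coassociativity, read off in \<open>K \<otimes> A\<close> for \<open>K = H \<otimes> H\<^sup>o\<^sup>p\<close>, says that \<open>U\<close> conjugates \<open>\<lambda>\<^sub>1\<close> into \<open>\<lambda>\<^sub>2\<close>. In
  \<open>K \<otimes> K \<otimes> A\<close> the property of \<open>f\<close> turns \<open>(\<Delta> \<otimes> id)(U\<^sup>-\<^sup>1)\<close> into a conjugate of the inverse of \<open>\<Phi>\<^sub>\<lambda>\<^sub>\<rho>\<close> evaluated along
  convolutions, and the formula for the reassociators follows from the two mixed pentagons.
\<close>

section \<open>Tensor products of modules\<close>

text \<open>Antipodes reverse products, and the equations of \<alpha> and \<beta> apply only to
  neighbouring legs. A reading that involves antipodes is therefore no algebra map, and a product
  cannot be evaluated under it factor by factor. The way out is to calculate in a tensor power of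
  \<open>H\<close>, where the pentagon is available, and to apply a linear map \<open>J\<close> that
  inserts \<open>S\<close>, \<alpha> and \<beta> afterwards. Under \<open>J\<close>, legs joined by
  an \<alpha> cancel at the left end of a product and legs joined by a \<beta> at the right end; the
  calculations are arranged to bring them there. The definition of \<open>f\<close> only mentions
  \<gamma>. Inverting \<open>f\<close> also takes an element \<delta> that plays the part of \<beta>
  for the second antipode, together with the two normalisations that link \<gamma> and \<delta>;
  proving these is the longest piece of work. The inverse of \<open>f\<close> is then given by the
  same formula with the two antipodes exchanged. In \<open>K\<close> the problem with antipodes
  disappears: \<open>S^{-1}\<close> reverses products, but it is an algebra map into the opposite
  algebra, so every leg of the two comodule structures is an honest algebra map on \<open>H\<close>
  or \<open>A\<close>.\<close>

lemma linear_mapsI: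
  assumes "\<And>x. x \<in> carrier V \<Longrightarrow> f x \<in> carrier W"
    and "\<And>x y. \<lbrakk>x \<in> carrier V; y \<in> carrier V\<rbrakk> \<Longrightarrow> f (x \<oplus>\<^bsub>V\<^esub> y) = f x \<oplus>\<^bsub>W\<^esub> f y"
    and "\<And>c x. \<lbrakk>c \<in> carrier k; x \<in> carrier V\<rbrakk> \<Longrightarrow> f (c \<odot>\<^bsub>V\<^esub> x) = c \<odot>\<^bsub>W\<^esub> f x"
  shows "f \<in> linear_maps k V W"
  using assms by (auto simp: linear_maps_def)

lemma linear_maps_closed: "\<lbrakk>f \<in> linear_maps k V W; x \<in> carrier V\<rbrakk> \<Longrightarrow> f x \<in> carrier W"
  by (auto simp: linear_maps_def)

lemma linear_maps_add:
  "\<lbrakk>f \<in> linear_maps k V W; x \<in> carrier V; y \<in> carrier V\<rbrakk> \<Longrightarrow> f (x \<oplus>\<^bsub>V\<^esub> y) = f x \<oplus>\<^bsub>W\<^esub> f y"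
  by (auto simp: linear_maps_def)

lemma linear_maps_smult:
  "\<lbrakk>f \<in> linear_maps k V W; c \<in> carrier k; x \<in> carrier V\<rbrakk> \<Longrightarrow> f (c \<odot>\<^bsub>V\<^esub> x) = c \<odot>\<^bsub>W\<^esub> f x"
  by (auto simp: linear_maps_def)

lemma linear_maps_id: "(\<lambda>x. x) \<in> linear_maps k V V"
  by (auto simp: linear_maps_def)

lemma linear_maps_comp:
  "\<lbrakk>f \<in> linear_maps k V W; g \<in> linear_maps k W X\<rbrakk> \<Longrightarrow> (\<lambda>x. g (f x)) \<in> linear_maps k V X"
  by (auto simp: linear_maps_def Pi_iff)

section \<open>Free modules and linear extension from a basis\<close>

lemma free_module_simps [simp]:
  "x \<oplus>\<^bsub>free_module k S\<^esub> y = (\<lambda>s. x s \<oplus>\<^bsub>k\<^esub> y s)"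
  "c \<odot>\<^bsub>free_module k S\<^esub> x = (\<lambda>s. c \<otimes>\<^bsub>k\<^esub> x s)"
  "\<zero>\<^bsub>free_module k S\<^esub> = (\<lambda>s. \<zero>\<^bsub>k\<^esub>)"
  by (simp_all add: free_module_def)

lemma in_free_module_iff:
  "f \<in> carrier (free_module k S) \<longleftrightarrow>
    range f \<subseteq> carrier k \<and> finite {s. f s \<noteq> \<zero>\<^bsub>k\<^esub>} \<and> {s. f s \<noteq> \<zero>\<^bsub>k\<^esub>} \<subseteq> S"
  by (simp add: free_module_def)

lemma free_module_value: "f \<in> carrier (free_module k S) \<Longrightarrow> f s \<in> carrier k"
  by (auto simp: in_free_module_iff)

lemma module_free_module:
  assumes "cring k"
  shows "module k (free_module k S)"
proof -
  interpret cring k by fact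
  let ?F = "free_module k S"
  have add: "(\<lambda>s. x s \<oplus>\<^bsub>k\<^esub> y s) \<in> carrier ?F" if "x \<in> carrier ?F" "y \<in> carrier ?F" for x y
  proof -
    have "{s. x s \<oplus>\<^bsub>k\<^esub> y s \<noteq> \<zero>\<^bsub>k\<^esub>} \<subseteq> {s. x s \<noteq> \<zero>\<^bsub>k\<^esub>} \<union> {s. y s \<noteq> \<zero>\<^bsub>k\<^esub>}"
      by auto
    moreover have "x s \<oplus>\<^bsub>k\<^esub> y s \<in> carrier k" for s
      using that by (simp add: free_module_value)
    ultimately show ?thesis
      using that unfolding in_free_module_iff by (auto intro: finite_subset)
  qed
  have scale: "(\<lambda>s. c \<otimes>\<^bsub>k\<^esub> x s) \<in> carrier ?F" if "c \<in> carrier k" "x \<in> carrier ?F" for c x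
  proof -
    have "{s. c \<otimes>\<^bsub>k\<^esub> x s \<noteq> \<zero>\<^bsub>k\<^esub>} \<subseteq> {s. x s \<noteq> \<zero>\<^bsub>k\<^esub>}"
      using that by auto
    moreover have "c \<otimes>\<^bsub>k\<^esub> x s \<in> carrier k" for s
      using that by (simp add: free_module_value)
    ultimately show ?thesis
      using that unfolding in_free_module_iff by (auto intro: finite_subset)
  qed
  have zero: "(\<lambda>_. \<zero>\<^bsub>k\<^esub>) \<in> carrier ?F"
    by (auto simp: in_free_module_iff)
  have val: "\<forall>s. x s \<in> carrier k" if "x \<in> carrier ?F" for x
    using that by (simp add: free_module_value)
  show ?thesis
  proof (intro moduleI abelian_groupI)
    fix x assume x: "x \<in> carrier ?F"
    \<comment> \<open>The additive inverse is taken as the multiple by -1, whose closure is already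
      known from \<open>scale\<close>.\<close>
    have "(\<lambda>s. \<ominus>\<^bsub>k\<^esub> \<one>\<^bsub>k\<^esub> \<otimes>\<^bsub>k\<^esub> x s) \<oplus>\<^bsub>?F\<^esub> x = \<zero>\<^bsub>?F\<^esub>"
      using free_module_value[OF x] by (auto simp: l_minus l_neg)
    moreover have "(\<lambda>s. \<ominus>\<^bsub>k\<^esub> \<one>\<^bsub>k\<^esub> \<otimes>\<^bsub>k\<^esub> x s) \<in> carrier ?F"
      using x by (intro scale) auto
    ultimately show "\<exists>y\<in>carrier ?F. y \<oplus>\<^bsub>?F\<^esub> x = \<zero>\<^bsub>?F\<^esub>" by blast
  next
    show "x \<oplus>\<^bsub>?F\<^esub> y = y \<oplus>\<^bsub>?F\<^esub> x" if "x \<in> carrier ?F" "y \<in> carrier ?F" for x y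
      using that by (auto dest!: val simp: a_comm)
    show "x \<oplus>\<^bsub>?F\<^esub> y \<oplus>\<^bsub>?F\<^esub> z = x \<oplus>\<^bsub>?F\<^esub> (y \<oplus>\<^bsub>?F\<^esub> z)"
      if "x \<in> carrier ?F" "y \<in> carrier ?F" "z \<in> carrier ?F" for x y z
      using that by (auto dest!: val simp: a_assoc)
    show "c \<odot>\<^bsub>?F\<^esub> (x \<oplus>\<^bsub>?F\<^esub> y) = c \<odot>\<^bsub>?F\<^esub> x \<oplus>\<^bsub>?F\<^esub> c \<odot>\<^bsub>?F\<^esub> y"
      if "c \<in> carrier k" "x \<in> carrier ?F" "y \<in> carrier ?F" for c x y
      using that by (auto dest!: val simp: r_distr)
  qed (auto simp: assms add scale zero a_assoc m_assoc l_distr r_distr dest: val)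
qed

lemma basis_vector_closed:
  assumes "cring k" "s \<in> S"
  shows "basis_vector k s \<in> carrier (free_module k S)"
proof -
  interpret cring k by fact
  have "{t. basis_vector k s t \<noteq> \<zero>\<^bsub>k\<^esub>} \<subseteq> {s}"
    by (auto simp: basis_vector_def)
  then show ?thesis
    using assms(2) unfolding in_free_module_iff
    by (auto intro: finite_subset simp: basis_vector_def)
qed

text \<open>Induction on the support: one of its points is split off as a scaled basis vector, and
  the rest vanishes there. The zero function is a case of its own because its support is
  empty.\<close>

lemma free_module_induct [consumes 2, case_names zero basis add]:
  assumes "cring k" and f: "f \<in> carrier (free_module k S)"
    and zero: "P (\<lambda>_. \<zero>\<^bsub>k\<^esub>)"
    and basis: "\<And>c s. \<lbrakk>c \<in> carrier k; s \<in> S\<rbrakk> \<Longrightarrow> P (\<lambda>t. c \<otimes>\<^bsub>k\<^esub> basis_vector k s t)"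
    and add: "\<And>x y. \<lbrakk>x \<in> carrier (free_module k S); y \<in> carrier (free_module k S); P x; P y\<rbrakk>
      \<Longrightarrow> P (\<lambda>t. x t \<oplus>\<^bsub>k\<^esub> y t)"
  shows "P f"
proof -
  interpret cring k by fact
  interpret F: module k "free_module k S" by (rule module_free_module) fact
  have "finite D \<Longrightarrow> \<forall>f. f \<in> carrier (free_module k S) \<longrightarrow> {s. f s \<noteq> \<zero>\<^bsub>k\<^esub>} = D \<longrightarrow> P f" for D
  proof (induction D rule: finite_induct)
    case empty
    show ?case
    proof (intro allI impI)
      fix f assume "f \<in> carrier (free_module k S)" and "{s. f s \<noteq> \<zero>\<^bsub>k\<^esub>} = {}"
      then have "f = (\<lambda>_. \<zero>\<^bsub>k\<^esub>)" by auto
      then show "P f" using zero by simp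
    qed
  next
    case (insert s D)
    show ?case
    proof (intro allI impI)
      fix f assume f: "f \<in> carrier (free_module k S)" and D: "{t. f t \<noteq> \<zero>\<^bsub>k\<^esub>} = insert s D"
      define g where "g = f(s := \<zero>\<^bsub>k\<^esub>)"
      have gD: "{t. g t \<noteq> \<zero>\<^bsub>k\<^esub>} = D"
        using D insert.hyps by (auto simp: g_def)
      have sS: "s \<in> S" using f D by (auto simp: in_free_module_iff)
      have gF: "g \<in> carrier (free_module k S)"
        using f gD D insert.hyps unfolding in_free_module_iff by (auto simp: g_def)
      let ?b = "\<lambda>t. f s \<otimes>\<^bsub>k\<^esub> basis_vector k s t"
      have fs: "f s \<in> carrier k" using f by (rule free_module_value)
      have b: "?b \<in> carrier (free_module k S)"
        using F.smult_closed[OF fs basis_vector_closed[OF assms(1) sS]] by simp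
      have "P (\<lambda>t. ?b t \<oplus>\<^bsub>k\<^esub> g t)"
        using insert.IH gF gD basis[OF fs sS] by (intro add b) auto
      also have "(\<lambda>t. ?b t \<oplus>\<^bsub>k\<^esub> g t) = f"
        using free_module_value[OF f] by (auto simp: g_def basis_vector_def)
      finally show "P f" .
    qed
  qed
  moreover have "finite {s. f s \<noteq> \<zero>\<^bsub>k\<^esub>}"
    using f by (simp add: in_free_module_iff)
  ultimately show ?thesis using f by blast
qed

declare free_module_simps [simp del]

text \<open>The linear extension of \<open>g\<close> from the basis. Summing over the support keeps
  the sum finite when there are infinitely many basis vectors.\<close>

definition free_lift ::
  "('k, 'c) ring_scheme \<Rightarrow> ('k, 't, 'p) module_scheme \<Rightarrow> ('s \<Rightarrow> 't) \<Rightarrow> ('s \<Rightarrow> 'k) \<Rightarrow> 't" where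
  "free_lift k T g f = finsum T (\<lambda>s. f s \<odot>\<^bsub>T\<^esub> g s) {s. f s \<noteq> \<zero>\<^bsub>k\<^esub>}"

text \<open>The supports of \<open>x\<close>, of \<open>y\<close> and of their sum differ, so
  additivity can be compared only over a common finite index set; the additional terms
  vanish.\<close>

lemma free_lift_superset:
  assumes "module k T" "g \<in> S \<rightarrow> carrier T" "f \<in> carrier (free_module k S)"
    and "finite D" "{s. f s \<noteq> \<zero>\<^bsub>k\<^esub>} \<subseteq> D" "D \<subseteq> S"
  shows "free_lift k T g f = finsum T (\<lambda>s. f s \<odot>\<^bsub>T\<^esub> g s) D"
proof -
  interpret T: module k T by fact
  show ?thesis
    unfolding free_lift_def using assms free_module_value[OF assms(3)]
    by (intro T.add.finprod_mono_neutral_cong_left) (auto simp: Pi_iff subset_iff)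
qed

lemma free_lift_linear:
  assumes "module k T" and g: "g \<in> S \<rightarrow> carrier T"
  shows "free_lift k T g \<in> linear_maps k (free_module k S) T"
proof -
  interpret T: module k T by fact
  interpret F: module k "free_module k S"
    by (rule module_free_module) (rule T.is_cring)
  let ?s = "\<lambda>f. {s. f s \<noteq> \<zero>\<^bsub>k\<^esub>}"
  have fin: "finite (?s f)" "?s f \<subseteq> S" if "f \<in> carrier (free_module k S)" for f
    using that by (auto simp: in_free_module_iff)
  note val = free_module_value[of _ k S]
  show ?thesis
  proof (rule linear_mapsI)
    fix x assume x: "x \<in> carrier (free_module k S)"
    then show "free_lift k T g x \<in> carrier T"
      unfolding free_lift_def using val[OF x] fin[OF x] g by (intro T.finsum_closed) auto
  next
    fix x y assume x: "x \<in> carrier (free_module k S)" and y: "y \<in> carrier (free_module k S)"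
    let ?D = "?s x \<union> ?s y"
    note xy = F.M.a_closed[OF x y]
    have D: "finite ?D" "?D \<subseteq> S" using fin[OF x] fin[OF y] by auto
    have "free_lift k T g (x \<oplus>\<^bsub>free_module k S\<^esub> y) =
        finsum T (\<lambda>s. (x s \<oplus>\<^bsub>k\<^esub> y s) \<odot>\<^bsub>T\<^esub> g s) ?D"
      by (subst free_lift_superset[OF assms xy D(1) _ D(2)]) (auto simp: free_module_simps)
    also have "\<dots> = finsum T (\<lambda>s. x s \<odot>\<^bsub>T\<^esub> g s \<oplus>\<^bsub>T\<^esub> y s \<odot>\<^bsub>T\<^esub> g s) ?D"
      using D g val[OF x] val[OF y]
      by (intro T.add.finprod_cong') (auto simp: T.smult_l_distr Pi_iff subset_iff)
    also have "\<dots> = finsum T (\<lambda>s. x s \<odot>\<^bsub>T\<^esub> g s) ?D \<oplus>\<^bsub>T\<^esub> finsum T (\<lambda>s. y s \<odot>\<^bsub>T\<^esub> g s) ?D"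
      using D g val[OF x] val[OF y] by (intro T.finsum_addf) (auto simp: Pi_iff subset_iff)
    also have "\<dots> = free_lift k T g x \<oplus>\<^bsub>T\<^esub> free_lift k T g y"
      using D free_lift_superset[OF assms x D(1) _ D(2)] free_lift_superset[OF assms y D(1) _ D(2)]
      by simp
    finally show "free_lift k T g (x \<oplus>\<^bsub>free_module k S\<^esub> y) = free_lift k T g x \<oplus>\<^bsub>T\<^esub> free_lift k T g y" .
  next
    fix c x assume c: "c \<in> carrier k" and x: "x \<in> carrier (free_module k S)"
    let ?D = "?s x"
    note cx = F.smult_closed[OF c x]
    have D: "finite ?D" "?D \<subseteq> S" using fin[OF x] by auto
    have "free_lift k T g (c \<odot>\<^bsub>free_module k S\<^esub> x) = finsum T (\<lambda>s. (c \<otimes>\<^bsub>k\<^esub> x s) \<odot>\<^bsub>T\<^esub> g s) ?D"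
      using c by (subst free_lift_superset[OF assms cx D(1) _ D(2)]) (auto simp: free_module_simps)
    also have "\<dots> = finsum T (\<lambda>s. c \<odot>\<^bsub>T\<^esub> (x s \<odot>\<^bsub>T\<^esub> g s)) ?D"
      using D g val[OF x] c
      by (intro T.add.finprod_cong') (auto simp: T.smult_assoc1 Pi_iff subset_iff)
    also have "\<dots> = c \<odot>\<^bsub>T\<^esub> finsum T (\<lambda>s. x s \<odot>\<^bsub>T\<^esub> g s) ?D"
      using D g val[OF x] c
      by (intro T.finsum_smult_ldistr[symmetric]) (auto simp: Pi_iff subset_iff)
    finally show "free_lift k T g (c \<odot>\<^bsub>free_module k S\<^esub> x) = c \<odot>\<^bsub>T\<^esub> free_lift k T g x"
      by (simp add: free_lift_def)
  qed
qed

lemma free_lift_basis_vector: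
  assumes "module k T" and g: "g \<in> S \<rightarrow> carrier T" and s: "s \<in> S"
  shows "free_lift k T g (basis_vector k s) = g s"
proof -
  interpret T: module k T by fact
  \<comment> \<open>The sum is taken over \<open>{s}\<close> and not over the support, which would
    be empty if one and zero coincided in \<open>k\<close>.\<close>
  have "free_lift k T g (basis_vector k s) = finsum T (\<lambda>t. basis_vector k s t \<odot>\<^bsub>T\<^esub> g t) {s}"
    using s basis_vector_closed[OF T.is_cring s]
    by (intro free_lift_superset[OF assms(1) g]) (auto simp: basis_vector_def)
  also have "\<dots> = g s"
    using g s by (subst T.finsum_insert) (auto simp: basis_vector_def Pi_iff)
  finally show ?thesis .
qed

text \<open>This makes \<open>bilinear_null\<close>, an intersection over all submodules that
  contain the relations, a submodule. The family has to be nonempty because an empty intersection is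
  the whole type.\<close>

lemma submodule_Inter:
  assumes "module k F" "\<And>N. N \<in> \<S> \<Longrightarrow> submodule N k F" "\<S> \<noteq> {}"
  shows "submodule (\<Inter>\<S>) k F"
proof -
  interpret module k F by fact
  note E = submoduleE[OF assms(2)]
  obtain N0 where "N0 \<in> \<S>" using assms(3) by auto
  show ?thesis
  proof (rule submoduleI)
    show "\<Inter>\<S> \<subseteq> carrier F" using E(1) \<open>N0 \<in> \<S>\<close> by blast
    show "\<zero>\<^bsub>F\<^esub> \<in> \<Inter>\<S>"
    proof
      fix N assume N: "N \<in> \<S>"
      show "\<zero>\<^bsub>F\<^esub> \<in> N" using subgroup.one_closed[OF submodule.axioms(1)[OF assms(2)[OF N]]] by simp
    qed
    show "\<ominus>\<^bsub>F\<^esub> x \<in> \<Inter>\<S>" if "x \<in> \<Inter>\<S>" for x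
      using that by (auto intro: E(3))
    show "x \<oplus>\<^bsub>F\<^esub> y \<in> \<Inter>\<S>" if "x \<in> \<Inter>\<S>" "y \<in> \<Inter>\<S>" for x y
      using that by (auto intro: E(5))
    show "c \<odot>\<^bsub>F\<^esub> x \<in> \<Inter>\<S>" if "c \<in> carrier k" "x \<in> \<Inter>\<S>" for c x
      using that by (auto intro: E(4))
  qed
qed

text \<open>Scalar multiplication on \<open>tensor_space\<close> is a union over all representatives
  of a coset. It amounts to a single coset since two representatives differ by an element of
  \<open>N\<close>, and scaling stays in \<open>N\<close>.\<close>

lemma smult_coset:
  assumes "module k F" "submodule N k F" "c \<in> carrier k" "x \<in> carrier F"
  shows "(\<Union>y\<in>N +>\<^bsub>F\<^esub> x. N +>\<^bsub>F\<^esub> (c \<odot>\<^bsub>F\<^esub> y)) = N +>\<^bsub>F\<^esub> (c \<odot>\<^bsub>F\<^esub> x)"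
proof -
  interpret module k F by fact
  interpret N: submodule N k F by fact
  interpret abelian_subgroup N F
    by (rule abelian_subgroupI3)
      (use N.subgroup_axioms abelian_group_axioms in \<open>auto simp: additive_subgroup_def\<close>)
  have "N +>\<^bsub>F\<^esub> (c \<odot>\<^bsub>F\<^esub> y) = N +>\<^bsub>F\<^esub> (c \<odot>\<^bsub>F\<^esub> x)" if y: "y \<in> N +>\<^bsub>F\<^esub> x" for y
  proof -
    obtain n where n: "n \<in> N" "y = n \<oplus>\<^bsub>F\<^esub> x"
      using y by (auto simp: a_r_coset_def')
    have nF: "n \<in> carrier F" using n(1) a_subset by auto
    have "c \<odot>\<^bsub>F\<^esub> y = c \<odot>\<^bsub>F\<^esub> n \<oplus>\<^bsub>F\<^esub> c \<odot>\<^bsub>F\<^esub> x"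
      using n nF assms by (simp add: smult_r_distr)
    moreover have "c \<odot>\<^bsub>F\<^esub> n \<in> N" using n assms(3) by simp
    ultimately have "c \<odot>\<^bsub>F\<^esub> y \<in> N +>\<^bsub>F\<^esub> (c \<odot>\<^bsub>F\<^esub> x)"
      by (auto simp: a_r_coset_def')
    then show ?thesis
      using a_repr_independence'[of "c \<odot>\<^bsub>F\<^esub> y" "c \<odot>\<^bsub>F\<^esub> x"] assms by simp
  qed
  moreover have "x \<in> N +>\<^bsub>F\<^esub> x"
    using assms(4) by (rule a_rcos_self)
  ultimately show ?thesis by blast
qed

definition bilinear_maps ::
  "('k, 'c) ring_scheme \<Rightarrow> ('k, 'v, 'm) module_scheme \<Rightarrow> ('k, 'w, 'n) module_scheme \<Rightarrow>
   ('k, 't, 'p) module_scheme \<Rightarrow> ('v \<Rightarrow> 'w \<Rightarrow> 't) set" where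
  "bilinear_maps k V W T = {b.
     (\<forall>v\<in>carrier V. b v \<in> linear_maps k W T) \<and>
     (\<forall>w\<in>carrier W. (\<lambda>v. b v w) \<in> linear_maps k V T)}"

section \<open>The tensor product of two modules and its universal property\<close>

context
  fixes k :: "('k, 'c) ring_scheme" and V :: "('k, 'v, 'm) module_scheme"
    and W :: "('k, 'w, 'n) module_scheme"
  assumes V: "module k V" and W: "module k W"
begin

interpretation V: module k V by (rule V)
interpretation W: module k W by (rule W)

abbreviation (input) "tensF \<equiv> free_module k (carrier V \<times> carrier W)"
abbreviation (input) "tensN \<equiv> bilinear_null k V W"

interpretation F: module k tensF by (rule module_free_module) (rule V.is_cring)

lemma basis_pair_closed:
  "\<lbrakk>v \<in> carrier V; w \<in> carrier W\<rbrakk> \<Longrightarrow> basis_vector k (v, w) \<in> carrier tensF"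
  by (rule basis_vector_closed) (auto intro: V.is_cring)

lemma bilinear_relations_subset: "bilinear_relations k V W \<subseteq> carrier tensF"
  unfolding bilinear_relations_def Let_def
  by (auto intro!: F.M.minus_closed F.M.a_closed F.smult_closed basis_pair_closed)

lemma submodule_bilinear_null: "submodule tensN k tensF"
  unfolding bilinear_null_def
  by (rule submodule_Inter[OF F.module_axioms])
    (use F.carrier_is_submodule bilinear_relations_subset in blast)+

lemma bilinear_relations_null: "bilinear_relations k V W \<subseteq> tensN"
  unfolding bilinear_null_def by auto

interpretation N: submodule tensN k tensF by (rule submodule_bilinear_null)

interpretation abelian_subgroup tensN tensF
  by (rule abelian_subgroupI3)
    (use N.subgroup_axioms F.abelian_group_axioms in \<open>auto simp: additive_subgroup_def\<close>)

lemma tensor_space_carrier: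
  "carrier (tensor_space k V W) = {tensN +>\<^bsub>tensF\<^esub> x | x. x \<in> carrier tensF}"
  by (auto simp: tensor_space_def Let_def A_RCOSETS_def')

text \<open>The zero field is the submodule itself; as the coset of zero it takes the form in which
  all operations are computed on representatives.\<close>

lemma tensor_space_zero: "\<zero>\<^bsub>tensor_space k V W\<^esub> = tensN +>\<^bsub>tensF\<^esub> \<zero>\<^bsub>tensF\<^esub>"
proof -
  have "tensN +>\<^bsub>tensF\<^esub> \<zero>\<^bsub>tensF\<^esub> = tensN"
    by (rule F.M.a_coset_add_zero) (rule a_subset)
  then show ?thesis by (simp add: tensor_space_def Let_def)
qed

lemma tensor_space_add:
  "\<lbrakk>x \<in> carrier tensF; y \<in> carrier tensF\<rbrakk> \<Longrightarrow>
    (tensN +>\<^bsub>tensF\<^esub> x) \<oplus>\<^bsub>tensor_space k V W\<^esub> (tensN +>\<^bsub>tensF\<^esub> y) = tensN +>\<^bsub>tensF\<^esub> (x \<oplus>\<^bsub>tensF\<^esub> y)"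
  by (simp add: tensor_space_def Let_def a_rcos_sum)

lemma tensor_space_smult:
  "\<lbrakk>c \<in> carrier k; x \<in> carrier tensF\<rbrakk> \<Longrightarrow>
    c \<odot>\<^bsub>tensor_space k V W\<^esub> (tensN +>\<^bsub>tensF\<^esub> x) = tensN +>\<^bsub>tensF\<^esub> (c \<odot>\<^bsub>tensF\<^esub> x)"
  by (simp add: tensor_space_def Let_def smult_coset[OF F.module_axioms N.submodule_axioms]
     )

lemma module_tensor_space: "module k (tensor_space k V W)"
proof (intro moduleI abelian_groupI)
  let ?T = "tensor_space k V W"
  note simps = tensor_space_carrier tensor_space_add tensor_space_smult tensor_space_zero
  show "cring k" by (rule V.is_cring)
  show "\<zero>\<^bsub>?T\<^esub> \<in> carrier ?T"
    unfolding simps by auto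
  show "x \<oplus>\<^bsub>?T\<^esub> y \<in> carrier ?T" if "x \<in> carrier ?T" "y \<in> carrier ?T" for x y
    using that unfolding tensor_space_carrier by (auto simp: tensor_space_add)
  show "x \<oplus>\<^bsub>?T\<^esub> y \<oplus>\<^bsub>?T\<^esub> z = x \<oplus>\<^bsub>?T\<^esub> (y \<oplus>\<^bsub>?T\<^esub> z)"
    if "x \<in> carrier ?T" "y \<in> carrier ?T" "z \<in> carrier ?T" for x y z
    using that unfolding tensor_space_carrier by (auto simp: tensor_space_add F.M.a_assoc)
  show "x \<oplus>\<^bsub>?T\<^esub> y = y \<oplus>\<^bsub>?T\<^esub> x" if "x \<in> carrier ?T" "y \<in> carrier ?T" for x y
    using that unfolding tensor_space_carrier by (auto simp: tensor_space_add F.M.a_comm)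
  show "\<zero>\<^bsub>?T\<^esub> \<oplus>\<^bsub>?T\<^esub> x = x" if "x \<in> carrier ?T" for x
    using that unfolding tensor_space_carrier tensor_space_zero by (auto simp: tensor_space_add)
  show "\<exists>y\<in>carrier ?T. y \<oplus>\<^bsub>?T\<^esub> x = \<zero>\<^bsub>?T\<^esub>" if x: "x \<in> carrier ?T" for x
  proof -
    obtain f where f: "f \<in> carrier tensF" "x = tensN +>\<^bsub>tensF\<^esub> f"
      using x by (auto simp: tensor_space_carrier)
    have "(tensN +>\<^bsub>tensF\<^esub> (\<ominus>\<^bsub>tensF\<^esub> f)) \<oplus>\<^bsub>?T\<^esub> x = \<zero>\<^bsub>?T\<^esub>"
      using f by (simp add: tensor_space_add tensor_space_zero F.M.l_neg)
    moreover have "tensN +>\<^bsub>tensF\<^esub> (\<ominus>\<^bsub>tensF\<^esub> f) \<in> carrier ?T"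
      using f by (auto simp: tensor_space_carrier)
    ultimately show ?thesis by blast
  qed
  show "c \<odot>\<^bsub>?T\<^esub> x \<in> carrier ?T" if "c \<in> carrier k" "x \<in> carrier ?T" for c x
    using that unfolding tensor_space_carrier by (auto simp: tensor_space_smult)
  show "(c \<oplus>\<^bsub>k\<^esub> d) \<odot>\<^bsub>?T\<^esub> x = c \<odot>\<^bsub>?T\<^esub> x \<oplus>\<^bsub>?T\<^esub> d \<odot>\<^bsub>?T\<^esub> x"
    if "c \<in> carrier k" "d \<in> carrier k" "x \<in> carrier ?T" for c d x
    using that unfolding tensor_space_carrier
    by (auto simp: tensor_space_smult tensor_space_add F.smult_l_distr)
  show "c \<odot>\<^bsub>?T\<^esub> (x \<oplus>\<^bsub>?T\<^esub> y) = c \<odot>\<^bsub>?T\<^esub> x \<oplus>\<^bsub>?T\<^esub> c \<odot>\<^bsub>?T\<^esub> y"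
    if "c \<in> carrier k" "x \<in> carrier ?T" "y \<in> carrier ?T" for c x y
    using that unfolding tensor_space_carrier
    by (auto simp: tensor_space_smult tensor_space_add F.smult_r_distr)
  show "(c \<otimes>\<^bsub>k\<^esub> d) \<odot>\<^bsub>?T\<^esub> x = c \<odot>\<^bsub>?T\<^esub> (d \<odot>\<^bsub>?T\<^esub> x)"
    if "c \<in> carrier k" "d \<in> carrier k" "x \<in> carrier ?T" for c d x
    using that unfolding tensor_space_carrier
    by (auto simp: tensor_space_smult F.smult_assoc1)
  show "\<one>\<^bsub>k\<^esub> \<odot>\<^bsub>?T\<^esub> x = x" if "x \<in> carrier ?T" for x
    using that unfolding tensor_space_carrier by (auto simp: tensor_space_smult)
qed

lemma pure_closed: "\<lbrakk>v \<in> carrier V; w \<in> carrier W\<rbrakk> \<Longrightarrow> pure k V W v w \<in> carrier (tensor_space k V W)"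
  using basis_pair_closed by (auto simp: tensor_space_carrier pure_def)

text \<open>An identity between pure tensors is thereby reduced to finding one difference in the
  list of generating relations.\<close>

lemma coset_eqI:
  assumes "x \<in> carrier tensF" "y \<in> carrier tensF" "x \<ominus>\<^bsub>tensF\<^esub> y \<in> bilinear_relations k V W"
  shows "tensN +>\<^bsub>tensF\<^esub> x = tensN +>\<^bsub>tensF\<^esub> y"
proof -
  have "x \<ominus>\<^bsub>tensF\<^esub> y \<in> tensN" using assms(3) bilinear_relations_null by auto
  moreover have "x = x \<ominus>\<^bsub>tensF\<^esub> y \<oplus>\<^bsub>tensF\<^esub> y"
    using assms by (simp add: a_minus_def F.M.a_assoc F.M.l_neg)
  ultimately have "x \<in> tensN +>\<^bsub>tensF\<^esub> y"
    unfolding a_r_coset_def' by blast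
  then show ?thesis
    using a_repr_independence'[of x y] assms by simp
qed

lemma pure_bilinear: "pure k V W \<in> bilinear_maps k V W (tensor_space k V W)"
proof -
  note closed = basis_pair_closed
  have 1: "pure k V W (v \<oplus>\<^bsub>V\<^esub> v') w = pure k V W v w \<oplus>\<^bsub>tensor_space k V W\<^esub> pure k V W v' w"
    if "v \<in> carrier V" "v' \<in> carrier V" "w \<in> carrier W" for v v' w
    using that unfolding pure_def
    by (subst tensor_space_add, simp_all add: closed, intro coset_eqI)
      (auto simp: closed bilinear_relations_def Let_def)
  have 2: "pure k V W v (w \<oplus>\<^bsub>W\<^esub> w') = pure k V W v w \<oplus>\<^bsub>tensor_space k V W\<^esub> pure k V W v w'"
    if "v \<in> carrier V" "w' \<in> carrier W" "w \<in> carrier W" for v w w'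
    using that unfolding pure_def
    by (subst tensor_space_add, simp_all add: closed, intro coset_eqI)
      (auto simp: closed bilinear_relations_def Let_def)
  have 3: "pure k V W (c \<odot>\<^bsub>V\<^esub> v) w = c \<odot>\<^bsub>tensor_space k V W\<^esub> pure k V W v w"
    if "v \<in> carrier V" "c \<in> carrier k" "w \<in> carrier W" for v c w
    using that unfolding pure_def
    by (subst tensor_space_smult, simp_all add: closed, intro coset_eqI)
      (auto simp: closed bilinear_relations_def Let_def)
  have 4: "pure k V W v (c \<odot>\<^bsub>W\<^esub> w) = c \<odot>\<^bsub>tensor_space k V W\<^esub> pure k V W v w"
    if "v \<in> carrier V" "c \<in> carrier k" "w \<in> carrier W" for v c w
    using that unfolding pure_def
    by (subst tensor_space_smult, simp_all add: closed, intro coset_eqI)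
      (auto simp: closed bilinear_relations_def Let_def)
  show ?thesis
    by (auto simp: bilinear_maps_def 1 2 3 4 pure_closed intro!: linear_mapsI)
qed

lemma pure_linear_left: "w \<in> carrier W \<Longrightarrow> (\<lambda>v. pure k V W v w) \<in> linear_maps k V (tensor_space k V W)"
  and pure_linear_right: "v \<in> carrier V \<Longrightarrow> pure k V W v \<in> linear_maps k W (tensor_space k V W)"
  using pure_bilinear by (auto simp: bilinear_maps_def)

text \<open>There is neither a zero case nor a scalar case: a multiple of
  \<open>v \<otimes> w\<close> is the pure tensor with \<open>v\<close> scaled, and zero is the pure
  tensor of two zeros.\<close>

lemma tensor_induct [consumes 1, case_names pure add]:
  assumes z: "z \<in> carrier (tensor_space k V W)"
    and pure: "\<And>v w. \<lbrakk>v \<in> carrier V; w \<in> carrier W\<rbrakk> \<Longrightarrow> P (pure k V W v w)"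
    and add: "\<And>x y. \<lbrakk>x \<in> carrier (tensor_space k V W); y \<in> carrier (tensor_space k V W); P x; P y\<rbrakk>
      \<Longrightarrow> P (x \<oplus>\<^bsub>tensor_space k V W\<^esub> y)"
  shows "P z"
proof -
  interpret T: module k "tensor_space k V W" by (rule module_tensor_space)
  have smult: "P (tensN +>\<^bsub>tensF\<^esub> (c \<odot>\<^bsub>tensF\<^esub> basis_vector k s))"
    if c: "c \<in> carrier k" and "s \<in> carrier V \<times> carrier W" for c s
  proof -
    from \<open>s \<in> carrier V \<times> carrier W\<close>
    obtain v w where s: "s = (v, w)" "v \<in> carrier V" "w \<in> carrier W" by auto
    have "tensN +>\<^bsub>tensF\<^esub> (c \<odot>\<^bsub>tensF\<^esub> basis_vector k s) = c \<odot>\<^bsub>tensor_space k V W\<^esub> pure k V W v w"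
      using s c basis_pair_closed by (simp add: pure_def tensor_space_smult)
    also have "\<dots> = pure k V W (c \<odot>\<^bsub>V\<^esub> v) w"
      using linear_maps_smult[OF pure_linear_left] s c by simp
    finally show ?thesis using pure s c by simp
  qed
  obtain f where f: "f \<in> carrier tensF" and zf: "z = tensN +>\<^bsub>tensF\<^esub> f"
    using z by (auto simp: tensor_space_carrier)
  from V.is_cring f have "P (tensN +>\<^bsub>tensF\<^esub> f)"
  proof (induction f rule: free_module_induct)
    case zero
    have "\<zero>\<^bsub>tensor_space k V W\<^esub> = pure k V W \<zero>\<^bsub>V\<^esub> \<zero>\<^bsub>W\<^esub>"
    proof -
      have "pure k V W (\<zero>\<^bsub>k\<^esub> \<odot>\<^bsub>V\<^esub> \<zero>\<^bsub>V\<^esub>) \<zero>\<^bsub>W\<^esub> = \<zero>\<^bsub>k\<^esub> \<odot>\<^bsub>tensor_space k V W\<^esub> pure k V W \<zero>\<^bsub>V\<^esub> \<zero>\<^bsub>W\<^esub>"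
        by (rule linear_maps_smult[OF pure_linear_left]) auto
      then show ?thesis by (simp add: pure_closed)
    qed
    then show ?case using pure[of "\<zero>\<^bsub>V\<^esub>" "\<zero>\<^bsub>W\<^esub>"] tensor_space_zero by (simp add: free_module_simps)
  next
    case (basis c s)
    then show ?case using smult by (simp add: free_module_simps)
  next
    case (add x y)
    have "P ((tensN +>\<^bsub>tensF\<^esub> x) \<oplus>\<^bsub>tensor_space k V W\<^esub> (tensN +>\<^bsub>tensF\<^esub> y))"
      using add by (intro assms(3)) (auto simp: tensor_space_carrier)
    then show ?case using add.hyps by (simp add: tensor_space_add free_module_simps)
  qed
  then show ?thesis by (simp add: zf)
qed

lemma linear_maps_tensor_eqI:
  assumes "f \<in> linear_maps k (tensor_space k V W) T" "g \<in> linear_maps k (tensor_space k V W) T"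
    and "\<And>v w. \<lbrakk>v \<in> carrier V; w \<in> carrier W\<rbrakk> \<Longrightarrow> f (pure k V W v w) = g (pure k V W v w)"
    and "z \<in> carrier (tensor_space k V W)"
  shows "f z = g z"
  using assms(4)
proof (induction z rule: tensor_induct)
  case (add x y)
  then show ?case
    by (simp add: linear_maps_add[OF assms(1)] linear_maps_add[OF assms(2)])
qed (use assms in auto)

text \<open>The linear extension of \<open>b\<close> to the free module kills every relation because
  \<open>b\<close> is bilinear. Its kernel is thus one of the submodules whose intersection is
  \<open>bilinear_null\<close>, and the extension is constant on cosets.\<close>

lemma tensor_lift_exists:
  assumes T: "module k T" and b: "b \<in> bilinear_maps k V W T"
  shows "\<exists>h \<in> linear_maps k (tensor_space k V W) T.
    \<forall>v\<in>carrier V. \<forall>w\<in>carrier W. h (pure k V W v w) = b v w"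
proof -
  interpret T: module k T by fact
  let ?S = "carrier V \<times> carrier W"
  let ?g = "\<lambda>(v, w). b v w"
  have bl: "b v \<in> linear_maps k W T" "(\<lambda>v. b v w) \<in> linear_maps k V T"
    if "v \<in> carrier V" "w \<in> carrier W" for v w
    using b that by (auto simp: bilinear_maps_def)
  have gS: "?g \<in> ?S \<rightarrow> carrier T"
    using linear_maps_closed[OF bl(1)] by auto
  note lift = free_lift_linear[OF T gS]
  have lift_basis: "free_lift k T ?g (basis_vector k (v, w)) = b v w"
    if "v \<in> carrier V" "w \<in> carrier W" for v w
    using free_lift_basis_vector[OF T gS, of "(v, w)"] that by simp
  interpret L: abelian_group_hom tensF T "free_lift k T ?g"
    by (intro abelian_group_homI group_hom.intro group_hom_axioms.intro F.abelian_group_axioms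
        T.abelian_group_axioms F.a_group T.a_group)
      (auto simp: hom_def linear_maps_closed[OF lift] linear_maps_add[OF lift])
  let ?K = "{x \<in> carrier tensF. free_lift k T ?g x = \<zero>\<^bsub>T\<^esub>}"
  have sub: "submodule ?K k tensF"
    by (rule F.submoduleI) (auto simp: linear_maps_smult[OF lift])
  have minus: "free_lift k T ?g (x \<ominus>\<^bsub>tensF\<^esub> y) = \<zero>\<^bsub>T\<^esub>"
    if "x \<in> carrier tensF" "y \<in> carrier tensF" "free_lift k T ?g x = free_lift k T ?g y" for x y
    using that by (simp add: a_minus_def T.M.r_neg)
  have "bilinear_relations k V W \<subseteq> ?K"
    unfolding bilinear_relations_def Let_def
    by (auto intro!: F.M.minus_closed F.M.a_closed F.smult_closed
        basis_pair_closed minus simp: lift_basis basis_pair_closed linear_maps_smult[OF lift]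
        linear_maps_add[OF bl(1)] linear_maps_add[OF bl(2)] linear_maps_smult[OF bl(1)] linear_maps_smult[OF bl(2)])
  with sub have NK: "tensN \<subseteq> ?K"
    unfolding bilinear_null_def by auto
  have coset: "free_lift k T ?g y = free_lift k T ?g x"
    if "y \<in> tensN +>\<^bsub>tensF\<^esub> x" "x \<in> carrier tensF" for x y
  proof -
    obtain n where "n \<in> tensN" "y = n \<oplus>\<^bsub>tensF\<^esub> x"
      using \<open>y \<in> tensN +>\<^bsub>tensF\<^esub> x\<close> unfolding a_r_coset_def' by blast
    then show ?thesis using NK that(2) linear_maps_closed[OF lift that(2)] by (auto)
  qed
  \<comment> \<open>A representative is chosen arbitrarily; \<open>coset\<close> shows that the
    value does not depend on the choice.\<close>
  define h where "h X = free_lift k T ?g (SOME x. x \<in> X)" for X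
  have h: "h (tensN +>\<^bsub>tensF\<^esub> x) = free_lift k T ?g x" if "x \<in> carrier tensF" for x
    unfolding h_def using someI[of "\<lambda>y. y \<in> tensN +>\<^bsub>tensF\<^esub> x", OF a_rcos_self[OF that]] that
    by (rule coset)
  have "h \<in> linear_maps k (tensor_space k V W) T"
    by (rule linear_mapsI)
      (auto simp: tensor_space_carrier tensor_space_add tensor_space_smult h linear_maps_add[OF lift]
        linear_maps_smult[OF lift] linear_maps_closed[OF lift])
  moreover have "\<forall>v\<in>carrier V. \<forall>w\<in>carrier W. h (pure k V W v w) = b v w"
    by (auto simp: pure_def h basis_pair_closed lift_basis)
  ultimately show ?thesis by blast
qed

text \<open>A \<open>tsum\<close> is computed by exhibiting any linear map with the right values on
  pure tensors. The description in \<open>tsum\<close> is unique because pure tensors generate; it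
  denotes \<open>f\<close> cut off outside the carrier, since it asks for an extensional
  map.\<close>

lemma tsum_eqI:
  assumes f: "f \<in> linear_maps k (tensor_space k V W) T"
    and fb: "\<And>v w. \<lbrakk>v \<in> carrier V; w \<in> carrier W\<rbrakk> \<Longrightarrow> f (pure k V W v w) = b v w"
    and z: "z \<in> carrier (tensor_space k V W)"
  shows "tsum k V W T z b = f z"
proof -
  let ?C = "carrier (tensor_space k V W)"
  interpret TS: module k "tensor_space k V W" by (rule module_tensor_space)
  have "(THE h. h \<in> linear_maps k (tensor_space k V W) T \<and> h \<in> extensional ?C \<and>
      (\<forall>v\<in>carrier V. \<forall>w\<in>carrier W. h (pure k V W v w) = b v w)) = restrict f ?C"
  proof (rule the_equality)
    show "restrict f ?C \<in> linear_maps k (tensor_space k V W) T \<and> restrict f ?C \<in> extensional ?C \<and>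
      (\<forall>v\<in>carrier V. \<forall>w\<in>carrier W. restrict f ?C (pure k V W v w) = b v w)"
      using f by (auto intro!: linear_mapsI
          simp: pure_closed fb linear_maps_closed linear_maps_add linear_maps_smult)
  next
    fix h assume h: "h \<in> linear_maps k (tensor_space k V W) T \<and> h \<in> extensional ?C \<and>
      (\<forall>v\<in>carrier V. \<forall>w\<in>carrier W. h (pure k V W v w) = b v w)"
    show "h = restrict f ?C"
      by (rule extensionalityI[of _ ?C])
        (use h linear_maps_tensor_eqI[of h T f] f fb in auto)
  qed
  then show ?thesis by (simp add: tsum_def z)
qed

end

text \<open>The two definite descriptions are the same predicate, because the summand is consulted
  only on the carriers. So the rule applies before the summand is known to be bilinear.\<close>

lemma tsum_cong:
  assumes "\<And>v w. \<lbrakk>v \<in> carrier V; w \<in> carrier W\<rbrakk> \<Longrightarrow> b v w = b' v w"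
  shows "tsum k V W T z b = tsum k V W T z b'"
proof -
  have "(\<forall>v\<in>carrier V. \<forall>w\<in>carrier W. h (pure k V W v w) = b v w) \<longleftrightarrow>
      (\<forall>v\<in>carrier V. \<forall>w\<in>carrier W. h (pure k V W v w) = b' v w)" for h
    using assms by auto
  then show ?thesis by (simp add: tsum_def)
qed

section \<open>Tensor products of algebras\<close>

text \<open>Functions defined through \<open>tsum\<close> are known only on the carrier. They
  inherit linearity from the lift with which they agree there; the module structure of
  \<open>V\<close> keeps sums and multiples inside.\<close>

lemma linear_maps_cong:
  "\<lbrakk>f \<in> linear_maps k V W; module k V; \<And>x. x \<in> carrier V \<Longrightarrow> g x = f x\<rbrakk> \<Longrightarrow> g \<in> linear_maps k V W"
  unfolding linear_maps_def module_def
  by (auto simp: abelian_monoid.a_closed abelian_group.axioms(1) module.smult_closed module_def)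

lemma linear_maps_sum:
  assumes "module k W" "f \<in> linear_maps k V W" "g \<in> linear_maps k V W"
  shows "(\<lambda>x. f x \<oplus>\<^bsub>W\<^esub> g x) \<in> linear_maps k V W"
proof -
  interpret W: module k W by fact
  note f = assms(2) and g = assms(3)
  note [simp] = linear_maps_closed[OF f] linear_maps_closed[OF g] linear_maps_add[OF f] linear_maps_add[OF g]
    linear_maps_smult[OF f] linear_maps_smult[OF g]
  show ?thesis
    by (rule linear_mapsI) (simp_all add: W.M.a_ac W.smult_r_distr)
qed

lemma linear_maps_scale:
  assumes "module k W" "f \<in> linear_maps k V W" "c \<in> carrier k"
  shows "(\<lambda>x. c \<odot>\<^bsub>W\<^esub> f x) \<in> linear_maps k V W"
proof -
  interpret W: module k W by fact
  note f = assms(2)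
  note [simp] = linear_maps_closed[OF f] linear_maps_add[OF f] linear_maps_smult[OF f]
  show ?thesis
    using assms(3)
    by (intro linear_mapsI) (simp_all add: W.smult_r_distr W.R.m_comm flip: W.smult_assoc1)
qed

lemma assoc_algebra_module: "assoc_algebra k A \<Longrightarrow> module k A"
  and assoc_algebra_ring: "assoc_algebra k A \<Longrightarrow> ring A"
  and assoc_algebra_field: "assoc_algebra k A \<Longrightarrow> field k"
  by (simp_all add: assoc_algebra_def)

lemma assoc_algebra_mult_linear:
  assumes "assoc_algebra k A" "a \<in> carrier A"
  shows "(\<lambda>x. a \<otimes>\<^bsub>A\<^esub> x) \<in> linear_maps k A A" "(\<lambda>x. x \<otimes>\<^bsub>A\<^esub> a) \<in> linear_maps k A A"
proof -
  interpret A: ring A by (rule assoc_algebra_ring) fact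
  show "(\<lambda>x. a \<otimes>\<^bsub>A\<^esub> x) \<in> linear_maps k A A" "(\<lambda>x. x \<otimes>\<^bsub>A\<^esub> a) \<in> linear_maps k A A"
    using assms(2) assoc_algebra.smult_mult_left[OF assms(1)] assoc_algebra.smult_mult_right[OF assms(1)]
    by (auto intro!: linear_mapsI simp: A.l_distr A.r_distr)
qed

lemma linear_maps_lmult:
  "\<lbrakk>assoc_algebra k A; f \<in> linear_maps k V A; a \<in> carrier A\<rbrakk> \<Longrightarrow> (\<lambda>x. a \<otimes>\<^bsub>A\<^esub> f x) \<in> linear_maps k V A"
  by (rule linear_maps_comp[OF _ assoc_algebra_mult_linear(1)])

lemma linear_maps_rmult:
  "\<lbrakk>assoc_algebra k A; f \<in> linear_maps k V A; a \<in> carrier A\<rbrakk> \<Longrightarrow> (\<lambda>x. f x \<otimes>\<^bsub>A\<^esub> a) \<in> linear_maps k V A"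
  by (rule linear_maps_comp[OF _ assoc_algebra_mult_linear(2)])

lemma tensor_simps [simp]:
  "carrier (A \<boxtimes>\<^bsub>k\<^esub> B) = carrier (tensor_space k A B)"
  "x \<oplus>\<^bsub>A \<boxtimes>\<^bsub>k\<^esub> B\<^esub> y = x \<oplus>\<^bsub>tensor_space k A B\<^esub> y"
  "c \<odot>\<^bsub>A \<boxtimes>\<^bsub>k\<^esub> B\<^esub> x = c \<odot>\<^bsub>tensor_space k A B\<^esub> x"
  "\<zero>\<^bsub>A \<boxtimes>\<^bsub>k\<^esub> B\<^esub> = \<zero>\<^bsub>tensor_space k A B\<^esub>"
  "\<one>\<^bsub>A \<boxtimes>\<^bsub>k\<^esub> B\<^esub> = pure k A B \<one>\<^bsub>A\<^esub> \<one>\<^bsub>B\<^esub>"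
  by (simp_all add: tensor_def)

lemma linear_maps_tensor [simp]:
  "linear_maps k (A \<boxtimes>\<^bsub>k\<^esub> B) T = linear_maps k (tensor_space k A B) T"
  "linear_maps k V (A \<boxtimes>\<^bsub>k\<^esub> B) = linear_maps k V (tensor_space k A B)"
  by (simp_all add: linear_maps_def)

section \<open>The multiplication on the tensor product of two algebras\<close>

context
  fixes k :: "('k, 'c) ring_scheme" and A :: "('k, 'a, 'm) module_scheme"
    and B :: "('k, 'b, 'n) module_scheme"
  assumes A: "assoc_algebra k A" and B: "assoc_algebra k B"
begin

interpretation A: ring A by (rule assoc_algebra_ring[OF A])
interpretation B: ring B by (rule assoc_algebra_ring[OF B])
interpretation k: field k by (rule assoc_algebra_field[OF B])

private lemmas mA = assoc_algebra_module[OF A] and mB = assoc_algebra_module[OF B]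
interpretation S: module k "tensor_space k A B" by (rule module_tensor_space[OF mA mB])
abbreviation (input) "TS \<equiv> tensor_space k A B"

text \<open>Left multiplication by \<open>a \<otimes> b\<close>: the inner one of the two nested
  sums in the product of \<open>A \<boxtimes> B\<close>. The outer sum can be evaluated once this is
  known to be bilinear in \<open>a\<close> and \<open>b\<close>.\<close>

definition "tensor_mul_pure a b y = tsum k A B TS y (\<lambda>a' b'. pure k A B (a \<otimes>\<^bsub>A\<^esub> a') (b \<otimes>\<^bsub>B\<^esub> b'))"

private lemmas closed = pure_closed[OF mA mB]

lemma mul_pure:
  assumes a: "a \<in> carrier A" and b: "b \<in> carrier B"
  shows "tensor_mul_pure a b \<in> linear_maps k TS TS"
    and "\<lbrakk>a' \<in> carrier A; b' \<in> carrier B\<rbrakk> \<Longrightarrow>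
      tensor_mul_pure a b (pure k A B a' b') = pure k A B (a \<otimes>\<^bsub>A\<^esub> a') (b \<otimes>\<^bsub>B\<^esub> b')"
proof -
  have "(\<lambda>a' b'. pure k A B (a \<otimes>\<^bsub>A\<^esub> a') (b \<otimes>\<^bsub>B\<^esub> b')) \<in> bilinear_maps k A B TS"
    unfolding bilinear_maps_def
    using linear_maps_comp[OF assoc_algebra_mult_linear(1)[OF A a] pure_linear_left[OF mA mB]]
      linear_maps_comp[OF assoc_algebra_mult_linear(1)[OF B b] pure_linear_right[OF mA mB]] a b
    by auto
  from tensor_lift_exists[OF mA mB S.module_axioms this] obtain h
    where h: "h \<in> linear_maps k TS TS"
      "\<And>v w. \<lbrakk>v \<in> carrier A; w \<in> carrier B\<rbrakk> \<Longrightarrow>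
        h (pure k A B v w) = pure k A B (a \<otimes>\<^bsub>A\<^esub> v) (b \<otimes>\<^bsub>B\<^esub> w)"
    by blast
  have eq: "tensor_mul_pure a b z = h z" if "z \<in> carrier TS" for z
    unfolding tensor_mul_pure_def by (rule tsum_eqI[OF mA mB h(1) h(2) that])
  show "tensor_mul_pure a b \<in> linear_maps k TS TS"
    by (rule linear_maps_cong[OF h(1) S.module_axioms eq])
  show "tensor_mul_pure a b (pure k A B a' b') = pure k A B (a \<otimes>\<^bsub>A\<^esub> a') (b \<otimes>\<^bsub>B\<^esub> b')"
    if "a' \<in> carrier A" "b' \<in> carrier B"
    using eq[OF closed] h(2) that by simp
qed

text \<open>For fixed \<open>a\<close> and \<open>b\<close> both sides of each law are linear in
  \<open>y\<close>, so it suffices to compare them on pure tensors, where they reduce to laws of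
  \<open>A\<close> and \<open>B\<close>.\<close>

lemma mul_pure_bilinear:
  assumes y: "y \<in> carrier TS"
  shows "(\<lambda>a b. tensor_mul_pure a b y) \<in> bilinear_maps k A B TS"
proof -
  note lin = mul_pure(1) and val = mul_pure(2)
  note pl = pure_linear_left[OF mA mB] and pr = pure_linear_right[OF mA mB]
  note am = assoc_algebra.smult_mult_left[OF A] and bm = assoc_algebra.smult_mult_left[OF B]
  note ca = module.smult_closed[OF mA] and cb = module.smult_closed[OF mB]
  note S = S.module_axioms
  have "tensor_mul_pure (a \<oplus>\<^bsub>A\<^esub> a') b y = tensor_mul_pure a b y \<oplus>\<^bsub>TS\<^esub> tensor_mul_pure a' b y"
    if "a \<in> carrier A" "a' \<in> carrier A" "b \<in> carrier B" for a a' b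
    by (rule linear_maps_tensor_eqI[OF mA mB lin linear_maps_sum[OF S lin lin]])
      (use that y in \<open>simp_all add: val A.l_distr linear_maps_add[OF pl]\<close>)
  moreover have "tensor_mul_pure a (b \<oplus>\<^bsub>B\<^esub> b') y = tensor_mul_pure a b y \<oplus>\<^bsub>TS\<^esub> tensor_mul_pure a b' y"
    if "a \<in> carrier A" "b' \<in> carrier B" "b \<in> carrier B" for a b b'
    by (rule linear_maps_tensor_eqI[OF mA mB lin linear_maps_sum[OF S lin lin]])
      (use that y in \<open>simp_all add: val B.l_distr linear_maps_add[OF pr]\<close>)
  moreover have "tensor_mul_pure (c \<odot>\<^bsub>A\<^esub> a) b y = c \<odot>\<^bsub>TS\<^esub> tensor_mul_pure a b y"
    if "a \<in> carrier A" "c \<in> carrier k" "b \<in> carrier B" for a c b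
    by (rule linear_maps_tensor_eqI[OF mA mB lin linear_maps_scale[OF S lin]])
      (use that y in \<open>simp_all add: ca val am linear_maps_smult[OF pl]\<close>)
  moreover have "tensor_mul_pure a (c \<odot>\<^bsub>B\<^esub> b) y = c \<odot>\<^bsub>TS\<^esub> tensor_mul_pure a b y"
    if "a \<in> carrier A" "c \<in> carrier k" "b \<in> carrier B" for a c b
    by (rule linear_maps_tensor_eqI[OF mA mB lin linear_maps_scale[OF S lin]])
      (use that y in \<open>simp_all add: cb val bm linear_maps_smult[OF pr]\<close>)
  ultimately show ?thesis
    using linear_maps_closed[OF lin y] by (auto simp: bilinear_maps_def intro!: linear_mapsI)
qed

lemma tensor_mult_linear_left:
  assumes y: "y \<in> carrier TS"
  shows "(\<lambda>x. x \<otimes>\<^bsub>A \<boxtimes>\<^bsub>k\<^esub> B\<^esub> y) \<in> linear_maps k TS TS"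
    and "\<lbrakk>a \<in> carrier A; b \<in> carrier B\<rbrakk> \<Longrightarrow> pure k A B a b \<otimes>\<^bsub>A \<boxtimes>\<^bsub>k\<^esub> B\<^esub> y = tensor_mul_pure a b y"
proof -
  from tensor_lift_exists[OF mA mB S.module_axioms mul_pure_bilinear[OF y]] obtain h
    where h: "h \<in> linear_maps k TS TS"
      "\<And>v w. \<lbrakk>v \<in> carrier A; w \<in> carrier B\<rbrakk> \<Longrightarrow> h (pure k A B v w) = tensor_mul_pure v w y"
    by blast
  have eq: "z \<otimes>\<^bsub>A \<boxtimes>\<^bsub>k\<^esub> B\<^esub> y = h z" if "z \<in> carrier TS" for z
    using tsum_eqI[OF mA mB h(1) h(2) that] by (simp add: tensor_def tensor_mul_pure_def)
  show "(\<lambda>x. x \<otimes>\<^bsub>A \<boxtimes>\<^bsub>k\<^esub> B\<^esub> y) \<in> linear_maps k TS TS"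
    by (rule linear_maps_cong[OF h(1) S.module_axioms eq])
  show "pure k A B a b \<otimes>\<^bsub>A \<boxtimes>\<^bsub>k\<^esub> B\<^esub> y = tensor_mul_pure a b y" if "a \<in> carrier A" "b \<in> carrier B"
    using eq[OF closed] h(2) that by simp
qed

lemma pure_mult_pure:
  "\<lbrakk>a \<in> carrier A; b \<in> carrier B; a' \<in> carrier A; b' \<in> carrier B\<rbrakk> \<Longrightarrow>
    pure k A B a b \<otimes>\<^bsub>A \<boxtimes>\<^bsub>k\<^esub> B\<^esub> pure k A B a' b' = pure k A B (a \<otimes>\<^bsub>A\<^esub> a') (b \<otimes>\<^bsub>B\<^esub> b')"
  by (simp add: tensor_mult_linear_left(2)[OF closed] mul_pure(2))

text \<open>The outer sum of the product gives linearity only in the left factor. Hence the left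
  factor is decomposed into pure tensors, for which the claim is \<open>mul_pure\<close>.\<close>

lemma tensor_mult_linear_right:
  assumes x: "x \<in> carrier TS"
  shows "(\<lambda>y. x \<otimes>\<^bsub>A \<boxtimes>\<^bsub>k\<^esub> B\<^esub> y) \<in> linear_maps k TS TS"
  using x
proof (induction x rule: tensor_induct[OF mA mB, consumes 1, case_names pure add])
  case (pure a b)
  show ?case
    by (rule linear_maps_cong[OF mul_pure(1)[OF pure] S.module_axioms])
      (rule tensor_mult_linear_left(2)[OF _ pure])
next
  case (add x x')
  show ?case
    by (rule linear_maps_cong[OF linear_maps_sum[OF S.module_axioms add.IH] S.module_axioms])
      (rule linear_maps_add[OF tensor_mult_linear_left(1) add.hyps])
qed

lemma assoc_algebra_tensor: "assoc_algebra k (A \<boxtimes>\<^bsub>k\<^esub> B)"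
proof -
  let ?T = "A \<boxtimes>\<^bsub>k\<^esub> B"
  note left = tensor_mult_linear_left(1) and right = tensor_mult_linear_right
  note comp = linear_maps_comp
  note indep = linear_maps_tensor_eqI[OF mA mB]
  have mcl: "x \<otimes>\<^bsub>?T\<^esub> y \<in> carrier TS" if "x \<in> carrier TS" "y \<in> carrier TS" for x y
    using linear_maps_closed[OF left] that by blast
  \<comment> \<open>Associativity is reduced to pure tensors one argument at a time:
    \<open>1\<close> has \<open>x\<close> and \<open>y\<close> pure, \<open>2\<close> only
    \<open>x\<close>, and \<open>assoc\<close> is the general case.\<close>
  have 1: "(x \<otimes>\<^bsub>?T\<^esub> y) \<otimes>\<^bsub>?T\<^esub> z = x \<otimes>\<^bsub>?T\<^esub> (y \<otimes>\<^bsub>?T\<^esub> z)"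
    if x: "x = pure k A B a b" "a \<in> carrier A" "b \<in> carrier B"
      and y: "y = pure k A B a' b'" "a' \<in> carrier A" "b' \<in> carrier B" and z: "z \<in> carrier TS"
    for x y z a b a' b'
    by (rule indep[OF right[OF mcl] comp[OF right right] _ z])
      (use x y in \<open>simp_all add: closed pure_mult_pure A.m_assoc B.m_assoc\<close>)
  have 2: "(x \<otimes>\<^bsub>?T\<^esub> y) \<otimes>\<^bsub>?T\<^esub> z = x \<otimes>\<^bsub>?T\<^esub> (y \<otimes>\<^bsub>?T\<^esub> z)"
    if x: "x = pure k A B a b" "a \<in> carrier A" "b \<in> carrier B"
      and y: "y \<in> carrier TS" and z: "z \<in> carrier TS"
    for x y z a b
    by (rule indep[OF comp[OF right left] comp[OF left right] _ y])
      (use x z in \<open>simp_all add: closed 1\<close>)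
  have assoc: "(x \<otimes>\<^bsub>?T\<^esub> y) \<otimes>\<^bsub>?T\<^esub> z = x \<otimes>\<^bsub>?T\<^esub> (y \<otimes>\<^bsub>?T\<^esub> z)"
    if x: "x \<in> carrier TS" and y: "y \<in> carrier TS" and z: "z \<in> carrier TS" for x y z
    by (rule indep[OF comp[OF left left] left[OF mcl] _ x]) (use y z in \<open>simp_all add: 2\<close>)
  have one_l: "pure k A B \<one>\<^bsub>A\<^esub> \<one>\<^bsub>B\<^esub> \<otimes>\<^bsub>?T\<^esub> x = x" if x: "x \<in> carrier TS" for x
    by (rule indep[OF right linear_maps_id _ x]) (auto simp: closed pure_mult_pure)
  have one_r: "x \<otimes>\<^bsub>?T\<^esub> pure k A B \<one>\<^bsub>A\<^esub> \<one>\<^bsub>B\<^esub> = x" if x: "x \<in> carrier TS" for x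
    by (rule indep[OF left linear_maps_id _ x]) (auto simp: closed pure_mult_pure)
  have neg: "\<exists>y\<in>carrier TS. y \<oplus>\<^bsub>TS\<^esub> x = \<zero>\<^bsub>TS\<^esub>" if "x \<in> carrier TS" for x
    using S.M.l_neg[OF that] S.M.a_inv_closed[OF that] by blast
  have ab: "abelian_group ?T"
    by (rule abelian_groupI) (simp_all add: S.M.a_assoc neg, simp add: S.M.a_comm)
  show ?thesis
  proof (intro assoc_algebra.intro k.field_axioms)
    show "module k ?T"
      by (rule moduleI) (simp_all add: k.is_cring ab S.smult_l_distr S.smult_r_distr S.smult_assoc1)
    have "monoid ?T"
      by (rule monoidI) (simp_all add: assoc mcl closed one_l one_r)
    then show "ring ?T"
      by (intro ringI ab) (simp_all add: linear_maps_add[OF left] linear_maps_add[OF right])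
    show "assoc_algebra_axioms k ?T"
      by unfold_locales (simp_all add: linear_maps_smult[OF left] linear_maps_smult[OF right])
  qed
qed

end

declare tensor_simps [simp del] linear_maps_tensor [simp del]

section \<open>Pairings of linear maps into an algebra\<close>

lemma algebra_maps_linear: "f \<in> algebra_maps k A B \<Longrightarrow> f \<in> linear_maps k A B"
  and algebra_maps_mult: "\<lbrakk>f \<in> algebra_maps k A B; x \<in> carrier A; y \<in> carrier A\<rbrakk> \<Longrightarrow>
    f (x \<otimes>\<^bsub>A\<^esub> y) = f x \<otimes>\<^bsub>B\<^esub> f y"
  and algebra_maps_one: "f \<in> algebra_maps k A B \<Longrightarrow> f \<one>\<^bsub>A\<^esub> = \<one>\<^bsub>B\<^esub>"
  and algebra_maps_closed: "\<lbrakk>f \<in> algebra_maps k A B; x \<in> carrier A\<rbrakk> \<Longrightarrow> f x \<in> carrier B"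
  by (auto simp: algebra_maps_def ring_hom_def linear_maps_def)

lemma algebra_mapsI:
  assumes "f \<in> linear_maps k A B"
    and "\<And>x y. \<lbrakk>x \<in> carrier A; y \<in> carrier A\<rbrakk> \<Longrightarrow> f (x \<otimes>\<^bsub>A\<^esub> y) = f x \<otimes>\<^bsub>B\<^esub> f y"
    and "f \<one>\<^bsub>A\<^esub> = \<one>\<^bsub>B\<^esub>"
  shows "f \<in> algebra_maps k A B"
  using assms by (simp add: algebra_maps_def ring_hom_def linear_maps_def Pi_iff)

lemma algebra_maps_id: "(\<lambda>x. x) \<in> algebra_maps k A A"
  by (auto intro: algebra_mapsI linear_maps_id)

lemma algebra_maps_comp:
  "\<lbrakk>f \<in> algebra_maps k A B; g \<in> algebra_maps k B C\<rbrakk> \<Longrightarrow> (\<lambda>x. g (f x)) \<in> algebra_maps k A C"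
  by (rule algebra_mapsI)
    (auto intro: linear_maps_comp algebra_maps_linear simp: algebra_maps_mult algebra_maps_closed algebra_maps_one)

lemma algebra_maps_inverse:
  assumes "f \<in> algebra_maps k A B" "assoc_algebra k A" "x \<in> Units A"
  shows "f x \<otimes>\<^bsub>B\<^esub> f (inv\<^bsub>A\<^esub> x) = \<one>\<^bsub>B\<^esub>" "f (inv\<^bsub>A\<^esub> x) \<otimes>\<^bsub>B\<^esub> f x = \<one>\<^bsub>B\<^esub>"
proof -
  interpret A: ring A by (rule assoc_algebra_ring) fact
  have "x \<in> carrier A" "inv\<^bsub>A\<^esub> x \<in> carrier A" using assms(3) by auto
  then show "f x \<otimes>\<^bsub>B\<^esub> f (inv\<^bsub>A\<^esub> x) = \<one>\<^bsub>B\<^esub>" "f (inv\<^bsub>A\<^esub> x) \<otimes>\<^bsub>B\<^esub> f x = \<one>\<^bsub>B\<^esub>"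
    using assms(1,3) by (simp_all add: algebra_maps_one flip: algebra_maps_mult)
qed

definition commuting ::
  "('t, 'p) monoid_scheme \<Rightarrow> ('a, 'm) partial_object_scheme \<Rightarrow> ('b, 'n) partial_object_scheme \<Rightarrow>
   ('a \<Rightarrow> 't) \<Rightarrow> ('b \<Rightarrow> 't) \<Rightarrow> bool" where
  "commuting T A B i j \<longleftrightarrow> (\<forall>a\<in>carrier A. \<forall>b\<in>carrier B. i a \<otimes>\<^bsub>T\<^esub> j b = j b \<otimes>\<^bsub>T\<^esub> i a)"

lemma commutingD: "\<lbrakk>commuting T A B i j; a \<in> carrier A; b \<in> carrier B\<rbrakk> \<Longrightarrow> i a \<otimes>\<^bsub>T\<^esub> j b = j b \<otimes>\<^bsub>T\<^esub> i a"
  by (auto simp: commuting_def)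

lemma commuting_sym: "commuting T A B i j \<Longrightarrow> commuting T B A j i"
  by (simp add: commuting_def)

lemma commuting_comp:
  "\<lbrakk>commuting T A B i j; f \<in> linear_maps k X A\<rbrakk> \<Longrightarrow> commuting T X B (\<lambda>x. i (f x)) j"
  by (simp add: commuting_def linear_maps_closed)

definition pairing ::
  "('k, 'c) ring_scheme \<Rightarrow> ('k, 'a, 'm) module_scheme \<Rightarrow> ('k, 'b, 'n) module_scheme \<Rightarrow>
   ('k, 't, 'p) module_scheme \<Rightarrow> ('a \<Rightarrow> 't) \<Rightarrow> ('b \<Rightarrow> 't) \<Rightarrow> ('k, 'a, 'b) tens \<Rightarrow> 't" where
  "pairing k A B T i j z = tsum k A B T z (\<lambda>a b. i a \<otimes>\<^bsub>T\<^esub> j b)"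

lemma pairing_cong:
  "\<lbrakk>\<And>a. a \<in> carrier A \<Longrightarrow> i a = i' a; \<And>b. b \<in> carrier B \<Longrightarrow> j b = j' b\<rbrakk> \<Longrightarrow>
    pairing k A B T i j z = pairing k A B T i' j' z"
  unfolding pairing_def by (rule tsum_cong) simp

definition inl :: "('k, 'c) ring_scheme \<Rightarrow> ('k, 'a, 'm) module_scheme \<Rightarrow> ('k, 'b, 'n) module_scheme \<Rightarrow>
   'a \<Rightarrow> ('k, 'a, 'b) tens" where "inl k A B a = pure k A B a \<one>\<^bsub>B\<^esub>"

definition inr :: "('k, 'c) ring_scheme \<Rightarrow> ('k, 'a, 'm) module_scheme \<Rightarrow> ('k, 'b, 'n) module_scheme \<Rightarrow>
   'b \<Rightarrow> ('k, 'a, 'b) tens" where "inr k A B b = pure k A B \<one>\<^bsub>A\<^esub> b"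

context
  fixes k :: "('k, 'c) ring_scheme" and A :: "('k, 'a, 'm) module_scheme"
    and B :: "('k, 'b, 'n) module_scheme"
  assumes A: "assoc_algebra k A" and B: "assoc_algebra k B"
begin

interpretation A: ring A by (rule assoc_algebra_ring[OF A])
interpretation B: ring B by (rule assoc_algebra_ring[OF B])
interpretation AB: ring "A \<boxtimes>\<^bsub>k\<^esub> B" by (rule assoc_algebra_ring[OF assoc_algebra_tensor[OF A B]])

private lemmas module_A = assoc_algebra_module[OF A] and module_B = assoc_algebra_module[OF B]

lemma pure_carrier: "\<lbrakk>a \<in> carrier A; b \<in> carrier B\<rbrakk> \<Longrightarrow> pure k A B a b \<in> carrier (A \<boxtimes>\<^bsub>k\<^esub> B)"
  by (simp add: tensor_simps pure_closed module_A module_B)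

lemma tensor_ext:
  assumes "f \<in> linear_maps k (A \<boxtimes>\<^bsub>k\<^esub> B) T" "g \<in> linear_maps k (A \<boxtimes>\<^bsub>k\<^esub> B) T"
    and "\<And>a b. \<lbrakk>a \<in> carrier A; b \<in> carrier B\<rbrakk> \<Longrightarrow> f (pure k A B a b) = g (pure k A B a b)"
    and "z \<in> carrier (A \<boxtimes>\<^bsub>k\<^esub> B)"
  shows "f z = g z"
  using linear_maps_tensor_eqI[OF module_A module_B, of f T g z] assms by (simp add: tensor_simps linear_maps_tensor)

lemma tsum_unique:
  assumes "f \<in> linear_maps k (A \<boxtimes>\<^bsub>k\<^esub> B) T"
    and "\<And>a b. \<lbrakk>a \<in> carrier A; b \<in> carrier B\<rbrakk> \<Longrightarrow> f (pure k A B a b) = g a b"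
    and "z \<in> carrier (A \<boxtimes>\<^bsub>k\<^esub> B)"
  shows "tsum k A B T z g = f z"
  using tsum_eqI[OF module_A module_B, of f T g z] assms by (simp add: tensor_simps linear_maps_tensor)

lemma inl_hom: "inl k A B \<in> algebra_maps k A (A \<boxtimes>\<^bsub>k\<^esub> B)"
proof (rule algebra_mapsI)
  have "inl k A B = (\<lambda>a. pure k A B a \<one>\<^bsub>B\<^esub>)" by (simp add: fun_eq_iff inl_def)
  then show "inl k A B \<in> linear_maps k A (A \<boxtimes>\<^bsub>k\<^esub> B)"
    using pure_linear_left[OF module_A module_B] by (simp add: linear_maps_tensor)
qed (simp_all add: inl_def pure_mult_pure[OF A B] tensor_simps)

lemma inr_hom: "inr k A B \<in> algebra_maps k B (A \<boxtimes>\<^bsub>k\<^esub> B)"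
proof (rule algebra_mapsI)
  have "inr k A B = (\<lambda>b. pure k A B \<one>\<^bsub>A\<^esub> b)" by (simp add: fun_eq_iff inr_def)
  then show "inr k A B \<in> linear_maps k B (A \<boxtimes>\<^bsub>k\<^esub> B)"
    using pure_linear_right[OF module_A module_B] by (simp add: linear_maps_tensor)
qed (simp_all add: inr_def pure_mult_pure[OF A B] tensor_simps)

lemma pure_eq_inl_inr:
  "\<lbrakk>a \<in> carrier A; b \<in> carrier B\<rbrakk> \<Longrightarrow> pure k A B a b = inl k A B a \<otimes>\<^bsub>A \<boxtimes>\<^bsub>k\<^esub> B\<^esub> inr k A B b"
  by (simp add: inl_def inr_def pure_mult_pure[OF A B])

lemma inl_inr_commuting: "commuting (A \<boxtimes>\<^bsub>k\<^esub> B) A B (inl k A B) (inr k A B)"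
  by (simp add: commuting_def inl_def inr_def pure_mult_pure[OF A B])

text \<open>Reading along the two embeddings changes nothing. This is how an equation between values
  in an algebra turns back into an equation in the tensor product.\<close>

lemma pairing_inl_inr:
  assumes z: "z \<in> carrier (A \<boxtimes>\<^bsub>k\<^esub> B)"
  shows "pairing k A B (A \<boxtimes>\<^bsub>k\<^esub> B) (inl k A B) (inr k A B) z = z"
  unfolding pairing_def
  by (rule tsum_unique[OF linear_maps_id _ z]) (rule pure_eq_inl_inr)

context
  fixes T :: "('k, 't, 'p) module_scheme" and i :: "'a \<Rightarrow> 't" and j :: "'b \<Rightarrow> 't"
  assumes T: "assoc_algebra k T" and i: "i \<in> linear_maps k A T" and j: "j \<in> linear_maps k B T"
begin

interpretation T: ring T by (rule assoc_algebra_ring[OF T])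

lemma pairing_linear_pure:
  "pairing k A B T i j \<in> linear_maps k (A \<boxtimes>\<^bsub>k\<^esub> B) T \<and>
   (\<forall>a\<in>carrier A. \<forall>b\<in>carrier B. pairing k A B T i j (pure k A B a b) = i a \<otimes>\<^bsub>T\<^esub> j b)"
proof -
  note cl = linear_maps_closed[OF i] linear_maps_closed[OF j]
  have "(\<lambda>a b. i a \<otimes>\<^bsub>T\<^esub> j b) \<in> bilinear_maps k A B T"
    using linear_maps_comp[OF i assoc_algebra_mult_linear(2)[OF T cl(2)]]
      linear_maps_comp[OF j assoc_algebra_mult_linear(1)[OF T cl(1)]]
    by (simp add: bilinear_maps_def)
  from tensor_lift_exists[OF module_A module_B assoc_algebra_module[OF T] this] obtain h
    where h: "h \<in> linear_maps k (A \<boxtimes>\<^bsub>k\<^esub> B) T"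
      "\<And>v w. \<lbrakk>v \<in> carrier A; w \<in> carrier B\<rbrakk> \<Longrightarrow> h (pure k A B v w) = i v \<otimes>\<^bsub>T\<^esub> j w"
    by (auto simp: linear_maps_tensor)
  have eq: "pairing k A B T i j z = h z" if "z \<in> carrier (A \<boxtimes>\<^bsub>k\<^esub> B)" for z
    unfolding pairing_def by (rule tsum_unique[OF h that])
  have "module k (A \<boxtimes>\<^bsub>k\<^esub> B)"
    by (rule assoc_algebra_module[OF assoc_algebra_tensor[OF A B]])
  from linear_maps_cong[OF h(1) this eq] show ?thesis
    using eq pure_carrier h(2) by simp
qed

lemmas pairing_linear = pairing_linear_pure[THEN conjunct1]

lemma pairing_pure: "\<lbrakk>a \<in> carrier A; b \<in> carrier B\<rbrakk> \<Longrightarrow> pairing k A B T i j (pure k A B a b) = i a \<otimes>\<^bsub>T\<^esub> j b"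
  using pairing_linear_pure by blast

lemma pairing_closed: "z \<in> carrier (A \<boxtimes>\<^bsub>k\<^esub> B) \<Longrightarrow> pairing k A B T i j z \<in> carrier T"
  by (rule linear_maps_closed[OF pairing_linear])

lemma pairing_eqI:
  assumes "f \<in> linear_maps k (A \<boxtimes>\<^bsub>k\<^esub> B) T"
    and "\<And>a b. \<lbrakk>a \<in> carrier A; b \<in> carrier B\<rbrakk> \<Longrightarrow> f (pure k A B a b) = i a \<otimes>\<^bsub>T\<^esub> j b"
    and "z \<in> carrier (A \<boxtimes>\<^bsub>k\<^esub> B)"
  shows "f z = pairing k A B T i j z"
  by (rule tensor_ext[OF assms(1) pairing_linear _ assms(3)]) (simp add: assms(2) pairing_pure)

lemma pairing_inl: "\<lbrakk>j \<one>\<^bsub>B\<^esub> = \<one>\<^bsub>T\<^esub>; a \<in> carrier A\<rbrakk> \<Longrightarrow> pairing k A B T i j (inl k A B a) = i a"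
  by (simp add: inl_def pairing_pure linear_maps_closed[OF i])

lemma pairing_inr: "\<lbrakk>i \<one>\<^bsub>A\<^esub> = \<one>\<^bsub>T\<^esub>; b \<in> carrier B\<rbrakk> \<Longrightarrow> pairing k A B T i j (inr k A B b) = j b"
  by (simp add: inr_def pairing_pure linear_maps_closed[OF j])

end

text \<open>In a product of two values, \<open>j b\<close> and \<open>i a'\<close> have to change
  places; this is the one use of the commuting images.\<close>

lemma pairing_hom:
  assumes T: "assoc_algebra k T" and i: "i \<in> algebra_maps k A T" and j: "j \<in> algebra_maps k B T"
    and c: "commuting T A B i j"
  shows "pairing k A B T i j \<in> algebra_maps k (A \<boxtimes>\<^bsub>k\<^esub> B) T"
proof -
  interpret T: ring T by (rule assoc_algebra_ring[OF T])
  note AB = assoc_algebra_tensor[OF A B]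
  note il = algebra_maps_linear[OF i] and jl = algebra_maps_linear[OF j]
  let ?p = "pairing k A B T i j"
  note pl = pairing_linear[OF T il jl] and pp = pairing_pure[OF T il jl] and pc = pairing_closed[OF T il jl]
  note [simp] = algebra_maps_closed[OF i] algebra_maps_closed[OF j]
  have 1: "?p (pure k A B a b \<otimes>\<^bsub>A \<boxtimes>\<^bsub>k\<^esub> B\<^esub> y) = ?p (pure k A B a b) \<otimes>\<^bsub>T\<^esub> ?p y"
    if a: "a \<in> carrier A" and b: "b \<in> carrier B" and y: "y \<in> carrier (A \<boxtimes>\<^bsub>k\<^esub> B)" for a b y
  proof (rule tensor_ext[OF linear_maps_comp[OF assoc_algebra_mult_linear(1)[OF AB pure_carrier[OF a b]] pl]
        linear_maps_lmult[OF T pl pc[OF pure_carrier[OF a b]]] _ y])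
    fix a' b' assume a': "a' \<in> carrier A" and b': "b' \<in> carrier B"
    have "i a \<otimes>\<^bsub>T\<^esub> i a' \<otimes>\<^bsub>T\<^esub> (j b \<otimes>\<^bsub>T\<^esub> j b') = i a \<otimes>\<^bsub>T\<^esub> (i a' \<otimes>\<^bsub>T\<^esub> j b) \<otimes>\<^bsub>T\<^esub> j b'"
      using a b a' b' by (simp add: T.m_assoc)
    also have "\<dots> = i a \<otimes>\<^bsub>T\<^esub> j b \<otimes>\<^bsub>T\<^esub> (i a' \<otimes>\<^bsub>T\<^esub> j b')"
      using a b a' b' by (simp add: commutingD[OF c a' b] T.m_assoc)
    finally show "?p (pure k A B a b \<otimes>\<^bsub>A \<boxtimes>\<^bsub>k\<^esub> B\<^esub> pure k A B a' b') = ?p (pure k A B a b) \<otimes>\<^bsub>T\<^esub> ?p (pure k A B a' b')"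
      using a b a' b' by (simp add: pure_mult_pure[OF A B] pp algebra_maps_mult[OF i] algebra_maps_mult[OF j])
  qed
  show ?thesis
  proof (rule algebra_mapsI[OF pl])
    show "?p \<one>\<^bsub>A \<boxtimes>\<^bsub>k\<^esub> B\<^esub> = \<one>\<^bsub>T\<^esub>"
      by (simp add: tensor_simps(5) pp algebra_maps_one[OF i] algebra_maps_one[OF j])
    show "?p (x \<otimes>\<^bsub>A \<boxtimes>\<^bsub>k\<^esub> B\<^esub> y) = ?p x \<otimes>\<^bsub>T\<^esub> ?p y"
      if x: "x \<in> carrier (A \<boxtimes>\<^bsub>k\<^esub> B)" and y: "y \<in> carrier (A \<boxtimes>\<^bsub>k\<^esub> B)" for x y
      by (rule tensor_ext[OF linear_maps_comp[OF assoc_algebra_mult_linear(2)[OF AB y] pl]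
            linear_maps_rmult[OF T pl pc[OF y]] 1[OF _ _ y] x])
  qed
qed

text \<open>Naturality in the target: both sides are linear in \<open>z\<close> and agree on pure
  tensors. It transports calculations from one target algebra to another.\<close>

lemma hom_pairing:
  assumes T: "assoc_algebra k T" and T': "assoc_algebra k T'"
    and i: "i \<in> linear_maps k A T" and j: "j \<in> linear_maps k B T" and F: "F \<in> algebra_maps k T T'"
    and z: "z \<in> carrier (A \<boxtimes>\<^bsub>k\<^esub> B)"
  shows "F (pairing k A B T i j z) = pairing k A B T' (\<lambda>a. F (i a)) (\<lambda>b. F (j b)) z"
proof -
  note Fl = algebra_maps_linear[OF F]
  note cl = linear_maps_closed[OF i] linear_maps_closed[OF j]
  show ?thesis
    by (rule pairing_eqI[OF T' linear_maps_comp[OF i Fl] linear_maps_comp[OF j Fl]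
          linear_maps_comp[OF pairing_linear[OF T i j] Fl] _ z])
      (simp add: pairing_pure[OF T i j] algebra_maps_mult[OF F] cl)
qed

text \<open>The element \<open>c\<close> is passed first through \<open>i a\<close> and then through
  \<open>j b\<close>. With \<open>i' = i\<close> and \<open>j' = j\<close> the result is
  commutation, from which \<open>commuting_pairing\<close> follows.\<close>

lemma pairing_intertwine:
  assumes T: "assoc_algebra k T"
    and i: "i \<in> linear_maps k A T" and j: "j \<in> linear_maps k B T"
    and i': "i' \<in> linear_maps k A T" and j': "j' \<in> linear_maps k B T"
    and c: "c \<in> carrier T"
    and ci: "\<And>a. a \<in> carrier A \<Longrightarrow> c \<otimes>\<^bsub>T\<^esub> i a = i' a \<otimes>\<^bsub>T\<^esub> c"
    and cj: "\<And>b. b \<in> carrier B \<Longrightarrow> c \<otimes>\<^bsub>T\<^esub> j b = j' b \<otimes>\<^bsub>T\<^esub> c"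
    and z: "z \<in> carrier (A \<boxtimes>\<^bsub>k\<^esub> B)"
  shows "c \<otimes>\<^bsub>T\<^esub> pairing k A B T i j z = pairing k A B T i' j' z \<otimes>\<^bsub>T\<^esub> c"
proof (rule tensor_ext[OF linear_maps_lmult[OF T pairing_linear[OF T i j] c]
        linear_maps_rmult[OF T pairing_linear[OF T i' j'] c] _ z])
  interpret T: ring T by (rule assoc_algebra_ring[OF T])
  fix a b assume a: "a \<in> carrier A" and b: "b \<in> carrier B"
  note cl = linear_maps_closed[OF i a] linear_maps_closed[OF j b] linear_maps_closed[OF i' a] linear_maps_closed[OF j' b] c
  have "c \<otimes>\<^bsub>T\<^esub> (i a \<otimes>\<^bsub>T\<^esub> j b) = i' a \<otimes>\<^bsub>T\<^esub> (c \<otimes>\<^bsub>T\<^esub> j b)"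
    using cl by (simp add: ci[OF a] flip: T.m_assoc)
  also have "\<dots> = i' a \<otimes>\<^bsub>T\<^esub> j' b \<otimes>\<^bsub>T\<^esub> c"
    using cl by (simp add: cj[OF b] T.m_assoc)
  finally show "c \<otimes>\<^bsub>T\<^esub> pairing k A B T i j (pure k A B a b) = pairing k A B T i' j' (pure k A B a b) \<otimes>\<^bsub>T\<^esub> c"
    using a b by (simp add: pairing_pure[OF T] i j i' j')
qed

lemma commuting_pairing:
  assumes T: "assoc_algebra k T"
    and i: "i \<in> linear_maps k A T" and j: "j \<in> linear_maps k B T" and l: "l \<in> linear_maps k C T"
    and il: "commuting T A C i l" and jl: "commuting T B C j l"
  shows "commuting T (A \<boxtimes>\<^bsub>k\<^esub> B) C (pairing k A B T i j) l"
  unfolding commuting_def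
  using pairing_intertwine[OF T i j i j linear_maps_closed[OF l]] commutingD[OF il] commutingD[OF jl]
  by (metis (no_types, lifting))

text \<open>Under \<open>J\<close> only a factor at the right end may be replaced. So
  \<open>j b\<close> is replaced first; then \<open>i a\<close> is moved to the end past
  \<open>j' b\<close>, replaced there and moved back, which explains the two commutation
  hypotheses.\<close>

lemma pairing_collapse_right:
  assumes T: "assoc_algebra k T" and J: "J \<in> linear_maps k T M"
    and i: "i \<in> linear_maps k A T" and j: "j \<in> linear_maps k B T"
    and i': "i' \<in> linear_maps k A T" and j': "j' \<in> linear_maps k B T"
    and Ji: "\<And>y a. \<lbrakk>y \<in> carrier T; a \<in> carrier A\<rbrakk> \<Longrightarrow> J (y \<otimes>\<^bsub>T\<^esub> i a) = J (y \<otimes>\<^bsub>T\<^esub> i' a)"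
    and Jj: "\<And>y b. \<lbrakk>y \<in> carrier T; b \<in> carrier B\<rbrakk> \<Longrightarrow> J (y \<otimes>\<^bsub>T\<^esub> j b) = J (y \<otimes>\<^bsub>T\<^esub> j' b)"
    and c: "commuting T A B i j'" "commuting T A B i' j'"
    and y: "y \<in> carrier T" and z: "z \<in> carrier (A \<boxtimes>\<^bsub>k\<^esub> B)"
  shows "J (y \<otimes>\<^bsub>T\<^esub> pairing k A B T i j z) = J (y \<otimes>\<^bsub>T\<^esub> pairing k A B T i' j' z)"
proof (rule tensor_ext[OF linear_maps_comp[OF linear_maps_lmult[OF T pairing_linear[OF T i j] y] J]
        linear_maps_comp[OF linear_maps_lmult[OF T pairing_linear[OF T i' j'] y] J] _ z])
  interpret T: ring T by (rule assoc_algebra_ring[OF T])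
  fix a b assume a: "a \<in> carrier A" and b: "b \<in> carrier B"
  note cl = linear_maps_closed[OF i a] linear_maps_closed[OF j b] linear_maps_closed[OF i' a] linear_maps_closed[OF j' b] y
  have "J (y \<otimes>\<^bsub>T\<^esub> (i a \<otimes>\<^bsub>T\<^esub> j b)) = J (y \<otimes>\<^bsub>T\<^esub> (i a \<otimes>\<^bsub>T\<^esub> j' b))"
    using cl Jj[of "y \<otimes>\<^bsub>T\<^esub> i a" b] b by (simp add: T.m_assoc)
  also have "\<dots> = J (y \<otimes>\<^bsub>T\<^esub> j' b \<otimes>\<^bsub>T\<^esub> i a)"
    using cl by (simp add: commutingD[OF c(1) a b] T.m_assoc)
  also have "\<dots> = J (y \<otimes>\<^bsub>T\<^esub> (i' a \<otimes>\<^bsub>T\<^esub> j' b))"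
    using cl a Ji[of "y \<otimes>\<^bsub>T\<^esub> j' b" a] by (simp add: commutingD[OF c(2) a b] T.m_assoc)
  finally show "J (y \<otimes>\<^bsub>T\<^esub> pairing k A B T i j (pure k A B a b)) =
      J (y \<otimes>\<^bsub>T\<^esub> pairing k A B T i' j' (pure k A B a b))"
    using a b by (simp add: pairing_pure[OF T] i j i' j')
qed

text \<open>Here \<open>i a\<close> already stands at the left end and is replaced first. Then
  \<open>j b\<close> is brought in front of \<open>i' a\<close>, so it is \<open>i'\<close> that has
  to commute with \<open>j\<close> and with \<open>j'\<close>.\<close>

lemma pairing_collapse_left:
  assumes T: "assoc_algebra k T" and J: "J \<in> linear_maps k T M"
    and i: "i \<in> linear_maps k A T" and j: "j \<in> linear_maps k B T"
    and i': "i' \<in> linear_maps k A T" and j': "j' \<in> linear_maps k B T"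
    and Ji: "\<And>y a. \<lbrakk>y \<in> carrier T; a \<in> carrier A\<rbrakk> \<Longrightarrow> J (i a \<otimes>\<^bsub>T\<^esub> y) = J (i' a \<otimes>\<^bsub>T\<^esub> y)"
    and Jj: "\<And>y b. \<lbrakk>y \<in> carrier T; b \<in> carrier B\<rbrakk> \<Longrightarrow> J (j b \<otimes>\<^bsub>T\<^esub> y) = J (j' b \<otimes>\<^bsub>T\<^esub> y)"
    and c: "commuting T A B i' j" "commuting T A B i' j'"
    and y: "y \<in> carrier T" and z: "z \<in> carrier (A \<boxtimes>\<^bsub>k\<^esub> B)"
  shows "J (pairing k A B T i j z \<otimes>\<^bsub>T\<^esub> y) = J (pairing k A B T i' j' z \<otimes>\<^bsub>T\<^esub> y)"
proof (rule tensor_ext[OF linear_maps_comp[OF linear_maps_rmult[OF T pairing_linear[OF T i j] y] J]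
        linear_maps_comp[OF linear_maps_rmult[OF T pairing_linear[OF T i' j'] y] J] _ z])
  interpret T: ring T by (rule assoc_algebra_ring[OF T])
  fix a b assume a: "a \<in> carrier A" and b: "b \<in> carrier B"
  note cl = linear_maps_closed[OF i a] linear_maps_closed[OF j b] linear_maps_closed[OF i' a] linear_maps_closed[OF j' b] y
  have "J (i a \<otimes>\<^bsub>T\<^esub> j b \<otimes>\<^bsub>T\<^esub> y) = J (i' a \<otimes>\<^bsub>T\<^esub> j b \<otimes>\<^bsub>T\<^esub> y)"
    using cl Ji[of "j b \<otimes>\<^bsub>T\<^esub> y" a] a by (simp add: T.m_assoc)
  also have "\<dots> = J (j b \<otimes>\<^bsub>T\<^esub> (i' a \<otimes>\<^bsub>T\<^esub> y))"
    using cl by (simp add: commutingD[OF c(1) a b] T.m_assoc)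
  also have "\<dots> = J (j' b \<otimes>\<^bsub>T\<^esub> i' a \<otimes>\<^bsub>T\<^esub> y)"
    using cl b Jj[of "i' a \<otimes>\<^bsub>T\<^esub> y" b] by (simp add: T.m_assoc)
  also have "\<dots> = J (i' a \<otimes>\<^bsub>T\<^esub> j' b \<otimes>\<^bsub>T\<^esub> y)"
    using cl by (simp add: commutingD[OF c(2) a b])
  finally show "J (pairing k A B T i j (pure k A B a b) \<otimes>\<^bsub>T\<^esub> y) =
      J (pairing k A B T i' j' (pure k A B a b) \<otimes>\<^bsub>T\<^esub> y)"
    using a b by (simp add: pairing_pure[OF T] i j i' j')
qed

end

section \<open>Iterated readings and the structural maps that occur in the axioms\<close>

abbreviation pairing3 ::
  "('k, 'c) ring_scheme \<Rightarrow> ('k, 'a1, 'm1) module_scheme \<Rightarrow> ('k, 'a2, 'm2) module_scheme \<Rightarrow>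
   ('k, 'a3, 'm3) module_scheme \<Rightarrow> ('k, 't, 'p) module_scheme \<Rightarrow>
   ('a1 \<Rightarrow> 't) \<Rightarrow> ('a2 \<Rightarrow> 't) \<Rightarrow> ('a3 \<Rightarrow> 't) \<Rightarrow> ('k, 'a1, ('k, 'a2, 'a3) tens) tens \<Rightarrow> 't" where
  "pairing3 k A B C T i j l \<equiv> pairing k A (B \<boxtimes>\<^bsub>k\<^esub> C) T i (pairing k B C T j l)"

abbreviation pairing4 ::
  "('k, 'c) ring_scheme \<Rightarrow> ('k, 'a1, 'm1) module_scheme \<Rightarrow> ('k, 'a2, 'm2) module_scheme \<Rightarrow>
   ('k, 'a3, 'm3) module_scheme \<Rightarrow> ('k, 'a4, 'm4) module_scheme \<Rightarrow> ('k, 't, 'p) module_scheme \<Rightarrow>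
   ('a1 \<Rightarrow> 't) \<Rightarrow> ('a2 \<Rightarrow> 't) \<Rightarrow> ('a3 \<Rightarrow> 't) \<Rightarrow> ('a4 \<Rightarrow> 't) \<Rightarrow>
   ('k, 'a1, ('k, 'a2, ('k, 'a3, 'a4) tens) tens) tens \<Rightarrow> 't" where
  "pairing4 k A B C D T i j l m \<equiv>
     pairing k A (B \<boxtimes>\<^bsub>k\<^esub> C \<boxtimes>\<^bsub>k\<^esub> D) T i (pairing3 k B C D T j l m)"

lemma inl_closed:
  "\<lbrakk>assoc_algebra k A; assoc_algebra k B; a \<in> carrier A\<rbrakk> \<Longrightarrow> inl k A B a \<in> carrier (A \<boxtimes>\<^bsub>k\<^esub> B)"
  and inr_closed:
  "\<lbrakk>assoc_algebra k A; assoc_algebra k B; b \<in> carrier B\<rbrakk> \<Longrightarrow> inr k A B b \<in> carrier (A \<boxtimes>\<^bsub>k\<^esub> B)"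
  by (blast intro: algebra_maps_closed[OF inl_hom] algebra_maps_closed[OF inr_hom])+

lemma assoc_algebra_one_closed: "assoc_algebra k A \<Longrightarrow> \<one>\<^bsub>A\<^esub> \<in> carrier A"
  using ring.ring_simprules(6)[OF assoc_algebra_ring] .

text \<open>The maps from which the axioms are built are themselves readings, along embeddings into
  the target tensor product; hence the rules for \<open>pairing\<close> apply to them.\<close>

lemma tensor_map_eq_pairing:
  assumes "assoc_algebra k A'" "assoc_algebra k B'" "f \<in> linear_maps k A A'" "g \<in> linear_maps k B B'"
  shows "tensor_map k A B A' B' f g z =
    pairing k A B (A' \<boxtimes>\<^bsub>k\<^esub> B') (\<lambda>a. inl k A' B' (f a)) (\<lambda>b. inr k A' B' (g b)) z"
  unfolding tensor_map_def pairing_def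
  by (rule tsum_cong) (simp add: pure_eq_inl_inr[OF assms(1,2)] linear_maps_closed[OF assms(3)]
      linear_maps_closed[OF assms(4)])

lemma map_right_eq_pairing:
  assumes "assoc_algebra k A" "assoc_algebra k B'" "g \<in> linear_maps k B B'"
  shows "map_right k A B B' g z =
    pairing k A B (A \<boxtimes>\<^bsub>k\<^esub> B') (inl k A B') (\<lambda>b. inr k A B' (g b)) z"
  unfolding map_right_def using tensor_map_eq_pairing[OF assms(1,2) linear_maps_id assms(3)] by simp

context
  fixes k :: "('k, 'c) ring_scheme" and A :: "('k, 'a, 'm) module_scheme"
    and B :: "('k, 'b, 'n) module_scheme" and B' :: "('k, 'b1, 'n1) module_scheme"
    and g :: "'b \<Rightarrow> 'b1"
  assumes A: "assoc_algebra k A" and B: "assoc_algebra k B" and B': "assoc_algebra k B'"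
    and g: "g \<in> linear_maps k B B'"
begin

lemma map_right_linear: "map_right k A B B' g \<in> linear_maps k (A \<boxtimes>\<^bsub>k\<^esub> B) (A \<boxtimes>\<^bsub>k\<^esub> B')"
proof -
  note m = assoc_algebra_module[OF assoc_algebra_tensor[OF A B]]
  show ?thesis
    by (rule linear_maps_cong[OF pairing_linear[OF A B assoc_algebra_tensor[OF A B']
          algebra_maps_linear[OF inl_hom[OF A B']]
          linear_maps_comp[OF g algebra_maps_linear[OF inr_hom[OF A B']]]] m
          map_right_eq_pairing[OF A B' g]])
qed

lemma map_right_pure:
  assumes "a \<in> carrier A" "b \<in> carrier B"
  shows "map_right k A B B' g (pure k A B a b) = pure k A B' a (g b)"
  using assms linear_maps_closed[OF g]
  by (simp add: map_right_eq_pairing[OF A B' g] pure_eq_inl_inr[OF A B']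
      pairing_pure[OF A B assoc_algebra_tensor[OF A B'] algebra_maps_linear[OF inl_hom[OF A B']]
        linear_maps_comp[OF g algebra_maps_linear[OF inr_hom[OF A B']]]])

text \<open>Together with \<open>pairing_expand_left\<close> this translates the axioms: a map
  applied to one factor is absorbed into the reading of that factor.\<close>

lemma pairing_map_right:
  assumes T: "assoc_algebra k T" and i: "i \<in> linear_maps k A T" and j: "j \<in> linear_maps k B' T"
    and z: "z \<in> carrier (A \<boxtimes>\<^bsub>k\<^esub> B)"
  shows "pairing k A B' T i j (map_right k A B B' g z) = pairing k A B T i (\<lambda>b. j (g b)) z"
  by (rule pairing_eqI[OF A B T i linear_maps_comp[OF g j]
        linear_maps_comp[OF map_right_linear pairing_linear[OF A B' T i j]] _ z])
    (simp add: map_right_pure pairing_pure[OF A B' T i j] linear_maps_closed[OF g])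

end

context
  fixes k :: "('k, 'c) ring_scheme" and A :: "('k, 'a, 'm) module_scheme"
    and B :: "('k, 'b, 'n) module_scheme" and C :: "('k, 'd, 'q) module_scheme"
  assumes A: "assoc_algebra k A" and B: "assoc_algebra k B" and C: "assoc_algebra k C"
begin

private lemma AB: "assoc_algebra k (A \<boxtimes>\<^bsub>k\<^esub> B)" by (rule assoc_algebra_tensor[OF A B])
private lemma BC: "assoc_algebra k (B \<boxtimes>\<^bsub>k\<^esub> C)" by (rule assoc_algebra_tensor[OF B C])
private lemma ABC: "assoc_algebra k (A \<boxtimes>\<^bsub>k\<^esub> B \<boxtimes>\<^bsub>k\<^esub> C)" by (rule assoc_algebra_tensor[OF A BC])
private lemma AB_C: "assoc_algebra k ((A \<boxtimes>\<^bsub>k\<^esub> B) \<boxtimes>\<^bsub>k\<^esub> C)" by (rule assoc_algebra_tensor[OF AB C])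

interpretation BC: ring "B \<boxtimes>\<^bsub>k\<^esub> C" by (rule assoc_algebra_ring[OF BC])
interpretation ABC: ring "A \<boxtimes>\<^bsub>k\<^esub> B \<boxtimes>\<^bsub>k\<^esub> C" by (rule assoc_algebra_ring[OF ABC])

abbreviation (input) "slot1 \<equiv> inl k A (B \<boxtimes>\<^bsub>k\<^esub> C)"
abbreviation (input) "slot2 \<equiv> \<lambda>b. inr k A (B \<boxtimes>\<^bsub>k\<^esub> C) (inl k B C b)"
abbreviation (input) "slot3 \<equiv> \<lambda>c. inr k A (B \<boxtimes>\<^bsub>k\<^esub> C) (inr k B C c)"

lemma slot_homs:
  "slot1 \<in> algebra_maps k A (A \<boxtimes>\<^bsub>k\<^esub> B \<boxtimes>\<^bsub>k\<^esub> C)"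
  "slot2 \<in> algebra_maps k B (A \<boxtimes>\<^bsub>k\<^esub> B \<boxtimes>\<^bsub>k\<^esub> C)"
  "slot3 \<in> algebra_maps k C (A \<boxtimes>\<^bsub>k\<^esub> B \<boxtimes>\<^bsub>k\<^esub> C)"
  by (rule inl_hom[OF A BC] algebra_maps_comp[OF inl_hom[OF B C] inr_hom[OF A BC]]
      algebra_maps_comp[OF inr_hom[OF B C] inr_hom[OF A BC]])+

lemmas slot_linear = slot_homs[THEN algebra_maps_linear]
  and slot_closed = slot_homs[THEN algebra_maps_closed]

lemma pure3_eq_slots:
  "\<lbrakk>a \<in> carrier A; b \<in> carrier B; c \<in> carrier C\<rbrakk> \<Longrightarrow>
    pure3 k A B C a b c = slot1 a \<otimes>\<^bsub>A \<boxtimes>\<^bsub>k\<^esub> B \<boxtimes>\<^bsub>k\<^esub> C\<^esub> (slot2 b \<otimes>\<^bsub>A \<boxtimes>\<^bsub>k\<^esub> B \<boxtimes>\<^bsub>k\<^esub> C\<^esub> slot3 c)"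
  by (simp add: pure3_def pure_eq_inl_inr[OF A BC] pure_carrier[OF B C] pure_eq_inl_inr[OF B C]
      algebra_maps_mult[OF inr_hom[OF A BC]] inl_closed[OF B C] inr_closed[OF B C])

lemma assoc_eq_pairing:
  "assoc k A B C z = pairing k (A \<boxtimes>\<^bsub>k\<^esub> B) C (A \<boxtimes>\<^bsub>k\<^esub> B \<boxtimes>\<^bsub>k\<^esub> C)
     (pairing k A B (A \<boxtimes>\<^bsub>k\<^esub> B \<boxtimes>\<^bsub>k\<^esub> C) slot1 slot2) slot3 z"
  unfolding assoc_def pairing_def[of k "A \<boxtimes>\<^bsub>k\<^esub> B"]
proof (rule tsum_cong)
  fix x c assume x: "x \<in> carrier (A \<boxtimes>\<^bsub>k\<^esub> B)" and c: "c \<in> carrier C"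
  let ?p = "pairing k A B (A \<boxtimes>\<^bsub>k\<^esub> B \<boxtimes>\<^bsub>k\<^esub> C) slot1 slot2"
  show "tsum k A B (A \<boxtimes>\<^bsub>k\<^esub> B \<boxtimes>\<^bsub>k\<^esub> C) x (\<lambda>a b. pure3 k A B C a b c) =
      ?p x \<otimes>\<^bsub>A \<boxtimes>\<^bsub>k\<^esub> B \<boxtimes>\<^bsub>k\<^esub> C\<^esub> slot3 c"
    by (rule tsum_unique[OF A B linear_maps_rmult[OF ABC pairing_linear[OF A B ABC slot_linear(1,2)] slot_closed(3)[OF c]] _ x])
      (simp add: pairing_pure[OF A B ABC slot_linear(1,2)] pure3_eq_slots c slot_closed ABC.m_assoc)
qed

lemma assoc_linear: "assoc k A B C \<in> linear_maps k ((A \<boxtimes>\<^bsub>k\<^esub> B) \<boxtimes>\<^bsub>k\<^esub> C) (A \<boxtimes>\<^bsub>k\<^esub> B \<boxtimes>\<^bsub>k\<^esub> C)"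
  by (rule linear_maps_cong[OF pairing_linear[OF AB C ABC pairing_linear[OF A B ABC slot_linear(1,2)] slot_linear(3)]
        assoc_algebra_module[OF AB_C] assoc_eq_pairing])

context
  fixes T :: "('k, 't, 'p) module_scheme" and i :: "'a \<Rightarrow> 't" and j :: "'b \<Rightarrow> 't" and l :: "'d \<Rightarrow> 't"
  assumes T: "assoc_algebra k T" and i: "i \<in> linear_maps k A T" and j: "j \<in> linear_maps k B T"
    and l: "l \<in> linear_maps k C T"
begin

interpretation T: ring T by (rule assoc_algebra_ring[OF T])

private lemmas ij = pairing_linear[OF A B T i j] and jl = pairing_linear[OF B C T j l]
lemmas pairing3_linear = pairing_linear[OF A BC T i jl]

lemma pairing3_pure3:
  "\<lbrakk>a \<in> carrier A; b \<in> carrier B; c \<in> carrier C\<rbrakk> \<Longrightarrow>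
    pairing3 k A B C T i j l (pure3 k A B C a b c) = i a \<otimes>\<^bsub>T\<^esub> (j b \<otimes>\<^bsub>T\<^esub> l c)"
  by (simp add: pure3_def pairing_pure[OF A BC T i jl] pairing_pure[OF B C T j l] pure_carrier[OF B C])

text \<open>The identification of the two bracketings leaves no trace after reading off, because
  multiplication in \<open>T\<close> is associative.\<close>

lemma pairing3_assoc:
  assumes z: "z \<in> carrier ((A \<boxtimes>\<^bsub>k\<^esub> B) \<boxtimes>\<^bsub>k\<^esub> C)"
  shows "pairing3 k A B C T i j l (assoc k A B C z) = pairing k (A \<boxtimes>\<^bsub>k\<^esub> B) C T (pairing k A B T i j) l z"
proof (rule pairing_eqI[OF AB C T ij l linear_maps_comp[OF assoc_linear pairing3_linear] _ z])
  fix x c assume x: "x \<in> carrier (A \<boxtimes>\<^bsub>k\<^esub> B)" and c: "c \<in> carrier C"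
  let ?p = "pairing k A B (A \<boxtimes>\<^bsub>k\<^esub> B \<boxtimes>\<^bsub>k\<^esub> C) slot1 slot2"
  note p = pairing_linear[OF A B ABC slot_linear(1,2)]
  have "pairing3 k A B C T i j l (?p x \<otimes>\<^bsub>A \<boxtimes>\<^bsub>k\<^esub> B \<boxtimes>\<^bsub>k\<^esub> C\<^esub> slot3 c) = pairing k A B T i j x \<otimes>\<^bsub>T\<^esub> l c"
  proof (rule tensor_ext[OF A B linear_maps_comp[OF linear_maps_rmult[OF ABC p slot_closed(3)[OF c]] pairing3_linear]
        linear_maps_rmult[OF T ij linear_maps_closed[OF l c]] _ x])
    fix a b assume a: "a \<in> carrier A" and b: "b \<in> carrier B"
    have "?p (pure k A B a b) \<otimes>\<^bsub>A \<boxtimes>\<^bsub>k\<^esub> B \<boxtimes>\<^bsub>k\<^esub> C\<^esub> slot3 c = pure3 k A B C a b c"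
      using a b c by (simp add: pairing_pure[OF A B ABC slot_linear(1,2)] pure3_eq_slots slot_closed ABC.m_assoc)
    then show "pairing3 k A B C T i j l (?p (pure k A B a b) \<otimes>\<^bsub>A \<boxtimes>\<^bsub>k\<^esub> B \<boxtimes>\<^bsub>k\<^esub> C\<^esub> slot3 c) =
        pairing k A B T i j (pure k A B a b) \<otimes>\<^bsub>T\<^esub> l c"
      using a b c by (simp add: pairing3_pure3 pairing_pure[OF A B T i j] T.m_assoc linear_maps_closed[OF i]
          linear_maps_closed[OF j] linear_maps_closed[OF l])
  qed
  then show "pairing3 k A B C T i j l (assoc k A B C (pure k (A \<boxtimes>\<^bsub>k\<^esub> B) C x c)) = pairing k A B T i j x \<otimes>\<^bsub>T\<^esub> l c"
    by (simp add: assoc_eq_pairing pairing_pure[OF AB C ABC p slot_linear(3)] x c)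
qed

end

end

context
  fixes k :: "('k, 'c) ring_scheme" and A :: "('k, 'a, 'm) module_scheme"
    and B :: "('k, 'b, 'n) module_scheme" and A1 :: "('k, 'a1, 'm1) module_scheme"
    and A2 :: "('k, 'a2, 'm2) module_scheme" and f :: "'a \<Rightarrow> ('k, 'a1, 'a2) tens"
  assumes A: "assoc_algebra k A" and B: "assoc_algebra k B"
    and A1: "assoc_algebra k A1" and A2: "assoc_algebra k A2"
    and f: "f \<in> linear_maps k A (A1 \<boxtimes>\<^bsub>k\<^esub> A2)"
begin

private lemma A12: "assoc_algebra k (A1 \<boxtimes>\<^bsub>k\<^esub> A2)" by (rule assoc_algebra_tensor[OF A1 A2])
private lemma A12B: "assoc_algebra k ((A1 \<boxtimes>\<^bsub>k\<^esub> A2) \<boxtimes>\<^bsub>k\<^esub> B)" by (rule assoc_algebra_tensor[OF A12 B])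

private lemmas f_inl = linear_maps_comp[OF f algebra_maps_linear[OF inl_hom[OF A12 B]]]
private lemmas inr_lin = algebra_maps_linear[OF inr_hom[OF A12 B]]

lemma tensor_map_left_linear:
  "tensor_map k A B (A1 \<boxtimes>\<^bsub>k\<^esub> A2) B f (\<lambda>b. b) \<in> linear_maps k (A \<boxtimes>\<^bsub>k\<^esub> B) ((A1 \<boxtimes>\<^bsub>k\<^esub> A2) \<boxtimes>\<^bsub>k\<^esub> B)"
  by (rule linear_maps_cong[OF pairing_linear[OF A B A12B f_inl inr_lin]
        assoc_algebra_module[OF assoc_algebra_tensor[OF A B]]])
    (simp add: tensor_map_eq_pairing[OF A12 B f linear_maps_id])

lemma expand_left_linear:
  "expand_left k A B A1 A2 f \<in> linear_maps k (A \<boxtimes>\<^bsub>k\<^esub> B) (A1 \<boxtimes>\<^bsub>k\<^esub> A2 \<boxtimes>\<^bsub>k\<^esub> B)"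
  using linear_maps_comp[OF tensor_map_left_linear assoc_linear[OF A1 A2 B]]
  by (simp add: expand_left_def[abs_def])

text \<open>When \<open>f\<close> splits one factor into two, reading these along \<open>i\<close>
  and \<open>j\<close> is a single reading of the original factor. For a comultiplication this is a
  convolution, for a coaction an action on maps.\<close>

lemma pairing_expand_left:
  assumes T: "assoc_algebra k T" and i: "i \<in> linear_maps k A1 T" and j: "j \<in> linear_maps k A2 T"
    and l: "l \<in> linear_maps k B T" and z: "z \<in> carrier (A \<boxtimes>\<^bsub>k\<^esub> B)"
  shows "pairing3 k A1 A2 B T i j l (expand_left k A B A1 A2 f z) =
    pairing k A B T (\<lambda>a. pairing k A1 A2 T i j (f a)) l z"
proof -
  note ij = pairing_linear[OF A1 A2 T i j]
  have "pairing3 k A1 A2 B T i j l (expand_left k A B A1 A2 f z) =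
     pairing k (A1 \<boxtimes>\<^bsub>k\<^esub> A2) B T (pairing k A1 A2 T i j) l (tensor_map k A B (A1 \<boxtimes>\<^bsub>k\<^esub> A2) B f (\<lambda>b. b) z)"
    unfolding expand_left_def
    by (rule pairing3_assoc[OF A1 A2 B T i j l linear_maps_closed[OF tensor_map_left_linear z]])
  also have "\<dots> = pairing k A B T (\<lambda>a. pairing k A1 A2 T i j (f a)) l z"
    by (rule pairing_eqI[OF A B T linear_maps_comp[OF f ij] l
          linear_maps_comp[OF tensor_map_left_linear pairing_linear[OF A12 B T ij l]] _ z])
      (simp add: tensor_map_eq_pairing[OF A12 B f linear_maps_id] pairing_pure[OF A B A12B f_inl inr_lin]
        linear_maps_closed[OF f] pairing_pure[OF A12 B T ij l] flip: pure_eq_inl_inr[OF A12 B])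
  finally show ?thesis .
qed

end

text \<open>The appended unit is read as \<open>m \<one>\<close>, which is one. Membership in the
  carrier is recorded too, since a product in the fourfold tensor product can be mapped factorwise
  only with it.\<close>

lemma pairing4_append_one:
  assumes A: "assoc_algebra k A" and B: "assoc_algebra k B" and C: "assoc_algebra k C" and D: "assoc_algebra k D"
    and T: "assoc_algebra k T" and i: "i \<in> linear_maps k A T" and j: "j \<in> linear_maps k B T"
    and l: "l \<in> linear_maps k C T" and m: "m \<in> linear_maps k D T" and m1: "m \<one>\<^bsub>D\<^esub> = \<one>\<^bsub>T\<^esub>"
    and z: "z \<in> carrier (A \<boxtimes>\<^bsub>k\<^esub> B \<boxtimes>\<^bsub>k\<^esub> C)"
  shows "append_one k A B C D z \<in> carrier (A \<boxtimes>\<^bsub>k\<^esub> B \<boxtimes>\<^bsub>k\<^esub> C \<boxtimes>\<^bsub>k\<^esub> D)" (is ?th1)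
    and "pairing4 k A B C D T i j l m (append_one k A B C D z) = pairing3 k A B C T i j l z" (is ?th2)
proof -
  interpret T: ring T by (rule assoc_algebra_ring[OF T])
  note CD = assoc_algebra_tensor[OF C D]
  note BC = assoc_algebra_tensor[OF B C]
  note BCD = assoc_algebra_tensor[OF B CD]
  note ABCD = assoc_algebra_tensor[OF A BCD]
  let ?T4 = "A \<boxtimes>\<^bsub>k\<^esub> B \<boxtimes>\<^bsub>k\<^esub> C \<boxtimes>\<^bsub>k\<^esub> D"
  let ?i1 = "inl k A (B \<boxtimes>\<^bsub>k\<^esub> C \<boxtimes>\<^bsub>k\<^esub> D)"
  let ?r = "inr k A (B \<boxtimes>\<^bsub>k\<^esub> C \<boxtimes>\<^bsub>k\<^esub> D)"
  let ?i2 = "\<lambda>b. ?r (inl k B (C \<boxtimes>\<^bsub>k\<^esub> D) b)"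
  let ?i3 = "\<lambda>c. ?r (inr k B (C \<boxtimes>\<^bsub>k\<^esub> D) (inl k C D c))"
  note D1 = assoc_algebra_one_closed[OF D]
  note i1 = inl_hom[OF A BCD] and i2 = slot_homs(2)[OF A B CD]
  note i3 = algebra_maps_comp[OF inl_hom[OF C D] slot_homs(3)[OF A B CD]]
  note lin = i1[THEN algebra_maps_linear] i2[THEN algebra_maps_linear] i3[THEN algebra_maps_linear]
  note cl = i1[THEN algebra_maps_closed] i2[THEN algebra_maps_closed] i3[THEN algebra_maps_closed]
  have pure4: "pure4 k A B C D a b c \<one>\<^bsub>D\<^esub> = ?i1 a \<otimes>\<^bsub>?T4\<^esub> (?i2 b \<otimes>\<^bsub>?T4\<^esub> ?i3 c)"
    if "a \<in> carrier A" "b \<in> carrier B" "c \<in> carrier C" for a b c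
    using that pure3_eq_slots[OF A B CD, of a b "inl k C D c"] inl_closed[OF C D]
    by (simp add: pure4_def pure3_def inl_def)
  have eq: "append_one k A B C D z = pairing3 k A B C ?T4 ?i1 ?i2 ?i3 z"
    unfolding append_one_def tsum3_def pairing_def[of k A]
  proof (rule tsum_cong)
    fix a y assume a: "a \<in> carrier A" and y: "y \<in> carrier (B \<boxtimes>\<^bsub>k\<^esub> C)"
    show "tsum k B C ?T4 y (\<lambda>b c. pure4 k A B C D a b c \<one>\<^bsub>D\<^esub>) =
        ?i1 a \<otimes>\<^bsub>?T4\<^esub> pairing k B C ?T4 ?i2 ?i3 y"
      by (rule tsum_unique[OF B C linear_maps_lmult[OF ABCD pairing_linear[OF B C ABCD lin(2,3)] cl(1)[OF a]] _ y])
        (simp add: pairing_pure[OF B C ABCD lin(2,3)] pure4 a)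
  qed
  show ?th1 unfolding eq
    by (rule pairing_closed[OF A BC ABCD lin(1) pairing_linear[OF B C ABCD lin(2,3)] z])
  note lm = pairing_linear[OF C D T l m]
  note jlm = pairing_linear[OF B CD T j lm]
  note ijlm = pairing_linear[OF A BCD T i jlm]
  note p34 = pairing_linear[OF B C ABCD lin(2,3)]
  note jl = pairing_linear[OF B C T j l]
  show ?th2 unfolding eq
  proof (rule pairing_eqI[OF A BC T i jl linear_maps_comp[OF pairing_linear[OF A BC ABCD lin(1) p34] ijlm] _ z])
    fix a y assume a: "a \<in> carrier A" and y: "y \<in> carrier (B \<boxtimes>\<^bsub>k\<^esub> C)"
    have "pairing4 k A B C D T i j l m (?i1 a \<otimes>\<^bsub>?T4\<^esub> pairing k B C ?T4 ?i2 ?i3 y) = i a \<otimes>\<^bsub>T\<^esub> pairing k B C T j l y"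
    proof (rule tensor_ext[OF B C linear_maps_comp[OF linear_maps_lmult[OF ABCD p34 cl(1)[OF a]] ijlm]
          linear_maps_lmult[OF T jl linear_maps_closed[OF i a]] _ y])
      fix b c assume b: "b \<in> carrier B" and c: "c \<in> carrier C"
      have "?i1 a \<otimes>\<^bsub>?T4\<^esub> pairing k B C ?T4 ?i2 ?i3 (pure k B C b c) = pure4 k A B C D a b c \<one>\<^bsub>D\<^esub>"
        using a b c by (simp add: pairing_pure[OF B C ABCD lin(2,3)] pure4)
      then show "pairing4 k A B C D T i j l m (?i1 a \<otimes>\<^bsub>?T4\<^esub> pairing k B C ?T4 ?i2 ?i3 (pure k B C b c)) =
          i a \<otimes>\<^bsub>T\<^esub> pairing k B C T j l (pure k B C b c)"
        using a b c D1
        by (simp add: pure4_def pure3_def pairing_pure[OF A BCD T i jlm] pairing_pure[OF B CD T j lm]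
            pairing_pure[OF C D T l m] pairing_pure[OF B C T j l] pure_carrier[OF C D] pure_carrier[OF B CD] m1
            linear_maps_closed[OF l])
    qed
    then show "pairing4 k A B C D T i j l m (pairing3 k A B C ?T4 ?i1 ?i2 ?i3 (pure k A (B \<boxtimes>\<^bsub>k\<^esub> C) a y)) =
        i a \<otimes>\<^bsub>T\<^esub> pairing k B C T j l y"
      by (simp add: pairing_pure[OF A BC ABCD lin(1) p34] a y)
  qed
qed

text \<open>A scalar acts as the corresponding multiple of one, so contracting with a functional is
  a reading like any other.\<close>

lemma contract_left_eq_pairing:
  assumes B: "assoc_algebra k B" and e: "e \<in> linear_maps k A (base_algebra k)"
  shows "contract_left k A B e z = pairing k A B B (\<lambda>a. e a \<odot>\<^bsub>B\<^esub> \<one>\<^bsub>B\<^esub>) (\<lambda>b. b) z"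
proof -
  interpret B: ring B by (rule assoc_algebra_ring[OF B])
  show ?thesis
    unfolding contract_left_def pairing_def
    by (rule tsum_cong)
      (use linear_maps_closed[OF e] in \<open>simp add: base_algebra_def assoc_algebra.smult_mult_left[OF B]\<close>)
qed

lemma contract_right_eq_pairing:
  assumes A: "assoc_algebra k A" and e: "e \<in> linear_maps k B (base_algebra k)"
  shows "contract_right k A B e z = pairing k A B A (\<lambda>a. a) (\<lambda>b. e b \<odot>\<^bsub>A\<^esub> \<one>\<^bsub>A\<^esub>) z"
proof -
  interpret A: ring A by (rule assoc_algebra_ring[OF A])
  show ?thesis
    unfolding contract_right_def pairing_def
    by (rule tsum_cong)
      (use linear_maps_closed[OF e] in \<open>simp add: base_algebra_def assoc_algebra.smult_mult_right[OF A]\<close>)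
qed

section \<open>Quasi-bialgebras evaluated in an algebra\<close>

text \<open>
  \<open>eq_right T A J i j\<close> says that \<open>i\<close> and \<open>j\<close> agree as rightmost factors under \<open>J\<close>. It lets the defining
  equations of \<open>\<alpha>\<close> and \<open>\<beta>\<close>, which only hold for adjacent factors, be used inside longer products.
\<close>

definition eq_right :: "('t, 'p) monoid_scheme \<Rightarrow> ('a, 'm) partial_object_scheme \<Rightarrow> ('t \<Rightarrow> 'b) \<Rightarrow>
   ('a \<Rightarrow> 't) \<Rightarrow> ('a \<Rightarrow> 't) \<Rightarrow> bool" where
  "eq_right T A J i j \<longleftrightarrow> (\<forall>y\<in>carrier T. \<forall>a\<in>carrier A. J (y \<otimes>\<^bsub>T\<^esub> i a) = J (y \<otimes>\<^bsub>T\<^esub> j a))"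

definition eq_left :: "('t, 'p) monoid_scheme \<Rightarrow> ('a, 'm) partial_object_scheme \<Rightarrow> ('t \<Rightarrow> 'b) \<Rightarrow>
   ('a \<Rightarrow> 't) \<Rightarrow> ('a \<Rightarrow> 't) \<Rightarrow> bool" where
  "eq_left T A J i j \<longleftrightarrow> (\<forall>y\<in>carrier T. \<forall>a\<in>carrier A. J (i a \<otimes>\<^bsub>T\<^esub> y) = J (j a \<otimes>\<^bsub>T\<^esub> y))"

lemma eq_right_refl: "eq_right T A J i i" and eq_left_refl: "eq_left T A J i i"
  by (simp_all add: eq_right_def eq_left_def)

lemma eq_right_trans: "\<lbrakk>eq_right T A J i j; eq_right T A J j l\<rbrakk> \<Longrightarrow> eq_right T A J i l"
  and eq_left_trans: "\<lbrakk>eq_left T A J i j; eq_left T A J j l\<rbrakk> \<Longrightarrow> eq_left T A J i l"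
  by (simp_all add: eq_right_def eq_left_def)

lemma eq_rightD: "\<lbrakk>eq_right T A J i j; y \<in> carrier T; a \<in> carrier A\<rbrakk> \<Longrightarrow> J (y \<otimes>\<^bsub>T\<^esub> i a) = J (y \<otimes>\<^bsub>T\<^esub> j a)"
  and eq_leftD: "\<lbrakk>eq_left T A J i j; y \<in> carrier T; a \<in> carrier A\<rbrakk> \<Longrightarrow> J (i a \<otimes>\<^bsub>T\<^esub> y) = J (j a \<otimes>\<^bsub>T\<^esub> y)"
  by (simp_all add: eq_right_def eq_left_def)

lemma eq_right_pairing:
  assumes "assoc_algebra k A" "assoc_algebra k B" "assoc_algebra k T" "J \<in> linear_maps k T M"
    "i \<in> linear_maps k A T" "j \<in> linear_maps k B T" "i' \<in> linear_maps k A T" "j' \<in> linear_maps k B T"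
    "eq_right T A J i i'" "eq_right T B J j j'" "commuting T A B i j'" "commuting T A B i' j'"
  shows "eq_right T (A \<boxtimes>\<^bsub>k\<^esub> B) J (pairing k A B T i j) (pairing k A B T i' j')"
  unfolding eq_right_def using assms(9,10)
  by (intro ballI pairing_collapse_right[OF assms(1-8) _ _ assms(11,12)]) (simp_all add: eq_right_def)

lemma eq_left_pairing:
  assumes "assoc_algebra k A" "assoc_algebra k B" "assoc_algebra k T" "J \<in> linear_maps k T M"
    "i \<in> linear_maps k A T" "j \<in> linear_maps k B T" "i' \<in> linear_maps k A T" "j' \<in> linear_maps k B T"
    "eq_left T A J i i'" "eq_left T B J j j'" "commuting T A B i' j" "commuting T A B i' j'"
  shows "eq_left T (A \<boxtimes>\<^bsub>k\<^esub> B) J (pairing k A B T i j) (pairing k A B T i' j')"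
  unfolding eq_left_def using assms(9,10)
  by (intro ballI pairing_collapse_left[OF assms(1-8) _ _ assms(11,12)]) (simp_all add: eq_left_def)

lemma pairing_pure_one:
  assumes "assoc_algebra k A" "assoc_algebra k B" "assoc_algebra k T"
    and "i \<in> algebra_maps k A T" "p \<in> linear_maps k B T" "z \<in> carrier B"
  shows "pairing k A B T i p (pure k A B \<one>\<^bsub>A\<^esub> z) = p z"
proof -
  interpret T: ring T by (rule assoc_algebra_ring) fact
  show ?thesis
    using assms by (simp add: pairing_pure algebra_maps_linear algebra_maps_one assoc_algebra_one_closed
        linear_maps_closed)
qed

lemma pairing3_intertwine:
  assumes A: "assoc_algebra k A" and B: "assoc_algebra k B" and C: "assoc_algebra k C" and T: "assoc_algebra k T"
    and l: "i \<in> linear_maps k A T" "j \<in> linear_maps k B T" "l \<in> linear_maps k C T"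
      "i' \<in> linear_maps k A T" "j' \<in> linear_maps k B T" "l' \<in> linear_maps k C T" and c: "c \<in> carrier T"
    and ci: "\<And>h. h \<in> carrier A \<Longrightarrow> c \<otimes>\<^bsub>T\<^esub> i h = i' h \<otimes>\<^bsub>T\<^esub> c"
    and cj: "\<And>h. h \<in> carrier B \<Longrightarrow> c \<otimes>\<^bsub>T\<^esub> j h = j' h \<otimes>\<^bsub>T\<^esub> c"
    and cl: "\<And>h. h \<in> carrier C \<Longrightarrow> c \<otimes>\<^bsub>T\<^esub> l h = l' h \<otimes>\<^bsub>T\<^esub> c"
    and z: "z \<in> carrier (A \<boxtimes>\<^bsub>k\<^esub> B \<boxtimes>\<^bsub>k\<^esub> C)"
  shows "c \<otimes>\<^bsub>T\<^esub> pairing3 k A B C T i j l z = pairing3 k A B C T i' j' l' z \<otimes>\<^bsub>T\<^esub> c"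
  using l by (intro pairing_intertwine[OF A assoc_algebra_tensor[OF B C] T _ _ _ _ c ci _ z] pairing_linear[OF B C T]
      pairing_intertwine[OF B C T _ _ _ _ c cj cl]) simp_all

lemma pairing3_hom:
  assumes A: "assoc_algebra k A" and B: "assoc_algebra k B" and C: "assoc_algebra k C" and T: "assoc_algebra k T"
    and a: "i \<in> algebra_maps k A T" "j \<in> algebra_maps k B T" "l \<in> algebra_maps k C T"
    and c: "commuting T A B i j" "commuting T A C i l" "commuting T B C j l"
  shows "pairing3 k A B C T i j l \<in> algebra_maps k (A \<boxtimes>\<^bsub>k\<^esub> B \<boxtimes>\<^bsub>k\<^esub> C) T"
  by (rule pairing_hom[OF A assoc_algebra_tensor[OF B C] T a(1) pairing_hom[OF B C T a(2,3) c(3)]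
        commuting_sym[OF commuting_pairing[OF B C T a(2,3,1)[THEN algebra_maps_linear] commuting_sym[OF c(1)] commuting_sym[OF c(2)]]]])

text \<open>Multiples of one are central, so a multiplicative functional gives an algebra map into
  any algebra. In this form, as \<open>eps\<close>, the counit takes part in convolutions.\<close>

lemma functional_hom:
  assumes B: "assoc_algebra k B" and e: "e \<in> algebra_maps k X (base_algebra k)"
  shows "(\<lambda>x. e x \<odot>\<^bsub>B\<^esub> \<one>\<^bsub>B\<^esub>) \<in> algebra_maps k X B"
proof (rule algebra_mapsI)
  interpret k: field k by (rule assoc_algebra_field[OF B])
  interpret BM: module k B by (rule assoc_algebra_module[OF B])
  interpret B: ring B by (rule assoc_algebra_ring[OF B])
  have cl: "e x \<in> carrier k" if "x \<in> carrier X" for x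
    using algebra_maps_closed[OF e that] by (simp add: base_algebra_def)
  show "(\<lambda>x. e x \<odot>\<^bsub>B\<^esub> \<one>\<^bsub>B\<^esub>) \<in> linear_maps k X B"
    using linear_maps_add[OF algebra_maps_linear[OF e]] linear_maps_smult[OF algebra_maps_linear[OF e]]
    by (intro linear_mapsI) (simp_all add: cl base_algebra_def BM.smult_l_distr BM.smult_assoc1)
  show "e (x \<otimes>\<^bsub>X\<^esub> y) \<odot>\<^bsub>B\<^esub> \<one>\<^bsub>B\<^esub> = (e x \<odot>\<^bsub>B\<^esub> \<one>\<^bsub>B\<^esub>) \<otimes>\<^bsub>B\<^esub> (e y \<odot>\<^bsub>B\<^esub> \<one>\<^bsub>B\<^esub>)"
    if "x \<in> carrier X" "y \<in> carrier X" for x y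
    using that algebra_maps_mult[OF e that] cl[OF that(1)] cl[OF that(2)]
    by (simp add: base_algebra_def BM.smult_assoc1 assoc_algebra.smult_mult_left[OF B])
  show "e \<one>\<^bsub>X\<^esub> \<odot>\<^bsub>B\<^esub> \<one>\<^bsub>B\<^esub> = \<one>\<^bsub>B\<^esub>"
    using algebra_maps_one[OF e] by (simp add: base_algebra_def)
qed

text \<open>The target is a parameter because the same calculus is run in many algebras: in tensor
  powers of \<open>H\<close>, where legs are rearranged, and later in \<open>A\<close>,
  \<open>K \<boxtimes> A\<close> and \<open>K \<boxtimes> K \<boxtimes> A\<close>.\<close>

locale hom_calculus =
  fixes k :: "('k, 'c) ring_scheme" and H :: "('k, 'h, 'm) qbialg_scheme" and T :: "('k, 't, 'p) module_scheme" (structure)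
  assumes quasi_bialgebra_H: "quasi_bialgebra k H" and T: "assoc_algebra k T"
begin

abbreviation (input) "H2 \<equiv> H \<boxtimes>\<^bsub>k\<^esub> H"
abbreviation (input) "H3 \<equiv> H \<boxtimes>\<^bsub>k\<^esub> H2"
abbreviation (input) "H4 \<equiv> H \<boxtimes>\<^bsub>k\<^esub> H3"

sublocale T: ring T by (rule assoc_algebra_ring[OF T])

lemma H: "assoc_algebra k H" by (rule quasi_bialgebra.axioms(1)[OF quasi_bialgebra_H])

sublocale H: ring H by (rule assoc_algebra_ring[OF H])

lemmas HH = assoc_algebra_tensor[OF H H]
lemmas HHH = assoc_algebra_tensor[OF H HH]

lemma comult: "comult H \<in> algebra_maps k H H2"
  and counit: "counit H \<in> algebra_maps k H (base_algebra k)"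
  and reassoc_Units: "reassoc H \<in> Units H3"
  using quasi_bialgebra_H by (simp_all add: quasi_bialgebra_def quasi_bialgebra_axioms_def)

lemmas comult_linear = algebra_maps_linear[OF comult]
lemmas comult_closed = algebra_maps_closed[OF comult]

lemma reassoc_closed: "reassoc H \<in> carrier H3"
  and reassoc_inv_closed: "inv\<^bsub>H3\<^esub> reassoc H \<in> carrier H3"
proof -
  interpret HHH: ring "H \<boxtimes>\<^bsub>k\<^esub> H \<boxtimes>\<^bsub>k\<^esub> H" by (rule assoc_algebra_ring[OF HHH])
  show "reassoc H \<in> carrier H3"
    "inv\<^bsub>H3\<^esub> reassoc H \<in> carrier H3"
    using reassoc_Units by (simp_all add: HHH.Units_closed)
qed

abbreviation "ahom i \<equiv> i \<in> algebra_maps k H T"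
abbreviation "cm i j \<equiv> commuting T H H i j"

text \<open>For algebra maps with commuting images the convolution is again an algebra map. It is
  associative only up to conjugation by \<open>Phi\<close>, so the bracketing of iterated
  convolutions matters everywhere below.\<close>

definition conv (infixl \<open>\<star>\<close> 72) where "i \<star> j = (\<lambda>h. pairing k H H T i j (comult H h))"
definition "Phi i j l = pairing3 k H H H T i j l (reassoc H)"
definition "Psi i j l = pairing3 k H H H T i j l (inv\<^bsub>H3\<^esub> reassoc H)"
definition "eps h = counit H h \<odot> \<one>"

lemma ahom_closed: "\<lbrakk>ahom i; h \<in> carrier H\<rbrakk> \<Longrightarrow> i h \<in> carrier T"
  by (rule algebra_maps_closed)

lemma conv_linear: "\<lbrakk>i \<in> linear_maps k H T; j \<in> linear_maps k H T\<rbrakk> \<Longrightarrow> i \<star> j \<in> linear_maps k H T"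
  unfolding conv_def by (rule linear_maps_comp[OF comult_linear pairing_linear[OF H H T]])

lemma conv_ahom [simp]: "\<lbrakk>ahom i; ahom j; cm i j\<rbrakk> \<Longrightarrow> ahom (i \<star> j)"
  unfolding conv_def by (rule algebra_maps_comp[OF comult pairing_hom[OF H H T]])

lemma cm_conv_left [simp]:
  "\<lbrakk>ahom i; ahom j; l \<in> linear_maps k C T; commuting T H C i l; commuting T H C j l\<rbrakk> \<Longrightarrow> commuting T H C (i \<star> j) l"
  unfolding conv_def
  by (rule commuting_comp[OF commuting_pairing[OF H H T] comult_linear]) (auto intro: algebra_maps_linear)

lemma cm_conv_right [simp]:
  "\<lbrakk>ahom i; ahom j; l \<in> linear_maps k C T; commuting T C H l i; commuting T C H l j\<rbrakk> \<Longrightarrow> commuting T C H l (i \<star> j)"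
  by (rule commuting_sym) (auto intro: cm_conv_left commuting_sym)

lemma ahom_linear [simp]: "ahom i \<Longrightarrow> i \<in> linear_maps k H T"
  by (rule algebra_maps_linear)

lemma Phi_closed [simp]: "\<lbrakk>ahom i; ahom j; ahom l\<rbrakk> \<Longrightarrow> Phi i j l \<in> carrier T"
  and Psi_closed [simp]: "\<lbrakk>ahom i; ahom j; ahom l\<rbrakk> \<Longrightarrow> Psi i j l \<in> carrier T"
  unfolding Phi_def Psi_def
  by (simp_all add: linear_maps_closed[OF pairing_linear[OF H HH T _ pairing_linear[OF H H T]]]
      reassoc_closed reassoc_inv_closed)

lemma Phi_Psi: "\<lbrakk>ahom i; ahom j; ahom l; cm i j; cm i l; cm j l\<rbrakk> \<Longrightarrow> Phi i j l \<otimes> Psi i j l = \<one>"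
  and Psi_Phi: "\<lbrakk>ahom i; ahom j; ahom l; cm i j; cm i l; cm j l\<rbrakk> \<Longrightarrow> Psi i j l \<otimes> Phi i j l = \<one>"
  unfolding Phi_def Psi_def
  using algebra_maps_inverse[OF pairing3_hom[OF H H H T] HHH reassoc_Units] by blast+

lemma Phi_cong:
  assumes "\<And>h. h \<in> carrier H \<Longrightarrow> i h = i' h" "\<And>h. h \<in> carrier H \<Longrightarrow> j h = j' h"
    "\<And>h. h \<in> carrier H \<Longrightarrow> l h = l' h"
  shows "Phi i j l = Phi i' j' l'" "Psi i j l = Psi i' j' l'"
  unfolding Phi_def Psi_def by (intro pairing_cong assms; simp)+

lemma counit_closed: "h \<in> carrier H \<Longrightarrow> counit H h \<in> carrier k"
  using algebra_maps_closed[OF counit] by (simp add: base_algebra_def)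

lemmas counit_one_hom = functional_hom[OF _ counit]

lemma eps_ahom [simp]: "ahom eps"
  using counit_one_hom[OF T] by (simp add: eps_def[abs_def])

lemma eps_mult: "\<lbrakk>h \<in> carrier H; x \<in> carrier T\<rbrakk> \<Longrightarrow> eps h \<otimes> x = counit H h \<odot> x"
  "\<lbrakk>h \<in> carrier H; x \<in> carrier T\<rbrakk> \<Longrightarrow> x \<otimes> eps h = counit H h \<odot> x"
  by (simp_all add: eps_def counit_closed assoc_algebra.smult_mult_left[OF T] assoc_algebra.smult_mult_right[OF T])

lemma eps_cm [simp]: "l \<in> linear_maps k C T \<Longrightarrow> commuting T H C eps l"
  "l \<in> linear_maps k C T \<Longrightarrow> commuting T C H l eps"
  by (simp_all add: commuting_def eps_mult linear_maps_closed)

lemma eps_conv_right: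
  assumes j: "ahom j" and h: "h \<in> carrier H"
  shows "(j \<star> eps) h = j h"
proof -
  let ?e = "\<lambda>b. counit H b \<odot>\<^bsub>H\<^esub> \<one>\<^bsub>H\<^esub>"
  note jl = algebra_maps_linear[OF j]
  have je: "j (?e b) = eps b" if "b \<in> carrier H" for b
    using that by (simp add: eps_def linear_maps_smult[OF jl] counit_closed algebra_maps_one[OF j])
  note e = algebra_maps_linear[OF counit_one_hom[OF H]]
  have "j h = j (contract_right k H H (counit H) (comult H h))"
    using quasi_bialgebra.counit_right[OF quasi_bialgebra_H h] by simp
  also have "\<dots> = pairing k H H T (\<lambda>a. j a) (\<lambda>b. j (?e b)) (comult H h)"
    unfolding contract_right_eq_pairing[OF H algebra_maps_linear[OF counit]]
    by (rule hom_pairing[OF H H H T linear_maps_id e j comult_closed[OF h]])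
  also have "\<dots> = (j \<star> eps) h"
    unfolding conv_def by (rule pairing_cong) (simp_all add: je)
  finally show ?thesis by simp
qed

lemma eps_conv_left:
  assumes j: "ahom j" and h: "h \<in> carrier H"
  shows "(eps \<star> j) h = j h"
proof -
  let ?e = "\<lambda>b. counit H b \<odot>\<^bsub>H\<^esub> \<one>\<^bsub>H\<^esub>"
  note jl = algebra_maps_linear[OF j]
  have je: "j (?e b) = eps b" if "b \<in> carrier H" for b
    using that by (simp add: eps_def linear_maps_smult[OF jl] counit_closed algebra_maps_one[OF j])
  note e = algebra_maps_linear[OF counit_one_hom[OF H]]
  have "j h = j (contract_left k H H (counit H) (comult H h))"
    using quasi_bialgebra.counit_left[OF quasi_bialgebra_H h] by simp
  also have "\<dots> = pairing k H H T (\<lambda>b. j (?e b)) (\<lambda>a. j a) (comult H h)"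
    unfolding contract_left_eq_pairing[OF H algebra_maps_linear[OF counit]]
    by (rule hom_pairing[OF H H H T e linear_maps_id j comult_closed[OF h]])
  also have "\<dots> = (eps \<star> j) h"
    unfolding conv_def by (rule pairing_cong) (simp_all add: je)
  finally show ?thesis by simp
qed

lemma quasi_coassoc:
  assumes a: "ahom i" "ahom j" "ahom l" and c: "cm i j" "cm i l" "cm j l" and h: "h \<in> carrier H"
  shows "Phi i j l \<otimes> ((i \<star> j) \<star> l) h = (i \<star> (j \<star> l)) h \<otimes> Phi i j l"
proof -
  interpret HHH: ring "H \<boxtimes>\<^bsub>k\<^esub> H \<boxtimes>\<^bsub>k\<^esub> H" by (rule assoc_algebra_ring[OF HHH])
  let ?F = "pairing3 k H H H T i j l"
  let ?m = "map_right k H H H2 (comult H) (comult H h)"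
  let ?x = "expand_left k H H H H (comult H) (comult H h)"
  note F = pairing3_hom[OF H H H T a c]
  note al = a[THEN algebra_maps_linear]
  have m: "?m \<in> carrier H3"
    by (rule linear_maps_closed[OF map_right_linear[OF H H HH comult_linear] comult_closed[OF h]])
  have x: "?x \<in> carrier H3"
    by (rule linear_maps_closed[OF expand_left_linear[OF H H H H comult_linear] comult_closed[OF h]])
  \<comment> \<open>The axiom carries the inverse reassociator at the right end; it is cleared
    before the equation is read off.\<close>
  have "?m \<otimes>\<^bsub>H3\<^esub> reassoc H = reassoc H \<otimes>\<^bsub>H3\<^esub> ?x"
    using x reassoc_Units
    by (simp add: quasi_bialgebra.quasi_coassoc[OF quasi_bialgebra_H h] HHH.m_assoc HHH.Units_closed)
  then have "?F ?m \<otimes> ?F (reassoc H) = ?F (reassoc H) \<otimes> ?F ?x"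
    using x m reassoc_closed by (simp flip: algebra_maps_mult[OF F])
  moreover have "?F ?m = (i \<star> (j \<star> l)) h"
    by (simp add: pairing_map_right[OF H H HH comult_linear T al(1) pairing_linear[OF H H T al(2,3)] comult_closed[OF h]] conv_def)
  moreover have "?F ?x = ((i \<star> j) \<star> l) h"
    by (simp add: pairing_expand_left[OF H H H H comult_linear T al comult_closed[OF h]] conv_def)
  ultimately show ?thesis by (simp add: Phi_def)
qed

text \<open>The five factors of the axiom are read along four commuting maps. Each comultiplied
  factor shows up as a convolution in one argument of \<open>Phi\<close>.\<close>

lemma pentagon:
  assumes a: "ahom i" "ahom j" "ahom l" "ahom m"
    and c: "cm i j" "cm i l" "cm i m" "cm j l" "cm j m" "cm l m"
  shows "Phi j l m \<otimes> Phi i (j \<star> l) m \<otimes> Phi i j l = Phi i j (l \<star> m) \<otimes> Phi (i \<star> j) l m"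
proof -
  let ?T4 = "H4"
  note HHHH = assoc_algebra_tensor[OF H HHH]
  interpret HHHH: ring ?T4 by (rule assoc_algebra_ring[OF HHHH])
  let ?F = "pairing4 k H H H H T i j l m"
  note al = a[THEN algebra_maps_linear]
  note lm = pairing_linear[OF H H T al(3,4)]
  note jlm = pairing_linear[OF H HH T al(2) lm]
  have F: "?F \<in> algebra_maps k ?T4 T"
    by (rule pairing_hom[OF H HHH T a(1) pairing3_hom[OF H H H T a(2-4) c(4-6)]
          commuting_sym[OF commuting_pairing[OF H HH T al(2) lm al(1) commuting_sym[OF c(1)]
              commuting_pairing[OF H H T al(3,4,1) commuting_sym[OF c(2)] commuting_sym[OF c(3)]]]]])
  note ex = expand_left_linear[OF H H H H comult_linear]
  note mr = map_right_linear[OF H H HH comult_linear]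
  let ?a = "pure k H H3 \<one>\<^bsub>H\<^esub> (reassoc H)"
  let ?b = "map_right k H H2 H3 (expand_left k H H H H (comult H)) (reassoc H)"
  let ?c = "append_one k H H H H (reassoc H)"
  let ?d = "map_right k H H2 H3
       (map_right k H H H2 (comult H)) (reassoc H)"
  let ?e = "expand_left k H H2 H H (comult H) (reassoc H)"
  note cl = pure_carrier[OF H HHH H.one_closed reassoc_closed]
    linear_maps_closed[OF map_right_linear[OF H HH HHH ex] reassoc_closed]
    pairing4_append_one(1)[OF H H H H T al algebra_maps_one[OF a(4)] reassoc_closed]
    linear_maps_closed[OF map_right_linear[OF H HH HHH mr] reassoc_closed]
    linear_maps_closed[OF expand_left_linear[OF H HH H H comult_linear] reassoc_closed]
  have "?F (?a \<otimes>\<^bsub>?T4\<^esub> ?b \<otimes>\<^bsub>?T4\<^esub> ?c) = ?F (?d \<otimes>\<^bsub>?T4\<^esub> ?e)"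
    by (simp add: quasi_bialgebra.pentagon[OF quasi_bialgebra_H])
  then have "?F ?a \<otimes> ?F ?b \<otimes> ?F ?c = ?F ?d \<otimes> ?F ?e"
    using cl by (simp add: algebra_maps_mult[OF F])
  moreover have "?F ?a = Phi j l m"
    unfolding Phi_def by (rule pairing_pure_one[OF H HHH T a(1) jlm reassoc_closed])
  moreover have "?F ?b = Phi i (j \<star> l) m"
    unfolding Phi_def pairing_map_right[OF H HH HHH ex T al(1) jlm reassoc_closed]
    by (rule pairing_cong) (simp_all add: pairing_expand_left[OF H H H H comult_linear T al(2-4)] conv_def)
  moreover have "?F ?c = Phi i j l"
    unfolding Phi_def by (rule pairing4_append_one(2)[OF H H H H T al algebra_maps_one[OF a(4)] reassoc_closed])
  moreover have "?F ?d = Phi i j (l \<star> m)"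
    unfolding Phi_def pairing_map_right[OF H HH HHH mr T al(1) jlm reassoc_closed]
    by (rule pairing_cong) (simp_all add: pairing_map_right[OF H H HH comult_linear T al(2) lm] conv_def)
  moreover have "?F ?e = Phi (i \<star> j) l m"
    unfolding Phi_def by (simp add: pairing_expand_left[OF H HH H H comult_linear T al(1,2) lm reassoc_closed] conv_def)
  ultimately show ?thesis by simp
qed

lemma Phi_eps_mid:
  assumes a: "ahom i" "ahom l" and c: "cm i l"
  shows "Phi i eps l = \<one>"
proof -
  let ?e = "\<lambda>b. counit H b \<odot>\<^bsub>H\<^esub> \<one>\<^bsub>H\<^esub>"
  note al = a[THEN algebra_maps_linear]
  note e = algebra_maps_linear[OF counit_one_hom[OF H]]
  have le: "l (?e b) = eps b" if "b \<in> carrier H" for b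
    using that by (simp add: eps_def linear_maps_smult[OF al(2)] counit_closed algebra_maps_one[OF a(2)])
  have cl: "contract_left k H H (counit H) \<in> linear_maps k H2 H"
    by (rule linear_maps_cong[OF pairing_linear[OF H H H e linear_maps_id] assoc_algebra_module[OF HH]
          contract_left_eq_pairing[OF H algebra_maps_linear[OF counit]]])
  have "Phi i eps l = pairing k H H2 T i (\<lambda>z. l (contract_left k H H (counit H) z)) (reassoc H)"
    unfolding Phi_def
  proof (rule pairing_cong)
    fix z assume z: "z \<in> carrier H2"
    show "pairing k H H T eps l z = l (contract_left k H H (counit H) z)"
      unfolding contract_left_eq_pairing[OF H algebra_maps_linear[OF counit]]
        hom_pairing[OF H H H T e linear_maps_id a(2) z]
      by (rule pairing_cong) (simp_all add: le)
  qed simp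
  also have "\<dots> = pairing k H H T i l (map_right k H H2 H (contract_left k H H (counit H)) (reassoc H))"
    by (rule pairing_map_right[OF H HH H cl T al reassoc_closed, symmetric])
  also have "\<dots> = \<one>"
    using algebra_maps_one[OF pairing_hom[OF H H T a c]]
    by (simp add: quasi_bialgebra.reassoc_counit[OF quasi_bialgebra_H])
  finally show ?thesis .
qed

text \<open>Only the middle counit condition is an axiom. With counits in the first two places the
  pentagon makes \<open>Phi eps l m\<close> idempotent, and an invertible idempotent is one.\<close>

lemma Phi_eps_left:
  assumes a: "ahom l" "ahom m" and c: "cm l m"
  shows "Phi eps l m = \<one>"
proof -
  have "Phi eps l m \<otimes> Phi eps (eps \<star> l) m \<otimes> Phi eps eps l = Phi eps eps (l \<star> m) \<otimes> Phi (eps \<star> eps) l m"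
    using a c by (intro pentagon) simp_all
  moreover have "Phi eps (eps \<star> l) m = Phi eps l m" "Phi (eps \<star> eps) l m = Phi eps l m"
    using a by (intro Phi_cong; simp add: eps_conv_left)+
  ultimately have *: "Phi eps l m \<otimes> Phi eps l m = Phi eps l m"
    using a c by (simp add: Phi_eps_mid)
  have "Phi eps l m = Phi eps l m \<otimes> Phi eps l m \<otimes> Psi eps l m"
    using a c by (simp add: T.m_assoc Phi_Psi)
  then show ?thesis using a c by (simp add: * Phi_Psi)
qed

lemma Phi_eps_right:
  assumes a: "ahom i" "ahom j" and c: "cm i j"
  shows "Phi i j eps = \<one>"
proof -
  have "Phi j eps eps \<otimes> Phi i (j \<star> eps) eps \<otimes> Phi i j eps = Phi i j (eps \<star> eps) \<otimes> Phi (i \<star> j) eps eps"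
    using a c by (intro pentagon) simp_all
  moreover have "Phi i (j \<star> eps) eps = Phi i j eps" "Phi i j (eps \<star> eps) = Phi i j eps"
    using a by (intro Phi_cong; simp add: eps_conv_right)+
  ultimately have *: "Phi i j eps \<otimes> Phi i j eps = Phi i j eps"
    using a c by (simp add: Phi_eps_mid)
  have "Phi i j eps = Phi i j eps \<otimes> Phi i j eps \<otimes> Psi i j eps"
    using a c by (simp add: T.m_assoc Phi_Psi)
  then show ?thesis using a c by (simp add: * Phi_Psi)
qed

lemma Psi_eps:
  "\<lbrakk>ahom i; ahom j; cm i j\<rbrakk> \<Longrightarrow> Psi i eps j = \<one>"
  "\<lbrakk>ahom i; ahom j; cm i j\<rbrakk> \<Longrightarrow> Psi eps i j = \<one>"
  "\<lbrakk>ahom i; ahom j; cm i j\<rbrakk> \<Longrightarrow> Psi i j eps = \<one>"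
  using Phi_Psi[of i eps j] Phi_Psi[of eps i j] Phi_Psi[of i j eps]
  by (simp_all add: Phi_eps_mid Phi_eps_left Phi_eps_right)

end

section \<open>Intertwining, rebracketing and collapse of legs\<close>

context hom_calculus
begin

lemma conv_closed [simp]: "\<lbrakk>i \<in> linear_maps k H T; j \<in> linear_maps k H T; h \<in> carrier H\<rbrakk> \<Longrightarrow> (i \<star> j) h \<in> carrier T"
  by (rule linear_maps_closed[OF conv_linear])

lemma conv_intertwine:
  assumes "ahom i" "ahom j" "ahom i'" "ahom j'" "c \<in> carrier T"
    and "\<And>h. h \<in> carrier H \<Longrightarrow> c \<otimes> i h = i' h \<otimes> c"
    and "\<And>h. h \<in> carrier H \<Longrightarrow> c \<otimes> j h = j' h \<otimes> c"
    and "h \<in> carrier H"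
  shows "c \<otimes> (i \<star> j) h = (i' \<star> j') h \<otimes> c"
  unfolding conv_def using assms by (intro pairing_intertwine[OF H H T]) (simp_all add: comult_closed)

lemma Phi_intertwine:
  assumes "ahom i" "ahom j" "ahom l" "ahom i'" "ahom j'" "ahom l'" "c \<in> carrier T"
    and "\<And>h. h \<in> carrier H \<Longrightarrow> c \<otimes> i h = i' h \<otimes> c"
    and "\<And>h. h \<in> carrier H \<Longrightarrow> c \<otimes> j h = j' h \<otimes> c"
    and "\<And>h. h \<in> carrier H \<Longrightarrow> c \<otimes> l h = l' h \<otimes> c"
  shows "c \<otimes> Phi i j l = Phi i' j' l' \<otimes> c" "c \<otimes> Psi i j l = Psi i' j' l' \<otimes> c"
  unfolding Phi_def Psi_def
  using pairing3_intertwine[OF H H H T assms(1-6)[THEN algebra_maps_linear] assms(7-10) reassoc_closed]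
    pairing3_intertwine[OF H H H T assms(1-6)[THEN algebra_maps_linear] assms(7-10) reassoc_inv_closed]
  by blast+

lemma Phi_commute:
  assumes "ahom i" "ahom j" "ahom l" "ahom m" "cm i m" "cm j m" "cm l m" "h \<in> carrier H"
  shows "Phi i j l \<otimes> m h = m h \<otimes> Phi i j l" "Psi i j l \<otimes> m h = m h \<otimes> Psi i j l"
  using Phi_intertwine[of i j l i j l "m h"] assms by (simp_all add: commuting_def ahom_closed)

lemma quasi_coassoc_inv:
  assumes a: "ahom i" "ahom j" "ahom l" and c: "cm i j" "cm i l" "cm j l" and h: "h \<in> carrier H"
  shows "Psi i j l \<otimes> (i \<star> (j \<star> l)) h = ((i \<star> j) \<star> l) h \<otimes> Psi i j l"
proof -
  have "Psi i j l \<otimes> ((i \<star> (j \<star> l)) h \<otimes> Phi i j l) \<otimes> Psi i j l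
      = Psi i j l \<otimes> (Phi i j l \<otimes> ((i \<star> j) \<star> l) h) \<otimes> Psi i j l"
    using quasi_coassoc[OF assms] by simp
  then have "Psi i j l \<otimes> (i \<star> (j \<star> l)) h \<otimes> (Phi i j l \<otimes> Psi i j l)
      = (Psi i j l \<otimes> Phi i j l) \<otimes> ((i \<star> j) \<star> l) h \<otimes> Psi i j l"
    using a c h by (simp add: T.m_assoc)
  then show ?thesis using a c h by (simp add: Phi_Psi Psi_Phi)
qed

text \<open>Both elements mediate between two neighbouring pairs of legs and a pair nested inside a
  pair; nested pairs can be collapsed one after the other. These are the elements from which
  \<gamma> and \<delta> will be made.\<close>

lemma coassoc4:
  assumes a: "ahom i" "ahom j" "ahom l" "ahom m"
    and c: "cm i j" "cm i l" "cm i m" "cm j l" "cm j m" "cm l m" and h: "h \<in> carrier H"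
  shows "Phi i j l \<otimes> Psi (i \<star> j) l m \<otimes> ((i \<star> j) \<star> (l \<star> m)) h =
      ((i \<star> (j \<star> l)) \<star> m) h \<otimes> (Phi i j l \<otimes> Psi (i \<star> j) l m)"
    "((i \<star> j) \<star> (l \<star> m)) h \<otimes> (Phi (i \<star> j) l m \<otimes> Psi i j l) =
      Phi (i \<star> j) l m \<otimes> Psi i j l \<otimes> ((i \<star> (j \<star> l)) \<star> m) h"
proof -
  note [simp] = a c c[THEN commuting_sym] h
  \<comment> \<open>Since \<open>m\<close> commutes with \<open>Phi i j l\<close>,
    quasi-coassociativity of the first three legs survives convolution with the fourth.\<close>
  have 1: "Phi i j l \<otimes> (((i \<star> j) \<star> l) \<star> m) h = ((i \<star> (j \<star> l)) \<star> m) h \<otimes> Phi i j l"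
    by (intro conv_intertwine quasi_coassoc Phi_commute) simp_all
  have "Phi i j l \<otimes> Psi (i \<star> j) l m \<otimes> ((i \<star> j) \<star> (l \<star> m)) h =
      Phi i j l \<otimes> (((i \<star> j) \<star> l) \<star> m) h \<otimes> Psi (i \<star> j) l m"
    by (simp add: quasi_coassoc_inv T.m_assoc)
  then show "Phi i j l \<otimes> Psi (i \<star> j) l m \<otimes> ((i \<star> j) \<star> (l \<star> m)) h =
      ((i \<star> (j \<star> l)) \<star> m) h \<otimes> (Phi i j l \<otimes> Psi (i \<star> j) l m)"
    by (simp add: 1 T.m_assoc)
  have 2: "Psi i j l \<otimes> ((i \<star> (j \<star> l)) \<star> m) h = (((i \<star> j) \<star> l) \<star> m) h \<otimes> Psi i j l"
    by (intro conv_intertwine quasi_coassoc_inv Phi_commute) simp_all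
  have "((i \<star> j) \<star> (l \<star> m)) h \<otimes> (Phi (i \<star> j) l m \<otimes> Psi i j l) =
      (((i \<star> j) \<star> (l \<star> m)) h \<otimes> Phi (i \<star> j) l m) \<otimes> Psi i j l"
    by (simp add: T.m_assoc)
  also have "\<dots> = Phi (i \<star> j) l m \<otimes> ((((i \<star> j) \<star> l) \<star> m) h \<otimes> Psi i j l)"
    by (simp add: T.m_assoc flip: quasi_coassoc)
  finally show "((i \<star> j) \<star> (l \<star> m)) h \<otimes> (Phi (i \<star> j) l m \<otimes> Psi i j l) =
      Phi (i \<star> j) l m \<otimes> Psi i j l \<otimes> ((i \<star> (j \<star> l)) \<star> m) h"
    by (simp add: T.m_assoc flip: 2)
qed

abbreviation "eqR J \<equiv> eq_right T H J"
abbreviation "eqL J \<equiv> eq_left T H J"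

lemma eqR_conv:
  assumes "J \<in> linear_maps k T B" "ahom i" "ahom j" "ahom i'" "ahom j'"
    "eqR J i i'" "eqR J j j'" "cm i j'" "cm i' j'"
  shows "eqR J (i \<star> j) (i' \<star> j')"
  using eq_right_pairing[OF H H T assms(1) _ _ _ _ assms(6-9)] assms(2-5)
  by (simp add: eq_right_def conv_def comult_closed)

lemma eqL_conv:
  assumes "J \<in> linear_maps k T B" "ahom i" "ahom j" "ahom i'" "ahom j'"
    "eqL J i i'" "eqL J j j'" "cm i' j" "cm i' j'"
  shows "eqL J (i \<star> j) (i' \<star> j')"
  using eq_left_pairing[OF H H T assms(1) _ _ _ _ assms(6-9)] assms(2-5)
  by (simp add: eq_left_def conv_def comult_closed)

lemma eqR_eps_conv: "ahom i \<Longrightarrow> eqR J (eps \<star> i) i" "ahom i \<Longrightarrow> eqR J (i \<star> eps) i"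
  and eqL_eps_conv: "ahom i \<Longrightarrow> eqL J (eps \<star> i) i" "ahom i \<Longrightarrow> eqL J (i \<star> eps) i"
  by (simp_all add: eq_right_def eq_left_def eps_conv_left eps_conv_right)

text \<open>The inner pair becomes the counit and drops out of the convolution. Then
  \<open>i\<close> and \<open>m\<close> are neighbours and collapse as well.\<close>

lemma eqR_nested:
  assumes J: "J \<in> linear_maps k T B" and a: "ahom i" "ahom j" "ahom l" "ahom m"
    and c: "cm i j" "cm i l" "cm i m" "cm j l" "cm j m" "cm l m"
    and jl: "eqR J (j \<star> l) eps" and im: "eqR J (i \<star> m) eps"
  shows "eqR J ((i \<star> (j \<star> l)) \<star> m) eps"
proof -
  have "eqR J (i \<star> (j \<star> l)) (i \<star> eps)"
    using a c by (intro eqR_conv[OF J _ _ _ _ eq_right_refl jl]) simp_all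
  then have "eqR J (i \<star> (j \<star> l)) i"
    using eqR_eps_conv(2)[OF a(1)] by (rule eq_right_trans)
  then have "eqR J ((i \<star> (j \<star> l)) \<star> m) (i \<star> m)"
    using a c by (intro eqR_conv[OF J _ _ _ _ _ eq_right_refl]) simp_all
  then show ?thesis using im by (rule eq_right_trans)
qed

lemma eqL_nested:
  assumes J: "J \<in> linear_maps k T B" and a: "ahom i" "ahom j" "ahom l" "ahom m"
    and c: "cm i j" "cm i l" "cm i m" "cm j l" "cm j m" "cm l m"
    and jl: "eqL J (j \<star> l) eps" and im: "eqL J (i \<star> m) eps"
  shows "eqL J ((i \<star> (j \<star> l)) \<star> m) eps"
proof -
  have "eqL J (i \<star> (j \<star> l)) (i \<star> eps)"
    using a c by (intro eqL_conv[OF J _ _ _ _ eq_left_refl jl]) simp_all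
  then have "eqL J (i \<star> (j \<star> l)) i"
    using eqL_eps_conv(2)[OF a(1)] by (rule eq_left_trans)
  then have "eqL J ((i \<star> (j \<star> l)) \<star> m) (i \<star> m)"
    using a c by (intro eqL_conv[OF J _ _ _ _ _ eq_left_refl]) simp_all
  then show ?thesis using im by (rule eq_left_trans)
qed

lemma eqR_pairing3:
  assumes J: "J \<in> linear_maps k T B" and a: "ahom i" "ahom j" "ahom l" "ahom i'" "ahom j'" "ahom l'"
    and e: "eqR J i i'" "eqR J j j'" "eqR J l l'"
    and c: "cm i j'" "cm i l'" "cm i' j'" "cm i' l'" "cm j l'" "cm j' l'"
  shows "eq_right T H3 J (pairing3 k H H H T i j l) (pairing3 k H H H T i' j' l')"
  using a c
  by (intro eq_right_pairing[OF H HH T J _ _ _ _ e(1)] eq_right_pairing[OF H H T J _ _ _ _ e(2,3)]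
      pairing_linear[OF H H T] commuting_sym[OF commuting_pairing[OF H H T]])
    (simp_all add: commuting_sym)

lemma eqL_pairing3:
  assumes J: "J \<in> linear_maps k T B" and a: "ahom i" "ahom j" "ahom l" "ahom i'" "ahom j'" "ahom l'"
    and e: "eqL J i i'" "eqL J j j'" "eqL J l l'"
    and c: "cm i' j" "cm i' l" "cm i' j'" "cm i' l'" "cm j' l" "cm j' l'"
  shows "eq_left T H3 J (pairing3 k H H H T i j l) (pairing3 k H H H T i' j' l')"
  using a c
  by (intro eq_left_pairing[OF H HH T J _ _ _ _ e(1)] eq_left_pairing[OF H H T J _ _ _ _ e(2,3)]
      pairing_linear[OF H H T] commuting_sym[OF commuting_pairing[OF H H T]])
    (simp_all add: commuting_sym)

lemma eqR_Phi:
  assumes "J \<in> linear_maps k T B" "ahom i" "ahom j" "ahom l" "ahom i'" "ahom j'" "ahom l'"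
    "eqR J i i'" "eqR J j j'" "eqR J l l'"
    "cm i j'" "cm i l'" "cm i' j'" "cm i' l'" "cm j l'" "cm j' l'" "y \<in> carrier T"
  shows "J (y \<otimes> Phi i j l) = J (y \<otimes> Phi i' j' l')"
    "J (y \<otimes> Psi i j l) = J (y \<otimes> Psi i' j' l')"
  unfolding Phi_def Psi_def
  by (rule eq_rightD[OF eqR_pairing3[OF assms(1-16)] assms(17) reassoc_closed]
      eq_rightD[OF eqR_pairing3[OF assms(1-16)] assms(17) reassoc_inv_closed])+

lemma eqL_Phi:
  assumes "J \<in> linear_maps k T B" "ahom i" "ahom j" "ahom l" "ahom i'" "ahom j'" "ahom l'"
    "eqL J i i'" "eqL J j j'" "eqL J l l'"
    "cm i' j" "cm i' l" "cm i' j'" "cm i' l'" "cm j' l" "cm j' l'" "y \<in> carrier T"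
  shows "J (Phi i j l \<otimes> y) = J (Phi i' j' l' \<otimes> y)"
    "J (Psi i j l \<otimes> y) = J (Psi i' j' l' \<otimes> y)"
  unfolding Phi_def Psi_def
  by (rule eq_leftD[OF eqL_pairing3[OF assms(1-16)] assms(17) reassoc_closed]
      eq_leftD[OF eqL_pairing3[OF assms(1-16)] assms(17) reassoc_inv_closed])+

text \<open>A factor that commutes with the legs concerned can be absorbed into \<open>J\<close>.
  This gives access to legs that do not stand at the very end of a product.\<close>

lemma eqL_shift:
  assumes e: "eqL J i i'" and a: "ahom i" "ahom i'" and c: "c \<in> carrier T"
    and ci: "\<And>h. h \<in> carrier H \<Longrightarrow> c \<otimes> i h = i h \<otimes> c"
      "\<And>h. h \<in> carrier H \<Longrightarrow> c \<otimes> i' h = i' h \<otimes> c"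
  shows "eqL (\<lambda>y. J (c \<otimes> y)) i i'"
  using e c a by (simp add: eq_left_def ahom_closed ci T.m_assoc flip: T.m_assoc[of c "i _"] T.m_assoc[of c "i' _"])

lemma eqR_shift:
  assumes e: "eqR J i i'" and a: "ahom i" "ahom i'" and c: "c \<in> carrier T"
    and ci: "\<And>h. h \<in> carrier H \<Longrightarrow> c \<otimes> i h = i h \<otimes> c"
      "\<And>h. h \<in> carrier H \<Longrightarrow> c \<otimes> i' h = i' h \<otimes> c"
  shows "eqR (\<lambda>y. J (y \<otimes> c)) i i'"
  using e c a by (simp add: eq_right_def ahom_closed T.m_assoc flip: ci) (simp add: ahom_closed flip: T.m_assoc)

text \<open>The mechanism behind every collapse: \<open>G\<close> puts \<open>M a\<close> next to
  \<open>N b\<close> between fixed factors. Summation over the comultiplication then produces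
  \<open>M h\<^sub>1\<close> next to \<open>N h\<^sub>2\<close>, where the equation for \<alpha> or
  \<beta> applies.\<close>

lemma conv_collapse:
  assumes B: "assoc_algebra k B" and G: "G \<in> linear_maps k T B" and ij: "i \<in> linear_maps k H T" "j \<in> linear_maps k H T"
    and M: "M \<in> linear_maps k H B" and N: "N \<in> linear_maps k H B" and p: "p \<in> carrier B" and q: "q \<in> carrier B"
    and G_eq: "\<And>a b. \<lbrakk>a \<in> carrier H; b \<in> carrier H\<rbrakk> \<Longrightarrow> G (i a \<otimes> j b) = p \<otimes>\<^bsub>B\<^esub> (M a \<otimes>\<^bsub>B\<^esub> N b) \<otimes>\<^bsub>B\<^esub> q"
    and MN: "pairing k H H B M N (comult H h) = counit H h \<odot>\<^bsub>B\<^esub> c" and c: "c \<in> carrier B" and h: "h \<in> carrier H"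
  shows "G ((i \<star> j) h) = counit H h \<odot>\<^bsub>B\<^esub> (p \<otimes>\<^bsub>B\<^esub> c \<otimes>\<^bsub>B\<^esub> q)"
proof -
  interpret B: ring B by (rule assoc_algebra_ring[OF B])
  note pB = pairing_linear[OF H H B M N]
  have "G (pairing k H H T i j (comult H h)) = p \<otimes>\<^bsub>B\<^esub> pairing k H H B M N (comult H h) \<otimes>\<^bsub>B\<^esub> q"
    by (rule tensor_ext[OF H H linear_maps_comp[OF pairing_linear[OF H H T ij] G]
          linear_maps_rmult[OF B linear_maps_lmult[OF B pB p] q] _ comult_closed[OF h]])
      (simp add: pairing_pure[OF H H T ij] pairing_pure[OF H H B M N] G_eq)
  then show ?thesis
    using p q c h by (simp add: conv_def MN counit_closed assoc_algebra.smult_mult_left[OF B]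
        assoc_algebra.smult_mult_right[OF B])
qed

end

section \<open>Transport of collapses and values along embeddings and algebra maps\<close>

lemma eq_left_inl:
  assumes L: "assoc_algebra k L" and M: "assoc_algebra k M" and B: "assoc_algebra k B" and X: "assoc_algebra k X"
    and f: "f \<in> linear_maps k L B" and g: "g \<in> linear_maps k M B"
    and i: "i \<in> linear_maps k X L" and i': "i' \<in> linear_maps k X L"
    and e: "eq_left L X f i i'"
  shows "eq_left (L \<boxtimes>\<^bsub>k\<^esub> M) X (pairing k L M B f g) (\<lambda>x. inl k L M (i x)) (\<lambda>x. inl k L M (i' x))"
  unfolding eq_left_def
proof (intro ballI)
  interpret L: ring L by (rule assoc_algebra_ring[OF L])
  interpret M: ring M by (rule assoc_algebra_ring[OF M])
  note LM = assoc_algebra_tensor[OF L M]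
  fix y a assume y: "y \<in> carrier (L \<boxtimes>\<^bsub>k\<^esub> M)" and a: "a \<in> carrier X"
  note cl = linear_maps_closed[OF i a] linear_maps_closed[OF i' a]
  note pl = pairing_linear[OF L M B f g]
  show "pairing k L M B f g (inl k L M (i a) \<otimes>\<^bsub>L \<boxtimes>\<^bsub>k\<^esub> M\<^esub> y) = pairing k L M B f g (inl k L M (i' a) \<otimes>\<^bsub>L \<boxtimes>\<^bsub>k\<^esub> M\<^esub> y)"
    by (rule tensor_ext[OF L M linear_maps_comp[OF assoc_algebra_mult_linear(1)[OF LM inl_closed[OF L M cl(1)]] pl]
          linear_maps_comp[OF assoc_algebra_mult_linear(1)[OF LM inl_closed[OF L M cl(2)]] pl] _ y])
      (use e a cl in \<open>simp add: inl_def pure_mult_pure[OF L M] pairing_pure[OF L M B f g] eq_left_def\<close>)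
qed

lemma eq_right_inl:
  assumes L: "assoc_algebra k L" and M: "assoc_algebra k M" and B: "assoc_algebra k B" and X: "assoc_algebra k X"
    and f: "f \<in> linear_maps k L B" and g: "g \<in> linear_maps k M B"
    and i: "i \<in> linear_maps k X L" and i': "i' \<in> linear_maps k X L"
    and e: "eq_right L X f i i'"
  shows "eq_right (L \<boxtimes>\<^bsub>k\<^esub> M) X (pairing k L M B f g) (\<lambda>x. inl k L M (i x)) (\<lambda>x. inl k L M (i' x))"
  unfolding eq_right_def
proof (intro ballI)
  interpret L: ring L by (rule assoc_algebra_ring[OF L])
  interpret M: ring M by (rule assoc_algebra_ring[OF M])
  note LM = assoc_algebra_tensor[OF L M]
  fix y a assume y: "y \<in> carrier (L \<boxtimes>\<^bsub>k\<^esub> M)" and a: "a \<in> carrier X"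
  note cl = linear_maps_closed[OF i a] linear_maps_closed[OF i' a]
  note pl = pairing_linear[OF L M B f g]
  show "pairing k L M B f g (y \<otimes>\<^bsub>L \<boxtimes>\<^bsub>k\<^esub> M\<^esub> inl k L M (i a)) = pairing k L M B f g (y \<otimes>\<^bsub>L \<boxtimes>\<^bsub>k\<^esub> M\<^esub> inl k L M (i' a))"
    by (rule tensor_ext[OF L M linear_maps_comp[OF assoc_algebra_mult_linear(2)[OF LM inl_closed[OF L M cl(1)]] pl]
          linear_maps_comp[OF assoc_algebra_mult_linear(2)[OF LM inl_closed[OF L M cl(2)]] pl] _ y])
      (use e a cl in \<open>simp add: inl_def pure_mult_pure[OF L M] pairing_pure[OF L M B f g] eq_right_def\<close>)
qed

lemma eq_left_inr:
  assumes L: "assoc_algebra k L" and M: "assoc_algebra k M" and B: "assoc_algebra k B" and X: "assoc_algebra k X"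
    and f: "f \<in> linear_maps k L B" and g: "g \<in> linear_maps k M B"
    and i: "i \<in> linear_maps k X M" and i': "i' \<in> linear_maps k X M"
    and e: "eq_left M X g i i'"
  shows "eq_left (L \<boxtimes>\<^bsub>k\<^esub> M) X (pairing k L M B f g) (\<lambda>x. inr k L M (i x)) (\<lambda>x. inr k L M (i' x))"
  unfolding eq_left_def
proof (intro ballI)
  interpret L: ring L by (rule assoc_algebra_ring[OF L])
  interpret M: ring M by (rule assoc_algebra_ring[OF M])
  note LM = assoc_algebra_tensor[OF L M]
  fix y a assume y: "y \<in> carrier (L \<boxtimes>\<^bsub>k\<^esub> M)" and a: "a \<in> carrier X"
  note cl = linear_maps_closed[OF i a] linear_maps_closed[OF i' a]
  note pl = pairing_linear[OF L M B f g]
  show "pairing k L M B f g (inr k L M (i a) \<otimes>\<^bsub>L \<boxtimes>\<^bsub>k\<^esub> M\<^esub> y) = pairing k L M B f g (inr k L M (i' a) \<otimes>\<^bsub>L \<boxtimes>\<^bsub>k\<^esub> M\<^esub> y)"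
    by (rule tensor_ext[OF L M linear_maps_comp[OF assoc_algebra_mult_linear(1)[OF LM inr_closed[OF L M cl(1)]] pl]
          linear_maps_comp[OF assoc_algebra_mult_linear(1)[OF LM inr_closed[OF L M cl(2)]] pl] _ y])
      (use e a cl in \<open>simp add: inr_def pure_mult_pure[OF L M] pairing_pure[OF L M B f g] eq_left_def\<close>)
qed

lemma eq_right_inr:
  assumes L: "assoc_algebra k L" and M: "assoc_algebra k M" and B: "assoc_algebra k B" and X: "assoc_algebra k X"
    and f: "f \<in> linear_maps k L B" and g: "g \<in> linear_maps k M B"
    and i: "i \<in> linear_maps k X M" and i': "i' \<in> linear_maps k X M"
    and e: "eq_right M X g i i'"
  shows "eq_right (L \<boxtimes>\<^bsub>k\<^esub> M) X (pairing k L M B f g) (\<lambda>x. inr k L M (i x)) (\<lambda>x. inr k L M (i' x))"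
  unfolding eq_right_def
proof (intro ballI)
  interpret L: ring L by (rule assoc_algebra_ring[OF L])
  interpret M: ring M by (rule assoc_algebra_ring[OF M])
  note LM = assoc_algebra_tensor[OF L M]
  fix y a assume y: "y \<in> carrier (L \<boxtimes>\<^bsub>k\<^esub> M)" and a: "a \<in> carrier X"
  note cl = linear_maps_closed[OF i a] linear_maps_closed[OF i' a]
  note pl = pairing_linear[OF L M B f g]
  show "pairing k L M B f g (y \<otimes>\<^bsub>L \<boxtimes>\<^bsub>k\<^esub> M\<^esub> inr k L M (i a)) = pairing k L M B f g (y \<otimes>\<^bsub>L \<boxtimes>\<^bsub>k\<^esub> M\<^esub> inr k L M (i' a))"
    by (rule tensor_ext[OF L M linear_maps_comp[OF assoc_algebra_mult_linear(2)[OF LM inr_closed[OF L M cl(1)]] pl]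
          linear_maps_comp[OF assoc_algebra_mult_linear(2)[OF LM inr_closed[OF L M cl(2)]] pl] _ y])
      (use e a cl in \<open>simp add: inr_def pure_mult_pure[OF L M] pairing_pure[OF L M B f g] eq_right_def\<close>)
qed

lemma hom_conv:
  assumes "hom_calculus k H T" "hom_calculus k H T'" "F \<in> algebra_maps k T T'"
    and "i \<in> linear_maps k H T" "j \<in> linear_maps k H T" "h \<in> carrier H"
  shows "F (hom_calculus.conv k H T i j h) = hom_calculus.conv k H T' (\<lambda>h. F (i h)) (\<lambda>h. F (j h)) h"
proof -
  interpret X: hom_calculus k H T by fact
  interpret Y: hom_calculus k H T' by fact
  show ?thesis
    unfolding X.conv_def Y.conv_def by (rule hom_pairing[OF X.H X.H X.T Y.T assms(4,5,3) X.comult_closed[OF assms(6)]])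
qed

lemma hom_eps:
  assumes "hom_calculus k H T" "hom_calculus k H T'" "F \<in> algebra_maps k T T'" "h \<in> carrier H"
  shows "F (hom_calculus.eps H T h) = hom_calculus.eps H T' h"
proof -
  interpret X: hom_calculus k H T by fact
  interpret Y: hom_calculus k H T' by fact
  show ?thesis
    using linear_maps_smult[OF algebra_maps_linear[OF assms(3)]] assms(4)
    by (simp add: X.eps_def Y.eps_def X.counit_closed algebra_maps_one[OF assms(3)])
qed

lemma hom_pairing3:
  assumes A: "assoc_algebra k A" "assoc_algebra k B" "assoc_algebra k C" and T: "assoc_algebra k T" "assoc_algebra k T'"
    and l: "i \<in> linear_maps k A T" "j \<in> linear_maps k B T" "l \<in> linear_maps k C T"
    and F: "F \<in> algebra_maps k T T'" and z: "z \<in> carrier (A \<boxtimes>\<^bsub>k\<^esub> B \<boxtimes>\<^bsub>k\<^esub> C)"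
  shows "F (pairing3 k A B C T i j l z) = pairing3 k A B C T' (\<lambda>x. F (i x)) (\<lambda>x. F (j x)) (\<lambda>x. F (l x)) z"
  unfolding hom_pairing[OF A(1) assoc_algebra_tensor[OF A(2,3)] T l(1) pairing_linear[OF A(2,3) T(1) l(2,3)] F z]
  by (rule pairing_cong) (simp_all add: hom_pairing[OF A(2,3) T l(2,3) F])

section \<open>Antipodes along an algebra map\<close>

lemma pairing3_slots:
  assumes A: "assoc_algebra k A" and B: "assoc_algebra k B" and C: "assoc_algebra k C"
    and z: "z \<in> carrier (A \<boxtimes>\<^bsub>k\<^esub> B \<boxtimes>\<^bsub>k\<^esub> C)"
  shows "pairing3 k A B C (A \<boxtimes>\<^bsub>k\<^esub> B \<boxtimes>\<^bsub>k\<^esub> C) (inl k A (B \<boxtimes>\<^bsub>k\<^esub> C))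
    (\<lambda>b. inr k A (B \<boxtimes>\<^bsub>k\<^esub> C) (inl k B C b)) (\<lambda>c. inr k A (B \<boxtimes>\<^bsub>k\<^esub> C) (inr k B C c)) z = z"
proof -
  note BC = assoc_algebra_tensor[OF B C]
  note ABC = assoc_algebra_tensor[OF A BC]
  have "pairing k B C (A \<boxtimes>\<^bsub>k\<^esub> B \<boxtimes>\<^bsub>k\<^esub> C) (\<lambda>b. inr k A (B \<boxtimes>\<^bsub>k\<^esub> C) (inl k B C b))
      (\<lambda>c. inr k A (B \<boxtimes>\<^bsub>k\<^esub> C) (inr k B C c)) w = inr k A (B \<boxtimes>\<^bsub>k\<^esub> C) w" if "w \<in> carrier (B \<boxtimes>\<^bsub>k\<^esub> C)" for w
    using hom_pairing[OF B C BC ABC algebra_maps_linear[OF inl_hom[OF B C]] algebra_maps_linear[OF inr_hom[OF B C]]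
        inr_hom[OF A BC] that] by (simp add: pairing_inl_inr[OF B C that])
  then show ?thesis
    using pairing_inl_inr[OF A BC z] pairing_cong[of A "inl k A (B \<boxtimes>\<^bsub>k\<^esub> C)" _ "B \<boxtimes>\<^bsub>k\<^esub> C"] by metis
qed

lemma slots_commuting:
  assumes A: "assoc_algebra k A" and B: "assoc_algebra k B" and f: "f \<in> linear_maps k X A" and g: "g \<in> linear_maps k Y B"
  shows "commuting (A \<boxtimes>\<^bsub>k\<^esub> B) X Y (\<lambda>x. inl k A B (f x)) (\<lambda>y. inr k A B (g y))"
    "commuting (A \<boxtimes>\<^bsub>k\<^esub> B) Y X (\<lambda>y. inr k A B (g y)) (\<lambda>x. inl k A B (f x))"
  using inl_inr_commuting[OF A B] linear_maps_closed[OF f] linear_maps_closed[OF g]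
  by (simp_all add: commuting_def)

lemma commuting_hom:
  assumes "F \<in> algebra_maps k T T'" "commuting T X Y f g" "f \<in> linear_maps k X T" "g \<in> linear_maps k Y T"
  shows "commuting T' X Y (\<lambda>x. F (f x)) (\<lambda>y. F (g y))"
  using assms(2-4) unfolding commuting_def by (auto simp: linear_maps_closed simp flip: algebra_maps_mult[OF assms(1)])

context hom_calculus
begin

definition "anti S \<longleftrightarrow> S \<in> linear_maps k H T \<and> S \<one>\<^bsub>H\<^esub> = \<one> \<and>
  (\<forall>x\<in>carrier H. \<forall>y\<in>carrier H. S (x \<otimes>\<^bsub>H\<^esub> y) = S y \<otimes> S x)"

definition "alpha_pair D S a \<longleftrightarrow> ahom D \<and> anti S \<and> a \<in> carrier T \<and>
  (\<forall>h\<in>carrier H. pairing k H H T (\<lambda>h. S h \<otimes> a) D (comult H h) = counit H h \<odot> a)"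

definition "beta_pair D S b \<longleftrightarrow> ahom D \<and> anti S \<and> b \<in> carrier T \<and>
  (\<forall>h\<in>carrier H. pairing k H H T (\<lambda>h. D h \<otimes> b) S (comult H h) = counit H h \<odot> b)"

text \<open>The quasi-Hopf axioms for \<open>S\<close>, \<alpha> and \<beta> with elements of
  \<open>H\<close> read along \<open>D\<close>; for \<open>T = H\<close> and \<open>D\<close> the
  identity they are the axioms themselves. The last two equations are what makes the comparison of
  two antipodes invertible.\<close>

definition "antipode_along D S a b \<longleftrightarrow> alpha_pair D S a \<and> beta_pair D S b \<and>
  pairing3 k H H H T (\<lambda>h. D h \<otimes> b) (\<lambda>h. S h \<otimes> a) D (reassoc H) = \<one> \<and>
  pairing3 k H H H T (\<lambda>h. S h \<otimes> a) (\<lambda>h. D h \<otimes> b) S (inv\<^bsub>H3\<^esub> reassoc H) = \<one>"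

lemma antiD:
  assumes "anti S"
  shows "S \<in> linear_maps k H T" "S \<one>\<^bsub>H\<^esub> = \<one>"
    "\<lbrakk>x \<in> carrier H; y \<in> carrier H\<rbrakk> \<Longrightarrow> S (x \<otimes>\<^bsub>H\<^esub> y) = S y \<otimes> S x"
    "x \<in> carrier H \<Longrightarrow> S x \<in> carrier T"
  using assms linear_maps_closed by (auto simp: anti_def)

text \<open>In the application \<open>p h\<close> is \<open>S h \<otimes> a\<close>. As
  \<open>S\<close> reverses products, a left factor \<open>h\<close> comes out at the right end of
  \<open>p\<close>, where it meets the left factor released by \<open>r\<close>. So legs from
  different tensor factors become neighbours.\<close>

lemma link_left:
  assumes Y: "assoc_algebra k Y" and j: "j \<in> algebra_maps k H Y"
    and p: "p \<in> linear_maps k H T" and r: "r \<in> linear_maps k Y T"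
    and M: "M \<in> linear_maps k H T" and N: "N \<in> linear_maps k H T" and P: "\<And>a. a \<in> carrier H \<Longrightarrow> P a \<in> carrier T"
    and pM: "\<And>h a. \<lbrakk>h \<in> carrier H; a \<in> carrier H\<rbrakk> \<Longrightarrow> p (h \<otimes>\<^bsub>H\<^esub> a) = P a \<otimes> M h"
    and rN: "\<And>h y. \<lbrakk>h \<in> carrier H; y \<in> carrier Y\<rbrakk> \<Longrightarrow> r (j h \<otimes>\<^bsub>Y\<^esub> y) = N h \<otimes> r y"
    and MN: "\<And>h. h \<in> carrier H \<Longrightarrow> pairing k H H T M N (comult H h) = counit H h \<odot> (M \<one>\<^bsub>H\<^esub> \<otimes> N \<one>\<^bsub>H\<^esub>)"
  shows "eq_left (H \<boxtimes>\<^bsub>k\<^esub> Y) H (pairing k H Y T p r)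
    (hom_calculus.conv k H (H \<boxtimes>\<^bsub>k\<^esub> Y) (inl k H Y) (\<lambda>h. inr k H Y (j h))) (hom_calculus.eps H (H \<boxtimes>\<^bsub>k\<^esub> Y))"
proof -
  note HY = assoc_algebra_tensor[OF H Y]
  interpret X: hom_calculus k H "H \<boxtimes>\<^bsub>k\<^esub> Y" by (rule hom_calculus.intro[OF quasi_bialgebra_H HY])
  interpret Y: ring Y by (rule assoc_algebra_ring[OF Y])
  let ?J = "pairing k H Y T p r"
  note J = pairing_linear[OF H Y T p r]
  note inl = inl_hom[OF H Y] and inr = algebra_maps_comp[OF j inr_hom[OF H Y]]
  note lin = inl[THEN algebra_maps_linear] inr[THEN algebra_maps_linear]
  note jc = algebra_maps_closed[OF j]
  note cl = linear_maps_closed[OF M] linear_maps_closed[OF N] linear_maps_closed[OF r] P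
  show ?thesis
    unfolding eq_left_def
  proof (intro ballI)
    fix y h assume y: "y \<in> carrier (H \<boxtimes>\<^bsub>k\<^esub> Y)" and h: "h \<in> carrier H"
    let ?c = "X.conv (inl k H Y) (\<lambda>h. inr k H Y (j h)) h"
    have c: "?c \<in> carrier (H \<boxtimes>\<^bsub>k\<^esub> Y)" by (rule X.conv_closed[OF lin h])
    show "?J (?c \<otimes>\<^bsub>H \<boxtimes>\<^bsub>k\<^esub> Y\<^esub> y) = ?J (X.eps h \<otimes>\<^bsub>H \<boxtimes>\<^bsub>k\<^esub> Y\<^esub> y)"
    proof (rule tensor_ext[OF H Y linear_maps_comp[OF assoc_algebra_mult_linear(1)[OF HY c] J]
          linear_maps_comp[OF assoc_algebra_mult_linear(1)[OF HY X.ahom_closed[OF X.eps_ahom h]] J] _ y])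
      fix a b assume a: "a \<in> carrier H" and b: "b \<in> carrier Y"
      have ab: "pure k H Y a b \<in> carrier (H \<boxtimes>\<^bsub>k\<^esub> Y)" using a b by (rule pure_carrier[OF H Y])
      \<comment> \<open>The case \<open>h = \<one>\<close> writes \<open>p a\<close> in factored
        form, and likewise \<open>r b\<close>; the constant
        \<open>M \<one> \<otimes> N \<one>\<close> left by the collapse can then be folded back into
        their product.\<close>
      have pa: "p a = P a \<otimes> M \<one>\<^bsub>H\<^esub>" using pM[OF H.one_closed a] a by simp
      have rb: "r b = N \<one>\<^bsub>H\<^esub> \<otimes> r b" using rN[OF H.one_closed b] by (metis algebra_maps_one[OF j] Y.l_one[OF b])
      have "?J (?c \<otimes>\<^bsub>H \<boxtimes>\<^bsub>k\<^esub> Y\<^esub> pure k H Y a b) = counit H h \<odot> (P a \<otimes> (M \<one>\<^bsub>H\<^esub> \<otimes> N \<one>\<^bsub>H\<^esub>) \<otimes> r b)"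
        by (rule X.conv_collapse[OF T linear_maps_comp[OF assoc_algebra_mult_linear(2)[OF HY ab] J] lin M N P[OF a] linear_maps_closed[OF r b] _ MN[OF h]])
          (simp_all add: inl_def inr_def pure_mult_pure[OF H Y] pairing_pure[OF H Y T p r] a b h jc cl pM rN T.m_assoc)
      also have "P a \<otimes> (M \<one>\<^bsub>H\<^esub> \<otimes> N \<one>\<^bsub>H\<^esub>) \<otimes> r b = P a \<otimes> M \<one>\<^bsub>H\<^esub> \<otimes> (N \<one>\<^bsub>H\<^esub> \<otimes> r b)"
        using a b by (simp add: cl T.m_assoc)
      also have "\<dots> = ?J (pure k H Y a b)"
        unfolding pairing_pure[OF H Y T p r a b] by (simp only: flip: pa rb)
      also have "counit H h \<odot> ?J (pure k H Y a b) = ?J (X.eps h \<otimes>\<^bsub>H \<boxtimes>\<^bsub>k\<^esub> Y\<^esub> pure k H Y a b)"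
        by (simp add: X.eps_mult h ab linear_maps_smult[OF J] counit_closed)
      finally show "?J (?c \<otimes>\<^bsub>H \<boxtimes>\<^bsub>k\<^esub> Y\<^esub> pure k H Y a b) = ?J (X.eps h \<otimes>\<^bsub>H \<boxtimes>\<^bsub>k\<^esub> Y\<^esub> pure k H Y a b)" .
    qed
  qed
qed

text \<open>The mirror image, for \<open>p h\<close> equal to \<open>D h \<otimes> b\<close>: here
  \<open>p\<close> keeps the order of products and \<open>r\<close> reverses it, so factors on the
  right become neighbours.\<close>

lemma link_right:
  assumes Y: "assoc_algebra k Y" and j: "j \<in> algebra_maps k H Y"
    and p: "p \<in> linear_maps k H T" and r: "r \<in> linear_maps k Y T"
    and M: "M \<in> linear_maps k H T" and N: "N \<in> linear_maps k H T" and P: "\<And>a. a \<in> carrier H \<Longrightarrow> P a \<in> carrier T"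
    and pM: "\<And>h a. \<lbrakk>h \<in> carrier H; a \<in> carrier H\<rbrakk> \<Longrightarrow> p (a \<otimes>\<^bsub>H\<^esub> h) = P a \<otimes> M h"
    and rN: "\<And>h y. \<lbrakk>h \<in> carrier H; y \<in> carrier Y\<rbrakk> \<Longrightarrow> r (y \<otimes>\<^bsub>Y\<^esub> j h) = N h \<otimes> r y"
    and MN: "\<And>h. h \<in> carrier H \<Longrightarrow> pairing k H H T M N (comult H h) = counit H h \<odot> (M \<one>\<^bsub>H\<^esub> \<otimes> N \<one>\<^bsub>H\<^esub>)"
  shows "eq_right (H \<boxtimes>\<^bsub>k\<^esub> Y) H (pairing k H Y T p r)
    (hom_calculus.conv k H (H \<boxtimes>\<^bsub>k\<^esub> Y) (inl k H Y) (\<lambda>h. inr k H Y (j h))) (hom_calculus.eps H (H \<boxtimes>\<^bsub>k\<^esub> Y))"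
proof -
  note HY = assoc_algebra_tensor[OF H Y]
  interpret X: hom_calculus k H "H \<boxtimes>\<^bsub>k\<^esub> Y" by (rule hom_calculus.intro[OF quasi_bialgebra_H HY])
  interpret Y: ring Y by (rule assoc_algebra_ring[OF Y])
  let ?J = "pairing k H Y T p r"
  note J = pairing_linear[OF H Y T p r]
  note inl = inl_hom[OF H Y] and inr = algebra_maps_comp[OF j inr_hom[OF H Y]]
  note lin = inl[THEN algebra_maps_linear] inr[THEN algebra_maps_linear]
  note jc = algebra_maps_closed[OF j]
  note cl = linear_maps_closed[OF M] linear_maps_closed[OF N] linear_maps_closed[OF r] P
  show ?thesis
    unfolding eq_right_def
  proof (intro ballI)
    fix y h assume y: "y \<in> carrier (H \<boxtimes>\<^bsub>k\<^esub> Y)" and h: "h \<in> carrier H"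
    let ?c = "X.conv (inl k H Y) (\<lambda>h. inr k H Y (j h)) h"
    have c: "?c \<in> carrier (H \<boxtimes>\<^bsub>k\<^esub> Y)" by (rule X.conv_closed[OF lin h])
    show "?J (y \<otimes>\<^bsub>H \<boxtimes>\<^bsub>k\<^esub> Y\<^esub> ?c) = ?J (y \<otimes>\<^bsub>H \<boxtimes>\<^bsub>k\<^esub> Y\<^esub> X.eps h)"
    proof (rule tensor_ext[OF H Y linear_maps_comp[OF assoc_algebra_mult_linear(2)[OF HY c] J]
          linear_maps_comp[OF assoc_algebra_mult_linear(2)[OF HY X.ahom_closed[OF X.eps_ahom h]] J] _ y])
      fix a b assume a: "a \<in> carrier H" and b: "b \<in> carrier Y"
      have ab: "pure k H Y a b \<in> carrier (H \<boxtimes>\<^bsub>k\<^esub> Y)" using a b by (rule pure_carrier[OF H Y])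
      have pa: "p a = P a \<otimes> M \<one>\<^bsub>H\<^esub>" using pM[OF H.one_closed a] a by simp
      have rb: "r b = N \<one>\<^bsub>H\<^esub> \<otimes> r b" using rN[OF H.one_closed b] by (metis algebra_maps_one[OF j] Y.r_one[OF b])
      have "?J (pure k H Y a b \<otimes>\<^bsub>H \<boxtimes>\<^bsub>k\<^esub> Y\<^esub> ?c) = counit H h \<odot> (P a \<otimes> (M \<one>\<^bsub>H\<^esub> \<otimes> N \<one>\<^bsub>H\<^esub>) \<otimes> r b)"
        by (rule X.conv_collapse[OF T linear_maps_comp[OF assoc_algebra_mult_linear(1)[OF HY ab] J] lin M N P[OF a] linear_maps_closed[OF r b] _ MN[OF h]])
          (simp_all add: inl_def inr_def pure_mult_pure[OF H Y] pairing_pure[OF H Y T p r] a b h jc cl pM rN T.m_assoc)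
      also have "P a \<otimes> (M \<one>\<^bsub>H\<^esub> \<otimes> N \<one>\<^bsub>H\<^esub>) \<otimes> r b = P a \<otimes> M \<one>\<^bsub>H\<^esub> \<otimes> (N \<one>\<^bsub>H\<^esub> \<otimes> r b)"
        using a b by (simp add: cl T.m_assoc)
      also have "\<dots> = ?J (pure k H Y a b)"
        unfolding pairing_pure[OF H Y T p r a b] by (simp only: flip: pa rb)
      also have "counit H h \<odot> ?J (pure k H Y a b) = ?J (pure k H Y a b \<otimes>\<^bsub>H \<boxtimes>\<^bsub>k\<^esub> Y\<^esub> X.eps h)"
        by (simp add: X.eps_mult h ab linear_maps_smult[OF J] counit_closed)
      finally show "?J (pure k H Y a b \<otimes>\<^bsub>H \<boxtimes>\<^bsub>k\<^esub> Y\<^esub> ?c) = ?J (pure k H Y a b \<otimes>\<^bsub>H \<boxtimes>\<^bsub>k\<^esub> Y\<^esub> X.eps h)" .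
    qed
  qed
qed

lemma link_alpha:
  assumes ap: "alpha_pair D S a" and Y: "assoc_algebra k Y" and j: "j \<in> algebra_maps k H Y"
    and r: "r \<in> linear_maps k Y T"
    and rN: "\<And>h y. \<lbrakk>h \<in> carrier H; y \<in> carrier Y\<rbrakk> \<Longrightarrow> r (j h \<otimes>\<^bsub>Y\<^esub> y) = D h \<otimes> r y"
  shows "eq_left (H \<boxtimes>\<^bsub>k\<^esub> Y) H (pairing k H Y T (\<lambda>h. S h \<otimes> a) r)
    (hom_calculus.conv k H (H \<boxtimes>\<^bsub>k\<^esub> Y) (inl k H Y) (\<lambda>h. inr k H Y (j h))) (hom_calculus.eps H (H \<boxtimes>\<^bsub>k\<^esub> Y))"
proof -
  have S: "anti S" and D: "ahom D" and a: "a \<in> carrier T" using ap by (simp_all add: alpha_pair_def)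
  note Sa = linear_maps_rmult[OF T antiD(1)[OF S] a]
  show ?thesis
    by (rule link_left[OF Y j Sa r Sa ahom_linear[OF D] antiD(4)[OF S] _ rN])
      (use ap a antiD[OF S] algebra_maps_one[OF D] in \<open>simp_all add: alpha_pair_def T.m_assoc\<close>)
qed

lemma link_beta:
  assumes bp: "beta_pair D S b" and Y: "assoc_algebra k Y" and j: "j \<in> algebra_maps k H Y"
    and r: "r \<in> linear_maps k Y T"
    and rN: "\<And>h y. \<lbrakk>h \<in> carrier H; y \<in> carrier Y\<rbrakk> \<Longrightarrow> r (y \<otimes>\<^bsub>Y\<^esub> j h) = S h \<otimes> r y"
  shows "eq_right (H \<boxtimes>\<^bsub>k\<^esub> Y) H (pairing k H Y T (\<lambda>h. D h \<otimes> b) r)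
    (hom_calculus.conv k H (H \<boxtimes>\<^bsub>k\<^esub> Y) (inl k H Y) (\<lambda>h. inr k H Y (j h))) (hom_calculus.eps H (H \<boxtimes>\<^bsub>k\<^esub> Y))"
proof -
  have S: "anti S" and D: "ahom D" and b: "b \<in> carrier T" using bp by (simp_all add: beta_pair_def)
  note Db = linear_maps_rmult[OF T ahom_linear[OF D] b]
  show ?thesis
    by (rule link_right[OF Y j Db r Db antiD(1)[OF S] ahom_closed[OF D] _ rN])
      (use bp b antiD[OF S] algebra_maps_one[OF D] in \<open>simp_all add: beta_pair_def T.m_assoc algebra_maps_mult[OF D] ahom_closed[OF D]\<close>)
qed

text \<open>A collapse inside the second tensor factor persists when a further factor is read in
  front of it. Algebra maps preserve convolutions and the counit, so the legs need only be
  renamed.\<close>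

lemma eq_conv_inr:
  assumes L: "assoc_algebra k L" and Y: "assoc_algebra k Y" and f: "f \<in> linear_maps k L T" and g: "g \<in> linear_maps k Y T"
    and i: "i \<in> algebra_maps k H Y" and j: "j \<in> algebra_maps k H Y"
  shows "eq_left Y H g (hom_calculus.conv k H Y i j) (hom_calculus.eps H Y) \<Longrightarrow>
      eq_left (L \<boxtimes>\<^bsub>k\<^esub> Y) H (pairing k L Y T f g)
      (hom_calculus.conv k H (L \<boxtimes>\<^bsub>k\<^esub> Y) (\<lambda>h. inr k L Y (i h)) (\<lambda>h. inr k L Y (j h))) (hom_calculus.eps H (L \<boxtimes>\<^bsub>k\<^esub> Y))" (is "?A \<Longrightarrow> ?B")
    and "eq_right Y H g (hom_calculus.conv k H Y i j) (hom_calculus.eps H Y) \<Longrightarrow>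
      eq_right (L \<boxtimes>\<^bsub>k\<^esub> Y) H (pairing k L Y T f g)
      (hom_calculus.conv k H (L \<boxtimes>\<^bsub>k\<^esub> Y) (\<lambda>h. inr k L Y (i h)) (\<lambda>h. inr k L Y (j h))) (hom_calculus.eps H (L \<boxtimes>\<^bsub>k\<^esub> Y))" (is "?C \<Longrightarrow> ?D")
proof -
  note LY = assoc_algebra_tensor[OF L Y]
  interpret Y: hom_calculus k H Y by (rule hom_calculus.intro[OF quasi_bialgebra_H Y])
  interpret X: hom_calculus k H "L \<boxtimes>\<^bsub>k\<^esub> Y" by (rule hom_calculus.intro[OF quasi_bialgebra_H LY])
  note il = algebra_maps_linear[OF i] and jl = algebra_maps_linear[OF j]
  have c: "inr k L Y (Y.conv i j h) = X.conv (\<lambda>h. inr k L Y (i h)) (\<lambda>h. inr k L Y (j h)) h" if "h \<in> carrier H" for h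
    by (rule hom_conv[OF Y.hom_calculus_axioms X.hom_calculus_axioms inr_hom[OF L Y] il jl that])
  have e: "inr k L Y (Y.eps h) = X.eps h" if "h \<in> carrier H" for h
    by (rule hom_eps[OF Y.hom_calculus_axioms X.hom_calculus_axioms inr_hom[OF L Y] that])
  show "?A \<Longrightarrow> ?B"
    using eq_left_inr[OF L Y T H f g Y.conv_linear[OF il jl] Y.ahom_linear[OF Y.eps_ahom]]
    by (simp add: eq_left_def c e)
  show "?C \<Longrightarrow> ?D"
    using eq_right_inr[OF L Y T H f g Y.conv_linear[OF il jl] Y.ahom_linear[OF Y.eps_ahom]]
    by (simp add: eq_right_def c e)
qed

lemma eq_conv_inl:
  assumes L: "assoc_algebra k L" and Y: "assoc_algebra k Y" and f: "f \<in> linear_maps k L T" and g: "g \<in> linear_maps k Y T"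
    and i: "i \<in> algebra_maps k H L" and j: "j \<in> algebra_maps k H L"
  shows "eq_left L H f (hom_calculus.conv k H L i j) (hom_calculus.eps H L) \<Longrightarrow>
      eq_left (L \<boxtimes>\<^bsub>k\<^esub> Y) H (pairing k L Y T f g)
      (hom_calculus.conv k H (L \<boxtimes>\<^bsub>k\<^esub> Y) (\<lambda>h. inl k L Y (i h)) (\<lambda>h. inl k L Y (j h))) (hom_calculus.eps H (L \<boxtimes>\<^bsub>k\<^esub> Y))" (is "?A \<Longrightarrow> ?B")
    and "eq_right L H f (hom_calculus.conv k H L i j) (hom_calculus.eps H L) \<Longrightarrow>
      eq_right (L \<boxtimes>\<^bsub>k\<^esub> Y) H (pairing k L Y T f g)
      (hom_calculus.conv k H (L \<boxtimes>\<^bsub>k\<^esub> Y) (\<lambda>h. inl k L Y (i h)) (\<lambda>h. inl k L Y (j h))) (hom_calculus.eps H (L \<boxtimes>\<^bsub>k\<^esub> Y))" (is "?C \<Longrightarrow> ?D")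
proof -
  note LY = assoc_algebra_tensor[OF L Y]
  interpret L: hom_calculus k H L by (rule hom_calculus.intro[OF quasi_bialgebra_H L])
  interpret X: hom_calculus k H "L \<boxtimes>\<^bsub>k\<^esub> Y" by (rule hom_calculus.intro[OF quasi_bialgebra_H LY])
  note il = algebra_maps_linear[OF i] and jl = algebra_maps_linear[OF j]
  have c: "inl k L Y (L.conv i j h) = X.conv (\<lambda>h. inl k L Y (i h)) (\<lambda>h. inl k L Y (j h)) h" if "h \<in> carrier H" for h
    by (rule hom_conv[OF L.hom_calculus_axioms X.hom_calculus_axioms inl_hom[OF L Y] il jl that])
  have e: "inl k L Y (L.eps h) = X.eps h" if "h \<in> carrier H" for h
    by (rule hom_eps[OF L.hom_calculus_axioms X.hom_calculus_axioms inl_hom[OF L Y] that])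
  show "?A \<Longrightarrow> ?B"
    using eq_left_inl[OF L Y T H f g L.conv_linear[OF il jl] L.ahom_linear[OF L.eps_ahom]]
    by (simp add: eq_left_def c e)
  show "?C \<Longrightarrow> ?D"
    using eq_right_inl[OF L Y T H f g L.conv_linear[OF il jl] L.ahom_linear[OF L.eps_ahom]]
    by (simp add: eq_right_def c e)
qed

end

section \<open>Extensionality and slotwise multiplication in iterated tensor products\<close>

lemma pure_right_linear:
  assumes "assoc_algebra k A" "assoc_algebra k B" "a \<in> carrier A"
  shows "pure k A B a \<in> linear_maps k B (A \<boxtimes>\<^bsub>k\<^esub> B)"
  using pure_linear_right[OF assoc_algebra_module[OF assms(1)] assoc_algebra_module[OF assms(2)] assms(3)]
  by (simp add: linear_maps_tensor)

lemma tensor_ext3: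
  assumes A: "assoc_algebra k A" and B: "assoc_algebra k B" and C: "assoc_algebra k C"
    and f: "f \<in> linear_maps k (A \<boxtimes>\<^bsub>k\<^esub> B \<boxtimes>\<^bsub>k\<^esub> C) T" and g: "g \<in> linear_maps k (A \<boxtimes>\<^bsub>k\<^esub> B \<boxtimes>\<^bsub>k\<^esub> C) T"
    and fg: "\<And>a b c. \<lbrakk>a \<in> carrier A; b \<in> carrier B; c \<in> carrier C\<rbrakk> \<Longrightarrow>
      f (pure k A (B \<boxtimes>\<^bsub>k\<^esub> C) a (pure k B C b c)) = g (pure k A (B \<boxtimes>\<^bsub>k\<^esub> C) a (pure k B C b c))"
    and z: "z \<in> carrier (A \<boxtimes>\<^bsub>k\<^esub> B \<boxtimes>\<^bsub>k\<^esub> C)"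
  shows "f z = g z"
proof (rule tensor_ext[OF A assoc_algebra_tensor[OF B C] f g _ z])
  fix a w assume a: "a \<in> carrier A" and w: "w \<in> carrier (B \<boxtimes>\<^bsub>k\<^esub> C)"
  note p = pure_right_linear[OF A assoc_algebra_tensor[OF B C] a]
  show "f (pure k A (B \<boxtimes>\<^bsub>k\<^esub> C) a w) = g (pure k A (B \<boxtimes>\<^bsub>k\<^esub> C) a w)"
    by (rule tensor_ext[OF B C linear_maps_comp[OF p f] linear_maps_comp[OF p g] fg[OF a] w])
qed

lemma tensor_ext4:
  assumes A: "assoc_algebra k A" and B: "assoc_algebra k B" and C: "assoc_algebra k C" and D: "assoc_algebra k D"
    and f: "f \<in> linear_maps k (A \<boxtimes>\<^bsub>k\<^esub> B \<boxtimes>\<^bsub>k\<^esub> C \<boxtimes>\<^bsub>k\<^esub> D) T" and g: "g \<in> linear_maps k (A \<boxtimes>\<^bsub>k\<^esub> B \<boxtimes>\<^bsub>k\<^esub> C \<boxtimes>\<^bsub>k\<^esub> D) T"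
    and fg: "\<And>a b c d. \<lbrakk>a \<in> carrier A; b \<in> carrier B; c \<in> carrier C; d \<in> carrier D\<rbrakk> \<Longrightarrow>
      f (pure k A (B \<boxtimes>\<^bsub>k\<^esub> C \<boxtimes>\<^bsub>k\<^esub> D) a (pure k B (C \<boxtimes>\<^bsub>k\<^esub> D) b (pure k C D c d))) =
      g (pure k A (B \<boxtimes>\<^bsub>k\<^esub> C \<boxtimes>\<^bsub>k\<^esub> D) a (pure k B (C \<boxtimes>\<^bsub>k\<^esub> D) b (pure k C D c d)))"
    and z: "z \<in> carrier (A \<boxtimes>\<^bsub>k\<^esub> B \<boxtimes>\<^bsub>k\<^esub> C \<boxtimes>\<^bsub>k\<^esub> D)"
  shows "f z = g z"
proof (rule tensor_ext[OF A assoc_algebra_tensor[OF B assoc_algebra_tensor[OF C D]] f g _ z])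
  fix a w assume a: "a \<in> carrier A" and w: "w \<in> carrier (B \<boxtimes>\<^bsub>k\<^esub> C \<boxtimes>\<^bsub>k\<^esub> D)"
  note p = pure_right_linear[OF A assoc_algebra_tensor[OF B assoc_algebra_tensor[OF C D]] a]
  show "f (pure k A (B \<boxtimes>\<^bsub>k\<^esub> C \<boxtimes>\<^bsub>k\<^esub> D) a w) = g (pure k A (B \<boxtimes>\<^bsub>k\<^esub> C \<boxtimes>\<^bsub>k\<^esub> D) a w)"
    by (rule tensor_ext3[OF B C D linear_maps_comp[OF p f] linear_maps_comp[OF p g] fg[OF a] w])
qed

context
  fixes k :: "('k, 'c) ring_scheme" and A :: "('k, 'a, 'm) module_scheme" and Y :: "('k, 'b, 'n) module_scheme"
    and T :: "('k, 't, 'p) module_scheme" and p r c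
  assumes A: "assoc_algebra k A" and Y: "assoc_algebra k Y" and T: "assoc_algebra k T"
    and p: "p \<in> linear_maps k A T" and r: "r \<in> linear_maps k Y T" and c: "c \<in> carrier T"
begin

interpretation T: ring T by (rule assoc_algebra_ring[OF T])
interpretation A: ring A by (rule assoc_algebra_ring[OF A])
interpretation Y: ring Y by (rule assoc_algebra_ring[OF Y])
lemmas AY = assoc_algebra_tensor[OF A Y]
lemmas pr = pairing_linear[OF A Y T p r] and pr_pure = pairing_pure[OF A Y T p r]
lemmas pcl = linear_maps_closed[OF p] and rcl = linear_maps_closed[OF r]

text \<open>This rule is for a first reading that keeps the order of products. For one that reverses
  it, a factor multiplied on the right emerges on the left, which is
  \<open>pairing_inl_rmult\<close>.\<close>

lemma pairing_inl_lmult: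
  assumes x: "x \<in> carrier A" and "\<And>a. a \<in> carrier A \<Longrightarrow> p (x \<otimes>\<^bsub>A\<^esub> a) = c \<otimes>\<^bsub>T\<^esub> p a"
    and y: "y \<in> carrier (A \<boxtimes>\<^bsub>k\<^esub> Y)"
  shows "pairing k A Y T p r (inl k A Y x \<otimes>\<^bsub>A \<boxtimes>\<^bsub>k\<^esub> Y\<^esub> y) = c \<otimes>\<^bsub>T\<^esub> pairing k A Y T p r y"
  by (rule tensor_ext[OF A Y linear_maps_comp[OF assoc_algebra_mult_linear(1)[OF AY inl_closed[OF A Y x]] pr]
        linear_maps_lmult[OF T pr c] _ y])
    (simp add: inl_def pure_mult_pure[OF A Y] pr_pure x assms(2) pcl rcl c T.m_assoc)

lemma pairing_inl_rmult:
  assumes x: "x \<in> carrier A" and "\<And>a. a \<in> carrier A \<Longrightarrow> p (a \<otimes>\<^bsub>A\<^esub> x) = c \<otimes>\<^bsub>T\<^esub> p a"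
    and y: "y \<in> carrier (A \<boxtimes>\<^bsub>k\<^esub> Y)"
  shows "pairing k A Y T p r (y \<otimes>\<^bsub>A \<boxtimes>\<^bsub>k\<^esub> Y\<^esub> inl k A Y x) = c \<otimes>\<^bsub>T\<^esub> pairing k A Y T p r y"
  by (rule tensor_ext[OF A Y linear_maps_comp[OF assoc_algebra_mult_linear(2)[OF AY inl_closed[OF A Y x]] pr]
        linear_maps_lmult[OF T pr c] _ y])
    (simp add: inl_def pure_mult_pure[OF A Y] pr_pure x assms(2) pcl rcl c T.m_assoc)

lemma pairing_inr_lmult:
  assumes x: "x \<in> carrier Y" and "\<And>a. a \<in> carrier Y \<Longrightarrow> r (x \<otimes>\<^bsub>Y\<^esub> a) = r a \<otimes>\<^bsub>T\<^esub> c"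
    and y: "y \<in> carrier (A \<boxtimes>\<^bsub>k\<^esub> Y)"
  shows "pairing k A Y T p r (inr k A Y x \<otimes>\<^bsub>A \<boxtimes>\<^bsub>k\<^esub> Y\<^esub> y) = pairing k A Y T p r y \<otimes>\<^bsub>T\<^esub> c"
  by (rule tensor_ext[OF A Y linear_maps_comp[OF assoc_algebra_mult_linear(1)[OF AY inr_closed[OF A Y x]] pr]
        linear_maps_rmult[OF T pr c] _ y])
    (simp add: inr_def pure_mult_pure[OF A Y] pr_pure x assms(2) pcl rcl c T.m_assoc)

lemma pairing_inr_rmult_commute:
  assumes x: "x \<in> carrier Y" and "\<And>a. a \<in> carrier Y \<Longrightarrow> r (a \<otimes>\<^bsub>Y\<^esub> x) = c \<otimes>\<^bsub>T\<^esub> r a"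
    and pc: "\<And>a. a \<in> carrier A \<Longrightarrow> p a \<otimes>\<^bsub>T\<^esub> c = c \<otimes>\<^bsub>T\<^esub> p a" and y: "y \<in> carrier (A \<boxtimes>\<^bsub>k\<^esub> Y)"
  shows "pairing k A Y T p r (y \<otimes>\<^bsub>A \<boxtimes>\<^bsub>k\<^esub> Y\<^esub> inr k A Y x) = c \<otimes>\<^bsub>T\<^esub> pairing k A Y T p r y"
proof (rule tensor_ext[OF A Y linear_maps_comp[OF assoc_algebra_mult_linear(2)[OF AY inr_closed[OF A Y x]] pr]
        linear_maps_lmult[OF T pr c] _ y])
  fix a b assume a: "a \<in> carrier A" and b: "b \<in> carrier Y"
  have "p a \<otimes>\<^bsub>T\<^esub> (c \<otimes>\<^bsub>T\<^esub> r b) = c \<otimes>\<^bsub>T\<^esub> (p a \<otimes>\<^bsub>T\<^esub> r b)"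
    using a b c by (simp add: pcl rcl pc flip: T.m_assoc)
  then show "pairing k A Y T p r (pure k A Y a b \<otimes>\<^bsub>A \<boxtimes>\<^bsub>k\<^esub> Y\<^esub> inr k A Y x) = c \<otimes>\<^bsub>T\<^esub> pairing k A Y T p r (pure k A Y a b)"
    by (simp add: inr_def pure_mult_pure[OF A Y] pr_pure a b x assms(2))
qed

lemma pairing_inr_lmult_commute:
  assumes x: "x \<in> carrier Y" and "\<And>a. a \<in> carrier Y \<Longrightarrow> r (x \<otimes>\<^bsub>Y\<^esub> a) = c \<otimes>\<^bsub>T\<^esub> r a"
    and pc: "\<And>a. a \<in> carrier A \<Longrightarrow> p a \<otimes>\<^bsub>T\<^esub> c = c \<otimes>\<^bsub>T\<^esub> p a" and y: "y \<in> carrier (A \<boxtimes>\<^bsub>k\<^esub> Y)"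
  shows "pairing k A Y T p r (inr k A Y x \<otimes>\<^bsub>A \<boxtimes>\<^bsub>k\<^esub> Y\<^esub> y) = c \<otimes>\<^bsub>T\<^esub> pairing k A Y T p r y"
proof (rule tensor_ext[OF A Y linear_maps_comp[OF assoc_algebra_mult_linear(1)[OF AY inr_closed[OF A Y x]] pr]
        linear_maps_lmult[OF T pr c] _ y])
  fix a b assume a: "a \<in> carrier A" and b: "b \<in> carrier Y"
  have "p a \<otimes>\<^bsub>T\<^esub> (c \<otimes>\<^bsub>T\<^esub> r b) = c \<otimes>\<^bsub>T\<^esub> (p a \<otimes>\<^bsub>T\<^esub> r b)"
    using a b c by (simp add: pcl rcl pc flip: T.m_assoc)
  then show "pairing k A Y T p r (inr k A Y x \<otimes>\<^bsub>A \<boxtimes>\<^bsub>k\<^esub> Y\<^esub> pure k A Y a b) = c \<otimes>\<^bsub>T\<^esub> pairing k A Y T p r (pure k A Y a b)"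
    by (simp add: inr_def pure_mult_pure[OF A Y] pr_pure a b x assms(2))
qed

end

section \<open>The element that compares two antipodes along the same map\<close>

context hom_calculus
begin

lemma target: "assoc_algebra k X \<Longrightarrow> hom_calculus k H X"
  by (rule hom_calculus.intro[OF quasi_bialgebra_H])

text \<open>\<open>J1\<close> reads \<open>X^1 b S(X^2) a X^3\<close> and \<open>J2\<close> reads
  \<open>S(x^1) a x^2 b S'(x^3)\<close>, the expressions of the two normalisations. The two
  antipodes in \<open>J2\<close> may differ, and this is what allows a comparison.\<close>

abbreviation (input) "J1 D b S a \<equiv> pairing3 k H H H T (\<lambda>h. D h \<otimes> b) (\<lambda>h. S h \<otimes> a) D"
abbreviation (input) "J2 S a D b S' \<equiv> pairing3 k H H H T (\<lambda>h. S h \<otimes> a) (\<lambda>h. D h \<otimes> b) S'"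

abbreviation (input) "conv3 \<equiv> hom_calculus.conv k H H3"
abbreviation (input) "eps3 \<equiv> hom_calculus.eps H H3"
abbreviation (input) "s1 \<equiv> inl k H H2"
abbreviation (input) "s2 \<equiv> \<lambda>h. inr k H H2 (inl k H H h)"
abbreviation (input) "s3 \<equiv> \<lambda>h. inr k H H2 (inr k H H h)"

lemma ahom_mult_linear: "\<lbrakk>i \<in> linear_maps k H T; b \<in> carrier T\<rbrakk> \<Longrightarrow> (\<lambda>h. i h \<otimes> b) \<in> linear_maps k H T"
  by (rule linear_maps_rmult[OF T])

context
  fixes D S S' a b
  assumes D: "ahom D" and S: "anti S" and S': "anti S'" and a: "a \<in> carrier T" and b: "b \<in> carrier T"
begin

lemmas Dl = ahom_linear[OF D] and Sl = antiD(1)[OF S] and Sl' = antiD(1)[OF S']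
lemmas Db = ahom_mult_linear[OF Dl b] and Sa = ahom_mult_linear[OF Sl a]
lemmas Dcl = ahom_closed[OF D] and Scl = antiD(4)[OF S] and Scl' = antiD(4)[OF S']

lemma J1_linear: "J1 D b S a \<in> linear_maps k H3 T"
  by (rule pairing3_linear[OF H H H T Db Sa Dl])

lemma J2_linear: "J2 S a D b S' \<in> linear_maps k H3 T"
  by (rule pairing3_linear[OF H H H T Sa Db Sl'])

lemma J1_collapse12:
  assumes bp: "beta_pair D S b"
  shows "eq_right H3 H (J1 D b S a) (conv3 s1 s2) eps3"
  by (rule link_beta[OF bp HH inl_hom[OF H H] pairing_linear[OF H H T Sa Dl]])
    (rule pairing_inl_rmult[OF H H T Sa Dl]; simp add: antiD[OF S] a T.m_assoc)

lemma J1_collapse23: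
  assumes ap: "alpha_pair D S a"
  shows "eq_left H3 H (J1 D b S a) (conv3 s2 s3) eps3"
proof (rule eq_conv_inr(1)[OF H HH Db pairing_linear[OF H H T Sa Dl] inl_hom[OF H H] inr_hom[OF H H]])
  show "eq_left H2 H (pairing k H H T (\<lambda>h. S h \<otimes> a) D)
    (hom_calculus.conv k H H2 (inl k H H) (inr k H H)) (hom_calculus.eps H H2)"
    using link_alpha[OF ap H algebra_maps_id Dl] by (simp add: algebra_maps_mult[OF D])
qed

lemma J2_collapse12:
  assumes ap: "alpha_pair D S a"
  shows "eq_left H3 H (J2 S a D b S') (conv3 s1 s2) eps3"
  by (rule link_alpha[OF ap HH inl_hom[OF H H] pairing_linear[OF H H T Db Sl']])
    (rule pairing_inl_lmult[OF H H T Db Sl']; simp add: algebra_maps_mult[OF D] Dcl b T.m_assoc)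

lemma J2_collapse23:
  assumes bp: "beta_pair D S' b"
  shows "eq_right H3 H (J2 S a D b S') (conv3 s2 s3) eps3"
proof (rule eq_conv_inr(2)[OF H HH Sa pairing_linear[OF H H T Db Sl'] inl_hom[OF H H] inr_hom[OF H H]])
  show "eq_right H2 H (pairing k H H T (\<lambda>h. D h \<otimes> b) S')
    (hom_calculus.conv k H H2 (inl k H H) (inr k H H)) (hom_calculus.eps H H2)"
    using link_beta[OF bp H algebra_maps_id Sl'] by (simp add: antiD[OF S'])
qed

text \<open>Both outer legs are read by antipodes, so a factor on one side of the argument leaves on
  the other side of the value.\<close>

lemma J2_outer:
  assumes h: "h \<in> carrier H" and y: "y \<in> carrier H3"
  shows "J2 S a D b S' (y \<otimes>\<^bsub>H3\<^esub> s1 h) = S h \<otimes> J2 S a D b S' y"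
    and "J2 S a D b S' (s3 h \<otimes>\<^bsub>H3\<^esub> y) = J2 S a D b S' y \<otimes> S' h"
proof -
  note DbS = pairing_linear[OF H H T Db Sl']
  show "J2 S a D b S' (y \<otimes>\<^bsub>H3\<^esub> s1 h) = S h \<otimes> J2 S a D b S' y"
    by (rule pairing_inl_rmult[OF H HH T Sa DbS Scl[OF h] h _ y]) (simp add: antiD[OF S] a T.m_assoc h)
  show "J2 S a D b S' (s3 h \<otimes>\<^bsub>H3\<^esub> y) = J2 S a D b S' y \<otimes> S' h"
    by (rule pairing_inr_lmult[OF H HH T Sa DbS Scl'[OF h] inr_closed[OF H H h] _ y])
      (rule pairing_inr_lmult[OF H H T Db Sl' Scl'[OF h] h]; simp add: antiD[OF S'] h)
qed

end

text \<open>Drinfeld's formula for the element relating two antipodes: \<open>a\<close> belongs to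
  the first and \<open>b\<close> to the second. If both antipodes are the same, it is the left side
  of the second normalisation.\<close>

definition "twist D S a b S' = J2 S a D b S' (inv\<^bsub>H3\<^esub> reassoc H)"

lemma twist_closed:
  assumes "alpha_pair D S a" "beta_pair D S' b"
  shows "twist D S a b S' \<in> carrier T"
  unfolding twist_def
  using assms by (intro linear_maps_closed[OF J2_linear] reassoc_inv_closed) (simp_all add: alpha_pair_def beta_pair_def)

text \<open>Quasi-coassociativity is evaluated under \<open>J2\<close>. On one side \<open>b\<close>
  collapses the last two legs and the first one leaves as \<open>S h\<close> on the left; on the
  other side \<open>a\<close> collapses the first two and the last one leaves as \<open>S' h\<close>
  on the right.\<close>

lemma twist_intertwines:
  assumes ap: "alpha_pair D S a" and bp: "beta_pair D S' b" and h: "h \<in> carrier H"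
  shows "twist D S a b S' \<otimes> S' h = S h \<otimes> twist D S a b S'"
proof -
  have D: "ahom D" and S: "anti S" and S': "anti S'" and a: "a \<in> carrier T" and b: "b \<in> carrier T"
    using ap bp by (simp_all add: alpha_pair_def beta_pair_def)
  interpret X: hom_calculus k H "H \<boxtimes>\<^bsub>k\<^esub> H \<boxtimes>\<^bsub>k\<^esub> H" by (rule target[OF HHH])
  let ?J = "J2 S a D b S'"
  note J = J2_linear[OF D S S' a b]
  note homs = slot_homs[OF H H H]
  have cms: "X.cm s1 s2" "X.cm s1 s3" "X.cm s2 s3"
    using slots_commuting(1)[OF H HH linear_maps_id algebra_maps_linear[OF inl_hom[OF H H]]]
      slots_commuting(1)[OF H HH linear_maps_id algebra_maps_linear[OF inr_hom[OF H H]]]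
      commuting_hom[OF inr_hom[OF H HH] inl_inr_commuting[OF H H] algebra_maps_linear[OF inl_hom[OF H H]] algebra_maps_linear[OF inr_hom[OF H H]]]
    by simp_all
  note [simp] = homs cms cms[THEN commuting_sym]
  have Psi: "X.Psi s1 s2 s3 = inv\<^bsub>H3\<^esub> reassoc H"
    unfolding X.Psi_def by (rule pairing3_slots[OF H H H reassoc_inv_closed])
  have r: "X.eqR ?J (X.conv s1 (X.conv s2 s3)) s1"
    by (rule eq_right_trans[OF X.eqR_conv[OF J _ _ _ _ eq_right_refl J2_collapse23[OF D S S' a b bp]] X.eqR_eps_conv(2)]) simp_all
  have l: "X.eqL ?J (X.conv (X.conv s1 s2) s3) s3"
    by (rule eq_left_trans[OF X.eqL_conv[OF J _ _ _ _ J2_collapse12[OF D S S' a b ap] eq_left_refl] X.eqL_eps_conv(1)]) simp_all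
  have "?J (X.Psi s1 s2 s3 \<otimes>\<^bsub>H3\<^esub> X.conv s1 (X.conv s2 s3) h) =
      ?J (X.conv (X.conv s1 s2) s3 h \<otimes>\<^bsub>H3\<^esub> X.Psi s1 s2 s3)"
    using h by (subst X.quasi_coassoc_inv) simp_all
  then show ?thesis
    using J2_outer[OF D S S' a b h reassoc_inv_closed] h
    by (simp add: eq_rightD[OF r] eq_leftD[OF l] Psi reassoc_inv_closed twist_def)
qed

end

lemma four_slots:
  fixes A :: "('k, 'a, 'm) module_scheme" and B :: "('k, 'b, 'n) module_scheme"
    and C :: "('k, 'd, 'q) module_scheme" and D :: "('k, 'e, 'r) module_scheme"
  assumes A: "assoc_algebra k A" and B: "assoc_algebra k B" and C: "assoc_algebra k C" and D: "assoc_algebra k D"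
  defines "X \<equiv> A \<boxtimes>\<^bsub>k\<^esub> B \<boxtimes>\<^bsub>k\<^esub> C \<boxtimes>\<^bsub>k\<^esub> D" and "Y \<equiv> B \<boxtimes>\<^bsub>k\<^esub> C \<boxtimes>\<^bsub>k\<^esub> D"
  defines "e1 \<equiv> inl k A Y" and "e2 \<equiv> \<lambda>h. inr k A Y (inl k B (C \<boxtimes>\<^bsub>k\<^esub> D) h)"
    and "e3 \<equiv> \<lambda>h. inr k A Y (inr k B (C \<boxtimes>\<^bsub>k\<^esub> D) (inl k C D h))"
    and "e4 \<equiv> \<lambda>h. inr k A Y (inr k B (C \<boxtimes>\<^bsub>k\<^esub> D) (inr k C D h))"
  shows "e1 \<in> algebra_maps k A X" "e2 \<in> algebra_maps k B X" "e3 \<in> algebra_maps k C X" "e4 \<in> algebra_maps k D X"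
    "commuting X A B e1 e2" "commuting X A C e1 e3" "commuting X A D e1 e4" "commuting X B C e2 e3"
    "commuting X B D e2 e4" "commuting X C D e3 e4"
proof -
  note CD = assoc_algebra_tensor[OF C D]
  note BCD = assoc_algebra_tensor[OF B CD]
  note s = slot_homs[OF B C D]
  note inr = inr_hom[OF A BCD]
  show "e1 \<in> algebra_maps k A X" "e2 \<in> algebra_maps k B X" "e3 \<in> algebra_maps k C X" "e4 \<in> algebra_maps k D X"
    unfolding X_def Y_def e1_def e2_def e3_def e4_def
    by (rule inl_hom[OF A BCD] algebra_maps_comp[OF s(1) inr] algebra_maps_comp[OF s(2) inr] algebra_maps_comp[OF s(3) inr])+
  note lin = s[THEN algebra_maps_linear]
  show "commuting X A B e1 e2" "commuting X A C e1 e3" "commuting X A D e1 e4"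
    unfolding X_def Y_def e1_def e2_def e3_def e4_def
    using slots_commuting(1)[OF A BCD linear_maps_id lin(1)] slots_commuting(1)[OF A BCD linear_maps_id lin(2)]
      slots_commuting(1)[OF A BCD linear_maps_id lin(3)] by simp_all
  show "commuting X B C e2 e3" "commuting X B D e2 e4" "commuting X C D e3 e4"
    unfolding X_def Y_def e1_def e2_def e3_def e4_def
    using commuting_hom[OF inr slots_commuting(1)[OF B CD linear_maps_id algebra_maps_linear[OF inl_hom[OF C D]]] lin(1,2)]
      commuting_hom[OF inr slots_commuting(1)[OF B CD linear_maps_id algebra_maps_linear[OF inr_hom[OF C D]]] lin(1,3)]
      commuting_hom[OF inr commuting_hom[OF inr_hom[OF B CD] inl_inr_commuting[OF C D]
          algebra_maps_linear[OF inl_hom[OF C D]] algebra_maps_linear[OF inr_hom[OF C D]]] lin(2,3)]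
    by simp_all
qed

context hom_calculus
begin

lemma pentagon_quotient:
  assumes a: "ahom i" "ahom j" "ahom l" "ahom m"
    and c: "cm i j" "cm i l" "cm i m" "cm j l" "cm j m" "cm l m"
  shows "Psi i j (l \<star> m) \<otimes> Phi j l m = Phi (i \<star> j) l m \<otimes> Psi i j l \<otimes> Psi i (j \<star> l) m"
proof -
  note [simp] = a c c[THEN commuting_sym]
  let ?a = "Phi j l m" and ?b = "Phi i (j \<star> l) m" and ?c = "Phi i j l"
    and ?d = "Phi i j (l \<star> m)" and ?e = "Phi (i \<star> j) l m"
    and ?b' = "Psi i (j \<star> l) m" and ?c' = "Psi i j l" and ?d' = "Psi i j (l \<star> m)"
  have p: "?a \<otimes> ?b \<otimes> ?c = ?d \<otimes> ?e" by (rule pentagon[OF a c])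
  have "?d' \<otimes> ?a = ?d' \<otimes> (?a \<otimes> ?b \<otimes> (?c \<otimes> ?c') \<otimes> ?b')"
    by (simp add: Phi_Psi T.m_assoc)
  also have "\<dots> = ?d' \<otimes> (?a \<otimes> ?b \<otimes> ?c) \<otimes> ?c' \<otimes> ?b'"
    by (simp add: T.m_assoc)
  also have "\<dots> = (?d' \<otimes> ?d) \<otimes> ?e \<otimes> ?c' \<otimes> ?b'"
    unfolding p by (simp add: T.m_assoc)
  finally show ?thesis by (simp add: Psi_Phi)
qed

text \<open>A rearranged pentagon is read as \<open>S u a D v b S' w a' D z\<close>. One side
  collapses to the reassociator in the last three legs, with value \<open>a\<close> because of
  \<open>norm\<close>; the other collapses to its inverse in the first three legs, with value the
  twist times \<open>a'\<close>.\<close>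

lemma twist_alpha:
  assumes ap: "alpha_pair D S a" and bp: "beta_pair D S' b" and ap': "alpha_pair D S' a'"
    and norm: "J1 D b S' a' (reassoc H) = \<one>"
  shows "twist D S a b S' \<otimes> a' = a"
proof -
  have D: "ahom D" and S: "anti S" and S': "anti S'" and a: "a \<in> carrier T" and b: "b \<in> carrier T"
    and a': "a' \<in> carrier T"
    using ap bp ap' by (simp_all add: alpha_pair_def beta_pair_def)
  let ?X = "H4"
  let ?L = "H3"
  note HHHH = assoc_algebra_tensor[OF H HHH]
  interpret X: hom_calculus k H ?X by (rule target[OF HHHH])
  note l1 = Sa[OF D S S' a b] and l2 = Db[OF D S S' a b] and l3 = Sa[OF D S' S a' b]
  note J1 = J1_linear[OF D S' S a' b] and J2 = J2_linear[OF D S S' a b]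
  let ?F = "pairing k H ?L T (\<lambda>h. S h \<otimes> a) (J1 D b S' a')"
  note F = pairing_linear[OF H HHH T l1 J1]
  let ?r = "inr k H ?L"
  let ?e1 = "inl k H ?L" and ?e2 = "\<lambda>h. ?r (s1 h)" and ?e3 = "\<lambda>h. ?r (s2 h)" and ?e4 = "\<lambda>h. ?r (s3 h)"
  note e = four_slots[OF H H H H]
  note [simp] = e e(5-10)[THEN commuting_sym]
  note sl = slot_homs[OF H H H]
  \<comment> \<open>Here \<open>a\<close> joins legs 1 and 2, \<open>b\<close> joins legs 2 and 3,
    and \<open>a'\<close> joins legs 3 and 4.\<close>
  have L12: "X.eqL ?F (X.conv ?e1 ?e2) X.eps"
    by (rule link_alpha[OF ap HHH inl_hom[OF H HH] J1])
      (rule pairing_inl_lmult[OF H HH T l2 pairing_linear[OF H H T l3 ahom_linear[OF D]]];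
        simp add: algebra_maps_mult[OF D] ahom_closed[OF D] b T.m_assoc)
  have R23: "X.eqR ?F (X.conv ?e2 ?e3) X.eps"
    by (rule eq_conv_inr(2)[OF H HHH l1 J1 sl(1,2) J1_collapse12[OF D S' S a' b bp]])
  have L34: "X.eqL ?F (X.conv ?e3 ?e4) X.eps"
    by (rule eq_conv_inr(1)[OF H HHH l1 J1 sl(2,3) J1_collapse23[OF D S' S a' b ap']])
  have "?F (X.Phi (X.conv ?e1 ?e2) ?e3 ?e4 \<otimes>\<^bsub>?X\<^esub> X.Psi ?e1 ?e2 ?e3 \<otimes>\<^bsub>?X\<^esub> X.Psi ?e1 (X.conv ?e2 ?e3) ?e4)
      = ?F (X.Phi (X.conv ?e1 ?e2) ?e3 ?e4 \<otimes>\<^bsub>?X\<^esub> X.Psi ?e1 ?e2 ?e3 \<otimes>\<^bsub>?X\<^esub> X.Psi ?e1 X.eps ?e4)"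
    by (rule X.eqR_Phi(2)[OF F _ _ _ _ _ _ eq_right_refl R23 eq_right_refl]) simp_all
  also have "\<dots> = ?F (X.Phi (X.conv ?e1 ?e2) ?e3 ?e4 \<otimes>\<^bsub>?X\<^esub> X.Psi ?e1 ?e2 ?e3)"
    by (simp add: X.Psi_eps)
  also have "\<dots> = ?F (X.Phi X.eps ?e3 ?e4 \<otimes>\<^bsub>?X\<^esub> X.Psi ?e1 ?e2 ?e3)"
    by (rule X.eqL_Phi(1)[OF F _ _ _ _ _ _ L12 eq_left_refl eq_left_refl]) simp_all
  also have "\<dots> = ?F (X.Psi ?e1 ?e2 ?e3)"
    by (simp add: X.Phi_eps_left)
  also have "\<dots> = twist D S a b S' \<otimes> a'"
    unfolding X.Psi_def twist_def
  proof (rule tensor_ext3[OF H H H linear_maps_comp[OF _ F] linear_maps_rmult[OF T J2 a'] _ reassoc_inv_closed])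
    show "pairing3 k H H H ?X ?e1 ?e2 ?e3 \<in> linear_maps k ?L ?X"
      by (rule pairing3_linear[OF H H H HHHH]) simp_all
    fix u v w assume [simp]: "u \<in> carrier H" "v \<in> carrier H" "w \<in> carrier H"
    have "pairing3 k H H H ?X ?e1 ?e2 ?e3 (pure k H H2 u (pure k H H v w)) =
        ?e1 u \<otimes>\<^bsub>?X\<^esub> (?e2 v \<otimes>\<^bsub>?X\<^esub> ?e3 w)"
      by (rule pairing3_pure3[OF H H H HHHH, unfolded pure3_def]) simp_all
    also have "\<dots> = pure k H ?L u (pure k H H2 v (pure k H H w \<one>\<^bsub>H\<^esub>))"
      by (simp add: inl_def inr_def tensor_simps(5) pure_carrier[OF H H] pure_carrier[OF H HH] pure_mult_pure[OF H HHH] pure_mult_pure[OF H HH] pure_mult_pure[OF H H])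
    finally show "?F (pairing3 k H H H ?X ?e1 ?e2 ?e3 (pure k H H2 u (pure k H H v w))) =
        J2 S a D b S' (pure k H H2 u (pure k H H v w)) \<otimes> a'"
      by (simp add: pairing_pure[OF H HHH T l1 J1] pure_carrier[OF H H] pure_carrier[OF H HH]
          pairing3_pure3[OF H H H T l2 l3 ahom_linear[OF D], unfolded pure3_def]
          pairing3_pure3[OF H H H T l1 l2 antiD(1)[OF S'], unfolded pure3_def]
          algebra_maps_one[OF D] antiD(4)[OF S] antiD(4)[OF S'] ahom_closed[OF D] a a' b T.m_assoc)
  qed
  finally have 1: "?F (X.Phi (X.conv ?e1 ?e2) ?e3 ?e4 \<otimes>\<^bsub>?X\<^esub> X.Psi ?e1 ?e2 ?e3 \<otimes>\<^bsub>?X\<^esub> X.Psi ?e1 (X.conv ?e2 ?e3) ?e4)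
     = twist D S a b S' \<otimes> a'" .
  \<comment> \<open>The last three slots form one embedded copy of \<open>H3\<close>, so the
    reassociator read along them is its image under that embedding.\<close>
  have Phi_inr: "X.Phi ?e2 ?e3 ?e4 = ?r (reassoc H)"
    unfolding X.Phi_def
    using hom_pairing3[OF H H H HHH HHHH sl[THEN algebra_maps_linear] inr_hom[OF H HHH] reassoc_closed]
    by (simp add: pairing3_slots[OF H H H reassoc_closed])
  have "?F (X.Psi ?e1 ?e2 (X.conv ?e3 ?e4) \<otimes>\<^bsub>?X\<^esub> X.Phi ?e2 ?e3 ?e4) = ?F (X.Psi ?e1 ?e2 X.eps \<otimes>\<^bsub>?X\<^esub> X.Phi ?e2 ?e3 ?e4)"
    by (rule X.eqL_Phi(2)[OF F _ _ _ _ _ _ eq_left_refl eq_left_refl L34]) simp_all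
  also have "\<dots> = ?F (X.Phi ?e2 ?e3 ?e4)"
    by (simp add: X.Psi_eps)
  also have "\<dots> = a"
    unfolding Phi_inr by (simp add: inr_def pairing_pure[OF H HHH T l1 J1] reassoc_closed norm antiD(2)[OF S] a)
  finally have "?F (X.Psi ?e1 ?e2 (X.conv ?e3 ?e4) \<otimes>\<^bsub>?X\<^esub> X.Phi ?e2 ?e3 ?e4) = a" .
  moreover have "X.Psi ?e1 ?e2 (X.conv ?e3 ?e4) \<otimes>\<^bsub>?X\<^esub> X.Phi ?e2 ?e3 ?e4 =
      X.Phi (X.conv ?e1 ?e2) ?e3 ?e4 \<otimes>\<^bsub>?X\<^esub> X.Psi ?e1 ?e2 ?e3 \<otimes>\<^bsub>?X\<^esub> X.Psi ?e1 (X.conv ?e2 ?e3) ?e4"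
    by (rule X.pentagon_quotient) simp_all
  ultimately show ?thesis
    using 1 by (simp only:)
qed

text \<open>Multiplied into the second twist from the left, the first one turns
  \<open>S' x \<otimes> a'\<close> into \<open>S x \<otimes> a\<close>, by
  \<open>twist_intertwines\<close> and \<open>twist_alpha\<close>. What remains is the second
  normalisation of \<open>S\<close>.\<close>

lemma twist_inverse:
  assumes A1: "antipode_along D S a b" and A2: "antipode_along D S' a' b'"
  shows "twist D S a b' S' \<otimes> twist D S' a' b S = \<one>"
proof -
  have ap: "alpha_pair D S a" and bp: "beta_pair D S b" and ap': "alpha_pair D S' a'" and bp': "beta_pair D S' b'"
    and n: "J1 D b' S' a' (reassoc H) = \<one>"
    and n2: "J2 S a D b S (inv\<^bsub>H3\<^esub> reassoc H) = \<one>"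
    using A1 A2 by (simp_all add: antipode_along_def)
  have D: "ahom D" and S: "anti S" and S': "anti S'" and a: "a \<in> carrier T" and b: "b \<in> carrier T"
    and a': "a' \<in> carrier T" and b': "b' \<in> carrier T"
    using ap bp ap' bp' by (simp_all add: alpha_pair_def beta_pair_def)
  let ?u = "twist D S a b' S'"
  note u = twist_closed[OF ap bp']
  note l1 = Sa[OF D S' S a' b] and l2 = Db[OF D S S' a b] and l3 = Sa[OF D S S' a b]
  have "?u \<otimes> twist D S' a' b S = J2 S a D b S (inv\<^bsub>H3\<^esub> reassoc H)"
    unfolding twist_def[of D S' a' b S]
  proof (rule tensor_ext3[OF H H H linear_maps_lmult[OF T J2_linear[OF D S' S a' b] u] J2_linear[OF D S S a b] _ reassoc_inv_closed])
    fix x y z assume [simp]: "x \<in> carrier H" "y \<in> carrier H" "z \<in> carrier H"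
    note cl = antiD(4)[OF S] antiD(4)[OF S'] ahom_closed[OF D] a a' b u
    have "?u \<otimes> (S' x \<otimes> a') = S x \<otimes> (?u \<otimes> a')"
      using twist_intertwines[OF ap bp', of x] by (simp add: cl flip: T.m_assoc)
    also have "\<dots> = S x \<otimes> a" by (simp add: twist_alpha[OF ap bp' ap' n])
    finally have "?u \<otimes> (S' x \<otimes> a') = S x \<otimes> a" .
    then have "?u \<otimes> (S' x \<otimes> a' \<otimes> (D y \<otimes> b \<otimes> S z)) = S x \<otimes> a \<otimes> (D y \<otimes> b \<otimes> S z)"
      by (simp add: cl flip: T.m_assoc)
    then show "?u \<otimes> J2 S' a' D b S (pure k H H2 x (pure k H H y z)) =
        J2 S a D b S (pure k H H2 x (pure k H H y z))"
      by (simp add: pairing3_pure3[OF H H H T l1 l2 antiD(1)[OF S], unfolded pure3_def]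
          pairing3_pure3[OF H H H T l3 l2 antiD(1)[OF S], unfolded pure3_def])
  qed
  then show ?thesis using n2 by simp
qed

lemma twist_Units:
  assumes "antipode_along D S a b" and "antipode_along D S' a' b'"
  shows "twist D S a b' S' \<in> Units T"
proof -
  have "twist D S a b' S' \<in> carrier T" "twist D S' a' b S \<in> carrier T"
    using assms by (simp_all add: antipode_along_def twist_closed)
  then show ?thesis
    unfolding Units_def using twist_inverse[OF assms] twist_inverse[OF assms(2,1)] by blast
qed

end

section \<open>Fourfold readings\<close>

lemma pairing4_slots:
  assumes A: "assoc_algebra k A" and B: "assoc_algebra k B" and C: "assoc_algebra k C" and D: "assoc_algebra k D"
    and z: "z \<in> carrier (A \<boxtimes>\<^bsub>k\<^esub> B \<boxtimes>\<^bsub>k\<^esub> C \<boxtimes>\<^bsub>k\<^esub> D)"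
  shows "pairing4 k A B C D (A \<boxtimes>\<^bsub>k\<^esub> B \<boxtimes>\<^bsub>k\<^esub> C \<boxtimes>\<^bsub>k\<^esub> D) (inl k A (B \<boxtimes>\<^bsub>k\<^esub> C \<boxtimes>\<^bsub>k\<^esub> D))
    (\<lambda>b. inr k A (B \<boxtimes>\<^bsub>k\<^esub> C \<boxtimes>\<^bsub>k\<^esub> D) (inl k B (C \<boxtimes>\<^bsub>k\<^esub> D) b))
    (\<lambda>c. inr k A (B \<boxtimes>\<^bsub>k\<^esub> C \<boxtimes>\<^bsub>k\<^esub> D) (inr k B (C \<boxtimes>\<^bsub>k\<^esub> D) (inl k C D c)))
    (\<lambda>d. inr k A (B \<boxtimes>\<^bsub>k\<^esub> C \<boxtimes>\<^bsub>k\<^esub> D) (inr k B (C \<boxtimes>\<^bsub>k\<^esub> D) (inr k C D d))) z = z"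
proof -
  note CD = assoc_algebra_tensor[OF C D]
  note BCD = assoc_algebra_tensor[OF B CD]
  note ABCD = assoc_algebra_tensor[OF A BCD]
  note s = slot_homs[OF B C D, THEN algebra_maps_linear]
  have "pairing3 k B C D (A \<boxtimes>\<^bsub>k\<^esub> B \<boxtimes>\<^bsub>k\<^esub> C \<boxtimes>\<^bsub>k\<^esub> D) 
    (\<lambda>b. inr k A (B \<boxtimes>\<^bsub>k\<^esub> C \<boxtimes>\<^bsub>k\<^esub> D) (inl k B (C \<boxtimes>\<^bsub>k\<^esub> D) b))
    (\<lambda>c. inr k A (B \<boxtimes>\<^bsub>k\<^esub> C \<boxtimes>\<^bsub>k\<^esub> D) (inr k B (C \<boxtimes>\<^bsub>k\<^esub> D) (inl k C D c)))
    (\<lambda>d. inr k A (B \<boxtimes>\<^bsub>k\<^esub> C \<boxtimes>\<^bsub>k\<^esub> D) (inr k B (C \<boxtimes>\<^bsub>k\<^esub> D) (inr k C D d))) w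
    = inr k A (B \<boxtimes>\<^bsub>k\<^esub> C \<boxtimes>\<^bsub>k\<^esub> D) w" if "w \<in> carrier (B \<boxtimes>\<^bsub>k\<^esub> C \<boxtimes>\<^bsub>k\<^esub> D)" for w
    using hom_pairing3[OF B C D BCD ABCD s inr_hom[OF A BCD] that] by (simp add: pairing3_slots[OF B C D that])
  then have "?thesis \<longleftrightarrow> pairing k A (B \<boxtimes>\<^bsub>k\<^esub> C \<boxtimes>\<^bsub>k\<^esub> D) (A \<boxtimes>\<^bsub>k\<^esub> B \<boxtimes>\<^bsub>k\<^esub> C \<boxtimes>\<^bsub>k\<^esub> D)
      (inl k A (B \<boxtimes>\<^bsub>k\<^esub> C \<boxtimes>\<^bsub>k\<^esub> D)) (inr k A (B \<boxtimes>\<^bsub>k\<^esub> C \<boxtimes>\<^bsub>k\<^esub> D)) z = z"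
    by (intro arg_cong[where f = "\<lambda>w. w = z"] pairing_cong) simp_all
  then show ?thesis by (simp only: pairing_inl_inr[OF A BCD z])
qed

lemma pairing4_linear:
  assumes "assoc_algebra k A" "assoc_algebra k B" "assoc_algebra k C" "assoc_algebra k D" "assoc_algebra k T"
    and "i \<in> linear_maps k A T" "j \<in> linear_maps k B T" "l \<in> linear_maps k C T" "m \<in> linear_maps k D T"
  shows "pairing4 k A B C D T i j l m \<in> linear_maps k (A \<boxtimes>\<^bsub>k\<^esub> B \<boxtimes>\<^bsub>k\<^esub> C \<boxtimes>\<^bsub>k\<^esub> D) T"
  using assms by (intro pairing_linear assoc_algebra_tensor)

lemma pairing4_pure:
  assumes "assoc_algebra k A" "assoc_algebra k B" "assoc_algebra k C" "assoc_algebra k D" "assoc_algebra k T"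
    and "i \<in> linear_maps k A T" "j \<in> linear_maps k B T" "l \<in> linear_maps k C T" "m \<in> linear_maps k D T"
    and "a \<in> carrier A" "b \<in> carrier B" "c \<in> carrier C" "d \<in> carrier D"
  shows "pairing4 k A B C D T i j l m (pure k A (B \<boxtimes>\<^bsub>k\<^esub> C \<boxtimes>\<^bsub>k\<^esub> D) a (pure k B (C \<boxtimes>\<^bsub>k\<^esub> D) b (pure k C D c d))) =
    i a \<otimes>\<^bsub>T\<^esub> (j b \<otimes>\<^bsub>T\<^esub> (l c \<otimes>\<^bsub>T\<^esub> m d))"
  using assms by (simp add: pairing_pure assoc_algebra_tensor pairing_linear pure_carrier)

lemma pairing4_hom:
  assumes A: "assoc_algebra k A" "assoc_algebra k B" "assoc_algebra k C" "assoc_algebra k D" and T: "assoc_algebra k T"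
    and a: "i \<in> algebra_maps k A T" "j \<in> algebra_maps k B T" "l \<in> algebra_maps k C T" "m \<in> algebra_maps k D T"
    and c: "commuting T A B i j" "commuting T A C i l" "commuting T A D i m" "commuting T B C j l"
      "commuting T B D j m" "commuting T C D l m"
  shows "pairing4 k A B C D T i j l m \<in> algebra_maps k (A \<boxtimes>\<^bsub>k\<^esub> B \<boxtimes>\<^bsub>k\<^esub> C \<boxtimes>\<^bsub>k\<^esub> D) T"
proof -
  note al = a[THEN algebra_maps_linear]
  note CD = assoc_algebra_tensor[OF A(3,4)]
  note lm = pairing_linear[OF A(3,4) T al(3,4)]
  note s = commuting_sym
  note c_j_lm = commuting_pairing[OF A(3,4) T al(3,4,2) s[OF c(4)] s[OF c(5)]]
  note c_i_lm = commuting_pairing[OF A(3,4) T al(3,4,1) s[OF c(2)] s[OF c(3)]]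
  note c_i_jlm = commuting_pairing[OF A(2) CD T al(2) lm al(1) s[OF c(1)] c_i_lm]
  show ?thesis
    by (intro pairing_hom assoc_algebra_tensor A T a c s[OF c_j_lm] s[OF c_i_jlm])
qed

lemma hom_Phi:
  assumes X: "hom_calculus k H T" and Y: "hom_calculus k H T'" and F: "F \<in> algebra_maps k T T'"
    and l: "i \<in> linear_maps k H T" "j \<in> linear_maps k H T" "l \<in> linear_maps k H T"
  shows "F (hom_calculus.Phi k H T i j l) = hom_calculus.Phi k H T' (\<lambda>h. F (i h)) (\<lambda>h. F (j h)) (\<lambda>h. F (l h))"
    "F (hom_calculus.Psi k H T i j l) = hom_calculus.Psi k H T' (\<lambda>h. F (i h)) (\<lambda>h. F (j h)) (\<lambda>h. F (l h))"
proof -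
  interpret X: hom_calculus k H T by fact
  interpret Y: hom_calculus k H T' by fact
  show "F (X.Phi i j l) = Y.Phi (\<lambda>h. F (i h)) (\<lambda>h. F (j h)) (\<lambda>h. F (l h))"
    "F (X.Psi i j l) = Y.Psi (\<lambda>h. F (i h)) (\<lambda>h. F (j h)) (\<lambda>h. F (l h))"
    unfolding X.Phi_def Y.Phi_def X.Psi_def Y.Psi_def
    using hom_pairing3[OF X.H X.H X.H X.T Y.T l F] X.reassoc_closed X.reassoc_inv_closed by blast+
qed

section \<open>Convolutions that pass through a linear map\<close>

context hom_calculus
begin

context
  fixes X :: "('k, 'x, 'y) module_scheme" and J i j I I'
  assumes X: "assoc_algebra k X" and J: "J \<in> linear_maps k X T"
    and i: "i \<in> linear_maps k H X" and j: "j \<in> linear_maps k H X"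
    and I: "I \<in> linear_maps k H T" and I': "I' \<in> linear_maps k H T"
begin

interpretation X: hom_calculus k H X by (rule target[OF X])

private lemmas ijX = pairing_linear[OF H H X i j] and ij_pure = pairing_pure[OF H H X i j]
  and II = pairing_linear[OF H H T I I'] and II_pure = pairing_pure[OF H H T I I']
lemmas cls = linear_maps_closed[OF i] linear_maps_closed[OF j] linear_maps_closed[OF I] linear_maps_closed[OF I']
  linear_maps_closed[OF J]

lemma conv_act_right_right:
  assumes "\<And>y u. \<lbrakk>y \<in> carrier X; u \<in> carrier H\<rbrakk> \<Longrightarrow> J (y \<otimes>\<^bsub>X\<^esub> i u) = J y \<otimes> I u"
    and "\<And>y u. \<lbrakk>y \<in> carrier X; u \<in> carrier H\<rbrakk> \<Longrightarrow> J (y \<otimes>\<^bsub>X\<^esub> j u) = J y \<otimes> I' u"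
    and y: "y \<in> carrier X" and h: "h \<in> carrier H"
  shows "J (y \<otimes>\<^bsub>X\<^esub> X.conv i j h) = J y \<otimes> (I \<star> I') h"
  unfolding conv_def X.conv_def
  by (rule tensor_ext[OF H H linear_maps_comp[OF linear_maps_lmult[OF X ijX y] J]
        linear_maps_lmult[OF T II linear_maps_closed[OF J y]] _ comult_closed[OF h]])
    (use y in \<open>simp add: ij_pure II_pure cls assms(1,2) T.m_assoc flip: X.T.m_assoc\<close>)

text \<open>Two factors on the right come out on the left in reverse order; \<open>cm I I'\<close>
  restores the order of the convolution.\<close>

lemma conv_act_right_left:
  assumes "\<And>y u. \<lbrakk>y \<in> carrier X; u \<in> carrier H\<rbrakk> \<Longrightarrow> J (y \<otimes>\<^bsub>X\<^esub> i u) = I u \<otimes> J y"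
    and "\<And>y u. \<lbrakk>y \<in> carrier X; u \<in> carrier H\<rbrakk> \<Longrightarrow> J (y \<otimes>\<^bsub>X\<^esub> j u) = I' u \<otimes> J y"
    and c: "cm I I'" and y: "y \<in> carrier X" and h: "h \<in> carrier H"
  shows "J (y \<otimes>\<^bsub>X\<^esub> X.conv i j h) = (I \<star> I') h \<otimes> J y"
  unfolding conv_def X.conv_def
  by (rule tensor_ext[OF H H linear_maps_comp[OF linear_maps_lmult[OF X ijX y] J]
        linear_maps_rmult[OF T II linear_maps_closed[OF J y]] _ comult_closed[OF h]])
    (use y in \<open>simp add: ij_pure II_pure cls assms(1,2) commutingD[OF c] T.m_assoc flip: X.T.m_assoc\<close>)

lemma conv_act_left_left:
  assumes "\<And>y u. \<lbrakk>y \<in> carrier X; u \<in> carrier H\<rbrakk> \<Longrightarrow> J (i u \<otimes>\<^bsub>X\<^esub> y) = I u \<otimes> J y"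
    and "\<And>y u. \<lbrakk>y \<in> carrier X; u \<in> carrier H\<rbrakk> \<Longrightarrow> J (j u \<otimes>\<^bsub>X\<^esub> y) = I' u \<otimes> J y"
    and y: "y \<in> carrier X" and h: "h \<in> carrier H"
  shows "J (X.conv i j h \<otimes>\<^bsub>X\<^esub> y) = (I \<star> I') h \<otimes> J y"
  unfolding conv_def X.conv_def
  by (rule tensor_ext[OF H H linear_maps_comp[OF linear_maps_rmult[OF X ijX y] J]
        linear_maps_rmult[OF T II linear_maps_closed[OF J y]] _ comult_closed[OF h]])
    (use y in \<open>simp add: ij_pure II_pure cls assms(1,2) T.m_assoc X.T.m_assoc\<close>)

lemma conv_act_left_right:
  assumes "\<And>y u. \<lbrakk>y \<in> carrier X; u \<in> carrier H\<rbrakk> \<Longrightarrow> J (i u \<otimes>\<^bsub>X\<^esub> y) = J y \<otimes> I u"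
    and "\<And>y u. \<lbrakk>y \<in> carrier X; u \<in> carrier H\<rbrakk> \<Longrightarrow> J (j u \<otimes>\<^bsub>X\<^esub> y) = J y \<otimes> I' u"
    and c: "cm I I'" and y: "y \<in> carrier X" and h: "h \<in> carrier H"
  shows "J (X.conv i j h \<otimes>\<^bsub>X\<^esub> y) = J y \<otimes> (I \<star> I') h"
  unfolding conv_def X.conv_def
  by (rule tensor_ext[OF H H linear_maps_comp[OF linear_maps_rmult[OF X ijX y] J]
        linear_maps_lmult[OF T II linear_maps_closed[OF J y]] _ comult_closed[OF h]])
    (use y in \<open>simp add: ij_pure II_pure cls assms(1,2) commutingD[OF c] T.m_assoc X.T.m_assoc\<close>)

end

text \<open>Commuting images allow the values of \<open>i\<close> and those of \<open>j\<close> to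
  be collected separately, and each of the two maps reverses its own factors.\<close>

lemma anti_conv:
  assumes i: "anti i" and j: "anti j" and c: "cm i j"
  shows "anti (i \<star> j)"
proof -
  note il = antiD(1)[OF i] and jl = antiD(1)[OF j]
  note pl = pairing_linear[OF H H T il jl] and pp = pairing_pure[OF H H T il jl]
  interpret HH: ring "H \<boxtimes>\<^bsub>k\<^esub> H" by (rule assoc_algebra_ring[OF HH])
  let ?p = "pairing k H H T i j"
  note [simp] = antiD(4)[OF i] antiD(4)[OF j]
  have 1: "?p (pure k H H a b \<otimes>\<^bsub>H2\<^esub> y) = ?p y \<otimes> ?p (pure k H H a b)"
    if a: "a \<in> carrier H" and b: "b \<in> carrier H" and y: "y \<in> carrier H2" for a b y
  proof (rule tensor_ext[OF H H linear_maps_comp[OF assoc_algebra_mult_linear(1)[OF HH pure_carrier[OF H H a b]] pl]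
        linear_maps_rmult[OF T pl linear_maps_closed[OF pl pure_carrier[OF H H a b]]] _ y])
    fix a' b' assume a': "a' \<in> carrier H" and b': "b' \<in> carrier H"
    have "i a' \<otimes> i a \<otimes> (j b' \<otimes> j b) = i a' \<otimes> (i a \<otimes> j b') \<otimes> j b"
      using a b a' b' by (simp add: T.m_assoc)
    also have "\<dots> = i a' \<otimes> j b' \<otimes> (i a \<otimes> j b)"
      using a b a' b' by (simp add: commutingD[OF c a b'] T.m_assoc)
    finally show "?p (pure k H H a b \<otimes>\<^bsub>H2\<^esub> pure k H H a' b') = ?p (pure k H H a' b') \<otimes> ?p (pure k H H a b)"
      using a b a' b' by (simp add: pure_mult_pure[OF H H] pp antiD(3)[OF i] antiD(3)[OF j])
  qed
  have 2: "?p (x \<otimes>\<^bsub>H2\<^esub> y) = ?p y \<otimes> ?p x"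
    if x: "x \<in> carrier H2" and y: "y \<in> carrier H2" for x y
    by (rule tensor_ext[OF H H linear_maps_comp[OF assoc_algebra_mult_linear(2)[OF HH y] pl]
          linear_maps_lmult[OF T pl linear_maps_closed[OF pl y]] 1[OF _ _ y] x])
  have "?p \<one>\<^bsub>H2\<^esub> = \<one>"
    by (simp add: tensor_simps(5) pp antiD(2)[OF i] antiD(2)[OF j])
  then show ?thesis
    using conv_linear[OF il jl]
    by (simp add: anti_def conv_def algebra_maps_mult[OF comult] algebra_maps_one[OF comult] 2 comult_closed)
qed

end

text \<open>The intended instance is \<open>H\<close> embedded twice in
  \<open>H \<otimes> H\<close>. Then \<open>D1 \<star> D2\<close> is \<Delta>, and
  \<open>S2 \<star> S1\<close> is \<open>S \<otimes> S\<close> after the opposite comultiplication.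
  The two copies have to commute elementwise, their constants included.\<close>

locale commuting_antipodes = hom_calculus k H T
  for k :: "('k, 'c) ring_scheme" and H :: "('k, 'h, 'm) qbialg_scheme" and T :: "('k, 't, 'p) module_scheme" (structure) +
  fixes D1 S1 a1 b1 D2 S2 a2 b2
  assumes A1: "antipode_along D1 S1 a1 b1" and A2: "antipode_along D2 S2 a2 b2"
    and comm: "\<lbrakk>x \<in> D1 ` carrier H \<union> S1 ` carrier H \<union> {a1, b1};
      y \<in> D2 ` carrier H \<union> S2 ` carrier H \<union> {a2, b2}\<rbrakk> \<Longrightarrow> x \<otimes>\<^bsub>T\<^esub> y = y \<otimes>\<^bsub>T\<^esub> x"
begin

definition "C1 = D1 ` carrier H \<union> S1 ` carrier H \<union> {a1, b1}"
definition "C2 = D2 ` carrier H \<union> S2 ` carrier H \<union> {a2, b2}"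

lemma in_C [simp]: "u \<in> carrier H \<Longrightarrow> D1 u \<in> C1" "u \<in> carrier H \<Longrightarrow> S1 u \<in> C1" "a1 \<in> C1" "b1 \<in> C1"
  "u \<in> carrier H \<Longrightarrow> D2 u \<in> C2" "u \<in> carrier H \<Longrightarrow> S2 u \<in> C2" "a2 \<in> C2" "b2 \<in> C2"
  by (auto simp: C1_def C2_def)

lemma pairs: "alpha_pair D1 S1 a1" "beta_pair D1 S1 b1" "alpha_pair D2 S2 a2" "beta_pair D2 S2 b2"
  using A1 A2 by (simp_all add: antipode_along_def)

lemma homs: "ahom D1" "ahom D2" "anti S1" "anti S2"
  using pairs by (simp_all add: alpha_pair_def)

lemma elems [simp]: "a1 \<in> carrier T" "b1 \<in> carrier T" "a2 \<in> carrier T" "b2 \<in> carrier T"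
  using pairs by (simp_all add: alpha_pair_def beta_pair_def)

lemmas vals [simp] = ahom_closed[OF homs(1)] ahom_closed[OF homs(2)] antiD(4)[OF homs(3)] antiD(4)[OF homs(4)]
lemmas mults = algebra_maps_mult[OF homs(1)] algebra_maps_mult[OF homs(2)] antiD(3)[OF homs(3)] antiD(3)[OF homs(4)]
lemmas lins = ahom_linear[OF homs(1)] ahom_linear[OF homs(2)] antiD(1)[OF homs(3)] antiD(1)[OF homs(4)]
lemmas lins_mult = ahom_mult_linear[OF lins(1) elems(2)] ahom_mult_linear[OF lins(2) elems(4)]
  ahom_mult_linear[OF lins(3) elems(1)] ahom_mult_linear[OF lins(4) elems(3)]

lemma C_closed: "x \<in> C1 \<Longrightarrow> x \<in> carrier T" "y \<in> C2 \<Longrightarrow> y \<in> carrier T"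
  by (auto simp: C1_def C2_def)

lemma C_commute: "\<lbrakk>x \<in> C1; y \<in> C2\<rbrakk> \<Longrightarrow> y \<otimes> x = x \<otimes> y"
  "\<lbrakk>x \<in> C1; y \<in> C2; z \<in> carrier T\<rbrakk> \<Longrightarrow> y \<otimes> (x \<otimes> z) = x \<otimes> (y \<otimes> z)"
proof -
  show 1: "y \<otimes> x = x \<otimes> y" if "x \<in> C1" "y \<in> C2" for x y
    using that unfolding C1_def C2_def by (rule comm[symmetric])
  show "y \<otimes> (x \<otimes> z) = x \<otimes> (y \<otimes> z)" if "x \<in> C1" "y \<in> C2" "z \<in> carrier T"
    using that 1[OF that(1,2)] C_closed by (simp flip: T.m_assoc)
qed

text \<open>Rewriting rules that move each factor of the first copy in front of each factor of the
  second; the variant with a trailing factor acts inside right-nested products.\<close>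

lemmas sort =
  C_commute[OF in_C(1) in_C(5)] C_commute[OF in_C(1) in_C(6)] C_commute[OF in_C(1) in_C(7)] C_commute[OF in_C(1) in_C(8)]
  C_commute[OF in_C(2) in_C(5)] C_commute[OF in_C(2) in_C(6)] C_commute[OF in_C(2) in_C(7)] C_commute[OF in_C(2) in_C(8)]
  C_commute[OF in_C(3) in_C(5)] C_commute[OF in_C(3) in_C(6)] C_commute[OF in_C(3) in_C(7)] C_commute[OF in_C(3) in_C(8)]
  C_commute[OF in_C(4) in_C(5)] C_commute[OF in_C(4) in_C(6)] C_commute[OF in_C(4) in_C(7)] C_commute[OF in_C(4) in_C(8)]

lemma cms: "cm D1 D2" "cm S1 S2" "cm D2 D1" "cm S2 S1"
  by (simp_all add: commuting_def sort)

text \<open>For the two embeddings into \<open>H \<otimes> H\<close>, \<open>G\<close> sends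
  \<open>A\<close> to \<open>S(A^2) \<alpha> A^3 \<otimes> S(A^1) \<alpha> A^4\<close>, the formula
  for \<gamma>. Its counterpart \<open>G'\<close> sends \<open>B\<close> to
  \<open>B^1 \<beta> S(B^4) \<otimes> B^2 \<beta> S(B^3)\<close>, the formula for \<delta>.\<close>

definition "G = pairing4 k H H H H T (\<lambda>h. S2 h \<otimes> a2) (\<lambda>h. S1 h \<otimes> a1) D1 D2"
definition "G' = pairing4 k H H H H T (\<lambda>h. D1 h \<otimes> b1) (\<lambda>h. D2 h \<otimes> b2) S2 S1"

lemmas HHHH = assoc_algebra_tensor[OF H HHH]

sublocale X4: hom_calculus k H "H \<boxtimes>\<^bsub>k\<^esub> H \<boxtimes>\<^bsub>k\<^esub> H \<boxtimes>\<^bsub>k\<^esub> H"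
  by (rule target[OF HHHH])

abbreviation "r1 \<equiv> inl k H H3"
abbreviation "r2 \<equiv> \<lambda>h. inr k H H3 (inl k H H2 h)"
abbreviation "r3 \<equiv> \<lambda>h. inr k H H3 (inr k H H2 (inl k H H h))"
abbreviation "r4 \<equiv> \<lambda>h. inr k H H3 (inr k H H2 (inr k H H h))"

lemmas r = four_slots[OF H H H H]
lemmas r_simps [simp] = r r(5-10)[THEN commuting_sym]
lemmas r_closed = r(1-4)[THEN algebra_maps_closed]
lemmas r_linear = r(1-4)[THEN algebra_maps_linear]

lemma G_linear: "G \<in> linear_maps k H4 T" and G'_linear: "G' \<in> linear_maps k H4 T"
  unfolding G_def G'_def by (intro pairing4_linear H T lins lins_mult)+

lemmas G_pure = pairing4_pure[OF H H H H T lins_mult(4,3) lins(1,2), folded G_def]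
lemmas G'_pure = pairing4_pure[OF H H H H T lins_mult(1,2) lins(4,3), folded G'_def]

lemmas pures = inl_def inr_def tensor_simps(5) pure_carrier[OF H H] pure_carrier[OF H HH] pure_carrier[OF H HHH]
  pure_mult_pure[OF H H] pure_mult_pure[OF H HH] pure_mult_pure[OF H HHH]

context
  fixes y u assumes y: "y \<in> carrier H4" and u: "u \<in> carrier H"
begin

private lemmas right_ext = tensor_ext4[OF H H H H linear_maps_comp[OF assoc_algebra_mult_linear(2)[OF HHHH]]]
private lemmas left_ext = tensor_ext4[OF H H H H linear_maps_comp[OF assoc_algebra_mult_linear(1)[OF HHHH]]]

lemma G_right:
  "G (y \<otimes>\<^bsub>H4\<^esub> r1 u) = S2 u \<otimes> G y" "G (y \<otimes>\<^bsub>H4\<^esub> r2 u) = S1 u \<otimes> G y"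
  "G (y \<otimes>\<^bsub>H4\<^esub> r3 u) = G y \<otimes> D1 u" "G (y \<otimes>\<^bsub>H4\<^esub> r4 u) = G y \<otimes> D2 u"
  by (rule right_ext[OF r_closed(1)[OF u] G_linear linear_maps_lmult[OF T G_linear] _ y]
      right_ext[OF r_closed(2)[OF u] G_linear linear_maps_lmult[OF T G_linear] _ y]
      right_ext[OF r_closed(3)[OF u] G_linear linear_maps_rmult[OF T G_linear] _ y]
      right_ext[OF r_closed(4)[OF u] G_linear linear_maps_rmult[OF T G_linear] _ y];
     simp add: u pures G_pure mults T.m_assoc sort)+

lemma G'_left:
  "G' (r1 u \<otimes>\<^bsub>H4\<^esub> y) = D1 u \<otimes> G' y" "G' (r2 u \<otimes>\<^bsub>H4\<^esub> y) = D2 u \<otimes> G' y"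
  "G' (r3 u \<otimes>\<^bsub>H4\<^esub> y) = G' y \<otimes> S2 u" "G' (r4 u \<otimes>\<^bsub>H4\<^esub> y) = G' y \<otimes> S1 u"
  by (rule left_ext[OF r_closed(1)[OF u] G'_linear linear_maps_lmult[OF T G'_linear] _ y]
      left_ext[OF r_closed(2)[OF u] G'_linear linear_maps_lmult[OF T G'_linear] _ y]
      left_ext[OF r_closed(3)[OF u] G'_linear linear_maps_rmult[OF T G'_linear] _ y]
      left_ext[OF r_closed(4)[OF u] G'_linear linear_maps_rmult[OF T G'_linear] _ y];
     simp add: u pures G'_pure mults T.m_assoc sort)+

end

end

context commuting_antipodes
begin

text \<open>\<open>A4\<close> is \<open>(\<Phi> \<otimes> 1)(\<Delta> \<otimes> id \<otimes>
  id)(\<Phi>^{-1})\<close>, as in the definition of \<gamma>. Correspondingly \<open>B4\<close> is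
  \<open>(\<Delta> \<otimes> id \<otimes> id)(\<Phi>)(\<Phi>^{-1} \<otimes> 1)\<close>, which
  rebrackets legs that are multiplied from the other side.\<close>

definition "A4 = X4.Phi r1 r2 r3 \<otimes>\<^bsub>H4\<^esub> X4.Psi (X4.conv r1 r2) r3 r4"
definition "B4 = X4.Phi (X4.conv r1 r2) r3 r4 \<otimes>\<^bsub>H4\<^esub> X4.Psi r1 r2 r3"
definition "gamma = G A4"
definition "delta = G' B4"

lemma A4_closed [simp]: "A4 \<in> carrier H4" and B4_closed [simp]: "B4 \<in> carrier H4"
  by (simp_all add: A4_def B4_def)

lemma gamma_closed [simp]: "gamma \<in> carrier T" and delta_closed [simp]: "delta \<in> carrier T"
  unfolding gamma_def delta_def by (simp_all add: linear_maps_closed[OF G_linear] linear_maps_closed[OF G'_linear])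

lemma D_ahom [simp]: "ahom (D1 \<star> D2)"
  using homs cms by simp

lemma S_anti: "anti (S2 \<star> S1)"
  by (rule anti_conv) (simp_all add: homs cms)

lemmas S_closed [simp] = antiD(4)[OF S_anti]
lemmas D_closed [simp] = ahom_closed[OF D_ahom]

lemma G_conv:
  assumes "y \<in> carrier H4" "u \<in> carrier H"
  shows "G (y \<otimes>\<^bsub>H4\<^esub> X4.conv r1 r2 u) = (S2 \<star> S1) u \<otimes> G y"
    "G (y \<otimes>\<^bsub>H4\<^esub> X4.conv r3 r4 u) = G y \<otimes> (D1 \<star> D2) u"
    "G' (X4.conv r1 r2 u \<otimes>\<^bsub>H4\<^esub> y) = (D1 \<star> D2) u \<otimes> G' y"
    "G' (X4.conv r3 r4 u \<otimes>\<^bsub>H4\<^esub> y) = G' y \<otimes> (S2 \<star> S1) u"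
  by (rule conv_act_right_left[OF HHHH G_linear r_linear(1,2) lins(4,3) G_right(1,2) cms(4) assms]
      conv_act_right_right[OF HHHH G_linear r_linear(3,4) lins(1,2) G_right(3,4) assms]
      conv_act_left_left[OF HHHH G'_linear r_linear(1,2) lins(1,2) G'_left(1,2) assms]
      conv_act_left_right[OF HHHH G'_linear r_linear(3,4) lins(4,3) G'_left(3,4) cms(4) assms]; assumption)+

text \<open>Legs 2 and 3 carry one copy and are direct neighbours. Legs 1 and 4 carry the other
  copy; what stands between them belongs to the inner copy and commutes with them.\<close>

lemma G_collapse:
  "X4.eqL G (X4.conv r2 r3) X4.eps" "X4.eqL G (X4.conv r1 r4) X4.eps"
  "X4.eqR G' (X4.conv r2 r3) X4.eps" "X4.eqR G' (X4.conv r1 r4) X4.eps"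
proof -
  note D12 = pairing_linear[OF H H T lins(1,2)]
  note SD12 = pairing3_linear[OF H H H T lins_mult(3) lins(1,2)]
  note S21 = pairing_linear[OF H H T lins(4,3)]
  note DS21 = pairing3_linear[OF H H H T lins_mult(2) lins(4,3)]
  note s = slot_homs[OF H H H]
  have pairing_hom: "pairing k H H T D1 D2 \<in> algebra_maps k H2 T"
    by (rule pairing_hom[OF H H T homs(1,2) cms(1)])
  show "X4.eqL G (X4.conv r2 r3) X4.eps"
    unfolding G_def
    by (rule eq_conv_inr(1)[OF H HHH lins_mult(4) SD12 s(1,2) link_alpha[OF pairs(1) HH inl_hom[OF H H] D12]])
      (rule pairing_inl_lmult[OF H H T lins(1,2)]; simp add: mults)
  show "X4.eqL G (X4.conv r1 r4) X4.eps"
    unfolding G_def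
  proof (rule link_alpha[OF pairs(3) HHH s(3) SD12])
    fix h y assume h: "h \<in> carrier H" and y: "y \<in> carrier H3"
    show "pairing3 k H H H T (\<lambda>h. S1 h \<otimes> a1) D1 D2 (inr k H H2 (inr k H H h) \<otimes>\<^bsub>H3\<^esub> y) =
        D2 h \<otimes> pairing3 k H H H T (\<lambda>h. S1 h \<otimes> a1) D1 D2 y"
      by (rule pairing_inr_lmult_commute[OF H HH T lins_mult(3) D12 _ _ _ _ y])
        (simp_all add: h inr_closed[OF H H] pairing_inr_lmult_commute[OF H H T lins(1,2)] mults sort T.m_assoc)
  qed
  show "X4.eqR G' (X4.conv r2 r3) X4.eps"
    unfolding G'_def
    by (rule eq_conv_inr(2)[OF H HHH lins_mult(1) DS21 s(1,2) link_beta[OF pairs(4) HH inl_hom[OF H H] S21]])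
      (rule pairing_inl_rmult[OF H H T lins(4,3)]; simp add: mults)
  show "X4.eqR G' (X4.conv r1 r4) X4.eps"
    unfolding G'_def
  proof (rule link_beta[OF pairs(2) HHH s(3) DS21])
    fix h y assume h: "h \<in> carrier H" and y: "y \<in> carrier H3"
    show "pairing3 k H H H T (\<lambda>h. D2 h \<otimes> b2) S2 S1 (y \<otimes>\<^bsub>H3\<^esub> inr k H H2 (inr k H H h)) =
        S1 h \<otimes> pairing3 k H H H T (\<lambda>h. D2 h \<otimes> b2) S2 S1 y"
      by (rule pairing_inr_rmult_commute[OF H HH T lins_mult(2) S21 _ _ _ _ y])
        (simp_all add: h inr_closed[OF H H] pairing_inr_rmult_commute[OF H H T lins(4,3)] mults sort T.m_assoc)
  qed
qed

lemma A4_intertwine: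
  assumes h: "h \<in> carrier H"
  shows "A4 \<otimes>\<^bsub>H4\<^esub> X4.conv (X4.conv r1 r2) (X4.conv r3 r4) h = X4.conv (X4.conv r1 (X4.conv r2 r3)) r4 h \<otimes>\<^bsub>H4\<^esub> A4"
  unfolding A4_def by (rule X4.coassoc4(1)) (simp_all add: h)

lemma B4_intertwine:
  assumes h: "h \<in> carrier H"
  shows "X4.conv (X4.conv r1 r2) (X4.conv r3 r4) h \<otimes>\<^bsub>H4\<^esub> B4 = B4 \<otimes>\<^bsub>H4\<^esub> X4.conv (X4.conv r1 (X4.conv r2 r3)) r4 h"
  unfolding B4_def by (rule X4.coassoc4(2)) (simp_all add: h)

text \<open>\<open>A4\<close> rebrackets the four legs into two nested pairs, and these are exactly
  the pairs that collapse under \<open>G\<close>. What is left is the counit times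
  \<open>G A4\<close>.\<close>

lemma alpha_pair_gamma: "alpha_pair (D1 \<star> D2) (S2 \<star> S1) gamma"
  unfolding alpha_pair_def
proof (intro conjI ballI)
  fix h assume h: "h \<in> carrier H"
  let ?i = "X4.conv r1 r2" and ?j = "X4.conv r3 r4"
  have lin: "(\<lambda>u. (S2 \<star> S1) u \<otimes> gamma) \<in> linear_maps k H T"
    by (rule ahom_mult_linear[OF antiD(1)[OF S_anti] gamma_closed])
  have ij: "?i \<in> linear_maps k H H4" "?j \<in> linear_maps k H H4"
    by (simp_all add: X4.conv_linear)
  \<comment> \<open>Under \<open>G\<close>, factors on legs 1 and 2 emerge on the left as
    \<open>S2 \<star> S1\<close>, and factors on legs 3 and 4 on the right as
    \<open>D1 \<star> D2\<close>; so the whole expression is a single value of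
    \<open>G\<close>.\<close>
  have "pairing k H H T (\<lambda>u. (S2 \<star> S1) u \<otimes> gamma) (D1 \<star> D2) (comult H h) =
      G (A4 \<otimes>\<^bsub>H4\<^esub> pairing k H H H4 ?i ?j (comult H h))"
    by (rule tensor_ext[OF H H pairing_linear[OF H H T lin ahom_linear[OF D_ahom]]
          linear_maps_comp[OF linear_maps_lmult[OF HHHH pairing_linear[OF H H HHHH ij] A4_closed] G_linear] _ comult_closed[OF h]])
      (simp add: pairing_pure[OF H H T lin ahom_linear[OF D_ahom]] pairing_pure[OF H H HHHH ij] G_conv flip: X4.T.m_assoc gamma_def)
  also have "\<dots> = G (X4.conv (X4.conv r1 (X4.conv r2 r3)) r4 h \<otimes>\<^bsub>H4\<^esub> A4)"
    using A4_intertwine[OF h] by (simp add: X4.conv_def[of ?i])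
  also have "\<dots> = G (X4.eps h \<otimes>\<^bsub>H4\<^esub> A4)"
    by (rule eq_leftD[OF X4.eqL_nested[OF G_linear _ _ _ _ _ _ _ _ _ _ G_collapse(1,2)]]) (simp_all add: h)
  also have "\<dots> = counit H h \<odot> gamma"
    using h by (simp add: X4.eps_mult gamma_def linear_maps_smult[OF G_linear] counit_closed)
  finally show "pairing k H H T (\<lambda>u. (S2 \<star> S1) u \<otimes> gamma) (D1 \<star> D2) (comult H h) = counit H h \<odot> gamma" .
qed (simp_all add: S_anti)

lemma beta_pair_delta: "beta_pair (D1 \<star> D2) (S2 \<star> S1) delta"
  unfolding beta_pair_def
proof (intro conjI ballI)
  fix h assume h: "h \<in> carrier H"
  let ?i = "X4.conv r1 r2" and ?j = "X4.conv r3 r4"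
  have lin: "(\<lambda>u. (D1 \<star> D2) u \<otimes> delta) \<in> linear_maps k H T"
    by (rule ahom_mult_linear[OF ahom_linear[OF D_ahom] delta_closed])
  have ij: "?i \<in> linear_maps k H H4" "?j \<in> linear_maps k H H4"
    by (simp_all add: X4.conv_linear)
  have "pairing k H H T (\<lambda>u. (D1 \<star> D2) u \<otimes> delta) (S2 \<star> S1) (comult H h) =
      G' (pairing k H H H4 ?i ?j (comult H h) \<otimes>\<^bsub>H4\<^esub> B4)"
    by (rule tensor_ext[OF H H pairing_linear[OF H H T lin antiD(1)[OF S_anti]]
          linear_maps_comp[OF linear_maps_rmult[OF HHHH pairing_linear[OF H H HHHH ij] B4_closed] G'_linear] _ comult_closed[OF h]])
      (simp add: pairing_pure[OF H H T lin antiD(1)[OF S_anti]] pairing_pure[OF H H HHHH ij] G_conv X4.T.m_assoc T.m_assoc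
        linear_maps_closed[OF G'_linear] flip: delta_def)
  also have "\<dots> = G' (B4 \<otimes>\<^bsub>H4\<^esub> X4.conv (X4.conv r1 (X4.conv r2 r3)) r4 h)"
    using B4_intertwine[OF h] by (simp add: X4.conv_def[of ?i])
  also have "\<dots> = G' (B4 \<otimes>\<^bsub>H4\<^esub> X4.eps h)"
    by (rule eq_rightD[OF X4.eqR_nested[OF G'_linear _ _ _ _ _ _ _ _ _ _ G_collapse(3,4)]]) (simp_all add: h)
  also have "\<dots> = counit H h \<odot> delta"
    using h by (simp add: X4.eps_mult delta_def linear_maps_smult[OF G'_linear] counit_closed)
  finally show "pairing k H H T (\<lambda>u. (D1 \<star> D2) u \<otimes> delta) (S2 \<star> S1) (comult H h) = counit H h \<odot> delta" .
qed (simp_all add: S_anti)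

end

text \<open>As all five terms are invertible, the pentagon can be solved for various partial
  products; these are the four forms that the calculations call for.\<close>

lemma (in ring) five_term:
  assumes cl: "a \<in> carrier R" "b \<in> carrier R" "c \<in> carrier R" "d \<in> carrier R" "e \<in> carrier R"
    "a' \<in> carrier R" "b' \<in> carrier R" "c' \<in> carrier R" "d' \<in> carrier R" "e' \<in> carrier R"
    and inv: "a \<otimes> a' = \<one>" "a' \<otimes> a = \<one>" "b \<otimes> b' = \<one>" "b' \<otimes> b = \<one>" "c \<otimes> c' = \<one>" "c' \<otimes> c = \<one>"
      "d \<otimes> d' = \<one>" "d' \<otimes> d = \<one>" "e \<otimes> e' = \<one>" "e' \<otimes> e = \<one>"
    and eq: "a \<otimes> b \<otimes> c = d \<otimes> e"
  shows "a' \<otimes> d = b \<otimes> c \<otimes> e'" "e \<otimes> c' = d' \<otimes> a \<otimes> b" "c' \<otimes> b' \<otimes> a' = e' \<otimes> d'" "c \<otimes> e' = b' \<otimes> a' \<otimes> d"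
proof -
  have "a' \<otimes> d = a' \<otimes> (d \<otimes> e) \<otimes> e'" using cl inv by (simp add: m_assoc)
  also have "\<dots> = (a' \<otimes> a) \<otimes> b \<otimes> c \<otimes> e'" unfolding eq[symmetric] using cl by (simp add: m_assoc)
  finally show 1: "a' \<otimes> d = b \<otimes> c \<otimes> e'" using cl inv by simp
  have "e \<otimes> c' = (d' \<otimes> d) \<otimes> e \<otimes> c'" using cl inv by simp
  also have "\<dots> = d' \<otimes> (a \<otimes> b \<otimes> c) \<otimes> c'" unfolding eq using cl by (simp add: m_assoc)
  finally show "e \<otimes> c' = d' \<otimes> a \<otimes> b" using cl inv by (simp add: m_assoc)
  have "c' \<otimes> b' \<otimes> a' = c' \<otimes> b' \<otimes> a' \<otimes> ((d \<otimes> e) \<otimes> (e' \<otimes> d'))"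
    using cl inv by (simp add: m_assoc flip: m_assoc[of e e'])
  also have "\<dots> = c' \<otimes> (b' \<otimes> (a' \<otimes> a) \<otimes> b) \<otimes> c \<otimes> (e' \<otimes> d')"
    unfolding eq[symmetric] using cl by (simp add: m_assoc)
  finally show "c' \<otimes> b' \<otimes> a' = e' \<otimes> d'" using cl inv by simp
  have "b' \<otimes> a' \<otimes> d = b' \<otimes> (a' \<otimes> d)" using cl by (simp add: m_assoc)
  also have "\<dots> = (b' \<otimes> b) \<otimes> c \<otimes> e'" unfolding 1 using cl by (simp add: m_assoc)
  finally show "c \<otimes> e' = b' \<otimes> a' \<otimes> d" using cl inv by simp
qed

section \<open>The six-leg calculations behind the normalisations of \<gamma> and \<delta>\<close>

context hom_calculus
begin

lemma pentagon_variants: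
  assumes a: "ahom i" "ahom j" "ahom l" "ahom m"
    and c: "cm i j" "cm i l" "cm i m" "cm j l" "cm j m" "cm l m"
  shows "Psi j l m \<otimes> Phi i j (l \<star> m) = Phi i (j \<star> l) m \<otimes> Phi i j l \<otimes> Psi (i \<star> j) l m"
    "Phi (i \<star> j) l m \<otimes> Psi i j l = Psi i j (l \<star> m) \<otimes> Phi j l m \<otimes> Phi i (j \<star> l) m"
    "Psi i j l \<otimes> Psi i (j \<star> l) m \<otimes> Psi j l m = Psi (i \<star> j) l m \<otimes> Psi i j (l \<star> m)"
    "Phi i j l \<otimes> Psi (i \<star> j) l m = Psi i (j \<star> l) m \<otimes> Psi j l m \<otimes> Phi i j (l \<star> m)"
proof -
  note [simp] = a c
  note * = T.five_term[of "Phi j l m" "Phi i (j \<star> l) m" "Phi i j l" "Phi i j (l \<star> m)" "Phi (i \<star> j) l m"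
      "Psi j l m" "Psi i (j \<star> l) m" "Psi i j l" "Psi i j (l \<star> m)" "Psi (i \<star> j) l m", OF _ _ _ _ _ _ _ _ _ _
      Phi_Psi Psi_Phi Phi_Psi Psi_Phi Phi_Psi Psi_Phi Phi_Psi Psi_Phi Phi_Psi Psi_Phi pentagon[OF a c]]
  show "Psi j l m \<otimes> Phi i j (l \<star> m) = Phi i (j \<star> l) m \<otimes> Phi i j l \<otimes> Psi (i \<star> j) l m"
    "Phi (i \<star> j) l m \<otimes> Psi i j l = Psi i j (l \<star> m) \<otimes> Phi j l m \<otimes> Phi i (j \<star> l) m"
    "Psi i j l \<otimes> Psi i (j \<star> l) m \<otimes> Psi j l m = Psi (i \<star> j) l m \<otimes> Psi i j (l \<star> m)"
    "Phi i j l \<otimes> Psi (i \<star> j) l m = Psi i (j \<star> l) m \<otimes> Psi j l m \<otimes> Phi i j (l \<star> m)"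
    by (rule *; simp)+
qed

lemma mult_commute:
  assumes "x \<otimes> c = c \<otimes> x" "y \<otimes> c = c \<otimes> y" "x \<in> carrier T" "y \<in> carrier T" "c \<in> carrier T"
  shows "x \<otimes> y \<otimes> c = c \<otimes> (x \<otimes> y)"
proof -
  have "x \<otimes> y \<otimes> c = x \<otimes> c \<otimes> y"
    using assms(2-) by (simp add: T.m_assoc)
  also have "\<dots> = c \<otimes> x \<otimes> y" by (simp only: assms(1))
  finally show ?thesis using assms(3-) by (simp add: T.m_assoc)
qed

lemma eqR_absorb: "\<lbrakk>J \<in> linear_maps k T B; ahom i; ahom j; ahom l; cm i j; cm i l; cm j l; eqR J (j \<star> l) eps\<rbrakk> \<Longrightarrow> eqR J (i \<star> (j \<star> l)) i"
  by (rule eq_right_trans[OF eqR_conv[OF _ _ _ _ _ eq_right_refl] eqR_eps_conv(2)]) simp_all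

lemma eqL_absorb: "\<lbrakk>J \<in> linear_maps k T B; ahom i; ahom j; ahom l; cm i j; cm i l; cm j l; eqL J (j \<star> l) eps\<rbrakk> \<Longrightarrow> eqL J (i \<star> (j \<star> l)) i"
  by (rule eq_left_trans[OF eqL_conv[OF _ _ _ _ _ eq_left_refl] eqL_eps_conv(2)]) simp_all

text \<open>
  The six legs carry two nested copies of \<open>X\<^sup>1 \<beta> S(X\<^sup>2) \<alpha> X\<^sup>3\<close> (or of its inverse counterpart), which \<open>J\<close> multiplies
  out. The pentagon brings the legs joined by an \<open>\<alpha>\<close> or a \<open>\<beta>\<close> together, where they collapse to the counit.
\<close>

context
  fixes J and M :: "('k, 'u, 'v) module_scheme" and e1 e2 e3 e4 e5 e6
  assumes J: "J \<in> linear_maps k T M"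
    and a: "ahom e1" "ahom e2" "ahom e3" "ahom e4" "ahom e5" "ahom e6"
    and c: "cm e1 e2" "cm e1 e3" "cm e1 e4" "cm e1 e5" "cm e1 e6" "cm e2 e3" "cm e2 e4" "cm e2 e5" "cm e2 e6"
      "cm e3 e4" "cm e3 e5" "cm e3 e6" "cm e4 e5" "cm e4 e6" "cm e5 e6"
  notes [simp] = a c c[THEN commuting_sym]
begin

lemma norm1_calc:
  assumes R14: "eqR J (e1 \<star> e4) eps" and R23: "eqR J (e2 \<star> e3) eps"
    and L45: "eqL J (e4 \<star> e5) eps" and L36: "eqL J (e3 \<star> e6) eps"
  shows "J (Phi e3 e4 e5 \<otimes> Psi (e3 \<star> e4) e5 e6 \<otimes> Phi (e1 \<star> e2) (e3 \<star> e4) (e5 \<star> e6) \<otimes>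
      (Phi (e1 \<star> e2) e3 e4 \<otimes> Psi e1 e2 e3)) = J (Phi e2 e3 e6 \<otimes> Phi e1 e4 e5)"
proof -
  let ?a = "Phi e3 e4 e5" and ?d = "Phi (e1 \<star> e2) e3 e4" and ?e = "Psi e1 e2 e3"
    and ?f = "Phi (e1 \<star> e2) ((e3 \<star> e4) \<star> e5) e6" and ?f' = "Phi (e1 \<star> e2) (e3 \<star> (e4 \<star> e5)) e6"
    and ?g = "Phi (e1 \<star> e2) (e3 \<star> e4) e5" and ?q = "Psi ((e1 \<star> e2) \<star> (e3 \<star> e4)) e5 e6"
    and ?q' = "Psi ((e1 \<star> (e2 \<star> e3)) \<star> e4) e5 e6" and ?s = "Phi (e1 \<star> e2) e3 e6"
    and ?m = "Phi (e1 \<star> e2) e3 (e4 \<star> e5)" and ?n = "Phi ((e1 \<star> e2) \<star> e3) e4 e5"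
    and ?n' = "Phi (e1 \<star> (e2 \<star> e3)) e4 e5" and ?t = "Phi e1 e4 e5"
    and ?v = "Phi e1 (e2 \<star> e3) e6" and ?w = "Psi e1 e2 (e3 \<star> e6)" and ?x = "Phi e2 e3 e6"
  \<comment> \<open>This carries the inverse reassociator to the right end. On the way the
    bracketing of its first argument changes to nested pairs, which collapse there.\<close>
  have q: "?d \<otimes> ?e \<otimes> ?q' = ?q \<otimes> (?d \<otimes> ?e)"
    by (rule Phi_intertwine(2)) (simp_all add: coassoc4(2) mult_commute Phi_commute ahom_closed)
  have f: "?a \<otimes> ?f = ?f' \<otimes> ?a"
    by (rule Phi_intertwine(1)) (simp_all add: Phi_commute quasi_coassoc)
  have p: "?a \<otimes> ?g \<otimes> ?d = ?m \<otimes> ?n"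
    by (rule pentagon) simp_all
  have n: "?e \<otimes> ?n' = ?n \<otimes> ?e"
    by (rule Phi_intertwine(1)) (simp_all add: Phi_commute quasi_coassoc_inv)
  have "J (?a \<otimes> Psi (e3 \<star> e4) e5 e6 \<otimes> Phi (e1 \<star> e2) (e3 \<star> e4) (e5 \<star> e6) \<otimes> (?d \<otimes> ?e))
      = J (?a \<otimes> (Psi (e3 \<star> e4) e5 e6 \<otimes> Phi (e1 \<star> e2) (e3 \<star> e4) (e5 \<star> e6)) \<otimes> (?d \<otimes> ?e))"
    by (simp add: T.m_assoc)
  also have "\<dots> = J ((?a \<otimes> ?f) \<otimes> ?g \<otimes> (?q \<otimes> (?d \<otimes> ?e)))"
    by (simp add: pentagon_variants(1) T.m_assoc)
  also have "\<dots> = J (?f' \<otimes> ?a \<otimes> ?g \<otimes> (?d \<otimes> ?e \<otimes> ?q'))"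
    unfolding f q ..
  also have "\<dots> = J ((?f' \<otimes> ?a \<otimes> ?g \<otimes> ?d \<otimes> ?e) \<otimes> ?q')"
    by (simp add: T.m_assoc)
  also have "\<dots> = J ((?f' \<otimes> ?a \<otimes> ?g \<otimes> ?d \<otimes> ?e) \<otimes> Psi eps e5 e6)"
    by (rule eqR_Phi(2)[OF J _ _ _ _ _ _ eqR_nested[OF J _ _ _ _ _ _ _ _ _ _ R23 R14] eq_right_refl eq_right_refl]) simp_all
  also have "\<dots> = J (?f' \<otimes> (?a \<otimes> ?g \<otimes> ?d \<otimes> ?e))"
    by (simp add: Psi_eps T.m_assoc)
  also have "\<dots> = J (?s \<otimes> (?a \<otimes> ?g \<otimes> ?d \<otimes> ?e))"
    by (rule eqL_Phi(1)[OF J _ _ _ _ _ _ eq_left_refl eqL_absorb[OF J] eq_left_refl]) (simp_all add: L45)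
  also have "\<dots> = J (?s \<otimes> (?m \<otimes> (?n \<otimes> ?e)))"
    unfolding p by (simp add: T.m_assoc)
  \<comment> \<open>\<open>?s\<close> involves only legs 1, 2, 3 and 6, so it commutes with legs 4
    and 5 and may be absorbed into \<open>J\<close>.\<close>
  also have "\<dots> = J (?s \<otimes> (Phi (e1 \<star> e2) e3 eps \<otimes> (?n \<otimes> ?e)))"
    by (rule eqL_Phi(1)[OF linear_maps_comp[OF assoc_algebra_mult_linear(1)[OF T] J] _ _ _ _ _ _ eq_left_refl eq_left_refl eqL_shift[OF L45]])
      (simp_all add: Phi_commute)
  also have "\<dots> = J (?s \<otimes> (?n \<otimes> ?e))"
    by (simp add: Phi_eps_right)
  also have "\<dots> = J ((?s \<otimes> ?e) \<otimes> ?n')"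
    unfolding n[symmetric] by (simp add: T.m_assoc)
  also have "\<dots> = J ((?s \<otimes> ?e) \<otimes> ?t)"
    by (rule eqR_Phi(1)[OF J _ _ _ _ _ _ eqR_absorb[OF J] eq_right_refl eq_right_refl]) (simp_all add: R23)
  \<comment> \<open>A last pentagon, in legs 1, 2, 3 and 6, separates the copies: \<open>?w\<close>
    and \<open>?v\<close> collapse to one, and each copy keeps a single reassociator.\<close>
  also have "\<dots> = J (?w \<otimes> (?x \<otimes> ?v \<otimes> ?t))"
    by (simp add: pentagon_variants(2)[of e1 e2 e3 e6] T.m_assoc)
  also have "\<dots> = J (Psi e1 e2 eps \<otimes> (?x \<otimes> ?v \<otimes> ?t))"
    by (rule eqL_Phi(2)[OF J _ _ _ _ _ _ eq_left_refl eq_left_refl L36]) simp_all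
  also have "\<dots> = J (?x \<otimes> ?v \<otimes> ?t)"
    by (simp add: Psi_eps)
  also have "\<dots> = J (?x \<otimes> Phi e1 eps e6 \<otimes> ?t)"
    by (rule eqR_Phi(1)[OF linear_maps_comp[OF assoc_algebra_mult_linear(2)[OF T] J] _ _ _ _ _ _ eq_right_refl eqR_shift[OF R23] eq_right_refl])
      (simp_all add: Phi_commute)
  finally show ?thesis by (simp add: Phi_eps_mid)
qed

text \<open>The preceding calculation read backwards, with \<open>Phi\<close> and \<open>Psi\<close>
  exchanged and with left and right collapses exchanged accordingly.\<close>

lemma norm2_calc:
  assumes L14: "eqL J (e1 \<star> e4) eps" and L23: "eqL J (e2 \<star> e3) eps"
    and R45: "eqR J (e4 \<star> e5) eps" and R36: "eqR J (e3 \<star> e6) eps"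
  shows "J (Phi e1 e2 e3 \<otimes> Psi (e1 \<star> e2) e3 e4 \<otimes> Psi (e1 \<star> e2) (e3 \<star> e4) (e5 \<star> e6) \<otimes>
      (Phi (e3 \<star> e4) e5 e6 \<otimes> Psi e3 e4 e5)) = J (Psi e1 e4 e5 \<otimes> Psi e2 e3 e6)"
proof -
  let ?a = "Psi e3 e4 e5" and ?d = "Psi (e1 \<star> e2) e3 e4" and ?e = "Phi e1 e2 e3"
    and ?f = "Psi (e1 \<star> e2) ((e3 \<star> e4) \<star> e5) e6" and ?f' = "Psi (e1 \<star> e2) (e3 \<star> (e4 \<star> e5)) e6"
    and ?g = "Psi (e1 \<star> e2) (e3 \<star> e4) e5" and ?q = "Phi ((e1 \<star> e2) \<star> (e3 \<star> e4)) e5 e6"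
    and ?q' = "Phi ((e1 \<star> (e2 \<star> e3)) \<star> e4) e5 e6" and ?s = "Psi (e1 \<star> e2) e3 e6"
    and ?m = "Psi (e1 \<star> e2) e3 (e4 \<star> e5)" and ?n = "Psi ((e1 \<star> e2) \<star> e3) e4 e5"
    and ?n' = "Psi (e1 \<star> (e2 \<star> e3)) e4 e5" and ?t = "Psi e1 e4 e5"
    and ?v = "Psi e1 (e2 \<star> e3) e6" and ?w = "Phi e1 e2 (e3 \<star> e6)" and ?x = "Psi e2 e3 e6"
  have q: "?e \<otimes> ?d \<otimes> ?q = ?q' \<otimes> (?e \<otimes> ?d)"
    by (rule Phi_intertwine(1)) (simp_all add: coassoc4(1) mult_commute Phi_commute ahom_closed)
  have f: "?a \<otimes> ?f' = ?f \<otimes> ?a"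
    by (rule Phi_intertwine(2)) (simp_all add: Phi_commute quasi_coassoc_inv)
  have p: "?d \<otimes> ?g \<otimes> ?a = ?n \<otimes> ?m"
    by (rule pentagon_variants(3)) simp_all
  have n: "?e \<otimes> ?n = ?n' \<otimes> ?e"
    by (rule Phi_intertwine(2)) (simp_all add: Phi_commute quasi_coassoc)
  have "J (?e \<otimes> ?d \<otimes> Psi (e1 \<star> e2) (e3 \<star> e4) (e5 \<star> e6) \<otimes> (Phi (e3 \<star> e4) e5 e6 \<otimes> ?a))
      = J ((?e \<otimes> ?d) \<otimes> (Psi (e1 \<star> e2) (e3 \<star> e4) (e5 \<star> e6) \<otimes> Phi (e3 \<star> e4) e5 e6) \<otimes> ?a)"
    by (simp add: T.m_assoc)
  also have "\<dots> = J ((?e \<otimes> ?d \<otimes> ?q) \<otimes> ?g \<otimes> (?f \<otimes> ?a))"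
    by (simp add: pentagon_quotient T.m_assoc)
  also have "\<dots> = J (?q' \<otimes> (?e \<otimes> ?d) \<otimes> ?g \<otimes> (?a \<otimes> ?f'))"
    unfolding f q ..
  also have "\<dots> = J (?q' \<otimes> (?e \<otimes> ?d \<otimes> ?g \<otimes> ?a \<otimes> ?f'))"
    by (simp add: T.m_assoc)
  also have "\<dots> = J (Phi eps e5 e6 \<otimes> (?e \<otimes> ?d \<otimes> ?g \<otimes> ?a \<otimes> ?f'))"
    by (rule eqL_Phi(1)[OF J _ _ _ _ _ _ eqL_nested[OF J _ _ _ _ _ _ _ _ _ _ L23 L14] eq_left_refl eq_left_refl]) simp_all
  also have "\<dots> = J ((?e \<otimes> ?d \<otimes> ?g \<otimes> ?a) \<otimes> ?f')"
    by (simp add: Phi_eps_left)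
  also have "\<dots> = J ((?e \<otimes> ?d \<otimes> ?g \<otimes> ?a) \<otimes> ?s)"
    by (rule eqR_Phi(2)[OF J _ _ _ _ _ _ eq_right_refl eqR_absorb[OF J] eq_right_refl]) (simp_all add: R45)
  also have "\<dots> = J (?e \<otimes> (?d \<otimes> ?g \<otimes> ?a) \<otimes> ?s)"
    by (simp add: T.m_assoc)
  also have "\<dots> = J ((?e \<otimes> ?n) \<otimes> ?m \<otimes> ?s)"
    unfolding p by (simp add: T.m_assoc)
  also have "\<dots> = J ((?e \<otimes> ?n) \<otimes> Psi (e1 \<star> e2) e3 eps \<otimes> ?s)"
    by (rule eqR_Phi(2)[OF linear_maps_comp[OF assoc_algebra_mult_linear(2)[OF T] J] _ _ _ _ _ _ eq_right_refl eq_right_refl eqR_shift[OF R45]])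
      (simp_all add: Phi_commute)
  also have "\<dots> = J ((?e \<otimes> ?n) \<otimes> ?s)"
    by (simp add: Psi_eps)
  also have "\<dots> = J (?n' \<otimes> (?e \<otimes> ?s))"
    unfolding n by (simp add: T.m_assoc)
  also have "\<dots> = J (?t \<otimes> (?e \<otimes> ?s))"
    by (rule eqL_Phi(2)[OF J _ _ _ _ _ _ eqL_absorb[OF J] eq_left_refl eq_left_refl]) (simp_all add: L23)
  also have "\<dots> = J ((?t \<otimes> (?v \<otimes> ?x)) \<otimes> ?w)"
    by (simp add: pentagon_variants(4)[of e1 e2 e3 e6] T.m_assoc)
  also have "\<dots> = J ((?t \<otimes> (?v \<otimes> ?x)) \<otimes> Phi e1 e2 eps)"
    by (rule eqR_Phi(1)[OF J _ _ _ _ _ _ eq_right_refl eq_right_refl R36]) simp_all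
  also have "\<dots> = J (?t \<otimes> (?v \<otimes> ?x))"
    by (simp add: Phi_eps_right)
  also have "\<dots> = J (?t \<otimes> (Psi e1 eps e6 \<otimes> ?x))"
    by (rule eqL_Phi(2)[OF linear_maps_comp[OF assoc_algebra_mult_linear(1)[OF T] J] _ _ _ _ _ _ eq_left_refl eqL_shift[OF L23] eq_left_refl])
      (simp_all add: Phi_commute)
  finally show ?thesis by (simp add: Psi_eps)
qed

end

end

section \<open>Six commuting legs in two copies of a threefold tensor product\<close>

lemma six_slots:
  fixes A :: "('k, 'a, 'm) module_scheme"
  assumes A: "assoc_algebra k A"
  defines "L \<equiv> A \<boxtimes>\<^bsub>k\<^esub> A \<boxtimes>\<^bsub>k\<^esub> A"
  defines "X \<equiv> L \<boxtimes>\<^bsub>k\<^esub> L"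
  defines "s1 \<equiv> inl k A (A \<boxtimes>\<^bsub>k\<^esub> A)" and "s2 \<equiv> \<lambda>h. inr k A (A \<boxtimes>\<^bsub>k\<^esub> A) (inl k A A h)"
    and "s3 \<equiv> \<lambda>h. inr k A (A \<boxtimes>\<^bsub>k\<^esub> A) (inr k A A h)"
  defines "t1 \<equiv> \<lambda>h. inl k L L (s1 h)" and "t2 \<equiv> \<lambda>h. inl k L L (s2 h)" and "t3 \<equiv> \<lambda>h. inl k L L (s3 h)"
    and "w1 \<equiv> \<lambda>h. inr k L L (s1 h)" and "w2 \<equiv> \<lambda>h. inr k L L (s2 h)" and "w3 \<equiv> \<lambda>h. inr k L L (s3 h)"
  shows "t1 \<in> algebra_maps k A X" "t2 \<in> algebra_maps k A X" "t3 \<in> algebra_maps k A X"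
    "w1 \<in> algebra_maps k A X" "w2 \<in> algebra_maps k A X" "w3 \<in> algebra_maps k A X"
    "commuting X A A t1 t2" "commuting X A A t1 t3" "commuting X A A t2 t3"
    "commuting X A A w1 w2" "commuting X A A w1 w3" "commuting X A A w2 w3"
    "commuting X A A t1 w1" "commuting X A A t1 w2" "commuting X A A t1 w3"
    "commuting X A A t2 w1" "commuting X A A t2 w2" "commuting X A A t2 w3"
    "commuting X A A t3 w1" "commuting X A A t3 w2" "commuting X A A t3 w3"
proof -
  note AA = assoc_algebra_tensor[OF A A]
  have L: "assoc_algebra k L" unfolding L_def by (rule assoc_algebra_tensor[OF A AA])
  note s = slot_homs[OF A A A, folded L_def s1_def s2_def s3_def]
  note sl = s[THEN algebra_maps_linear]
  note in1 = inl_hom[OF L L, folded X_def] and in2 = inr_hom[OF L L, folded X_def]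
  show "t1 \<in> algebra_maps k A X" "t2 \<in> algebra_maps k A X" "t3 \<in> algebra_maps k A X"
    "w1 \<in> algebra_maps k A X" "w2 \<in> algebra_maps k A X" "w3 \<in> algebra_maps k A X"
    unfolding t1_def t2_def t3_def w1_def w2_def w3_def
    by (rule algebra_maps_comp[OF s(1) in1] algebra_maps_comp[OF s(2) in1] algebra_maps_comp[OF s(3) in1]
        algebra_maps_comp[OF s(1) in2] algebra_maps_comp[OF s(2) in2] algebra_maps_comp[OF s(3) in2])+
  have c: "commuting L A A s1 s2" "commuting L A A s1 s3" "commuting L A A s2 s3"
    unfolding L_def s1_def s2_def s3_def
    using slots_commuting(1)[OF A AA linear_maps_id algebra_maps_linear[OF inl_hom[OF A A]]]
      slots_commuting(1)[OF A AA linear_maps_id algebra_maps_linear[OF inr_hom[OF A A]]]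
      commuting_hom[OF inr_hom[OF A AA] inl_inr_commuting[OF A A] algebra_maps_linear[OF inl_hom[OF A A]] algebra_maps_linear[OF inr_hom[OF A A]]]
    by simp_all
  show "commuting X A A t1 t2" "commuting X A A t1 t3" "commuting X A A t2 t3"
    "commuting X A A w1 w2" "commuting X A A w1 w3" "commuting X A A w2 w3"
    unfolding t1_def t2_def t3_def w1_def w2_def w3_def
    by (rule commuting_hom[OF in1 c(1) sl(1,2)] commuting_hom[OF in1 c(2) sl(1,3)] commuting_hom[OF in1 c(3) sl(2,3)]
      commuting_hom[OF in2 c(1) sl(1,2)] commuting_hom[OF in2 c(2) sl(1,3)] commuting_hom[OF in2 c(3) sl(2,3)])+
  note x = slots_commuting(1)[OF L L, folded X_def]
  show "commuting X A A t1 w1" "commuting X A A t1 w2" "commuting X A A t1 w3"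
    "commuting X A A t2 w1" "commuting X A A t2 w2" "commuting X A A t2 w3"
    "commuting X A A t3 w1" "commuting X A A t3 w2" "commuting X A A t3 w3"
    unfolding t1_def t2_def t3_def w1_def w2_def w3_def
    by (rule x[OF sl(1,1)] x[OF sl(1,2)] x[OF sl(1,3)] x[OF sl(2,1)] x[OF sl(2,2)] x[OF sl(2,3)]
       x[OF sl(3,1)] x[OF sl(3,2)] x[OF sl(3,3)])+
qed

lemma tensor_ext33:
  fixes A :: "('k, 'a, 'm) module_scheme"
  assumes A: "assoc_algebra k A"
  defines "L \<equiv> A \<boxtimes>\<^bsub>k\<^esub> A \<boxtimes>\<^bsub>k\<^esub> A"
  assumes f: "f \<in> linear_maps k (L \<boxtimes>\<^bsub>k\<^esub> L) T" and g: "g \<in> linear_maps k (L \<boxtimes>\<^bsub>k\<^esub> L) T"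
    and fg: "\<And>a b c a' b' c'. \<lbrakk>a \<in> carrier A; b \<in> carrier A; c \<in> carrier A; a' \<in> carrier A; b' \<in> carrier A; c' \<in> carrier A\<rbrakk> \<Longrightarrow>
      f (pure k L L (pure k A (A \<boxtimes>\<^bsub>k\<^esub> A) a (pure k A A b c)) (pure k A (A \<boxtimes>\<^bsub>k\<^esub> A) a' (pure k A A b' c'))) =
      g (pure k L L (pure k A (A \<boxtimes>\<^bsub>k\<^esub> A) a (pure k A A b c)) (pure k A (A \<boxtimes>\<^bsub>k\<^esub> A) a' (pure k A A b' c')))"
    and z: "z \<in> carrier (L \<boxtimes>\<^bsub>k\<^esub> L)"
  shows "f z = g z"
proof -
  note AA = assoc_algebra_tensor[OF A A]
  have L: "assoc_algebra k L" unfolding L_def by (rule assoc_algebra_tensor[OF A AA])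
  have left: "(\<lambda>x. pure k L L x y) \<in> linear_maps k L (L \<boxtimes>\<^bsub>k\<^esub> L)" if "y \<in> carrier L" for y
    using pure_linear_left[OF assoc_algebra_module[OF L] assoc_algebra_module[OF L] that]
    by (simp add: linear_maps_tensor)
  show ?thesis
  proof (rule tensor_ext[OF L L f g _ z])
    fix x y assume x: "x \<in> carrier L" and y: "y \<in> carrier L"
    have x': "x \<in> carrier (A \<boxtimes>\<^bsub>k\<^esub> A \<boxtimes>\<^bsub>k\<^esub> A)" and y': "y \<in> carrier (A \<boxtimes>\<^bsub>k\<^esub> A \<boxtimes>\<^bsub>k\<^esub> A)"
      using x y by (simp_all add: L_def)
    have "(\<lambda>x. f (pure k L L x y)) \<in> linear_maps k (A \<boxtimes>\<^bsub>k\<^esub> A \<boxtimes>\<^bsub>k\<^esub> A) T"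
      "(\<lambda>x. g (pure k L L x y)) \<in> linear_maps k (A \<boxtimes>\<^bsub>k\<^esub> A \<boxtimes>\<^bsub>k\<^esub> A) T"
      using linear_maps_comp[OF left[OF y] f] linear_maps_comp[OF left[OF y] g] by (simp_all add: L_def)
    note step = tensor_ext3[OF A A A this _ x']
    show "f (pure k L L x y) = g (pure k L L x y)"
    proof (rule step)
      fix a b c assume abc: "a \<in> carrier A" "b \<in> carrier A" "c \<in> carrier A"
      let ?p = "pure k A (A \<boxtimes>\<^bsub>k\<^esub> A) a (pure k A A b c)"
      have p: "?p \<in> carrier L"
        unfolding L_def using abc by (simp add: pure_carrier[OF A AA] pure_carrier[OF A A])
      have "(\<lambda>y. f (pure k L L ?p y)) \<in> linear_maps k (A \<boxtimes>\<^bsub>k\<^esub> A \<boxtimes>\<^bsub>k\<^esub> A) T"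
        "(\<lambda>y. g (pure k L L ?p y)) \<in> linear_maps k (A \<boxtimes>\<^bsub>k\<^esub> A \<boxtimes>\<^bsub>k\<^esub> A) T"
        using linear_maps_comp[OF pure_right_linear[OF L L p] f] linear_maps_comp[OF pure_right_linear[OF L L p] g]
        by (simp_all add: L_def)
      from tensor_ext3[OF A A A this fg[OF abc] y']
      show "f (pure k L L ?p y) = g (pure k L L ?p y)" .
    qed
  qed
qed

section \<open>The two normalisations for the convolved antipode\<close>

context commuting_antipodes
begin

text \<open>\<open>A4\<close> and \<open>B4\<close> are built from the slots of \<open>H4\<close>.
  Their values along any four commuting legs are needed because they reappear among six
  legs.\<close>

lemma pairing4_eval:
  assumes X: "assoc_algebra k X"
    and f: "f1 \<in> algebra_maps k H X" "f2 \<in> algebra_maps k H X" "f3 \<in> algebra_maps k H X" "f4 \<in> algebra_maps k H X"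
    and c: "commuting X H H f1 f2" "commuting X H H f1 f3" "commuting X H H f1 f4" "commuting X H H f2 f3"
      "commuting X H H f2 f4" "commuting X H H f3 f4"
  defines "F \<equiv> pairing4 k H H H H X f1 f2 f3 f4"
  shows "F \<in> algebra_maps k H4 X"
    "F A4 = hom_calculus.Phi k H X f1 f2 f3 \<otimes>\<^bsub>X\<^esub> hom_calculus.Psi k H X (hom_calculus.conv k H X f1 f2) f3 f4"
    "F B4 = hom_calculus.Phi k H X (hom_calculus.conv k H X f1 f2) f3 f4 \<otimes>\<^bsub>X\<^esub> hom_calculus.Psi k H X f1 f2 f3"
    "h \<in> carrier H \<Longrightarrow> F (X4.conv r1 r2 h) = hom_calculus.conv k H X f1 f2 h"
    "h \<in> carrier H \<Longrightarrow> F (X4.conv r3 r4 h) = hom_calculus.conv k H X f3 f4 h"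
proof -
  interpret X: hom_calculus k H X by (rule target[OF X])
  show F: "F \<in> algebra_maps k H4 X"
    unfolding F_def by (rule pairing4_hom[OF H H H H X f c])
  note p = pairing4_pure[OF H H H H X f[THEN algebra_maps_linear], folded F_def]
  have v: "F (r1 h) = f1 h" "F (r2 h) = f2 h" "F (r3 h) = f3 h" "F (r4 h) = f4 h" if "h \<in> carrier H" for h
    using that f[THEN algebra_maps_closed]
    by (simp_all add: inl_def inr_def tensor_simps(5) p f[THEN algebra_maps_one])
  have conv: "F (X4.conv i j h) = X.conv i' j' h" if "i \<in> linear_maps k H H4" "j \<in> linear_maps k H H4"
    "\<And>h. h \<in> carrier H \<Longrightarrow> F (i h) = i' h" "\<And>h. h \<in> carrier H \<Longrightarrow> F (j h) = j' h" "h \<in> carrier H" for i j i' j' h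
    unfolding hom_conv[OF X4.hom_calculus_axioms X.hom_calculus_axioms F that(1,2,5)] X.conv_def
    by (rule pairing_cong) (simp_all add: that(3,4))
  show c12: "F (X4.conv r1 r2 h) = X.conv f1 f2 h" and "F (X4.conv r3 r4 h) = X.conv f3 f4 h" if "h \<in> carrier H" for h
    using that by (simp_all add: conv v)
  note Phi = hom_Phi[OF X4.hom_calculus_axioms X.hom_calculus_axioms F]
  show "F A4 = X.Phi f1 f2 f3 \<otimes>\<^bsub>X\<^esub> X.Psi (X.conv f1 f2) f3 f4"
    unfolding A4_def
    by (simp add: algebra_maps_mult[OF F] Phi X4.conv_linear v c12 cong: X.Phi_cong)
  show "F B4 = X.Phi (X.conv f1 f2) f3 f4 \<otimes>\<^bsub>X\<^esub> X.Psi f1 f2 f3"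
    unfolding B4_def
    by (simp add: algebra_maps_mult[OF F] Phi X4.conv_linear v c12 cong: X.Phi_cong)
qed

abbreviation (input) "X6 \<equiv> H3 \<boxtimes>\<^bsub>k\<^esub> H3"
lemmas HH6 = assoc_algebra_tensor[OF HHH HHH]
lemmas pures6 = pures pure_carrier[OF HHH HHH] pure_mult_pure[OF HHH HHH]

text \<open>The left side is a value of one linear map \<open>J\<close> on
  \<open>H3 \<boxtimes> H3\<close> that multiplies the expressions of the two copies. Its argument
  is the reassociator along \<open>e1 \<star> e2\<close>, \<open>e3 \<star> e4\<close> and
  \<open>e5 \<star> e6\<close>, framed by \<open>A4\<close> and \<open>B4\<close>. By
  \<open>norm1_calc\<close> this leaves one reassociator in each copy, and each has value
  one.\<close>

lemma norm1:
  "pairing3 k H H H T (\<lambda>h. (D1 \<star> D2) h \<otimes> delta) (\<lambda>h. (S2 \<star> S1) h \<otimes> gamma) (D1 \<star> D2) (reassoc H) = \<one>"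
proof -
  interpret X: hom_calculus k H X6 by (rule target[OF HH6])
  let ?in = "inl k H3 H3" and ?ir = "inr k H3 H3"
  \<comment> \<open>Legs are numbered by their place in the combined expression: 1 and 2 are read by
    \<open>D\<close>, 3 and 4 by antipodes, 5 and 6 by \<open>D\<close>. The first copy owns legs 1,
    4, 5 and the second one legs 2, 3, 6.\<close>
  let ?e1 = "\<lambda>h. ?in (s1 h)" and ?e4 = "\<lambda>h. ?in (s2 h)" and ?e5 = "\<lambda>h. ?in (s3 h)"
    and ?e2 = "\<lambda>h. ?ir (s1 h)" and ?e3 = "\<lambda>h. ?ir (s2 h)" and ?e6 = "\<lambda>h. ?ir (s3 h)"
  note six = six_slots[OF H]
  note [simp] = six six(7-21)[THEN commuting_sym]
  note e_lin = six(1-6)[THEN algebra_maps_linear]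
  let ?j1 = "J1 D1 b1 S1 a1" and ?j2 = "J1 D2 b2 S2 a2"
  note j1 = J1_linear[OF homs(1,3,3) elems(1,2)] and j2 = J1_linear[OF homs(2,4,4) elems(3,4)]
  define J where "J = pairing k H3 H3 T ?j1 ?j2"
  have J: "J \<in> linear_maps k X6 T" unfolding J_def by (rule pairing_linear[OF HHH HHH T j1 j2])
  note s = slot_homs[OF H H H]
  note coll1 = J1_collapse12[OF homs(1,3,3) elems(1,2) pairs(2)] J1_collapse23[OF homs(1,3,3) elems(1,2) pairs(1)]
  note coll2 = J1_collapse12[OF homs(2,4,4) elems(3,4) pairs(4)] J1_collapse23[OF homs(2,4,4) elems(3,4) pairs(3)]
  have R14: "X.eqR J (X.conv ?e1 ?e4) X.eps" and L45: "X.eqL J (X.conv ?e4 ?e5) X.eps"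
    and R23: "X.eqR J (X.conv ?e2 ?e3) X.eps" and L36: "X.eqL J (X.conv ?e3 ?e6) X.eps"
    unfolding J_def
    by (rule eq_conv_inl(2)[OF HHH HHH j1 j2 s(1,2) coll1(1)] eq_conv_inl(1)[OF HHH HHH j1 j2 s(2,3) coll1(2)]
        eq_conv_inr(2)[OF HHH HHH j1 j2 s(1,2) coll2(1)] eq_conv_inr(1)[OF HHH HHH j1 j2 s(2,3) coll2(2)])+
  have J_pure: "J (pure k H3 H3 (pure k H H2 a (pure k H H b c)) (pure k H H2 a' (pure k H H b' c'))) =
      D1 a \<otimes> b1 \<otimes> (S1 b \<otimes> a1 \<otimes> D1 c) \<otimes> (D2 a' \<otimes> b2 \<otimes> (S2 b' \<otimes> a2 \<otimes> D2 c'))"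
    if "a \<in> carrier H" "b \<in> carrier H" "c \<in> carrier H" "a' \<in> carrier H" "b' \<in> carrier H" "c' \<in> carrier H" for a b c a' b' c'
    using that pairing3_pure3[OF H H H T lins_mult(1,3) lins(1), unfolded pure3_def]
      pairing3_pure3[OF H H H T lins_mult(2,4) lins(2), unfolded pure3_def]
    by (simp add: J_def pairing_pure[OF HHH HHH T j1 j2] pures)
  note left_ext = tensor_ext33[OF H linear_maps_comp[OF assoc_algebra_mult_linear(1)[OF HH6] J] linear_maps_lmult[OF T J]]
  note right_ext = tensor_ext33[OF H linear_maps_comp[OF assoc_algebra_mult_linear(2)[OF HH6] J] linear_maps_rmult[OF T J]]
  have J12: "J (?e1 u \<otimes>\<^bsub>X6\<^esub> y) = D1 u \<otimes> J y" "J (?e2 u \<otimes>\<^bsub>X6\<^esub> y) = D2 u \<otimes> J y"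
    if u: "u \<in> carrier H" and y: "y \<in> carrier X6" for u y
    by (rule left_ext[OF _ _ _ y]; simp add: u pures6 J_pure mults T.m_assoc sort)+
  have J56: "J (y \<otimes>\<^bsub>X6\<^esub> ?e5 u) = J y \<otimes> D1 u" "J (y \<otimes>\<^bsub>X6\<^esub> ?e6 u) = J y \<otimes> D2 u"
    if u: "u \<in> carrier H" and y: "y \<in> carrier X6" for u y
    by (rule right_ext[OF _ _ _ y]; simp add: u pures6 J_pure mults T.m_assoc sort)+
  have Jc12: "J (X.conv ?e1 ?e2 u \<otimes>\<^bsub>X6\<^esub> y) = (D1 \<star> D2) u \<otimes> J y" if "u \<in> carrier H" "y \<in> carrier X6" for u y
    by (rule conv_act_left_left[OF HH6 J e_lin(1,4) lins(1,2) J12 that(2,1)])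
  have Jc56: "J (y \<otimes>\<^bsub>X6\<^esub> X.conv ?e5 ?e6 u) = J y \<otimes> (D1 \<star> D2) u" if "u \<in> carrier H" "y \<in> carrier X6" for u y
    by (rule conv_act_right_right[OF HH6 J e_lin(3,6) lins(1,2) J56 that(2,1)])
  let ?F = "pairing4 k H H H H X6 ?e3 ?e4 ?e5 ?e6" and ?F' = "pairing4 k H H H H X6 ?e1 ?e2 ?e3 ?e4"
  have Fl: "?F \<in> linear_maps k H4 X6" "?F' \<in> linear_maps k H4 X6"
    by (intro pairing4_linear H HH6 e_lin)+
  \<comment> \<open>Legs 3 and 4 occur in both factors and are read by antipodes; this is why the
    two values come out in the opposite order.\<close>
  have mixed: "J (?F a \<otimes>\<^bsub>X6\<^esub> ?F' b) = G' b \<otimes> G a" if a: "a \<in> carrier H4" and b: "b \<in> carrier H4" for a b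
  proof (rule tensor_ext4[OF H H H H linear_maps_comp[OF linear_maps_rmult[OF HH6 Fl(1) linear_maps_closed[OF Fl(2) b]] J]
        linear_maps_lmult[OF T G_linear linear_maps_closed[OF G'_linear b]] _ a])
    fix a1' a2' a3' a4' assume a': "a1' \<in> carrier H" "a2' \<in> carrier H" "a3' \<in> carrier H" "a4' \<in> carrier H"
    let ?a = "pure k H H3 a1' (pure k H H2 a2' (pure k H H a3' a4'))"
    have a'': "?a \<in> carrier H4" using a' by (simp add: pures)
    show "J (?F ?a \<otimes>\<^bsub>X6\<^esub> ?F' b) = G' b \<otimes> G ?a"
      by (rule tensor_ext4[OF H H H H linear_maps_comp[OF linear_maps_lmult[OF HH6 Fl(2) linear_maps_closed[OF Fl(1) a'']] J]
          linear_maps_rmult[OF T G'_linear linear_maps_closed[OF G_linear a'']] _ b])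
        (simp add: a' pairing4_pure[OF H H H H HH6 e_lin(5,2,3,6)] pairing4_pure[OF H H H H HH6 e_lin(1,4,5,2)],
         simp add: a' pures6 J_pure G_pure G'_pure mults T.m_assoc sort)
  qed
  let ?A = "X.Phi ?e3 ?e4 ?e5 \<otimes>\<^bsub>X6\<^esub> X.Psi (X.conv ?e3 ?e4) ?e5 ?e6"
  let ?B = "X.Phi (X.conv ?e1 ?e2) ?e3 ?e4 \<otimes>\<^bsub>X6\<^esub> X.Psi ?e1 ?e2 ?e3"
  have F: "?F \<in> algebra_maps k H4 X6" "?F A4 = ?A" "\<And>h. h \<in> carrier H \<Longrightarrow> ?F (X4.conv r1 r2 h) = X.conv ?e3 ?e4 h"
    by (rule pairing4_eval[OF HH6]; simp)+
  have F': "?F' B4 = ?B"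
    by (rule pairing4_eval[OF HH6]; simp)
  have mid: "J (?A \<otimes>\<^bsub>X6\<^esub> X.conv ?e3 ?e4 q \<otimes>\<^bsub>X6\<^esub> ?B) = delta \<otimes> ((S2 \<star> S1) q \<otimes> gamma)" if q: "q \<in> carrier H" for q
  proof -
    have "?A \<otimes>\<^bsub>X6\<^esub> X.conv ?e3 ?e4 q = ?F (A4 \<otimes>\<^bsub>H4\<^esub> X4.conv r1 r2 q)"
      using q by (simp add: algebra_maps_mult[OF F(1)] F(2,3))
    then show ?thesis
      using q by (simp add: F'[symmetric] mixed G_conv gamma_def delta_def)
  qed
  let ?c = "\<lambda>p q r. X.conv ?e1 ?e2 p \<otimes>\<^bsub>X6\<^esub> (X.conv ?e3 ?e4 q \<otimes>\<^bsub>X6\<^esub> X.conv ?e5 ?e6 r)"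
  \<comment> \<open>\<open>?A\<close> does not involve legs 1 and 2, and \<open>?B\<close> does not
    involve legs 5 and 6. The outer convolutions can therefore be moved to the ends, where
    \<open>J\<close> releases them.\<close>
  have pull: "?A \<otimes>\<^bsub>X6\<^esub> ?c p q r \<otimes>\<^bsub>X6\<^esub> ?B =
      X.conv ?e1 ?e2 p \<otimes>\<^bsub>X6\<^esub> (?A \<otimes>\<^bsub>X6\<^esub> X.conv ?e3 ?e4 q \<otimes>\<^bsub>X6\<^esub> ?B \<otimes>\<^bsub>X6\<^esub> X.conv ?e5 ?e6 r)"
    if pqr: "p \<in> carrier H" "q \<in> carrier H" "r \<in> carrier H" for p q r
  proof -
    let ?p = "X.conv ?e1 ?e2 p" and ?q = "X.conv ?e3 ?e4 q" and ?r = "X.conv ?e5 ?e6 r"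
    have 1: "?A \<otimes>\<^bsub>X6\<^esub> ?p = ?p \<otimes>\<^bsub>X6\<^esub> ?A" and 2: "?B \<otimes>\<^bsub>X6\<^esub> ?r = ?r \<otimes>\<^bsub>X6\<^esub> ?B"
      using pqr by (intro X.mult_commute X.Phi_commute; simp)+
    have "?A \<otimes>\<^bsub>X6\<^esub> ?c p q r \<otimes>\<^bsub>X6\<^esub> ?B = (?A \<otimes>\<^bsub>X6\<^esub> ?p) \<otimes>\<^bsub>X6\<^esub> ?q \<otimes>\<^bsub>X6\<^esub> (?r \<otimes>\<^bsub>X6\<^esub> ?B)"
      using pqr by (simp add: X.T.m_assoc)
    also have "\<dots> = ?p \<otimes>\<^bsub>X6\<^esub> ?A \<otimes>\<^bsub>X6\<^esub> ?q \<otimes>\<^bsub>X6\<^esub> (?B \<otimes>\<^bsub>X6\<^esub> ?r)"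
      by (simp only: 1 2)
    finally show ?thesis using pqr by (simp add: X.T.m_assoc)
  qed
  have cl: "?A \<in> carrier X6" "?B \<in> carrier X6" by simp_all
  have lin: "(\<lambda>h. (D1 \<star> D2) h \<otimes> delta) \<in> linear_maps k H T" "(\<lambda>h. (S2 \<star> S1) h \<otimes> gamma) \<in> linear_maps k H T"
    "D1 \<star> D2 \<in> linear_maps k H T"
    by (simp_all add: ahom_mult_linear antiD(1)[OF S_anti])
  have clin: "X.conv ?e1 ?e2 \<in> linear_maps k H X6" "X.conv ?e3 ?e4 \<in> linear_maps k H X6" "X.conv ?e5 ?e6 \<in> linear_maps k H X6"
    by (simp_all add: X.conv_linear)
  note clin3 = pairing3_linear[OF H H H HH6 clin]
  have "pairing3 k H H H T (\<lambda>h. (D1 \<star> D2) h \<otimes> delta) (\<lambda>h. (S2 \<star> S1) h \<otimes> gamma) (D1 \<star> D2) (reassoc H) =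
      J (?A \<otimes>\<^bsub>X6\<^esub> X.Phi (X.conv ?e1 ?e2) (X.conv ?e3 ?e4) (X.conv ?e5 ?e6) \<otimes>\<^bsub>X6\<^esub> ?B)"
    unfolding X.Phi_def[of "X.conv ?e1 ?e2" "X.conv ?e3 ?e4" "X.conv ?e5 ?e6"]
  proof (rule tensor_ext3[OF H H H pairing3_linear[OF H H H T lin]
        linear_maps_comp[OF linear_maps_rmult[OF HH6 linear_maps_lmult[OF HH6 clin3 cl(1)] cl(2)] J] _ reassoc_closed])
    fix p q r assume pqr: "p \<in> carrier H" "q \<in> carrier H" "r \<in> carrier H"
    note mid' = mid[OF pqr(2)]
    have "J (?A \<otimes>\<^bsub>X6\<^esub> ?c p q r \<otimes>\<^bsub>X6\<^esub> ?B) =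
       (D1 \<star> D2) p \<otimes> (J (?A \<otimes>\<^bsub>X6\<^esub> X.conv ?e3 ?e4 q \<otimes>\<^bsub>X6\<^esub> ?B) \<otimes> (D1 \<star> D2) r)"
      unfolding pull[OF pqr] using pqr cl by (simp add: Jc12 Jc56)
    also have "\<dots> = (D1 \<star> D2) p \<otimes> delta \<otimes> ((S2 \<star> S1) q \<otimes> gamma \<otimes> (D1 \<star> D2) r)"
      unfolding mid' using pqr by (simp add: T.m_assoc)
    finally show "pairing3 k H H H T (\<lambda>h. (D1 \<star> D2) h \<otimes> delta) (\<lambda>h. (S2 \<star> S1) h \<otimes> gamma) (D1 \<star> D2)
        (pure k H H2 p (pure k H H q r)) =
      J (?A \<otimes>\<^bsub>X6\<^esub> pairing3 k H H H X6 (X.conv ?e1 ?e2) (X.conv ?e3 ?e4) (X.conv ?e5 ?e6) (pure k H H2 p (pure k H H q r)) \<otimes>\<^bsub>X6\<^esub> ?B)"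
      using pqr by (simp add: pairing3_pure3[OF H H H T lin, unfolded pure3_def] pairing3_pure3[OF H H H HH6 clin, unfolded pure3_def])
  qed
  also have "\<dots> = J (X.Phi ?e2 ?e3 ?e6 \<otimes>\<^bsub>X6\<^esub> X.Phi ?e1 ?e4 ?e5)"
    by (rule X.norm1_calc[OF J _ _ _ _ _ _ _ _ _ _ _ _ _ _ _ _ _ _ _ _ _ R14 R23 L45 L36]; simp)
  also have "X.Phi ?e2 ?e3 ?e6 \<otimes>\<^bsub>X6\<^esub> X.Phi ?e1 ?e4 ?e5 = pure k H3 H3 (reassoc H) (reassoc H)"
  proof -
    have "X.Phi ?e2 ?e3 ?e6 = ?ir (reassoc H)" "X.Phi ?e1 ?e4 ?e5 = ?in (reassoc H)"
      unfolding X.Phi_def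
      using hom_pairing3[OF H H H HHH HH6 s[THEN algebra_maps_linear] inr_hom[OF HHH HHH] reassoc_closed]
        hom_pairing3[OF H H H HHH HH6 s[THEN algebra_maps_linear] inl_hom[OF HHH HHH] reassoc_closed]
      by (simp_all add: pairing3_slots[OF H H H reassoc_closed])
    then show ?thesis
      using commutingD[OF inl_inr_commuting[OF HHH HHH] reassoc_closed reassoc_closed]
        pure_eq_inl_inr[OF HHH HHH reassoc_closed reassoc_closed] by simp
  qed
  also have "J \<dots> = \<one>"
    using A1 A2 by (simp add: J_def pairing_pure[OF HHH HHH T j1 j2] reassoc_closed antipode_along_def)
  finally show ?thesis .
qed

end

context commuting_antipodes
begin

text \<open>Now the outer legs are read by antipodes and the middle ones by \<open>D\<close>.
  Accordingly \<open>A4\<close> occupies legs 1 to 4 and \<open>B4\<close> legs 3 to 6, and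
  \<open>norm2_calc\<close> leaves the inverse reassociator in each copy.\<close>

lemma norm2:
  "pairing3 k H H H T (\<lambda>h. (S2 \<star> S1) h \<otimes> gamma) (\<lambda>h. (D1 \<star> D2) h \<otimes> delta) (S2 \<star> S1)
    (inv\<^bsub>H3\<^esub> reassoc H) = \<one>"
proof -
  interpret X: hom_calculus k H X6 by (rule target[OF HH6])
  let ?in = "inl k H3 H3" and ?ir = "inr k H3 H3"
  let ?inv = "inv\<^bsub>H3\<^esub> reassoc H"
  let ?e2 = "\<lambda>h. ?in (s1 h)" and ?e3 = "\<lambda>h. ?in (s2 h)" and ?e6 = "\<lambda>h. ?in (s3 h)"
    and ?e1 = "\<lambda>h. ?ir (s1 h)" and ?e4 = "\<lambda>h. ?ir (s2 h)" and ?e5 = "\<lambda>h. ?ir (s3 h)"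
  note six = six_slots[OF H]
  note [simp] = six six(7-21)[THEN commuting_sym]
  note e_lin = six(1-6)[THEN algebra_maps_linear]
  let ?j1 = "J2 S1 a1 D1 b1 S1" and ?j2 = "J2 S2 a2 D2 b2 S2"
  note j1 = J2_linear[OF homs(1,3,3) elems(1,2)] and j2 = J2_linear[OF homs(2,4,4) elems(3,4)]
  define J where "J = pairing k H3 H3 T ?j1 ?j2"
  have J: "J \<in> linear_maps k X6 T" unfolding J_def by (rule pairing_linear[OF HHH HHH T j1 j2])
  note s = slot_homs[OF H H H]
  note coll1 = J2_collapse12[OF homs(1,3,3) elems(1,2) pairs(1)] J2_collapse23[OF homs(1,3,3) elems(1,2) pairs(2)]
  note coll2 = J2_collapse12[OF homs(2,4,4) elems(3,4) pairs(3)] J2_collapse23[OF homs(2,4,4) elems(3,4) pairs(4)]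
  have L23: "X.eqL J (X.conv ?e2 ?e3) X.eps" and R36: "X.eqR J (X.conv ?e3 ?e6) X.eps"
    and L14: "X.eqL J (X.conv ?e1 ?e4) X.eps" and R45: "X.eqR J (X.conv ?e4 ?e5) X.eps"
    unfolding J_def
    by (rule eq_conv_inl(1)[OF HHH HHH j1 j2 s(1,2) coll1(1)] eq_conv_inl(2)[OF HHH HHH j1 j2 s(2,3) coll1(2)]
        eq_conv_inr(1)[OF HHH HHH j1 j2 s(1,2) coll2(1)] eq_conv_inr(2)[OF HHH HHH j1 j2 s(2,3) coll2(2)])+
  have J_pure: "J (pure k H3 H3 (pure k H H2 a (pure k H H b c)) (pure k H H2 a' (pure k H H b' c'))) =
      S1 a \<otimes> a1 \<otimes> (D1 b \<otimes> b1 \<otimes> S1 c) \<otimes> (S2 a' \<otimes> a2 \<otimes> (D2 b' \<otimes> b2 \<otimes> S2 c'))"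
    if "a \<in> carrier H" "b \<in> carrier H" "c \<in> carrier H" "a' \<in> carrier H" "b' \<in> carrier H" "c' \<in> carrier H" for a b c a' b' c'
    using that pairing3_pure3[OF H H H T lins_mult(3,1) lins(3), unfolded pure3_def]
      pairing3_pure3[OF H H H T lins_mult(4,2) lins(4), unfolded pure3_def]
    by (simp add: J_def pairing_pure[OF HHH HHH T j1 j2] pures)
  note left_ext = tensor_ext33[OF H linear_maps_comp[OF assoc_algebra_mult_linear(1)[OF HH6] J] linear_maps_rmult[OF T J]]
  note right_ext = tensor_ext33[OF H linear_maps_comp[OF assoc_algebra_mult_linear(2)[OF HH6] J] linear_maps_lmult[OF T J]]
  have J12: "J (y \<otimes>\<^bsub>X6\<^esub> ?e1 u) = S2 u \<otimes> J y" "J (y \<otimes>\<^bsub>X6\<^esub> ?e2 u) = S1 u \<otimes> J y"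
    if u: "u \<in> carrier H" and y: "y \<in> carrier X6" for u y
    by (rule right_ext[OF _ _ _ y]; simp add: u pures6 J_pure mults T.m_assoc sort)+
  have J56: "J (?e5 u \<otimes>\<^bsub>X6\<^esub> y) = J y \<otimes> S2 u" "J (?e6 u \<otimes>\<^bsub>X6\<^esub> y) = J y \<otimes> S1 u"
    if u: "u \<in> carrier H" and y: "y \<in> carrier X6" for u y
    by (rule left_ext[OF _ _ _ y]; simp add: u pures6 J_pure mults T.m_assoc sort)+
  have Jc12: "J (y \<otimes>\<^bsub>X6\<^esub> X.conv ?e1 ?e2 u) = (S2 \<star> S1) u \<otimes> J y" if "u \<in> carrier H" "y \<in> carrier X6" for u y
    by (rule conv_act_right_left[OF HH6 J e_lin(4,1) lins(4,3) J12 cms(4) that(2,1)])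
  have Jc56: "J (X.conv ?e5 ?e6 u \<otimes>\<^bsub>X6\<^esub> y) = J y \<otimes> (S2 \<star> S1) u" if "u \<in> carrier H" "y \<in> carrier X6" for u y
    by (rule conv_act_left_right[OF HH6 J e_lin(6,3) lins(4,3) J56 cms(4) that(2,1)])
  let ?F = "pairing4 k H H H H X6 ?e1 ?e2 ?e3 ?e4" and ?F' = "pairing4 k H H H H X6 ?e3 ?e4 ?e5 ?e6"
  have Fl: "?F \<in> linear_maps k H4 X6" "?F' \<in> linear_maps k H4 X6"
    by (intro pairing4_linear H HH6 e_lin)+
  have mixed: "J (?F a \<otimes>\<^bsub>X6\<^esub> ?F' b) = G a \<otimes> G' b" if a: "a \<in> carrier H4" and b: "b \<in> carrier H4" for a b
  proof (rule tensor_ext4[OF H H H H linear_maps_comp[OF linear_maps_rmult[OF HH6 Fl(1) linear_maps_closed[OF Fl(2) b]] J]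
        linear_maps_rmult[OF T G_linear linear_maps_closed[OF G'_linear b]] _ a])
    fix a1' a2' a3' a4' assume a': "a1' \<in> carrier H" "a2' \<in> carrier H" "a3' \<in> carrier H" "a4' \<in> carrier H"
    let ?a = "pure k H H3 a1' (pure k H H2 a2' (pure k H H a3' a4'))"
    have a'': "?a \<in> carrier H4" using a' by (simp add: pures)
    show "J (?F ?a \<otimes>\<^bsub>X6\<^esub> ?F' b) = G ?a \<otimes> G' b"
      by (rule tensor_ext4[OF H H H H linear_maps_comp[OF linear_maps_lmult[OF HH6 Fl(2) linear_maps_closed[OF Fl(1) a'']] J]
          linear_maps_lmult[OF T G'_linear linear_maps_closed[OF G_linear a'']] _ b])
        (simp add: a' pairing4_pure[OF H H H H HH6 e_lin(4,1,2,5)] pairing4_pure[OF H H H H HH6 e_lin(2,5,6,3)],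
         simp add: a' pures6 J_pure G_pure G'_pure mults T.m_assoc sort)
  qed
  let ?A = "X.Phi ?e1 ?e2 ?e3 \<otimes>\<^bsub>X6\<^esub> X.Psi (X.conv ?e1 ?e2) ?e3 ?e4"
  let ?B = "X.Phi (X.conv ?e3 ?e4) ?e5 ?e6 \<otimes>\<^bsub>X6\<^esub> X.Psi ?e3 ?e4 ?e5"
  have F: "?F \<in> algebra_maps k H4 X6" "?F A4 = ?A" "\<And>h. h \<in> carrier H \<Longrightarrow> ?F (X4.conv r3 r4 h) = X.conv ?e3 ?e4 h"
    by (rule pairing4_eval[OF HH6]; simp)+
  have F': "?F' B4 = ?B"
    by (rule pairing4_eval[OF HH6]; simp)
  have mid: "J (?A \<otimes>\<^bsub>X6\<^esub> X.conv ?e3 ?e4 q \<otimes>\<^bsub>X6\<^esub> ?B) = gamma \<otimes> (D1 \<star> D2) q \<otimes> delta" if q: "q \<in> carrier H" for q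
  proof -
    have "?A \<otimes>\<^bsub>X6\<^esub> X.conv ?e3 ?e4 q = ?F (A4 \<otimes>\<^bsub>H4\<^esub> X4.conv r3 r4 q)"
      using q by (simp add: algebra_maps_mult[OF F(1)] F(2,3))
    then show ?thesis
      using q by (simp add: F'[symmetric] mixed G_conv gamma_def delta_def)
  qed
  let ?c = "\<lambda>p q r. X.conv ?e1 ?e2 p \<otimes>\<^bsub>X6\<^esub> (X.conv ?e3 ?e4 q \<otimes>\<^bsub>X6\<^esub> X.conv ?e5 ?e6 r)"
  \<comment> \<open>Under \<open>J\<close> a factor on legs 1 and 2 has to stand at the right end in
    order to emerge on the left, and a factor on legs 5 and 6 the other way round. Hence
    \<open>?p\<close> and \<open>?r\<close> change sides first.\<close>
  have pull: "?A \<otimes>\<^bsub>X6\<^esub> ?c p q r \<otimes>\<^bsub>X6\<^esub> ?B =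
      X.conv ?e5 ?e6 r \<otimes>\<^bsub>X6\<^esub> ((?A \<otimes>\<^bsub>X6\<^esub> X.conv ?e3 ?e4 q \<otimes>\<^bsub>X6\<^esub> ?B) \<otimes>\<^bsub>X6\<^esub> X.conv ?e1 ?e2 p)"
    if pqr: "p \<in> carrier H" "q \<in> carrier H" "r \<in> carrier H" for p q r
  proof -
    let ?p = "X.conv ?e1 ?e2 p" and ?q = "X.conv ?e3 ?e4 q" and ?r = "X.conv ?e5 ?e6 r"
    have cl: "?p \<in> carrier X6" "?q \<in> carrier X6" "?r \<in> carrier X6" "?A \<in> carrier X6" "?B \<in> carrier X6"
      using pqr by simp_all
    have Ar: "?A \<otimes>\<^bsub>X6\<^esub> ?r = ?r \<otimes>\<^bsub>X6\<^esub> ?A" and Bp: "?B \<otimes>\<^bsub>X6\<^esub> ?p = ?p \<otimes>\<^bsub>X6\<^esub> ?B"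
      using pqr by (intro X.mult_commute X.Phi_commute; simp)+
    have cc: "X.cm (X.conv ?e1 ?e2) (X.conv ?e3 ?e4)" "X.cm (X.conv ?e1 ?e2) (X.conv ?e5 ?e6)"
      "X.cm (X.conv ?e3 ?e4) (X.conv ?e5 ?e6)"
      by simp_all
    have pq: "?p \<otimes>\<^bsub>X6\<^esub> ?q = ?q \<otimes>\<^bsub>X6\<^esub> ?p" and pr: "?p \<otimes>\<^bsub>X6\<^esub> ?r = ?r \<otimes>\<^bsub>X6\<^esub> ?p" and qr: "?q \<otimes>\<^bsub>X6\<^esub> ?r = ?r \<otimes>\<^bsub>X6\<^esub> ?q"
      by (rule commutingD[OF cc(1) pqr(1,2)] commutingD[OF cc(2) pqr(1,3)] commutingD[OF cc(3) pqr(2,3)])+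
    have "?c p q r = ?q \<otimes>\<^bsub>X6\<^esub> ?p \<otimes>\<^bsub>X6\<^esub> ?r"
      unfolding pq[symmetric] using cl by (simp only: X.T.m_assoc)
    also have "\<dots> = ?q \<otimes>\<^bsub>X6\<^esub> (?r \<otimes>\<^bsub>X6\<^esub> ?p)"
      unfolding pr[symmetric] using cl by (simp only: X.T.m_assoc)
    also have "\<dots> = ?r \<otimes>\<^bsub>X6\<^esub> (?q \<otimes>\<^bsub>X6\<^esub> ?p)"
      using cl by (simp only: qr X.T.m_assoc[symmetric])
    finally have "?A \<otimes>\<^bsub>X6\<^esub> ?c p q r \<otimes>\<^bsub>X6\<^esub> ?B = (?A \<otimes>\<^bsub>X6\<^esub> ?r) \<otimes>\<^bsub>X6\<^esub> ?q \<otimes>\<^bsub>X6\<^esub> (?p \<otimes>\<^bsub>X6\<^esub> ?B)"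
      using cl by (simp only: X.T.m_assoc X.T.m_closed)
    also have "\<dots> = ?r \<otimes>\<^bsub>X6\<^esub> ?A \<otimes>\<^bsub>X6\<^esub> ?q \<otimes>\<^bsub>X6\<^esub> (?B \<otimes>\<^bsub>X6\<^esub> ?p)"
      by (simp only: Ar Bp)
    finally show ?thesis using cl by (simp only: X.T.m_assoc X.T.m_closed)
  qed
  have cl: "?A \<in> carrier X6" "?B \<in> carrier X6" by simp_all
  have lin: "(\<lambda>h. (S2 \<star> S1) h \<otimes> gamma) \<in> linear_maps k H T" "(\<lambda>h. (D1 \<star> D2) h \<otimes> delta) \<in> linear_maps k H T"
    "S2 \<star> S1 \<in> linear_maps k H T"
    by (simp_all add: ahom_mult_linear antiD(1)[OF S_anti])
  have clin: "X.conv ?e1 ?e2 \<in> linear_maps k H X6" "X.conv ?e3 ?e4 \<in> linear_maps k H X6" "X.conv ?e5 ?e6 \<in> linear_maps k H X6"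
    by (simp_all add: X.conv_linear)
  note clin3 = pairing3_linear[OF H H H HH6 clin]
  have "pairing3 k H H H T (\<lambda>h. (S2 \<star> S1) h \<otimes> gamma) (\<lambda>h. (D1 \<star> D2) h \<otimes> delta) (S2 \<star> S1) ?inv =
      J (?A \<otimes>\<^bsub>X6\<^esub> X.Psi (X.conv ?e1 ?e2) (X.conv ?e3 ?e4) (X.conv ?e5 ?e6) \<otimes>\<^bsub>X6\<^esub> ?B)"
    unfolding X.Psi_def[of "X.conv ?e1 ?e2" "X.conv ?e3 ?e4" "X.conv ?e5 ?e6"]
  proof (rule tensor_ext3[OF H H H pairing3_linear[OF H H H T lin]
        linear_maps_comp[OF linear_maps_rmult[OF HH6 linear_maps_lmult[OF HH6 clin3 cl(1)] cl(2)] J] _ reassoc_inv_closed])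
    fix p q r assume pqr: "p \<in> carrier H" "q \<in> carrier H" "r \<in> carrier H"
    note mid' = mid[OF pqr(2)]
    have "J (?A \<otimes>\<^bsub>X6\<^esub> ?c p q r \<otimes>\<^bsub>X6\<^esub> ?B) =
       (S2 \<star> S1) p \<otimes> J (?A \<otimes>\<^bsub>X6\<^esub> X.conv ?e3 ?e4 q \<otimes>\<^bsub>X6\<^esub> ?B) \<otimes> (S2 \<star> S1) r"
      unfolding pull[OF pqr] using pqr cl by (simp add: Jc12 Jc56)
    also have "\<dots> = (S2 \<star> S1) p \<otimes> gamma \<otimes> ((D1 \<star> D2) q \<otimes> delta \<otimes> (S2 \<star> S1) r)"
      unfolding mid' using pqr by (simp add: T.m_assoc)
    finally show "pairing3 k H H H T (\<lambda>h. (S2 \<star> S1) h \<otimes> gamma) (\<lambda>h. (D1 \<star> D2) h \<otimes> delta) (S2 \<star> S1)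
        (pure k H H2 p (pure k H H q r)) =
      J (?A \<otimes>\<^bsub>X6\<^esub> pairing3 k H H H X6 (X.conv ?e1 ?e2) (X.conv ?e3 ?e4) (X.conv ?e5 ?e6) (pure k H H2 p (pure k H H q r)) \<otimes>\<^bsub>X6\<^esub> ?B)"
      using pqr by (simp add: pairing3_pure3[OF H H H T lin, unfolded pure3_def] pairing3_pure3[OF H H H HH6 clin, unfolded pure3_def])
  qed
  also have "\<dots> = J (X.Psi ?e1 ?e4 ?e5 \<otimes>\<^bsub>X6\<^esub> X.Psi ?e2 ?e3 ?e6)"
    by (rule X.norm2_calc[OF J _ _ _ _ _ _ _ _ _ _ _ _ _ _ _ _ _ _ _ _ _ L14 L23 R45 R36]; simp)
  also have "X.Psi ?e1 ?e4 ?e5 \<otimes>\<^bsub>X6\<^esub> X.Psi ?e2 ?e3 ?e6 = pure k H3 H3 ?inv ?inv"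
  proof -
    have "X.Psi ?e1 ?e4 ?e5 = ?ir ?inv" "X.Psi ?e2 ?e3 ?e6 = ?in ?inv"
      unfolding X.Psi_def
      using hom_pairing3[OF H H H HHH HH6 s[THEN algebra_maps_linear] inr_hom[OF HHH HHH] reassoc_inv_closed]
        hom_pairing3[OF H H H HHH HH6 s[THEN algebra_maps_linear] inl_hom[OF HHH HHH] reassoc_inv_closed]
      by (simp_all add: pairing3_slots[OF H H H reassoc_inv_closed])
    then show ?thesis
      using commutingD[OF inl_inr_commuting[OF HHH HHH] reassoc_inv_closed reassoc_inv_closed]
        pure_eq_inl_inr[OF HHH HHH reassoc_inv_closed reassoc_inv_closed] by simp
  qed
  also have "J \<dots> = \<one>"
    using A1 A2 by (simp add: J_def pairing_pure[OF HHH HHH T j1 j2] reassoc_inv_closed antipode_along_def)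
  finally show ?thesis .
qed

theorem antipode_along_tensor: "antipode_along (D1 \<star> D2) (S2 \<star> S1) gamma delta"
  unfolding antipode_along_def
  using alpha_pair_gamma beta_pair_delta norm1 norm2 by blast

end

section \<open>Translation of the summation notation, and transport of antipodes along algebra
  maps\<close>

lemma tsum3_eq_pairing3:
  assumes A: "assoc_algebra k A" and B: "assoc_algebra k B" and C: "assoc_algebra k C" and T: "assoc_algebra k T"
    and i: "i \<in> linear_maps k A T" and j: "j \<in> linear_maps k B T" and l: "l \<in> linear_maps k C T"
    and g: "\<And>a b c. \<lbrakk>a \<in> carrier A; b \<in> carrier B; c \<in> carrier C\<rbrakk> \<Longrightarrow> g a b c = i a \<otimes>\<^bsub>T\<^esub> (j b \<otimes>\<^bsub>T\<^esub> l c)"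
  shows "tsum3 k A B C T z g = pairing3 k A B C T i j l z"
  unfolding tsum3_def pairing_def[of k A]
proof (rule tsum_cong)
  fix a y assume a: "a \<in> carrier A" and y: "y \<in> carrier (B \<boxtimes>\<^bsub>k\<^esub> C)"
  show "tsum k B C T y (\<lambda>b c. g a b c) = i a \<otimes>\<^bsub>T\<^esub> pairing k B C T j l y"
    by (rule tsum_unique[OF B C linear_maps_lmult[OF T pairing_linear[OF B C T j l] linear_maps_closed[OF i a]] _ y])
      (simp add: pairing_pure[OF B C T j l] g a)
qed

lemma tsum4_eq_pairing4:
  assumes A: "assoc_algebra k A" and B: "assoc_algebra k B" and C: "assoc_algebra k C" and D: "assoc_algebra k D"
    and T: "assoc_algebra k T"
    and i: "i \<in> linear_maps k A T" and j: "j \<in> linear_maps k B T" and l: "l \<in> linear_maps k C T" and m: "m \<in> linear_maps k D T"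
    and g: "\<And>a b c d. \<lbrakk>a \<in> carrier A; b \<in> carrier B; c \<in> carrier C; d \<in> carrier D\<rbrakk> \<Longrightarrow>
      g a b c d = i a \<otimes>\<^bsub>T\<^esub> (j b \<otimes>\<^bsub>T\<^esub> (l c \<otimes>\<^bsub>T\<^esub> m d))"
  shows "tsum4 k A B C D T z g = pairing4 k A B C D T i j l m z"
  unfolding tsum4_def pairing_def[of k A]
proof (rule tsum_cong)
  interpret T: ring T by (rule assoc_algebra_ring[OF T])
  fix a y assume a: "a \<in> carrier A" and y: "y \<in> carrier (B \<boxtimes>\<^bsub>k\<^esub> C \<boxtimes>\<^bsub>k\<^esub> D)"
  note ia = linear_maps_closed[OF i a]
  have "tsum3 k B C D T y (g a) = pairing3 k B C D T (\<lambda>b. i a \<otimes>\<^bsub>T\<^esub> j b) l m y"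
    by (rule tsum3_eq_pairing3[OF B C D T linear_maps_lmult[OF T j ia] l m])
      (simp add: g a ia T.m_assoc linear_maps_closed[OF j] linear_maps_closed[OF l] linear_maps_closed[OF m])
  also have "\<dots> = i a \<otimes>\<^bsub>T\<^esub> pairing3 k B C D T j l m y"
    by (rule tensor_ext3[OF B C D pairing3_linear[OF B C D T linear_maps_lmult[OF T j ia] l m]
          linear_maps_lmult[OF T pairing3_linear[OF B C D T j l m] ia] _ y])
      (simp add: pairing3_pure3[OF B C D T linear_maps_lmult[OF T j ia] l m, unfolded pure3_def]
        pairing3_pure3[OF B C D T j l m, unfolded pure3_def] ia T.m_assoc linear_maps_closed[OF j] linear_maps_closed[OF l]
        linear_maps_closed[OF m])
  finally show "tsum3 k B C D T y (\<lambda>b c d. g a b c d) = i a \<otimes>\<^bsub>T\<^esub> pairing3 k B C D T j l m y" .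
qed

text \<open>All defining equations concern values of readings, and an algebra map passes through
  each of them. From the antipode of \<open>H\<close> this yields those along \<Delta> and along the
  two embeddings into \<open>H \<otimes> H\<close>.\<close>

lemma antipode_along_hom:
  assumes X: "hom_calculus k H T" and Y: "hom_calculus k H T'" and F: "F \<in> algebra_maps k T T'"
    and A: "hom_calculus.antipode_along k H T D S a b"
  shows "hom_calculus.antipode_along k H T' (\<lambda>h. F (D h)) (\<lambda>h. F (S h)) (F a) (F b)"
proof -
  interpret X: hom_calculus k H T by fact
  interpret Y: hom_calculus k H T' by fact
  have D: "X.ahom D" and S: "X.anti S" and a: "a \<in> carrier T" and b: "b \<in> carrier T"
    using A by (simp_all add: X.antipode_along_def X.alpha_pair_def X.beta_pair_def)
  note cl = X.ahom_closed[OF D] X.antiD(4)[OF S]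
  note Dl = X.ahom_linear[OF D] and Sl = X.antiD(1)[OF S]
  note Db = X.ahom_mult_linear[OF Dl b] and Sa = X.ahom_mult_linear[OF Sl a]
  have FD: "Y.ahom (\<lambda>h. F (D h))" by (rule algebra_maps_comp[OF D F])
  have FS: "Y.anti (\<lambda>h. F (S h))"
    unfolding Y.anti_def
    using linear_maps_comp[OF Sl algebra_maps_linear[OF F]]
    by (simp add: X.antiD[OF S] algebra_maps_one[OF F] algebra_maps_mult[OF F])
  have sm: "F (c \<odot>\<^bsub>T\<^esub> x) = c \<odot>\<^bsub>T'\<^esub> F x" if "c \<in> carrier k" "x \<in> carrier T" for c x
    by (rule linear_maps_smult[OF algebra_maps_linear[OF F] that])
  have 1: "pairing k H H T' (\<lambda>h. F (S h) \<otimes>\<^bsub>T'\<^esub> F a) (\<lambda>h. F (D h)) z = F (pairing k H H T (\<lambda>h. S h \<otimes>\<^bsub>T\<^esub> a) D z)"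
    if "z \<in> carrier (H \<boxtimes>\<^bsub>k\<^esub> H)" for z
    unfolding hom_pairing[OF X.H X.H X.T Y.T Sa Dl F that]
    by (rule pairing_cong) (simp_all add: algebra_maps_mult[OF F] cl a)
  have 2: "pairing k H H T' (\<lambda>h. F (D h) \<otimes>\<^bsub>T'\<^esub> F b) (\<lambda>h. F (S h)) z = F (pairing k H H T (\<lambda>h. D h \<otimes>\<^bsub>T\<^esub> b) S z)"
    if "z \<in> carrier (H \<boxtimes>\<^bsub>k\<^esub> H)" for z
    unfolding hom_pairing[OF X.H X.H X.T Y.T Db Sl F that]
    by (rule pairing_cong) (simp_all add: algebra_maps_mult[OF F] cl b)
  have 3: "pairing3 k H H H T' (\<lambda>h. F (D h) \<otimes>\<^bsub>T'\<^esub> F b) (\<lambda>h. F (S h) \<otimes>\<^bsub>T'\<^esub> F a) (\<lambda>h. F (D h)) z =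
      F (pairing3 k H H H T (\<lambda>h. D h \<otimes>\<^bsub>T\<^esub> b) (\<lambda>h. S h \<otimes>\<^bsub>T\<^esub> a) D z)"
    if "z \<in> carrier (H \<boxtimes>\<^bsub>k\<^esub> H \<boxtimes>\<^bsub>k\<^esub> H)" for z
    unfolding hom_pairing[OF X.H X.HH X.T Y.T Db pairing_linear[OF X.H X.H X.T Sa Dl] F that]
    by (rule pairing_cong) (simp_all add: algebra_maps_mult[OF F] cl b 1)
  have 4: "pairing3 k H H H T' (\<lambda>h. F (S h) \<otimes>\<^bsub>T'\<^esub> F a) (\<lambda>h. F (D h) \<otimes>\<^bsub>T'\<^esub> F b) (\<lambda>h. F (S h)) z =
      F (pairing3 k H H H T (\<lambda>h. S h \<otimes>\<^bsub>T\<^esub> a) (\<lambda>h. D h \<otimes>\<^bsub>T\<^esub> b) S z)"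
    if "z \<in> carrier (H \<boxtimes>\<^bsub>k\<^esub> H \<boxtimes>\<^bsub>k\<^esub> H)" for z
    unfolding hom_pairing[OF X.H X.HH X.T Y.T Sa pairing_linear[OF X.H X.H X.T Db Sl] F that]
    by (rule pairing_cong) (simp_all add: algebra_maps_mult[OF F] cl a 2)
  show ?thesis
    using A FD FS algebra_maps_closed[OF F a] algebra_maps_closed[OF F b]
    by (simp add: X.antipode_along_def X.alpha_pair_def X.beta_pair_def Y.antipode_along_def Y.alpha_pair_def Y.beta_pair_def
        1 2 3 4 X.comult_closed X.reassoc_closed X.reassoc_inv_closed a b sm X.counit_closed algebra_maps_one[OF F])
qed

lemma op_qbialg_simps [simp]:
  "carrier (op_qbialg k H) = carrier H" "x \<oplus>\<^bsub>op_qbialg k H\<^esub> y = x \<oplus>\<^bsub>H\<^esub> y" "c \<odot>\<^bsub>op_qbialg k H\<^esub> x = c \<odot>\<^bsub>H\<^esub> x"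
  "\<zero>\<^bsub>op_qbialg k H\<^esub> = \<zero>\<^bsub>H\<^esub>" "\<one>\<^bsub>op_qbialg k H\<^esub> = \<one>\<^bsub>H\<^esub>" "x \<otimes>\<^bsub>op_qbialg k H\<^esub> y = y \<otimes>\<^bsub>H\<^esub> x"
  "comult (op_qbialg k H) = comult H" "counit (op_qbialg k H) = counit H"
  by (simp_all add: op_qbialg_def)

section \<open>The Drinfeld twist\<close>

locale quasi_hopf =
  fixes k :: "('k, 'c) ring_scheme" and H :: "('k, 'h, 'm) qhopf_scheme"
  assumes quasi_hopf: "quasi_hopf_algebra k H"
begin

abbreviation (input) "H2 \<equiv> H \<boxtimes>\<^bsub>k\<^esub> H"
abbreviation (input) "H3 \<equiv> H \<boxtimes>\<^bsub>k\<^esub> H2"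

lemma qb: "quasi_bialgebra k H"
  by (rule quasi_hopf_algebra.axioms(1)[OF quasi_hopf])

lemma H: "assoc_algebra k H" by (rule quasi_bialgebra.axioms(1)[OF qb])
lemmas HH = assoc_algebra_tensor[OF H H]

sublocale I: hom_calculus k H H by (rule hom_calculus.intro[OF qb H])
sublocale B: hom_calculus k H "H \<boxtimes>\<^bsub>k\<^esub> H" by (rule hom_calculus.intro[OF qb HH])

abbreviation "S \<equiv> antipode H"

lemma alpha_closed [simp]: "alpha H \<in> carrier H" and beta_closed [simp]: "beta H \<in> carrier H"
  using quasi_hopf_algebra.alpha_closed[OF quasi_hopf] quasi_hopf_algebra.beta_closed[OF quasi_hopf] .

lemma antipode_anti: "I.anti S"
proof -
  note a = quasi_hopf_algebra.antipode_anti[OF quasi_hopf]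
  have "S \<in> linear_maps k H H"
    using algebra_maps_linear[OF a] by (simp add: linear_maps_def)
  then show ?thesis
    using algebra_maps_mult[OF a] algebra_maps_one[OF a] by (simp add: I.anti_def)
qed

lemmas S = I.antiD[OF antipode_anti]

lemma antipode_along_id: "I.antipode_along (\<lambda>h. h) S (alpha H) (beta H)"
proof -
  note Sa = I.ahom_mult_linear[OF S(1) alpha_closed] and b = I.ahom_mult_linear[OF linear_maps_id beta_closed]
  have "I.alpha_pair (\<lambda>h. h) S (alpha H)"
    using quasi_hopf_algebra.antipode_alpha[OF quasi_hopf]
    by (simp add: I.alpha_pair_def antipode_anti algebra_maps_id pairing_def)
  moreover have "I.beta_pair (\<lambda>h. h) S (beta H)"
    using quasi_hopf_algebra.antipode_beta[OF quasi_hopf]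
    by (simp add: I.beta_pair_def antipode_anti algebra_maps_id pairing_def)
  moreover have "tsum3 k H H H H (reassoc H) (\<lambda>X1 X2 X3. X1 \<otimes>\<^bsub>H\<^esub> beta H \<otimes>\<^bsub>H\<^esub> S X2 \<otimes>\<^bsub>H\<^esub> alpha H \<otimes>\<^bsub>H\<^esub> X3) =
      pairing3 k H H H H (\<lambda>h. h \<otimes>\<^bsub>H\<^esub> beta H) (\<lambda>h. S h \<otimes>\<^bsub>H\<^esub> alpha H) (\<lambda>h. h) (reassoc H)"
    by (rule tsum3_eq_pairing3[OF H H H H b Sa linear_maps_id]) (simp add: I.T.m_assoc S(4))
  moreover have "tsum3 k H H H H (inv\<^bsub>H3\<^esub> reassoc H) (\<lambda>x1 x2 x3. S x1 \<otimes>\<^bsub>H\<^esub> alpha H \<otimes>\<^bsub>H\<^esub> x2 \<otimes>\<^bsub>H\<^esub> beta H \<otimes>\<^bsub>H\<^esub> S x3) =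
      pairing3 k H H H H (\<lambda>h. S h \<otimes>\<^bsub>H\<^esub> alpha H) (\<lambda>h. h \<otimes>\<^bsub>H\<^esub> beta H) S (inv\<^bsub>H3\<^esub> reassoc H)"
    by (rule tsum3_eq_pairing3[OF H H H H Sa b S(1)]) (simp add: I.T.m_assoc S(4))
  ultimately show ?thesis
    using quasi_hopf_algebra.reassoc_antipode[OF quasi_hopf] quasi_hopf_algebra.reassoc_inv_antipode[OF quasi_hopf]
    by (simp add: I.antipode_along_def)
qed

abbreviation "left \<equiv> inl k H H"
abbreviation "right \<equiv> inr k H H"

lemma commuting_antipodes:
  "commuting_antipodes k H H2 left (\<lambda>h. left (S h)) (left (alpha H)) (left (beta H))
    right (\<lambda>h. right (S h)) (right (alpha H)) (right (beta H))"
proof (intro commuting_antipodes.intro commuting_antipodes_axioms.intro B.hom_calculus_axioms)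
  show "B.antipode_along left (\<lambda>h. left (S h)) (left (alpha H)) (left (beta H))"
    using antipode_along_hom[OF I.hom_calculus_axioms B.hom_calculus_axioms inl_hom[OF H H] antipode_along_id] by simp
  show "B.antipode_along right (\<lambda>h. right (S h)) (right (alpha H)) (right (beta H))"
    using antipode_along_hom[OF I.hom_calculus_axioms B.hom_calculus_axioms inr_hom[OF H H] antipode_along_id] by simp
  fix x y
  assume "x \<in> left ` carrier H \<union> (\<lambda>h. left (S h)) ` carrier H \<union> {left (alpha H), left (beta H)}"
    and "y \<in> right ` carrier H \<union> (\<lambda>h. right (S h)) ` carrier H \<union> {right (alpha H), right (beta H)}"
  then have "x \<in> left ` carrier H" "y \<in> right ` carrier H"
    using S(4) by auto
  then obtain u v where "u \<in> carrier H" "x = left u" "v \<in> carrier H" "y = right v"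
    by blast
  then show "x \<otimes>\<^bsub>H2\<^esub> y = y \<otimes>\<^bsub>H2\<^esub> x"
    using commutingD[OF inl_inr_commuting[OF H H]] by simp
qed

sublocale C: commuting_antipodes k H "H \<boxtimes>\<^bsub>k\<^esub> H" left "\<lambda>h. left (S h)" "left (alpha H)" "left (beta H)"
    right "\<lambda>h. right (S h)" "right (alpha H)" "right (beta H)"
  by (rule commuting_antipodes)

text \<open>\<open>S \<otimes> S\<close> after the opposite comultiplication: the first leg is sent
  to the right factor and the second to the left one.\<close>

definition "S2 = B.conv (\<lambda>h. right (S h)) (\<lambda>h. left (S h))"
definition "D = B.conv left right"

lemma D_eq_comult: "h \<in> carrier H \<Longrightarrow> D h = comult H h"
  unfolding D_def B.conv_def by (rule pairing_inl_inr[OF H H I.comult_closed])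

lemma D_hom: "D \<in> algebra_maps k H H2"
  unfolding D_def by (rule C.D_ahom)

lemma antipode_along_S2: "B.antipode_along D S2 C.gamma C.delta"
  unfolding D_def S2_def by (rule C.antipode_along_tensor)

text \<open>Pushing the structure of \<open>H\<close> forward along \<Delta> gives the second
  antipode along the same map \<open>D\<close>, with constants \<open>\<Delta>(\<alpha>)\<close> and
  \<open>\<Delta>(\<beta>)\<close>.\<close>

lemma antipode_along_comult: "B.antipode_along D (\<lambda>h. D (S h)) (D (alpha H)) (D (beta H))"
  using antipode_along_hom[OF I.hom_calculus_axioms B.hom_calculus_axioms D_hom antipode_along_id] by simp

lemma S2_eq: "S2 h = tsum k H H H2 (comult H h) (\<lambda>h1 h2. pure k H H (S h2) (S h1))"
  unfolding S2_def B.conv_def pairing_def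
  by (rule tsum_cong) (simp add: inl_def inr_def pure_mult_pure[OF H H] S(4))

text \<open>An element of the fourfold tensor product is its own value along the four slots. This is
  how the ingredients of \<open>drinfeld_gamma\<close> become values \<open>Phi\<close> and
  \<open>Psi\<close>.\<close>

lemma append_one_reassoc: "append_one k H H H H (reassoc H) = C.X4.Phi C.r1 C.r2 C.r3"
  using pairing4_append_one(1,2)[OF H H H H C.HHHH C.r_linear algebra_maps_one[OF C.r(4)] I.reassoc_closed]
  by (simp add: pairing4_slots[OF H H H H] C.X4.Phi_def)

lemma expand_left_reassoc_inv:
  "expand_left k H H2 H H (comult H) (inv\<^bsub>H3\<^esub> reassoc H) = C.X4.Psi (C.X4.conv C.r1 C.r2) C.r3 C.r4"
proof -
  note lm = pairing_linear[OF H H C.HHHH C.r_linear(3,4)]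
  show ?thesis
    using pairing_expand_left[OF H HH H H I.comult_linear C.HHHH C.r_linear(1,2) lm I.reassoc_inv_closed]
      linear_maps_closed[OF expand_left_linear[OF H HH H H I.comult_linear] I.reassoc_inv_closed]
    by (simp add: pairing4_slots[OF H H H H] C.X4.Psi_def C.X4.conv_def)
qed

lemma drinfeld_gamma_eq: "drinfeld_gamma k H = C.gamma"
  unfolding drinfeld_gamma_def C.gamma_def C.G_def append_one_reassoc expand_left_reassoc_inv C.A4_def[symmetric]
  by (rule tsum4_eq_pairing4[OF H H H H HH C.lins_mult(4,3) C.lins(1,2)])
    (simp add: inl_def inr_def pure_mult_pure[OF H H] S(4) I.T.m_assoc)

text \<open>The formula for \<open>f\<close> has the shape of \<open>twist\<close>, with
  \<open>S2\<close> and \<gamma> from the first antipode and \<open>\<Delta>(\<beta>)\<close> and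
  \<open>\<Delta> \<circ> S\<close> from the second. It only remains to split \<Delta> of the
  product \<open>x^2 \<beta> S(x^3)\<close>.\<close>

lemma drinfeld_twist_eq: "drinfeld_twist k H = B.twist D S2 C.gamma (D (beta H)) (\<lambda>h. D (S h))"
  unfolding drinfeld_twist_def B.twist_def drinfeld_gamma_eq S2_eq[symmetric]
proof (rule tsum3_eq_pairing3[OF H H H HH])
  have c: "B.anti S2" "B.ahom D" "D (beta H) \<in> carrier H2" "B.anti (\<lambda>h. D (S h))"
    using antipode_along_S2 antipode_along_comult
    by (simp_all add: B.antipode_along_def B.alpha_pair_def B.beta_pair_def)
  show "(\<lambda>h. S2 h \<otimes>\<^bsub>H2\<^esub> C.gamma) \<in> linear_maps k H H2"
    by (rule B.ahom_mult_linear[OF B.antiD(1)[OF c(1)] C.gamma_closed])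
  show "(\<lambda>h. D h \<otimes>\<^bsub>H2\<^esub> D (beta H)) \<in> linear_maps k H H2"
    by (rule B.ahom_mult_linear[OF B.ahom_linear[OF c(2)] c(3)])
  show "(\<lambda>h. D (S h)) \<in> linear_maps k H H2"
    by (rule B.antiD(1)[OF c(4)])
  show "S2 x \<otimes>\<^bsub>H2\<^esub> C.gamma \<otimes>\<^bsub>H2\<^esub> comult H (y \<otimes>\<^bsub>H\<^esub> beta H \<otimes>\<^bsub>H\<^esub> S z) =
      S2 x \<otimes>\<^bsub>H2\<^esub> C.gamma \<otimes>\<^bsub>H2\<^esub> (D y \<otimes>\<^bsub>H2\<^esub> D (beta H) \<otimes>\<^bsub>H2\<^esub> D (S z))"
    if "x \<in> carrier H" "y \<in> carrier H" "z \<in> carrier H" for x y z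
    using that by (simp add: S(4) algebra_maps_mult[OF D_hom] flip: D_eq_comult)
qed

theorem drinfeld_twist_unit: "drinfeld_twist k H \<in> Units H2"
  unfolding drinfeld_twist_eq by (rule B.twist_Units[OF antipode_along_S2 antipode_along_comult])

theorem drinfeld_twist_antipode:
  assumes h: "h \<in> carrier H"
  shows "drinfeld_twist k H \<otimes>\<^bsub>H2\<^esub> comult H (S h) = S2 h \<otimes>\<^bsub>H2\<^esub> drinfeld_twist k H"
  using B.twist_intertwines[of D S2 C.gamma "\<lambda>h. D (S h)" "D (beta H)" h] antipode_along_S2 antipode_along_comult h
  by (simp add: drinfeld_twist_eq D_eq_comult S(4) B.antipode_along_def)

end

section \<open>Bicomodule algebras evaluated in an algebra\<close>

locale bicomodule_calculus = hom_calculus k H T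
  for k :: "('k, 'c) ring_scheme" and H :: "('k, 'h, 'm) qbialg_scheme" and T :: "('k, 't, 'p) module_scheme" (structure) +
  fixes A :: "('k, 'a, 'n) module_scheme" and lam :: "'a \<Rightarrow> ('k, 'h, 'a) tens" and \<rho> :: "'a \<Rightarrow> ('k, 'a, 'h) tens"
    and \<Phi>l :: "('k, 'h, ('k, 'h, 'a) tens) tens" and \<Phi>\<rho> :: "('k, 'a, ('k, 'h, 'h) tens) tens"
    and \<Phi>l\<rho> :: "('k, 'h, ('k, 'a, 'h) tens) tens"
  assumes bicomodule: "bicomodule_algebra k H A lam \<rho> \<Phi>l \<Phi>\<rho> \<Phi>l\<rho>"
begin

lemma left_comodule: "left_comodule_algebra k H A lam \<Phi>l" and right_comodule: "right_comodule_algebra k H A \<rho> \<Phi>\<rho>"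
  by (rule bicomodule_algebra.axioms[OF bicomodule])+

lemma A: "assoc_algebra k A"
  by (rule left_comodule_algebra.axioms(2)[OF left_comodule])

sublocale A: ring A by (rule assoc_algebra_ring[OF A])

lemmas HA = assoc_algebra_tensor[OF H A] and AH = assoc_algebra_tensor[OF A H]
lemmas HHA = assoc_algebra_tensor[OF H HA] and AHH = assoc_algebra_tensor[OF A HH] and HAH = assoc_algebra_tensor[OF H AH]

lemma lam_hom: "lam \<in> algebra_maps k A (H \<boxtimes>\<^bsub>k\<^esub> A)" and rho_hom: "\<rho> \<in> algebra_maps k A (A \<boxtimes>\<^bsub>k\<^esub> H)"
  by (rule left_comodule_algebra.coact_algebra_map[OF left_comodule] right_comodule_algebra.coact_algebra_map[OF right_comodule])+

lemma Phi_Units: "\<Phi>l \<in> Units (H \<boxtimes>\<^bsub>k\<^esub> H \<boxtimes>\<^bsub>k\<^esub> A)" "\<Phi>\<rho> \<in> Units (A \<boxtimes>\<^bsub>k\<^esub> H2)" "\<Phi>l\<rho> \<in> Units (H \<boxtimes>\<^bsub>k\<^esub> A \<boxtimes>\<^bsub>k\<^esub> H)"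
  by (rule left_comodule_algebra.reassoc_unit[OF left_comodule] right_comodule_algebra.reassoc_unit[OF right_comodule]
      bicomodule_algebra.mixed_unit[OF bicomodule])+

lemma Units_in: "assoc_algebra k X \<Longrightarrow> x \<in> Units X \<Longrightarrow> x \<in> carrier X \<and> inv\<^bsub>X\<^esub> x \<in> carrier X"
  using monoid.Units_inv_closed[of X x] ring.is_monoid[OF assoc_algebra_ring[of k X]] by (auto simp: Units_def)

lemma Phi_in [simp]: "\<Phi>l \<in> carrier (H \<boxtimes>\<^bsub>k\<^esub> H \<boxtimes>\<^bsub>k\<^esub> A)" "\<Phi>\<rho> \<in> carrier (A \<boxtimes>\<^bsub>k\<^esub> H2)" "\<Phi>l\<rho> \<in> carrier (H \<boxtimes>\<^bsub>k\<^esub> A \<boxtimes>\<^bsub>k\<^esub> H)"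
  "inv\<^bsub>A \<boxtimes>\<^bsub>k\<^esub> H2\<^esub> \<Phi>\<rho> \<in> carrier (A \<boxtimes>\<^bsub>k\<^esub> H2)" "inv\<^bsub>H \<boxtimes>\<^bsub>k\<^esub> A \<boxtimes>\<^bsub>k\<^esub> H\<^esub> \<Phi>l\<rho> \<in> carrier (H \<boxtimes>\<^bsub>k\<^esub> A \<boxtimes>\<^bsub>k\<^esub> H)"
  using Units_in[OF HHA Phi_Units(1)] Units_in[OF AHH Phi_Units(2)] Units_in[OF HAH Phi_Units(3)] by simp_all

lemmas lam_linear = algebra_maps_linear[OF lam_hom] and rho_linear = algebra_maps_linear[OF rho_hom]
lemmas lam_closed = algebra_maps_closed[OF lam_hom] and rho_closed = algebra_maps_closed[OF rho_hom]

definition lact (infixr \<open>\<rhd>\<close> 71) where "i \<rhd> a = (\<lambda>u. pairing k H A T i a (lam u))"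
definition ract (infixl \<open>\<lhd>\<close> 71) where "a \<lhd> i = (\<lambda>u. pairing k A H T a i (\<rho> u))"
definition "Pl i j a = pairing3 k H H A T i j a \<Phi>l"
definition "Pr a i j = pairing3 k A H H T a i j \<Phi>\<rho>"
definition "Pr' a i j = pairing3 k A H H T a i j (inv\<^bsub>A \<boxtimes>\<^bsub>k\<^esub> H2\<^esub> \<Phi>\<rho>)"
definition "M i a j = pairing3 k H A H T i a j \<Phi>l\<rho>"
definition "M' i a j = pairing3 k H A H T i a j (inv\<^bsub>H \<boxtimes>\<^bsub>k\<^esub> A \<boxtimes>\<^bsub>k\<^esub> H\<^esub> \<Phi>l\<rho>)"

abbreviation "ahomA a \<equiv> a \<in> algebra_maps k A T"
abbreviation "cmHA i a \<equiv> commuting T H A i a"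
abbreviation "cmAH a i \<equiv> commuting T A H a i"

lemma ahomA_linear [simp]: "ahomA a \<Longrightarrow> a \<in> linear_maps k A T"
  by (rule algebra_maps_linear)

lemma lact_hom [simp]: "\<lbrakk>ahom i; ahomA a; cmHA i a\<rbrakk> \<Longrightarrow> ahomA (i \<rhd> a)"
  unfolding lact_def by (rule algebra_maps_comp[OF lam_hom pairing_hom[OF H A T]])

lemma ract_hom [simp]: "\<lbrakk>ahom i; ahomA a; cmAH a i\<rbrakk> \<Longrightarrow> ahomA (a \<lhd> i)"
  unfolding ract_def by (rule algebra_maps_comp[OF rho_hom pairing_hom[OF A H T]])

lemma lact_commuting [simp]:
  "\<lbrakk>ahom i; ahomA a; l \<in> linear_maps k C T; commuting T H C i l; commuting T A C a l\<rbrakk> \<Longrightarrow> commuting T A C (i \<rhd> a) l"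
  "\<lbrakk>ahom i; ahomA a; l \<in> linear_maps k C T; commuting T C H l i; commuting T C A l a\<rbrakk> \<Longrightarrow> commuting T C A l (i \<rhd> a)"
proof -
  show 1: "commuting T A C (i \<rhd> a) l" if "ahom i" "ahomA a" "l \<in> linear_maps k C T" "commuting T H C i l" "commuting T A C a l"
    unfolding lact_def using that
    by (intro commuting_comp[OF commuting_pairing[OF H A T] lam_linear]) (auto intro: algebra_maps_linear)
  show "commuting T C A l (i \<rhd> a)" if "ahom i" "ahomA a" "l \<in> linear_maps k C T" "commuting T C H l i" "commuting T C A l a"
    using that by (intro commuting_sym[OF 1]) (auto intro: commuting_sym)
qed

lemma ract_commuting [simp]:
  "\<lbrakk>ahom i; ahomA a; l \<in> linear_maps k C T; commuting T H C i l; commuting T A C a l\<rbrakk> \<Longrightarrow> commuting T A C (a \<lhd> i) l"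
  "\<lbrakk>ahom i; ahomA a; l \<in> linear_maps k C T; commuting T C H l i; commuting T C A l a\<rbrakk> \<Longrightarrow> commuting T C A l (a \<lhd> i)"
proof -
  show 1: "commuting T A C (a \<lhd> i) l" if "ahom i" "ahomA a" "l \<in> linear_maps k C T" "commuting T H C i l" "commuting T A C a l"
    unfolding ract_def using that
    by (intro commuting_comp[OF commuting_pairing[OF A H T] rho_linear]) (auto intro: algebra_maps_linear)
  show "commuting T C A l (a \<lhd> i)" if "ahom i" "ahomA a" "l \<in> linear_maps k C T" "commuting T C H l i" "commuting T C A l a"
    using that by (intro commuting_sym[OF 1]) (auto intro: commuting_sym)
qed

lemma act_closed [simp]:
  "\<lbrakk>ahom i; ahomA a; u \<in> carrier A\<rbrakk> \<Longrightarrow> (i \<rhd> a) u \<in> carrier T"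
  "\<lbrakk>ahom i; ahomA a; u \<in> carrier A\<rbrakk> \<Longrightarrow> (a \<lhd> i) u \<in> carrier T"
  unfolding lact_def ract_def
  by (simp_all add: linear_maps_closed[OF pairing_linear[OF H A T]] linear_maps_closed[OF pairing_linear[OF A H T]] lam_closed rho_closed)

lemma P_closed [simp]:
  "\<lbrakk>ahom i; ahom j; ahomA a\<rbrakk> \<Longrightarrow> Pl i j a \<in> carrier T"
  "\<lbrakk>ahom i; ahom j; ahomA a\<rbrakk> \<Longrightarrow> Pr a i j \<in> carrier T"
  "\<lbrakk>ahom i; ahom j; ahomA a\<rbrakk> \<Longrightarrow> Pr' a i j \<in> carrier T"
  "\<lbrakk>ahom i; ahom j; ahomA a\<rbrakk> \<Longrightarrow> M i a j \<in> carrier T"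
  "\<lbrakk>ahom i; ahom j; ahomA a\<rbrakk> \<Longrightarrow> M' i a j \<in> carrier T"
  unfolding Pl_def Pr_def Pr'_def M_def M'_def
  by (simp_all add: linear_maps_closed[OF pairing3_linear[OF H H A T]] linear_maps_closed[OF pairing3_linear[OF A H H T]]
      linear_maps_closed[OF pairing3_linear[OF H A H T]])

lemma P_inverse [simp]:
  "\<lbrakk>ahom i; ahom j; ahomA a; cmHA i a; cm i j; cmAH a j\<rbrakk> \<Longrightarrow> M i a j \<otimes> M' i a j = \<one>"
  "\<lbrakk>ahom i; ahom j; ahomA a; cmHA i a; cm i j; cmAH a j\<rbrakk> \<Longrightarrow> M' i a j \<otimes> M i a j = \<one>"
  "\<lbrakk>ahom i; ahom j; ahomA a; cmAH a i; cm i j; cmAH a j\<rbrakk> \<Longrightarrow> Pr a i j \<otimes> Pr' a i j = \<one>"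
  "\<lbrakk>ahom i; ahom j; ahomA a; cmAH a i; cm i j; cmAH a j\<rbrakk> \<Longrightarrow> Pr' a i j \<otimes> Pr a i j = \<one>"
  unfolding M_def M'_def Pr_def Pr'_def
  using algebra_maps_inverse[OF pairing3_hom[OF H A H T] HAH Phi_Units(3)]
    algebra_maps_inverse[OF pairing3_hom[OF A H H T] AHH Phi_Units(2)]
  by blast+

lemma mixed_coassoc:
  assumes a: "ahom i" "ahomA a" "ahom j" and c: "cmHA i a" "cm i j" "cmAH a j" and u: "u \<in> carrier A"
  shows "M i a j \<otimes> ((i \<rhd> a) \<lhd> j) u = (i \<rhd> (a \<lhd> j)) u \<otimes> M i a j"
proof -
  let ?F = "pairing3 k H A H T i a j"
  note al = ahom_linear[OF a(1)] ahomA_linear[OF a(2)] ahom_linear[OF a(3)]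
  note F = pairing3_hom[OF H A H T a c]
  let ?x = "expand_left k A H H A lam (\<rho> u)" and ?m = "map_right k H A (A \<boxtimes>\<^bsub>k\<^esub> H) \<rho> (lam u)"
  have "?x \<in> carrier (H \<boxtimes>\<^bsub>k\<^esub> A \<boxtimes>\<^bsub>k\<^esub> H)" "?m \<in> carrier (H \<boxtimes>\<^bsub>k\<^esub> A \<boxtimes>\<^bsub>k\<^esub> H)"
    by (rule linear_maps_closed[OF expand_left_linear[OF A H H A lam_linear] rho_closed[OF u]]
        linear_maps_closed[OF map_right_linear[OF H A AH rho_linear] lam_closed[OF u]])+
  then have "?F \<Phi>l\<rho> \<otimes> ?F ?x = ?F ?m \<otimes> ?F \<Phi>l\<rho>"
    using bicomodule_algebra.mixed_coassoc[OF bicomodule u] by (simp flip: algebra_maps_mult[OF F])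
  moreover have "?F ?x = ((i \<rhd> a) \<lhd> j) u"
    by (simp add: pairing_expand_left[OF A H H A lam_linear T al rho_closed[OF u]] ract_def lact_def)
  moreover have "?F ?m = (i \<rhd> (a \<lhd> j)) u"
    by (simp add: pairing_map_right[OF H A AH rho_linear T al(1) pairing_linear[OF A H T al(2,3)] lam_closed[OF u]] ract_def lact_def)
  ultimately show ?thesis by (simp add: M_def)
qed

lemma right_coassoc:
  assumes a: "ahomA a" "ahom i" "ahom j" and c: "cmAH a i" "cmAH a j" "cm i j" and u: "u \<in> carrier A"
  shows "Pr a i j \<otimes> ((a \<lhd> i) \<lhd> j) u = (a \<lhd> (i \<star> j)) u \<otimes> Pr a i j"
proof -
  let ?F = "pairing3 k A H H T a i j"
  note al = ahomA_linear[OF a(1)] ahom_linear[OF a(2)] ahom_linear[OF a(3)]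
  note F = pairing3_hom[OF A H H T a c]
  let ?x = "expand_left k A H A H \<rho> (\<rho> u)" and ?m = "map_right k A H H2 (comult H) (\<rho> u)"
  have "?x \<in> carrier (A \<boxtimes>\<^bsub>k\<^esub> H2)" "?m \<in> carrier (A \<boxtimes>\<^bsub>k\<^esub> H2)"
    by (rule linear_maps_closed[OF expand_left_linear[OF A H A H rho_linear] rho_closed[OF u]]
        linear_maps_closed[OF map_right_linear[OF A H HH comult_linear] rho_closed[OF u]])+
  then have "?F \<Phi>\<rho> \<otimes> ?F ?x = ?F ?m \<otimes> ?F \<Phi>\<rho>"
    using right_comodule_algebra.quasi_coassoc[OF right_comodule u] by (simp flip: algebra_maps_mult[OF F])
  moreover have "?F ?x = ((a \<lhd> i) \<lhd> j) u"
    by (simp add: pairing_expand_left[OF A H A H rho_linear T al rho_closed[OF u]] ract_def)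
  moreover have "?F ?m = (a \<lhd> (i \<star> j)) u"
    by (simp add: pairing_map_right[OF A H HH comult_linear T al(1) pairing_linear[OF H H T al(2,3)] rho_closed[OF u]] ract_def conv_def)
  ultimately show ?thesis by (simp add: Pr_def)
qed

lemma mixed_pentagon_left:
  assumes a: "ahom i" "ahom j" "ahomA a" "ahom l"
    and c: "cm i j" "cmHA i a" "cm i l" "cmHA j a" "cm j l" "cmAH a l"
  shows "M j a l \<otimes> M i (j \<rhd> a) l \<otimes> Pl i j a = Pl i j (a \<lhd> l) \<otimes> M (i \<star> j) a l"
proof -
  let ?T4 = "H \<boxtimes>\<^bsub>k\<^esub> H \<boxtimes>\<^bsub>k\<^esub> A \<boxtimes>\<^bsub>k\<^esub> H"
  note HHAH = assoc_algebra_tensor[OF H HAH]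
  let ?F = "pairing4 k H H A H T i j a l"
  note al = a[THEN algebra_maps_linear]
  note F = pairing4_hom[OF H H A H T a c]
  note al2 = pairing_linear[OF A H T al(3,4)]
  note jal = pairing_linear[OF H AH T al(2) al2]
  note ex = expand_left_linear[OF A H H A lam_linear]
  note mr = map_right_linear[OF H A AH rho_linear]
  let ?a = "pure k H (H \<boxtimes>\<^bsub>k\<^esub> A \<boxtimes>\<^bsub>k\<^esub> H) \<one>\<^bsub>H\<^esub> \<Phi>l\<rho>"
  let ?b = "map_right k H (A \<boxtimes>\<^bsub>k\<^esub> H) (H \<boxtimes>\<^bsub>k\<^esub> A \<boxtimes>\<^bsub>k\<^esub> H) (expand_left k A H H A lam) \<Phi>l\<rho>"
  let ?c = "append_one k H H A H \<Phi>l"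
  let ?d = "map_right k H (H \<boxtimes>\<^bsub>k\<^esub> A) (H \<boxtimes>\<^bsub>k\<^esub> A \<boxtimes>\<^bsub>k\<^esub> H) (map_right k H A (A \<boxtimes>\<^bsub>k\<^esub> H) \<rho>) \<Phi>l"
  let ?e = "expand_left k H (A \<boxtimes>\<^bsub>k\<^esub> H) H H (comult H) \<Phi>l\<rho>"
  interpret T4: ring ?T4 by (rule assoc_algebra_ring[OF HHAH])
  note cl = pure_carrier[OF H HAH H.one_closed Phi_in(3)]
    linear_maps_closed[OF map_right_linear[OF H AH HAH ex] Phi_in(3)]
    pairing4_append_one(1)[OF H H A H T al algebra_maps_one[OF a(4)] Phi_in(1)]
    linear_maps_closed[OF map_right_linear[OF H HA HAH mr] Phi_in(1)]
    linear_maps_closed[OF expand_left_linear[OF H AH H H comult_linear] Phi_in(3)]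
  have "?F (?a \<otimes>\<^bsub>?T4\<^esub> ?b \<otimes>\<^bsub>?T4\<^esub> ?c) = ?F (?d \<otimes>\<^bsub>?T4\<^esub> ?e)"
    by (simp add: bicomodule_algebra.mixed_pentagon_left[OF bicomodule])
  then have "?F ?a \<otimes> ?F ?b \<otimes> ?F ?c = ?F ?d \<otimes> ?F ?e"
    using cl by (simp add: algebra_maps_mult[OF F])
  moreover have "?F ?a = M j a l"
    unfolding M_def by (rule pairing_pure_one[OF H HAH T a(1) jal Phi_in(3)])
  moreover have "?F ?b = M i (j \<rhd> a) l"
    unfolding M_def pairing_map_right[OF H AH HAH ex T al(1) jal Phi_in(3)]
    by (rule pairing_cong) (simp_all add: pairing_expand_left[OF A H H A lam_linear T al(2-4)] lact_def)
  moreover have "?F ?c = Pl i j a"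
    unfolding Pl_def by (rule pairing4_append_one(2)[OF H H A H T al algebra_maps_one[OF a(4)] Phi_in(1)])
  moreover have "?F ?d = Pl i j (a \<lhd> l)"
    unfolding Pl_def pairing_map_right[OF H HA HAH mr T al(1) jal Phi_in(1)]
    by (rule pairing_cong) (simp_all add: pairing_map_right[OF H A AH rho_linear T al(2) al2] ract_def)
  moreover have "?F ?e = M (i \<star> j) a l"
    unfolding M_def by (simp add: pairing_expand_left[OF H AH H H comult_linear T al(1,2) al2 Phi_in(3)] conv_def)
  ultimately show ?thesis by simp
qed

lemma mixed_pentagon_right:
  assumes a: "ahom i" "ahomA a" "ahom j" "ahom l"
    and c: "cmHA i a" "cm i j" "cm i l" "cmAH a j" "cmAH a l" "cm j l"
  shows "Pr a j l \<otimes> M i (a \<lhd> j) l \<otimes> M i a j = M i a (j \<star> l) \<otimes> Pr (i \<rhd> a) j l"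
proof -
  let ?T4 = "H \<boxtimes>\<^bsub>k\<^esub> A \<boxtimes>\<^bsub>k\<^esub> H2"
  note HAHH = assoc_algebra_tensor[OF H AHH]
  let ?F = "pairing4 k H A H H T i a j l"
  note al = a[THEN algebra_maps_linear]
  note F = pairing4_hom[OF H A H H T a c]
  note jl = pairing_linear[OF H H T al(3,4)]
  note ajl = pairing_linear[OF A HH T al(2) jl]
  note ex = expand_left_linear[OF A H A H rho_linear]
  note mr = map_right_linear[OF A H HH comult_linear]
  let ?a = "pure k H (A \<boxtimes>\<^bsub>k\<^esub> H2) \<one>\<^bsub>H\<^esub> \<Phi>\<rho>"
  let ?b = "map_right k H (A \<boxtimes>\<^bsub>k\<^esub> H) (A \<boxtimes>\<^bsub>k\<^esub> H2) (expand_left k A H A H \<rho>) \<Phi>l\<rho>"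
  let ?c = "append_one k H A H H \<Phi>l\<rho>"
  let ?d = "map_right k H (A \<boxtimes>\<^bsub>k\<^esub> H) (A \<boxtimes>\<^bsub>k\<^esub> H2) (map_right k A H H2 (comult H)) \<Phi>l\<rho>"
  let ?e = "expand_left k A H2 H A lam \<Phi>\<rho>"
  interpret T4: ring ?T4 by (rule assoc_algebra_ring[OF HAHH])
  note cl = pure_carrier[OF H AHH H.one_closed Phi_in(2)]
    linear_maps_closed[OF map_right_linear[OF H AH AHH ex] Phi_in(3)]
    pairing4_append_one(1)[OF H A H H T al algebra_maps_one[OF a(4)] Phi_in(3)]
    linear_maps_closed[OF map_right_linear[OF H AH AHH mr] Phi_in(3)]
    linear_maps_closed[OF expand_left_linear[OF A HH H A lam_linear] Phi_in(2)]
  have "?F (?a \<otimes>\<^bsub>?T4\<^esub> ?b \<otimes>\<^bsub>?T4\<^esub> ?c) = ?F (?d \<otimes>\<^bsub>?T4\<^esub> ?e)"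
    by (simp add: bicomodule_algebra.mixed_pentagon_right[OF bicomodule])
  then have "?F ?a \<otimes> ?F ?b \<otimes> ?F ?c = ?F ?d \<otimes> ?F ?e"
    using cl by (simp add: algebra_maps_mult[OF F])
  moreover have "?F ?a = Pr a j l"
    unfolding Pr_def by (rule pairing_pure_one[OF H AHH T a(1) ajl Phi_in(2)])
  moreover have "?F ?b = M i (a \<lhd> j) l"
    unfolding M_def pairing_map_right[OF H AH AHH ex T al(1) ajl Phi_in(3)]
    by (rule pairing_cong) (simp_all add: pairing_expand_left[OF A H A H rho_linear T al(2-4)] ract_def)
  moreover have "?F ?c = M i a j"
    unfolding M_def by (rule pairing4_append_one(2)[OF H A H H T al algebra_maps_one[OF a(4)] Phi_in(3)])
  moreover have "?F ?d = M i a (j \<star> l)"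
    unfolding M_def pairing_map_right[OF H AH AHH mr T al(1) ajl Phi_in(3)]
    by (rule pairing_cong) (simp_all add: pairing_map_right[OF A H HH comult_linear T al(2) jl] conv_def)
  moreover have "?F ?e = Pr (i \<rhd> a) j l"
    unfolding Pr_def by (simp add: pairing_expand_left[OF A HH H A lam_linear T al(1,2) jl Phi_in(2)] lact_def)
  ultimately show ?thesis by simp
qed

lemma M_cong:
  assumes "\<And>h. h \<in> carrier H \<Longrightarrow> i h = i' h" "\<And>u. u \<in> carrier A \<Longrightarrow> a u = a' u" "\<And>h. h \<in> carrier H \<Longrightarrow> j h = j' h"
  shows "M i a j = M i' a' j'" "M' i a j = M' i' a' j'"
  unfolding M_def M'_def by (intro pairing_cong assms; simp)+

lemma eps_lact:
  assumes a: "ahomA a" and u: "u \<in> carrier A"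
  shows "(eps \<rhd> a) u = a u"
proof -
  let ?e = "\<lambda>b. counit H b \<odot>\<^bsub>A\<^esub> \<one>\<^bsub>A\<^esub>"
  note al = algebra_maps_linear[OF a]
  have ae: "a (?e b) = eps b" if "b \<in> carrier H" for b
    using that by (simp add: eps_def linear_maps_smult[OF al] counit_closed algebra_maps_one[OF a])
  have "a u = a (contract_left k H A (counit H) (lam u))"
    using left_comodule_algebra.coact_counit[OF left_comodule u] by simp
  also have "\<dots> = pairing k H A T (\<lambda>b. a (?e b)) (\<lambda>b. a b) (lam u)"
    unfolding contract_left_eq_pairing[OF A algebra_maps_linear[OF counit]]
    by (rule hom_pairing[OF H A A T algebra_maps_linear[OF counit_one_hom[OF A]] linear_maps_id a lam_closed[OF u]])
  also have "\<dots> = (eps \<rhd> a) u"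
    unfolding lact_def by (rule pairing_cong) (simp_all add: ae)
  finally show ?thesis by simp
qed

lemma Pl_eps:
  assumes a: "ahom j" "ahomA a" and c: "cmHA j a"
  shows "Pl eps j a = \<one>"
proof -
  let ?e = "\<lambda>b. counit H b \<odot>\<^bsub>H \<boxtimes>\<^bsub>k\<^esub> A\<^esub> \<one>\<^bsub>H \<boxtimes>\<^bsub>k\<^esub> A\<^esub>"
  let ?F = "pairing k H A T j a"
  note F = pairing_hom[OF H A T a c]
  have Fe: "?F (?e b) = eps b" if "b \<in> carrier H" for b
    using that linear_maps_smult[OF algebra_maps_linear[OF F]] assoc_algebra_one_closed[OF HA]
    by (simp add: eps_def counit_closed algebra_maps_one[OF F])
  have "?F (contract_left k H (H \<boxtimes>\<^bsub>k\<^esub> A) (counit H) \<Phi>l) = pairing k H (H \<boxtimes>\<^bsub>k\<^esub> A) T (\<lambda>b. ?F (?e b)) (\<lambda>b. ?F b) \<Phi>l"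
    unfolding contract_left_eq_pairing[OF HA algebra_maps_linear[OF counit]]
    by (rule hom_pairing[OF H HA HA T algebra_maps_linear[OF counit_one_hom[OF HA]] linear_maps_id F Phi_in(1)])
  also have "\<dots> = Pl eps j a"
    unfolding Pl_def by (rule pairing_cong) (simp_all add: Fe)
  finally show ?thesis
    by (simp add: left_comodule_algebra.reassoc_counit_left[OF left_comodule] algebra_maps_one[OF F])
qed

text \<open>No axiom states a counit condition for the mixed reassociator. The left mixed pentagon
  with two counits makes this value idempotent, and it is invertible.\<close>

lemma M_eps:
  assumes a: "ahomA a" "ahom l" and c: "cmAH a l"
  shows "M eps a l = \<one>"
proof -
  have "M eps a l \<otimes> M eps (eps \<rhd> a) l \<otimes> Pl eps eps a = Pl eps eps (a \<lhd> l) \<otimes> M (eps \<star> eps) a l"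
    using a c by (intro mixed_pentagon_left) simp_all
  moreover have "M eps (eps \<rhd> a) l = M eps a l" "M (eps \<star> eps) a l = M eps a l"
    using a by (intro M_cong; simp add: eps_conv_left eps_lact)+
  ultimately have *: "M eps a l \<otimes> M eps a l = M eps a l"
    using a c by (simp add: Pl_eps)
  have "M eps a l = M eps a l \<otimes> M eps a l \<otimes> M' eps a l"
    using a c by (simp add: T.m_assoc)
  then show ?thesis using a c by (simp add: *)
qed

lemma twist_equation:
  assumes a: "ahom e1" "ahom e2" "ahomA a" "ahom e4" "ahom e5"
    and c: "cm e1 e2" "cm e1 e4" "cm e1 e5" "cm e2 e4" "cm e2 e5" "cm e4 e5"
      "cmHA e1 a" "cmHA e2 a" "cmHA e4 a" "cmHA e5 a"
    and fg: "f \<in> carrier T" "g \<in> carrier T" "g \<otimes> f = \<one>"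
  shows "M e2 a e4 \<otimes> M e1 ((e2 \<rhd> a) \<lhd> e4) e5 \<otimes>
      (M e1 (e2 \<rhd> a) e4 \<otimes> (Pl e1 e2 a \<otimes> (Pr' ((e1 \<star> e2) \<rhd> a) e4 e5 \<otimes> g))) \<otimes>
      (f \<otimes> (M' (e1 \<star> e2) a (e4 \<star> e5) \<otimes> g)) =
    M' e2 (a \<lhd> e4) e5 \<otimes> (Pr' a e4 e5 \<otimes> (Pl e1 e2 (a \<lhd> (e4 \<star> e5)) \<otimes> g))"
proof -
  note [simp] = a c c[THEN commuting_sym] fg
  let ?i = "e1 \<star> e2"
  let ?m = "M e2 a e4" and ?x = "M e1 ((e2 \<rhd> a) \<lhd> e4) e5" and ?x' = "M e1 (e2 \<rhd> (a \<lhd> e4)) e5"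
    and ?y = "M e1 (e2 \<rhd> a) e4" and ?p = "Pl e1 e2 a" and ?r = "Pr' (?i \<rhd> a) e4 e5"
    and ?n' = "M' ?i a (e4 \<star> e5)" and ?n = "M ?i a (e4 \<star> e5)" and ?q = "Pl e1 e2 (a \<lhd> e4)" and ?t = "M ?i a e4"
    and ?v = "M' ?i (a \<lhd> e4) e5" and ?s = "Pr' a e4 e5" and ?w = "M' e2 (a \<lhd> e4) e5"
    and ?z = "Pl e1 e2 ((a \<lhd> e4) \<lhd> e5)" and ?z' = "Pl e1 e2 (a \<lhd> (e4 \<star> e5))"
  \<comment> \<open>Mixed quasi-coassociativity exchanges the order in which \<open>e2\<close> and
    \<open>e4\<close> act on \<open>a\<close>, while \<open>e1\<close> and \<open>e5\<close> commute
    with \<open>?m\<close>.\<close>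
  have 1: "?m \<otimes> ?x = ?x' \<otimes> ?m"
    unfolding M_def[of e1]
  proof (rule pairing3_intertwine[OF H A H T])
    fix h assume "h \<in> carrier H"
    then show "?m \<otimes> e1 h = e1 h \<otimes> ?m" "?m \<otimes> e5 h = e5 h \<otimes> ?m"
      unfolding M_def
      by (intro pairing3_intertwine[OF H A H T, symmetric]; simp add: ahom_closed commutingD[of T H H e1] commutingD[of T H A e1] commutingD[of T H H e5] commutingD[of T H A e5])+
  qed (simp_all add: mixed_coassoc)
  have 2: "?m \<otimes> ?y \<otimes> ?p = ?q \<otimes> ?t"
    by (rule mixed_pentagon_left) simp_all
  have 3: "?t \<otimes> ?r = ?v \<otimes> ?s \<otimes> ?n"
    by (rule T.five_term(4)[of "Pr a e4 e5" "M ?i (a \<lhd> e4) e5" ?t ?n "Pr (?i \<rhd> a) e4 e5" ?s ?v "M' ?i a e4" ?n' ?r])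
      (simp_all add: mixed_pentagon_right)
  have 4: "?x' \<otimes> ?q \<otimes> ?v = ?w \<otimes> ?z"
  proof -
    have e: "M e2 (a \<lhd> e4) e5 \<otimes> ?x' \<otimes> ?q = ?z \<otimes> M ?i (a \<lhd> e4) e5"
      by (rule mixed_pentagon_left) simp_all
    have "?x' \<otimes> ?q \<otimes> ?v = (?w \<otimes> M e2 (a \<lhd> e4) e5) \<otimes> ?x' \<otimes> ?q \<otimes> ?v"
      by simp
    also have "\<dots> = ?w \<otimes> (M e2 (a \<lhd> e4) e5 \<otimes> ?x' \<otimes> ?q) \<otimes> ?v"
      by (simp add: T.m_assoc del: P_inverse)
    also have "\<dots> = ?w \<otimes> ?z \<otimes> (M ?i (a \<lhd> e4) e5 \<otimes> ?v)"
      unfolding e by (simp add: T.m_assoc del: P_inverse)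
    finally show ?thesis by simp
  qed
  have s: "?s \<otimes> (a \<lhd> (e4 \<star> e5)) u = ((a \<lhd> e4) \<lhd> e5) u \<otimes> ?s" if u: "u \<in> carrier A" for u
  proof -
    have "?s \<otimes> (a \<lhd> (e4 \<star> e5)) u = ?s \<otimes> ((a \<lhd> (e4 \<star> e5)) u \<otimes> Pr a e4 e5) \<otimes> ?s"
      using u by (simp add: T.m_assoc)
    also have "\<dots> = (?s \<otimes> Pr a e4 e5) \<otimes> ((a \<lhd> e4) \<lhd> e5) u \<otimes> ?s"
      using u by (simp add: T.m_assoc del: P_inverse flip: right_coassoc)
    finally show ?thesis using u by simp
  qed
  have 5: "?s \<otimes> ?z' = ?z \<otimes> ?s"
    unfolding Pl_def
  proof (rule pairing3_intertwine[OF H H A T])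
    fix h assume "h \<in> carrier H"
    then show "?s \<otimes> e1 h = e1 h \<otimes> ?s" "?s \<otimes> e2 h = e2 h \<otimes> ?s"
      unfolding Pr'_def
      by (intro pairing3_intertwine[OF A H H T, symmetric]; simp add: ahom_closed commutingD[of T H H e1] commutingD[of T H A e1] commutingD[of T H H e2] commutingD[of T H A e2])+
  qed (simp_all add: s)
  have "?m \<otimes> ?x \<otimes> (?y \<otimes> (?p \<otimes> (?r \<otimes> g))) \<otimes> (f \<otimes> (?n' \<otimes> g)) =
      (?m \<otimes> ?x) \<otimes> (?y \<otimes> ?p) \<otimes> ?r \<otimes> (g \<otimes> f) \<otimes> (?n' \<otimes> g)"
    by (simp add: T.m_assoc del: fg(3))
  also have "\<dots> = ?x' \<otimes> (?m \<otimes> ?y \<otimes> ?p) \<otimes> ?r \<otimes> (?n' \<otimes> g)"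
    unfolding 1 by (simp add: T.m_assoc)
  also have "\<dots> = ?x' \<otimes> ?q \<otimes> (?t \<otimes> ?r) \<otimes> (?n' \<otimes> g)"
    unfolding 2 by (simp add: T.m_assoc)
  also have "\<dots> = (?x' \<otimes> ?q \<otimes> ?v) \<otimes> ?s \<otimes> (?n \<otimes> ?n') \<otimes> g"
    unfolding 3 by (simp add: T.m_assoc del: P_inverse)
  also have "\<dots> = ?w \<otimes> (?z \<otimes> ?s) \<otimes> g"
    unfolding 4 by (simp add: T.m_assoc)
  finally show ?thesis
    unfolding 5[symmetric] by (simp add: T.m_assoc)
qed

end

text \<open>Meant for nested sums: the bound variables of each sum occupy one stretch of a product,
  between factors that are fixed for that sum. Once the summand is sorted, the sums can be removed
  by associativity alone.\<close>

lemma tsum_between: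
  assumes A: "assoc_algebra k A" and B: "assoc_algebra k B" and T: "assoc_algebra k T"
    and i: "i \<in> linear_maps k A T" and j: "j \<in> linear_maps k B T" and c: "c \<in> carrier T" and d: "d \<in> carrier T"
    and z: "z \<in> carrier (A \<boxtimes>\<^bsub>k\<^esub> B)"
    and g: "\<And>a b. \<lbrakk>a \<in> carrier A; b \<in> carrier B\<rbrakk> \<Longrightarrow> g a b = c \<otimes>\<^bsub>T\<^esub> (i a \<otimes>\<^bsub>T\<^esub> j b) \<otimes>\<^bsub>T\<^esub> d"
  shows "tsum k A B T z g = c \<otimes>\<^bsub>T\<^esub> pairing k A B T i j z \<otimes>\<^bsub>T\<^esub> d"
  by (rule tsum_unique[OF A B linear_maps_rmult[OF T linear_maps_lmult[OF T pairing_linear[OF A B T i j] c] d] _ z])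
    (simp add: pairing_pure[OF A B T i j] g)

lemma tsum3_between:
  assumes A: "assoc_algebra k A" and B: "assoc_algebra k B" and C: "assoc_algebra k C" and T: "assoc_algebra k T"
    and i: "i \<in> linear_maps k A T" and j: "j \<in> linear_maps k B T" and l: "l \<in> linear_maps k C T"
    and c: "c \<in> carrier T" and d: "d \<in> carrier T" and z: "z \<in> carrier (A \<boxtimes>\<^bsub>k\<^esub> B \<boxtimes>\<^bsub>k\<^esub> C)"
    and g: "\<And>x y w. \<lbrakk>x \<in> carrier A; y \<in> carrier B; w \<in> carrier C\<rbrakk> \<Longrightarrow>
      g x y w = c \<otimes>\<^bsub>T\<^esub> (i x \<otimes>\<^bsub>T\<^esub> (j y \<otimes>\<^bsub>T\<^esub> l w)) \<otimes>\<^bsub>T\<^esub> d"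
  shows "tsum3 k A B C T z g = c \<otimes>\<^bsub>T\<^esub> pairing3 k A B C T i j l z \<otimes>\<^bsub>T\<^esub> d"
  unfolding tsum3_def
proof (rule tsum_between[OF A assoc_algebra_tensor[OF B C] T i pairing_linear[OF B C T j l] c d z])
  interpret T: ring T by (rule assoc_algebra_ring[OF T])
  fix x y assume x: "x \<in> carrier A" and y: "y \<in> carrier (B \<boxtimes>\<^bsub>k\<^esub> C)"
  note cl = linear_maps_closed[OF i x] c d linear_maps_closed[OF pairing_linear[OF B C T j l] y]
  have "tsum k B C T y (\<lambda>b w. g x b w) = c \<otimes>\<^bsub>T\<^esub> i x \<otimes>\<^bsub>T\<^esub> pairing k B C T j l y \<otimes>\<^bsub>T\<^esub> d"
    by (rule tsum_between[OF B C T j l _ d y])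
      (simp_all add: g x cl T.m_assoc linear_maps_closed[OF j] linear_maps_closed[OF l])
  then show "tsum k B C T y (\<lambda>b w. g x b w) = c \<otimes>\<^bsub>T\<^esub> (i x \<otimes>\<^bsub>T\<^esub> pairing k B C T j l y) \<otimes>\<^bsub>T\<^esub> d"
    using cl by (simp add: T.m_assoc)
qed

section \<open>The two reassociators over \<open>H \<otimes> H^op\<close>, evaluated along five
  legs\<close>

context bicomodule_calculus
begin

context
  fixes e1 e2 a e4 e5 G0
  assumes a: "ahom e1" "ahom e2" "ahomA a" "ahom e4" "ahom e5"
    and c: "cm e1 e2" "cm e1 e4" "cm e1 e5" "cm e2 e4" "cm e2 e5" "cm e4 e5"
      "cmHA e1 a" "cmHA e2 a" "cmHA e4 a" "cmHA e5 a"
    and G0: "G0 \<in> carrier H2"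
  notes [simp] = a c c[THEN commuting_sym] G0 a[THEN algebra_maps_closed]
begin

lemmas h_mult = algebra_maps_mult[OF a(1)] algebra_maps_mult[OF a(2)] algebra_maps_mult[OF a(3)] algebra_maps_mult[OF a(4)]
  algebra_maps_mult[OF a(5)]

lemma swap:
  assumes "commuting T X Y i j" "x \<in> carrier X" "y \<in> carrier Y" "i x \<in> carrier T" "j y \<in> carrier T"
  shows "j y \<otimes> i x = i x \<otimes> j y" "z \<in> carrier T \<Longrightarrow> j y \<otimes> (i x \<otimes> z) = i x \<otimes> (j y \<otimes> z)"
  using commutingD[OF assms(1-3)] assms(4,5) by (simp_all flip: T.m_assoc)

text \<open>Sorting rules for products of leg values, with the order \<open>e1\<close>,
  \<open>e2\<close>, \<open>a\<close>, \<open>e4\<close>, \<open>e5\<close>.\<close>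

lemmas h_sort = swap[OF c(1)] swap[OF c(2)] swap[OF c(3)] swap[OF c(4)] swap[OF c(5)] swap[OF c(6)]
  swap[OF c(7)] swap[OF c(8)] swap[OF commuting_sym[OF c(9)]] swap[OF commuting_sym[OF c(10)]]

abbreviation "g45 \<equiv> pairing k H H T e4 e5 G0"

lemma g45_closed [simp]: "g45 \<in> carrier T"
  by (rule linear_maps_closed[OF pairing_linear[OF H H T] G0]) simp_all

text \<open>The summand is regrouped so that the variables of each sum stand together, and the sums
  are removed from the innermost outwards. \<open>G0\<close> is left open here; it will be the
  inverse of the Drinfeld twist.\<close>

lemma Phi1_eval:
  "tsum3 k H A H T \<Phi>l\<rho> (\<lambda>\<Theta>1 \<Theta>2 \<Theta>3.
     tsum k H A T (lam \<Theta>2) (\<lambda>\<Theta>2m \<Theta>2z.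
     tsum3 k H H A T \<Phi>l (\<lambda>X1 X2 X3.
     tsum3 k A H H T (inv\<^bsub>A \<boxtimes>\<^bsub>k\<^esub> H2\<^esub> \<Phi>\<rho>) (\<lambda>x1 x2 x3.
     tsum k H A T (lam x1) (\<lambda>x1m x1z.
     tsum k H H T (comult H x1m) (\<lambda>x1m1 x1m2.
     tsum k H H T G0 (\<lambda>g1 g2.
       e1 (\<Theta>1 \<otimes>\<^bsub>H\<^esub> X1 \<otimes>\<^bsub>H\<^esub> x1m1) \<otimes> e5 (x3 \<otimes>\<^bsub>H\<^esub> g2) \<otimes>
       (e2 (\<Theta>2m \<otimes>\<^bsub>H\<^esub> X2 \<otimes>\<^bsub>H\<^esub> x1m2) \<otimes> e4 (\<Theta>3 \<otimes>\<^bsub>H\<^esub> x2 \<otimes>\<^bsub>H\<^esub> g1) \<otimes> a (\<Theta>2z \<otimes>\<^bsub>A\<^esub> X3 \<otimes>\<^bsub>A\<^esub> x1z))))))))) =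
   M e1 (e2 \<rhd> a) e4 \<otimes> (Pl e1 e2 a \<otimes> (Pr' ((e1 \<star> e2) \<rhd> a) e4 e5 \<otimes> g45))"
  (is "tsum3 k H A H T _ ?f1 = _")
proof -
  define b where "b \<Theta>1 \<Theta>2m \<Theta>2z \<Theta>3 X1 X2 X3 x1m1 x1m2 x1z x2 x3 g1 g2 =
       e1 (\<Theta>1 \<otimes>\<^bsub>H\<^esub> X1 \<otimes>\<^bsub>H\<^esub> x1m1) \<otimes> e5 (x3 \<otimes>\<^bsub>H\<^esub> g2) \<otimes>
       (e2 (\<Theta>2m \<otimes>\<^bsub>H\<^esub> X2 \<otimes>\<^bsub>H\<^esub> x1m2) \<otimes> e4 (\<Theta>3 \<otimes>\<^bsub>H\<^esub> x2 \<otimes>\<^bsub>H\<^esub> g1) \<otimes> a (\<Theta>2z \<otimes>\<^bsub>A\<^esub> X3 \<otimes>\<^bsub>A\<^esub> x1z))"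
    for \<Theta>1 \<Theta>2m \<Theta>2z \<Theta>3 X1 X2 X3 x1m1 x1m2 x1z x2 x3 g1 g2
  let ?i = "e1 \<star> e2"
  let ?R = "Pr' (?i \<rhd> a) e4 e5"
  let ?A = "\<lambda>t1 t2m t2z t3. e1 t1 \<otimes> (e2 t2m \<otimes> a t2z \<otimes> e4 t3)"
  let ?B = "\<lambda>X1 X2 X3. e1 X1 \<otimes> (e2 X2 \<otimes> a X3)"
  have b: "b t1 t2m t2z t3 X1 X2 X3 x11 x12 x1z x2 x3 g1 g2 =
      ?A t1 t2m t2z t3 \<otimes> ?B X1 X2 X3 \<otimes> (e1 x11 \<otimes> e2 x12 \<otimes> a x1z \<otimes> (e4 x2 \<otimes> e5 x3)) \<otimes> (e4 g1 \<otimes> e5 g2) \<otimes> \<one>"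
    if "t1 \<in> carrier H" "t2m \<in> carrier H" "t2z \<in> carrier A" "t3 \<in> carrier H" "X1 \<in> carrier H" "X2 \<in> carrier H" "X3 \<in> carrier A"
      "x11 \<in> carrier H" "x12 \<in> carrier H" "x1z \<in> carrier A" "x2 \<in> carrier H" "x3 \<in> carrier H" "g1 \<in> carrier H" "g2 \<in> carrier H"
    for t1 t2m t2z t3 X1 X2 X3 x11 x12 x1z x2 x3 g1 g2
    using that by (simp add: b_def h_mult T.m_assoc h_sort)
  have s7: "tsum k H H T G0 (b t1 t2m t2z t3 X1 X2 X3 x11 x12 x1z x2 x3) =
      ?A t1 t2m t2z t3 \<otimes> ?B X1 X2 X3 \<otimes> (e1 x11 \<otimes> e2 x12 \<otimes> a x1z \<otimes> (e4 x2 \<otimes> e5 x3)) \<otimes> g45 \<otimes> \<one>"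
    if "t1 \<in> carrier H" "t2m \<in> carrier H" "t2z \<in> carrier A" "t3 \<in> carrier H" "X1 \<in> carrier H" "X2 \<in> carrier H" "X3 \<in> carrier A"
      "x11 \<in> carrier H" "x12 \<in> carrier H" "x1z \<in> carrier A" "x2 \<in> carrier H" "x3 \<in> carrier H"
    for t1 t2m t2z t3 X1 X2 X3 x11 x12 x1z x2 x3
    by (rule tsum_between[OF H H T]) (simp_all add: that b)
  have s6: "tsum k H H T (comult H y) (\<lambda>x11 x12. tsum k H H T G0 (b t1 t2m t2z t3 X1 X2 X3 x11 x12 x1z x2 x3)) =
      ?A t1 t2m t2z t3 \<otimes> ?B X1 X2 X3 \<otimes> ?i y \<otimes> (a x1z \<otimes> (e4 x2 \<otimes> e5 x3) \<otimes> g45)"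
    if "t1 \<in> carrier H" "t2m \<in> carrier H" "t2z \<in> carrier A" "t3 \<in> carrier H" "X1 \<in> carrier H" "X2 \<in> carrier H" "X3 \<in> carrier A"
      "y \<in> carrier H" "x1z \<in> carrier A" "x2 \<in> carrier H" "x3 \<in> carrier H"
    for t1 t2m t2z t3 X1 X2 X3 y x1z x2 x3
    unfolding conv_def
    by (rule tsum_between[OF H H T]) (use that in \<open>simp_all add: s7 T.m_assoc comult_closed\<close>)
  have s5: "tsum k H A T (lam y) (\<lambda>x1m x1z. tsum k H H T (comult H x1m) (\<lambda>x11 x12. tsum k H H T G0 (b t1 t2m t2z t3 X1 X2 X3 x11 x12 x1z x2 x3))) =
      ?A t1 t2m t2z t3 \<otimes> ?B X1 X2 X3 \<otimes> (?i \<rhd> a) y \<otimes> (e4 x2 \<otimes> e5 x3 \<otimes> g45)"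
    if "t1 \<in> carrier H" "t2m \<in> carrier H" "t2z \<in> carrier A" "t3 \<in> carrier H" "X1 \<in> carrier H" "X2 \<in> carrier H" "X3 \<in> carrier A"
      "y \<in> carrier A" "x2 \<in> carrier H" "x3 \<in> carrier H"
    for t1 t2m t2z t3 X1 X2 X3 y x2 x3
    unfolding lact_def
    by (rule tsum_between[OF H A T]) (use that in \<open>simp_all add: s6 T.m_assoc lam_closed\<close>)
  have s4: "tsum3 k A H H T (inv\<^bsub>A \<boxtimes>\<^bsub>k\<^esub> H2\<^esub> \<Phi>\<rho>) (\<lambda>x1 x2 x3.
      tsum k H A T (lam x1) (\<lambda>x1m x1z. tsum k H H T (comult H x1m) (\<lambda>x11 x12. tsum k H H T G0 (b t1 t2m t2z t3 X1 X2 X3 x11 x12 x1z x2 x3)))) =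
      ?A t1 t2m t2z t3 \<otimes> ?B X1 X2 X3 \<otimes> ?R \<otimes> g45"
    if "t1 \<in> carrier H" "t2m \<in> carrier H" "t2z \<in> carrier A" "t3 \<in> carrier H" "X1 \<in> carrier H" "X2 \<in> carrier H" "X3 \<in> carrier A"
    for t1 t2m t2z t3 X1 X2 X3
    unfolding Pr'_def
    by (rule tsum3_between[OF A H H T]) (use that in \<open>simp_all add: s5 T.m_assoc\<close>)
  have s3: "tsum3 k H H A T \<Phi>l (\<lambda>X1 X2 X3. tsum3 k A H H T (inv\<^bsub>A \<boxtimes>\<^bsub>k\<^esub> H2\<^esub> \<Phi>\<rho>) (\<lambda>x1 x2 x3.
      tsum k H A T (lam x1) (\<lambda>x1m x1z. tsum k H H T (comult H x1m) (\<lambda>x11 x12. tsum k H H T G0 (b t1 t2m t2z t3 X1 X2 X3 x11 x12 x1z x2 x3))))) =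
      ?A t1 t2m t2z t3 \<otimes> Pl e1 e2 a \<otimes> (?R \<otimes> g45)"
    if "t1 \<in> carrier H" "t2m \<in> carrier H" "t2z \<in> carrier A" "t3 \<in> carrier H" for t1 t2m t2z t3
    unfolding Pl_def
    by (rule tsum3_between[OF H H A T]) (use that in \<open>simp_all add: s4 T.m_assoc\<close>)
  have s2: "tsum k H A T (lam y) (\<lambda>t2m t2z. tsum3 k H H A T \<Phi>l (\<lambda>X1 X2 X3. tsum3 k A H H T (inv\<^bsub>A \<boxtimes>\<^bsub>k\<^esub> H2\<^esub> \<Phi>\<rho>) (\<lambda>x1 x2 x3.
      tsum k H A T (lam x1) (\<lambda>x1m x1z. tsum k H H T (comult H x1m) (\<lambda>x11 x12. tsum k H H T G0 (b t1 t2m t2z t3 X1 X2 X3 x11 x12 x1z x2 x3)))))) =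
      e1 t1 \<otimes> (e2 \<rhd> a) y \<otimes> (e4 t3 \<otimes> (Pl e1 e2 a \<otimes> (?R \<otimes> g45)))"
    if "t1 \<in> carrier H" "y \<in> carrier A" "t3 \<in> carrier H" for t1 y t3
    unfolding lact_def[of e2]
    by (rule tsum_between[OF H A T]) (use that in \<open>simp_all add: s3 T.m_assoc lam_closed\<close>)
  have "tsum3 k H A H T \<Phi>l\<rho> ?f1 = \<one> \<otimes> M e1 (e2 \<rhd> a) e4 \<otimes> (Pl e1 e2 a \<otimes> (?R \<otimes> g45))"
    unfolding b_def[symmetric] M_def
    by (rule tsum3_between[OF H A H T]) (simp_all add: s2 T.m_assoc)
  then show ?thesis by simp
qed

lemma Phi2_eval:
  "tsum3 k H H A T \<Phi>l (\<lambda>X1 X2 X3.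
     tsum k A H T (\<rho> X3) (\<lambda>X3z X3p.
     tsum k H H T (comult H X3p) (\<lambda>X3p1 X3p2.
     tsum3 k H A H T (inv\<^bsub>H \<boxtimes>\<^bsub>k\<^esub> A \<boxtimes>\<^bsub>k\<^esub> H\<^esub> \<Phi>l\<rho>) (\<lambda>\<theta>1 \<theta>2 \<theta>3.
     tsum k A H T (\<rho> \<theta>2) (\<lambda>\<theta>2z \<theta>2p.
     tsum3 k A H H T (inv\<^bsub>A \<boxtimes>\<^bsub>k\<^esub> H2\<^esub> \<Phi>\<rho>) (\<lambda>x1 x2 x3.
     tsum k H H T G0 (\<lambda>g1 g2.
       e1 X1 \<otimes> e5 (\<theta>3 \<otimes>\<^bsub>H\<^esub> x3 \<otimes>\<^bsub>H\<^esub> X3p2 \<otimes>\<^bsub>H\<^esub> g2) \<otimes>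
       (e2 (\<theta>1 \<otimes>\<^bsub>H\<^esub> X2) \<otimes> e4 (\<theta>2p \<otimes>\<^bsub>H\<^esub> x2 \<otimes>\<^bsub>H\<^esub> X3p1 \<otimes>\<^bsub>H\<^esub> g1) \<otimes> a (\<theta>2z \<otimes>\<^bsub>A\<^esub> x1 \<otimes>\<^bsub>A\<^esub> X3z))))))))) =
   M' e2 (a \<lhd> e4) e5 \<otimes> (Pr' a e4 e5 \<otimes> (Pl e1 e2 (a \<lhd> (e4 \<star> e5)) \<otimes> g45))"
  (is "tsum3 k H H A T _ ?f1 = _")
proof -
  define b where "b X1 X2 X3z X3p1 X3p2 \<theta>1 \<theta>2z \<theta>2p \<theta>3 x1 x2 x3 g1 g2 =
       e1 X1 \<otimes> e5 (\<theta>3 \<otimes>\<^bsub>H\<^esub> x3 \<otimes>\<^bsub>H\<^esub> X3p2 \<otimes>\<^bsub>H\<^esub> g2) \<otimes>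
       (e2 (\<theta>1 \<otimes>\<^bsub>H\<^esub> X2) \<otimes> e4 (\<theta>2p \<otimes>\<^bsub>H\<^esub> x2 \<otimes>\<^bsub>H\<^esub> X3p1 \<otimes>\<^bsub>H\<^esub> g1) \<otimes> a (\<theta>2z \<otimes>\<^bsub>A\<^esub> x1 \<otimes>\<^bsub>A\<^esub> X3z))"
    for X1 X2 X3z X3p1 X3p2 \<theta>1 \<theta>2z \<theta>2p \<theta>3 x1 x2 x3 g1 g2
  \<comment> \<open>The sum over \<open>\<Phi>l\<close> is the outermost one, yet its factors stand
    to the right of those of the two inverse reassociators. They are kept together until the inner
    sums are gone.\<close>
  let ?C = "\<lambda>X1 X2 X3z p q. e1 X1 \<otimes> (e2 X2 \<otimes> (a X3z \<otimes> (e4 p \<otimes> e5 q)))"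
  let ?M = "M' e2 (a \<lhd> e4) e5" and ?R = "Pr' a e4 e5"
  have b: "b X1 X2 X3z p q t1 t2z t2p t3 x1 x2 x3 g1 g2 =
      e2 t1 \<otimes> (a t2z \<otimes> e4 t2p \<otimes> e5 t3) \<otimes> (a x1 \<otimes> (e4 x2 \<otimes> e5 x3)) \<otimes> ?C X1 X2 X3z p q \<otimes> (e4 g1 \<otimes> e5 g2) \<otimes> \<one>"
    if "X1 \<in> carrier H" "X2 \<in> carrier H" "X3z \<in> carrier A" "p \<in> carrier H" "q \<in> carrier H" "t1 \<in> carrier H" "t2z \<in> carrier A" "t2p \<in> carrier H"
      "t3 \<in> carrier H" "x1 \<in> carrier A" "x2 \<in> carrier H" "x3 \<in> carrier H" "g1 \<in> carrier H" "g2 \<in> carrier H"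
    for X1 X2 X3z p q t1 t2z t2p t3 x1 x2 x3 g1 g2
    using that by (simp add: b_def h_mult T.m_assoc h_sort)
  have s7: "tsum k H H T G0 (b X1 X2 X3z p q t1 t2z t2p t3 x1 x2 x3) =
      e2 t1 \<otimes> (a t2z \<otimes> e4 t2p \<otimes> e5 t3) \<otimes> (a x1 \<otimes> (e4 x2 \<otimes> e5 x3)) \<otimes> ?C X1 X2 X3z p q \<otimes> g45 \<otimes> \<one>"
    if "X1 \<in> carrier H" "X2 \<in> carrier H" "X3z \<in> carrier A" "p \<in> carrier H" "q \<in> carrier H" "t1 \<in> carrier H" "t2z \<in> carrier A" "t2p \<in> carrier H"
      "t3 \<in> carrier H" "x1 \<in> carrier A" "x2 \<in> carrier H" "x3 \<in> carrier H"
    for X1 X2 X3z p q t1 t2z t2p t3 x1 x2 x3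
    by (rule tsum_between[OF H H T]) (simp_all add: that b)
  have s6: "tsum3 k A H H T (inv\<^bsub>A \<boxtimes>\<^bsub>k\<^esub> H2\<^esub> \<Phi>\<rho>) (\<lambda>x1 x2 x3. tsum k H H T G0 (b X1 X2 X3z p q t1 t2z t2p t3 x1 x2 x3)) =
      e2 t1 \<otimes> (a t2z \<otimes> e4 t2p \<otimes> e5 t3) \<otimes> ?R \<otimes> (?C X1 X2 X3z p q \<otimes> g45)"
    if "X1 \<in> carrier H" "X2 \<in> carrier H" "X3z \<in> carrier A" "p \<in> carrier H" "q \<in> carrier H" "t1 \<in> carrier H" "t2z \<in> carrier A" "t2p \<in> carrier H"
      "t3 \<in> carrier H"
    for X1 X2 X3z p q t1 t2z t2p t3
    unfolding Pr'_def
    by (rule tsum3_between[OF A H H T]) (use that in \<open>simp_all add: s7 T.m_assoc\<close>)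
  have s5: "tsum k A H T (\<rho> y) (\<lambda>t2z t2p. tsum3 k A H H T (inv\<^bsub>A \<boxtimes>\<^bsub>k\<^esub> H2\<^esub> \<Phi>\<rho>) (\<lambda>x1 x2 x3. tsum k H H T G0 (b X1 X2 X3z p q t1 t2z t2p t3 x1 x2 x3))) =
      e2 t1 \<otimes> (a \<lhd> e4) y \<otimes> (e5 t3 \<otimes> (?R \<otimes> (?C X1 X2 X3z p q \<otimes> g45)))"
    if "X1 \<in> carrier H" "X2 \<in> carrier H" "X3z \<in> carrier A" "p \<in> carrier H" "q \<in> carrier H" "t1 \<in> carrier H" "y \<in> carrier A" "t3 \<in> carrier H"
    for X1 X2 X3z p q t1 y t3
    unfolding ract_def
    by (rule tsum_between[OF A H T]) (use that in \<open>simp_all add: s6 T.m_assoc rho_closed\<close>)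
  have s4: "tsum3 k H A H T (inv\<^bsub>H \<boxtimes>\<^bsub>k\<^esub> A \<boxtimes>\<^bsub>k\<^esub> H\<^esub> \<Phi>l\<rho>) (\<lambda>t1 t2 t3. tsum k A H T (\<rho> t2) (\<lambda>t2z t2p.
      tsum3 k A H H T (inv\<^bsub>A \<boxtimes>\<^bsub>k\<^esub> H2\<^esub> \<Phi>\<rho>) (\<lambda>x1 x2 x3. tsum k H H T G0 (b X1 X2 X3z p q t1 t2z t2p t3 x1 x2 x3)))) =
      \<one> \<otimes> ?M \<otimes> (?R \<otimes> (?C X1 X2 X3z p q \<otimes> g45))"
    if "X1 \<in> carrier H" "X2 \<in> carrier H" "X3z \<in> carrier A" "p \<in> carrier H" "q \<in> carrier H" for X1 X2 X3z p q
    unfolding M'_def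
    by (rule tsum3_between[OF H A H T]) (use that in \<open>simp_all add: s5 T.m_assoc\<close>)
  have s3: "tsum k H H T (comult H y) (\<lambda>p q. tsum3 k H A H T (inv\<^bsub>H \<boxtimes>\<^bsub>k\<^esub> A \<boxtimes>\<^bsub>k\<^esub> H\<^esub> \<Phi>l\<rho>) (\<lambda>t1 t2 t3. tsum k A H T (\<rho> t2) (\<lambda>t2z t2p.
      tsum3 k A H H T (inv\<^bsub>A \<boxtimes>\<^bsub>k\<^esub> H2\<^esub> \<Phi>\<rho>) (\<lambda>x1 x2 x3. tsum k H H T G0 (b X1 X2 X3z p q t1 t2z t2p t3 x1 x2 x3))))) =
      ?M \<otimes> ?R \<otimes> (e1 X1 \<otimes> (e2 X2 \<otimes> a X3z)) \<otimes> (e4 \<star> e5) y \<otimes> g45"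
    if "X1 \<in> carrier H" "X2 \<in> carrier H" "X3z \<in> carrier A" "y \<in> carrier H" for X1 X2 X3z y
    unfolding conv_def
    by (rule tsum_between[OF H H T]) (use that in \<open>simp_all add: s4 T.m_assoc comult_closed\<close>)
  have s2: "tsum k A H T (\<rho> y) (\<lambda>X3z X3p. tsum k H H T (comult H X3p) (\<lambda>p q. tsum3 k H A H T (inv\<^bsub>H \<boxtimes>\<^bsub>k\<^esub> A \<boxtimes>\<^bsub>k\<^esub> H\<^esub> \<Phi>l\<rho>) (\<lambda>t1 t2 t3. tsum k A H T (\<rho> t2) (\<lambda>t2z t2p.
      tsum3 k A H H T (inv\<^bsub>A \<boxtimes>\<^bsub>k\<^esub> H2\<^esub> \<Phi>\<rho>) (\<lambda>x1 x2 x3. tsum k H H T G0 (b X1 X2 X3z p q t1 t2z t2p t3 x1 x2 x3)))))) =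
      ?M \<otimes> ?R \<otimes> (e1 X1 \<otimes> e2 X2) \<otimes> (a \<lhd> (e4 \<star> e5)) y \<otimes> g45"
    if "X1 \<in> carrier H" "X2 \<in> carrier H" "y \<in> carrier A" for X1 X2 y
    unfolding ract_def[of a "e4 \<star> e5"]
    by (rule tsum_between[OF A H T]) (use that in \<open>simp_all add: s3 T.m_assoc rho_closed\<close>)
  have "tsum3 k H H A T \<Phi>l ?f1 = ?M \<otimes> ?R \<otimes> Pl e1 e2 (a \<lhd> (e4 \<star> e5)) \<otimes> g45"
    unfolding b_def[symmetric] Pl_def
    by (rule tsum3_between[OF H H A T]) (simp_all add: s2 T.m_assoc)
  then show ?thesis by (simp add: T.m_assoc)
qed

end

end

section \<open>The quasi-bialgebra \<open>H \<otimes> H\<^sup>o\<^sup>p\<close>\<close>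

text \<open>\<open>env_qbialg\<close> and the tensor product of \<open>H\<close> with
  \<open>op_qbialg\<close> are records of different types with the same algebra fields, so facts are
  transported field by field.\<close>

lemma module_cong:
  assumes A: "module k A" and c: "carrier A' = carrier A" "add A' = add A" "\<zero>\<^bsub>A'\<^esub> = \<zero>\<^bsub>A\<^esub>" "smult A' = smult A"
  shows "module k A'"
proof -
  interpret A: module k A by fact
  have "abelian_group A'"
    using A.M.l_neg by (intro abelian_groupI) (auto simp: c A.M.a_ac)
  then show ?thesis
    using A c by (simp add: module_def module_axioms_def)
qed

lemma assoc_algebra_cong:
  assumes A: "assoc_algebra k A" and c: "carrier A' = carrier A" "add A' = add A" "\<zero>\<^bsub>A'\<^esub> = \<zero>\<^bsub>A\<^esub>" "smult A' = smult A"
    "mult A' = mult A" "\<one>\<^bsub>A'\<^esub> = \<one>\<^bsub>A\<^esub>"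
  shows "assoc_algebra k A'"
proof -
  note m = module_cong[OF assoc_algebra_module[OF A] c(1-4)]
  interpret A: ring A by (rule assoc_algebra_ring[OF A])
  have "ring A'"
  proof (rule ringI)
    show "abelian_group A'" by (rule module.axioms(2)[OF m])
    show "Group.monoid A'" by (rule monoidI) (simp_all add: c A.m_assoc)
  qed (simp_all add: c A.l_distr A.r_distr)
  moreover have "assoc_algebra_axioms k A'"
    unfolding assoc_algebra_axioms_def c
    by (simp add: assoc_algebra.smult_mult_left[OF A] assoc_algebra.smult_mult_right[OF A])
  ultimately show ?thesis
    by (intro assoc_algebra.intro m assoc_algebra_field[OF A])
qed

lemma assoc_algebra_op:
  fixes H :: "('k, 'h, 'm) qbialg_scheme"
  assumes A: "assoc_algebra k H"
  shows "assoc_algebra k (op_qbialg k H)"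
proof -
  interpret H: ring H by (rule assoc_algebra_ring[OF A])
  have f: "carrier (op_qbialg k H) = carrier H" "add (op_qbialg k H) = add H" "\<zero>\<^bsub>op_qbialg k H\<^esub> = \<zero>\<^bsub>H\<^esub>" "smult (op_qbialg k H) = smult H"
    by (simp_all add: op_qbialg_def)
  note m = module_cong[OF assoc_algebra_module[OF A] f]
  have "ring (op_qbialg k H)"
  proof (rule ringI)
    show "abelian_group (op_qbialg k H)" by (rule module.axioms(2)[OF m])
    show "Group.monoid (op_qbialg k H)" by (rule monoidI) (simp_all add: H.m_assoc)
  qed (simp_all add: H.l_distr H.r_distr)
  moreover have "assoc_algebra_axioms k (op_qbialg k H)"
    by (simp add: assoc_algebra_axioms_def assoc_algebra.smult_mult_left[OF A] assoc_algebra.smult_mult_right[OF A])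
  ultimately show ?thesis
    by (intro assoc_algebra.intro m assoc_algebra_field[OF A])
qed

lemma bilinear_null_cong:
  assumes "carrier V' = carrier V" "add V' = add V" "smult V' = smult V"
    "carrier W' = carrier W" "add W' = add W" "smult W' = smult W"
  shows "bilinear_null k V' W' = bilinear_null k V W"
  using assms by (simp add: bilinear_null_def bilinear_relations_def)

text \<open>Tensor space, pure tensors and sums ignore multiplication. They are therefore literally
  equal for \<open>H\<close> and its opposite, and for \<open>K\<close> and the underlying tensor
  product.\<close>

lemma tensor_space_cong:
  assumes "carrier V' = carrier V" "add V' = add V" "smult V' = smult V"
    "carrier W' = carrier W" "add W' = add W" "smult W' = smult W"
  shows "tensor_space k V' W' = tensor_space k V W" "pure k V' W' = pure k V W" "tsum k V' W' T = tsum k V W T"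
proof -
  note n = bilinear_null_cong[OF assms]
  show 1: "tensor_space k V' W' = tensor_space k V W" by (simp add: tensor_space_def n assms)
  show 2: "pure k V' W' = pure k V W" by (intro ext) (simp add: pure_def n assms)
  show "tsum k V' W' T = tsum k V W T" by (intro ext) (simp add: tsum_def 1 2 assms)
qed

lemma tensor_cong:
  assumes "carrier V' = carrier V" "add V' = add V" "smult V' = smult V" "mult V' = mult V" "\<one>\<^bsub>V'\<^esub> = \<one>\<^bsub>V\<^esub>"
    "carrier W' = carrier W" "add W' = add W" "smult W' = smult W" "mult W' = mult W" "\<one>\<^bsub>W'\<^esub> = \<one>\<^bsub>W\<^esub>"
  shows "V' \<boxtimes>\<^bsub>k\<^esub> W' = V \<boxtimes>\<^bsub>k\<^esub> W"
  using assms by (simp add: tensor_def tensor_space_cong[of V' V W' W])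

lemma env_qbialg_fields:
  fixes k :: "('k, 'c) ring_scheme" and H :: "('k, 'h, 'm) qbialg_scheme"
  defines "E \<equiv> H \<boxtimes>\<^bsub>k\<^esub> op_qbialg k H"
  shows "carrier (env_qbialg k H) = carrier E" "add (env_qbialg k H) = add E" "smult (env_qbialg k H) = smult E"
    "\<zero>\<^bsub>env_qbialg k H\<^esub> = \<zero>\<^bsub>E\<^esub>" "mult (env_qbialg k H) = mult E" "\<one>\<^bsub>env_qbialg k H\<^esub> = \<one>\<^bsub>E\<^esub>"
  by (simp_all add: env_qbialg_def tensor_qbialg_def Let_def module.extend_def qbialg.fields_def E_def)

lemma env_qbialg_maps:
  fixes H :: "('k, 'h, 'm) qbialg_scheme"
  shows "algebra_maps k X (env_qbialg k H) = algebra_maps k X (H \<boxtimes>\<^bsub>k\<^esub> op_qbialg k H)"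
    "algebra_maps k (env_qbialg k H) X = algebra_maps k (H \<boxtimes>\<^bsub>k\<^esub> op_qbialg k H) X"
    "commuting (env_qbialg k H) = (commuting (H \<boxtimes>\<^bsub>k\<^esub> op_qbialg k H) :: ('x, 'p) partial_object_scheme \<Rightarrow> ('y, 'q) partial_object_scheme \<Rightarrow> _)"
    "pairing k C D (env_qbialg k H) = pairing k C D (H \<boxtimes>\<^bsub>k\<^esub> op_qbialg k H)"
  by (simp_all add: algebra_maps_def linear_maps_def ring_hom_def env_qbialg_fields fun_eq_iff commuting_def pairing_def tsum_def)

lemma assoc_algebra_env:
  assumes "assoc_algebra k (H :: ('k, 'h, 'm) qbialg_scheme)"
  shows "assoc_algebra k (env_qbialg k H)"
  by (rule assoc_algebra_cong[OF assoc_algebra_tensor[OF assms assoc_algebra_op[OF assms]]])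
    (simp_all add: env_qbialg_fields)

text \<open>The definition speaks of the underlying tensor product and of the opposite algebra; here
  both are replaced by \<open>K\<close> and \<open>H\<close>, for which the calculus is set
  up.\<close>

lemma env_comult:
  fixes k :: "('k, 'c) ring_scheme" and H :: "('k, 'h, 'm) qbialg_scheme"
  defines "K \<equiv> env_qbialg k H"
  shows "comult K x = tsum k H (op_qbialg k H) (K \<boxtimes>\<^bsub>k\<^esub> K) x (\<lambda>h l.
    tsum k H H (K \<boxtimes>\<^bsub>k\<^esub> K) (comult H h) (\<lambda>h1 h2.
    tsum k H H (K \<boxtimes>\<^bsub>k\<^esub> K) (comult H l) (\<lambda>l1 l2.
      pure k K K (env_pure k H h1 l1) (env_pure k H h2 l2))))"
proof -
  let ?E = "H \<boxtimes>\<^bsub>k\<^esub> op_qbialg k H"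
  have "?E \<boxtimes>\<^bsub>k\<^esub> ?E = K \<boxtimes>\<^bsub>k\<^esub> K" unfolding K_def
    by (rule tensor_cong) (simp_all add: env_qbialg_fields)
  moreover have "pure k ?E ?E = pure k K K" unfolding K_def
    by (rule tensor_space_cong) (simp_all add: env_qbialg_fields)
  moreover have "tsum k (op_qbialg k H) (op_qbialg k H) (K \<boxtimes>\<^bsub>k\<^esub> K) = tsum k H H (K \<boxtimes>\<^bsub>k\<^esub> K)"
    by (rule tensor_space_cong) (simp_all add: op_qbialg_def)
  moreover have "comult K x = tsum k H (op_qbialg k H) (?E \<boxtimes>\<^bsub>k\<^esub> ?E) x (\<lambda>h l.
      tsum k H H (?E \<boxtimes>\<^bsub>k\<^esub> ?E) (comult H h) (\<lambda>h1 h2.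
      tsum k (op_qbialg k H) (op_qbialg k H) (?E \<boxtimes>\<^bsub>k\<^esub> ?E) (comult H l) (\<lambda>l1 l2.
        pure k ?E ?E (env_pure k H h1 l1) (env_pure k H h2 l2))))"
    by (simp add: K_def env_qbialg_def tensor_qbialg_def Let_def module.extend_def qbialg.fields_def env_pure_def)
  ultimately show ?thesis by simp
qed

lemma env_counit:
  fixes H :: "('k, 'h, 'm) qbialg_scheme"
  shows "counit (env_qbialg k H) = pairing k H (op_qbialg k H) (base_algebra k) (counit H) (counit H)"
  by (simp add: fun_eq_iff env_qbialg_def tensor_qbialg_def Let_def module.extend_def qbialg.fields_def pairing_def base_algebra_def)

text \<open>The counit of \<open>K\<close> is a reading with values in the ground field, which
  therefore has to serve as a target algebra.\<close>

lemma assoc_algebra_base: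
  assumes "field k"
  shows "assoc_algebra k (base_algebra k)"
proof -
  interpret k: field k by fact
  have ag: "abelian_group (base_algebra k)"
    using k.add.l_inv_ex by (intro abelian_groupI) (auto simp: base_algebra_def k.a_ac)
  have "ring (base_algebra k)"
  proof (rule ringI[OF ag])
    show "Group.monoid (base_algebra k)" by (rule monoidI) (simp_all add: base_algebra_def k.m_assoc)
  qed (simp_all add: base_algebra_def k.l_distr k.r_distr)
  moreover have "module k (base_algebra k)"
    by (rule moduleI[OF k.is_cring ag]) (simp_all add: base_algebra_def k.l_distr k.r_distr k.m_assoc)
  ultimately show ?thesis
    by (intro assoc_algebra.intro assoc_algebra_axioms.intro assms) (simp_all add: base_algebra_def k.m_assoc k.m_lcomm)
qed

text \<open>The ground field is commutative, so reversing products in \<open>H\<close> does not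
  affect the counit.\<close>

lemma counit_hom_op:
  "e \<in> algebra_maps k H (base_algebra k) \<Longrightarrow> field k \<Longrightarrow> e \<in> algebra_maps k (op_qbialg k H) (base_algebra k)"
proof -
  assume e: "e \<in> algebra_maps k H (base_algebra k)" and "field k"
  interpret k: field k by fact
  show ?thesis
  proof (rule algebra_mapsI)
    show "e \<in> linear_maps k (op_qbialg k H) (base_algebra k)"
      using algebra_maps_linear[OF e] by (simp add: linear_maps_def)
    show "e (x \<otimes>\<^bsub>op_qbialg k H\<^esub> y) = e x \<otimes>\<^bsub>base_algebra k\<^esub> e y" if "x \<in> carrier (op_qbialg k H)" "y \<in> carrier (op_qbialg k H)" for x y
      using that algebra_maps_mult[OF e, of y x] algebra_maps_closed[OF e, of x] algebra_maps_closed[OF e, of y]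
      by (simp add: base_algebra_def k.m_comm)
  qed (use algebra_maps_one[OF e] in simp)
qed

section \<open>The two factors of \<open>H \<otimes> H^op\<close> as algebra maps on
  \<open>H\<close>\<close>

context quasi_hopf
begin

abbreviation "Sinv \<equiv> antipode_inv H"
abbreviation "Hop \<equiv> op_qbialg k H"
abbreviation "K \<equiv> env_qbialg k H"

lemmas Hop = assoc_algebra_op[OF H] and K = assoc_algebra_env[OF H]

lemma Sinv_closed [simp]: "h \<in> carrier H \<Longrightarrow> Sinv h \<in> carrier H"
  and S_Sinv [simp]: "h \<in> carrier H \<Longrightarrow> S (Sinv h) = h"
  and Sinv_S [simp]: "h \<in> carrier H \<Longrightarrow> Sinv (S h) = h"
  using bij_betwE[OF bij_betw_inv_into[OF quasi_hopf_algebra.antipode_bij[OF quasi_hopf]]]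
    bij_betw_inv_into_right[OF quasi_hopf_algebra.antipode_bij[OF quasi_hopf]]
    bij_betw_inv_into_left[OF quasi_hopf_algebra.antipode_bij[OF quasi_hopf]]
  by (auto simp: antipode_inv_def)

lemma Sinv_eqI: "\<lbrakk>x \<in> carrier H; S x = h\<rbrakk> \<Longrightarrow> Sinv h = x"
  by auto

lemma Sinv_hom: "Sinv \<in> algebra_maps k H Hop"
proof (rule algebra_mapsI)
  interpret H: module k H by (rule assoc_algebra_module[OF H])
  show "Sinv \<in> linear_maps k H Hop"
    by (intro linear_mapsI Sinv_eqI) (simp_all add: linear_maps_add[OF S(1)] linear_maps_smult[OF S(1)])
qed (intro Sinv_eqI; simp add: S)+

lemma counit_Sinv: "h \<in> carrier H \<Longrightarrow> counit H (Sinv h) = counit H h"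
  using quasi_hopf_algebra.counit_antipode[OF quasi_hopf, of "Sinv h"] by simp

definition "kl = inl k H Hop"
definition "kop = inr k H Hop"
text \<open>\<open>S^{-1}\<close> reverses products, and so does the passage to the opposite
  algebra; hence \<open>kr\<close> is an algebra map on \<open>H\<close>. Every
  \<open>S^{-1}\<close> in the two comodule structures occurs in this way.\<close>

definition "kr h = kop (Sinv h)"

lemma kl_hom: "kl \<in> algebra_maps k H K" and kop_hom: "kop \<in> algebra_maps k Hop K" and kr_hom: "kr \<in> algebra_maps k H K"
  using inl_hom[OF H Hop] inr_hom[OF H Hop] algebra_maps_comp[OF Sinv_hom inr_hom[OF H Hop]]
  by (simp_all add: env_qbialg_maps kl_def kop_def kr_def[abs_def])

lemma kl_kop_commuting: "commuting K H Hop kl kop" and kl_kr_commuting: "commuting K H H kl kr"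
proof -
  show "commuting K H Hop kl kop"
    unfolding env_qbialg_maps kl_def kop_def by (rule inl_inr_commuting[OF H Hop])
  then show "commuting K H H kl kr"
    by (simp add: commuting_def kr_def)
qed

lemma env_pure_eq: "\<lbrakk>h \<in> carrier H; l \<in> carrier H\<rbrakk> \<Longrightarrow> env_pure k H h l = kl h \<otimes>\<^bsub>K\<^esub> kop l"
  by (simp add: env_pure_def kl_def kop_def pure_eq_inl_inr[OF H Hop] env_qbialg_fields)

lemma env_pure_Sinv: "\<lbrakk>h \<in> carrier H; l \<in> carrier H\<rbrakk> \<Longrightarrow> env_pure k H h (Sinv l) = kl h \<otimes>\<^bsub>K\<^esub> kr l"
  by (simp add: env_pure_eq kr_def)

text \<open>The last equation is where the normalisation
  \<open>\<epsilon> \<circ> S = \<epsilon>\<close> enters.\<close>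

lemma counit_K: "counit K \<in> algebra_maps k K (base_algebra k)"
  "h \<in> carrier H \<Longrightarrow> counit K (kl h) = counit H h" "h \<in> carrier H \<Longrightarrow> counit K (kr h) = counit H h"
proof -
  interpret k: field k by (rule assoc_algebra_field[OF H])
  note e = I.counit and e' = counit_hom_op[OF I.counit k.field_axioms]
  note b = assoc_algebra_base[OF k.field_axioms]
  have "commuting (base_algebra k) H Hop (counit H) (counit H)"
    using I.counit_closed by (simp add: commuting_def base_algebra_def k.m_comm)
  then show "counit K \<in> algebra_maps k K (base_algebra k)"
    unfolding env_qbialg_maps env_counit by (rule pairing_hom[OF H Hop b e e'])
  show "counit K (kl h) = counit H h" if "h \<in> carrier H"
    unfolding env_counit kl_def using that algebra_maps_one[OF e]
    by (intro pairing_inl[OF H Hop b algebra_maps_linear[OF e] algebra_maps_linear[OF e']]) (simp_all add: base_algebra_def)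
  show "counit K (kr h) = counit H h" if "h \<in> carrier H"
    unfolding env_counit kr_def kop_def counit_Sinv[OF that, symmetric] using that algebra_maps_one[OF e]
    by (intro pairing_inr[OF H Hop b algebra_maps_linear[OF e] algebra_maps_linear[OF e']]) (simp_all add: base_algebra_def)
qed

end

section \<open>The twist \<open>U\<close>\<close>

locale bicomodule_over_quasi_hopf = quasi_hopf k H
  for k :: "('k, 'c) ring_scheme" and H :: "('k, 'h, 'm) qhopf_scheme" +
  fixes A :: "('k, 'a, 'n) module_scheme" and lam :: "'a \<Rightarrow> ('k, 'h, 'a) tens" and \<rho> :: "'a \<Rightarrow> ('k, 'a, 'h) tens"
    and \<Phi>l :: "('k, 'h, ('k, 'h, 'a) tens) tens" and \<Phi>\<rho> :: "('k, 'a, ('k, 'h, 'h) tens) tens"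
    and \<Phi>l\<rho> :: "('k, 'h, ('k, 'a, 'h) tens) tens"
  assumes bicomodule: "bicomodule_algebra k H A lam \<rho> \<Phi>l \<Phi>\<rho> \<Phi>l\<rho>"
begin

lemma A: "assoc_algebra k A"
  by (rule left_comodule_algebra.axioms(2)[OF bicomodule_algebra.axioms(1)[OF bicomodule]])

lemmas KA = assoc_algebra_tensor[OF K A]
lemmas KKA = assoc_algebra_tensor[OF K KA]

lemma bicomodule_calculus: "assoc_algebra k T \<Longrightarrow> bicomodule_calculus k H T A lam \<rho> \<Phi>l \<Phi>\<rho> \<Phi>l\<rho>"
  by (intro bicomodule_calculus.intro hom_calculus.intro bicomodule_calculus_axioms.intro qb bicomodule)

sublocale X: bicomodule_calculus k H A A lam \<rho> \<Phi>l \<Phi>\<rho> \<Phi>l\<rho>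
  by (rule bicomodule_calculus[OF A])
sublocale Y: bicomodule_calculus k H "K \<boxtimes>\<^bsub>k\<^esub> A" A lam \<rho> \<Phi>l \<Phi>\<rho> \<Phi>l\<rho>
  by (rule bicomodule_calculus[OF KA])

definition "c1 h = inl k K A (kl h)"
definition "c2 h = inl k K A (kr h)"
abbreviation "c0 \<equiv> inr k K A"

lemma c_hom [simp]: "Y.ahom c1" "Y.ahom c2" "Y.ahomA c0"
  unfolding c1_def[abs_def] c2_def[abs_def]
  by (rule algebra_maps_comp[OF kl_hom inl_hom[OF K A]] algebra_maps_comp[OF kr_hom inl_hom[OF K A]] inr_hom[OF K A])+

lemmas c_closed [simp] = c_hom[THEN algebra_maps_closed]

lemma c_commuting [simp]: "Y.cm c1 c2" "Y.cmHA c1 c0" "Y.cmHA c2 c0" "Y.cmAH c0 c2"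
proof -
  note l = algebra_maps_linear[OF kl_hom] and r = algebra_maps_linear[OF kr_hom]
  show "Y.cm c1 c2"
    unfolding c1_def[abs_def] c2_def[abs_def] by (rule commuting_hom[OF inl_hom[OF K A] kl_kr_commuting l r])
  show "Y.cmHA c1 c0" "Y.cmHA c2 c0" "Y.cmAH c0 c2"
    unfolding c1_def[abs_def] c2_def[abs_def]
    by (rule slots_commuting[OF K A l linear_maps_id] slots_commuting[OF K A r linear_maps_id])+
qed

text \<open>Both bracketings are recorded because in \<open>\<lambda>\<^sub>1\<close> the inner sum
  runs over \<open>c1\<close> and \<open>c0\<close>, in \<open>\<lambda>\<^sub>2\<close> over
  \<open>c0\<close> and \<open>c2\<close>.\<close>

lemma pure_K_A:
  assumes "h \<in> carrier H" "l \<in> carrier H" "u \<in> carrier A"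
  shows "pure k K A (env_pure k H h (Sinv l)) u = c1 h \<otimes>\<^bsub>K \<boxtimes>\<^bsub>k\<^esub> A\<^esub> c0 u \<otimes>\<^bsub>K \<boxtimes>\<^bsub>k\<^esub> A\<^esub> c2 l"
    "pure k K A (env_pure k H h (Sinv l)) u = c1 h \<otimes>\<^bsub>K \<boxtimes>\<^bsub>k\<^esub> A\<^esub> (c0 u \<otimes>\<^bsub>K \<boxtimes>\<^bsub>k\<^esub> A\<^esub> c2 l)"
proof -
  interpret K: ring K by (rule assoc_algebra_ring[OF K])
  note cl = algebra_maps_closed[OF kl_hom] algebra_maps_closed[OF kr_hom]
  have "pure k K A (env_pure k H h (Sinv l)) u = c1 h \<otimes>\<^bsub>K \<boxtimes>\<^bsub>k\<^esub> A\<^esub> c2 l \<otimes>\<^bsub>K \<boxtimes>\<^bsub>k\<^esub> A\<^esub> c0 u"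
    using assms by (simp add: env_pure_Sinv cl pure_eq_inl_inr[OF K A] c1_def c2_def algebra_maps_mult[OF inl_hom[OF K A]])
  also have "\<dots> = c1 h \<otimes>\<^bsub>K \<boxtimes>\<^bsub>k\<^esub> A\<^esub> (c2 l \<otimes>\<^bsub>K \<boxtimes>\<^bsub>k\<^esub> A\<^esub> c0 u)"
    by (intro Y.T.m_assoc c_closed assms)
  also have "c2 l \<otimes>\<^bsub>K \<boxtimes>\<^bsub>k\<^esub> A\<^esub> c0 u = c0 u \<otimes>\<^bsub>K \<boxtimes>\<^bsub>k\<^esub> A\<^esub> c2 l"
    by (rule commutingD[OF c_commuting(3) assms(2,3)])
  finally show 2: "pure k K A (env_pure k H h (Sinv l)) u = c1 h \<otimes>\<^bsub>K \<boxtimes>\<^bsub>k\<^esub> A\<^esub> (c0 u \<otimes>\<^bsub>K \<boxtimes>\<^bsub>k\<^esub> A\<^esub> c2 l)" .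
  show "pure k K A (env_pure k H h (Sinv l)) u = c1 h \<otimes>\<^bsub>K \<boxtimes>\<^bsub>k\<^esub> A\<^esub> c0 u \<otimes>\<^bsub>K \<boxtimes>\<^bsub>k\<^esub> A\<^esub> c2 l"
    unfolding 2 by (intro Y.T.m_assoc[symmetric] c_closed assms)
qed

abbreviation "U \<equiv> bicomodule_twist k H A \<Phi>l\<rho>"
abbreviation "lam1 \<equiv> lambda1 k H A lam \<rho>"
abbreviation "lam2 \<equiv> lambda2 k H A lam \<rho>"

lemma U_eq: "U = Y.M c1 c0 c2"
  unfolding bicomodule_twist_def Let_def Y.M_def
  by (rule tsum3_eq_pairing3[OF H A H KA]) (simp_all add: pure_K_A(2))

lemma lam1_eq: "u \<in> carrier A \<Longrightarrow> lam1 u = Y.ract (Y.lact c1 c0) c2 u"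
  unfolding lambda1_def Let_def Y.ract_def pairing_def[of k A]
proof (rule tsum_cong)
  fix u0 u1 assume u0: "u0 \<in> carrier A" and u1: "u1 \<in> carrier H"
  have "tsum k H A (K \<boxtimes>\<^bsub>k\<^esub> A) (lam u0) (\<lambda>m z. pure k K A (env_pure k H m (Sinv u1)) z) =
      \<one>\<^bsub>K \<boxtimes>\<^bsub>k\<^esub> A\<^esub> \<otimes>\<^bsub>K \<boxtimes>\<^bsub>k\<^esub> A\<^esub> Y.lact c1 c0 u0 \<otimes>\<^bsub>K \<boxtimes>\<^bsub>k\<^esub> A\<^esub> c2 u1"
    unfolding Y.lact_def by (rule tsum_between[OF H A KA]) (simp_all add: Y.lam_closed u0 u1 pure_K_A(1))
  then show "tsum k H A (K \<boxtimes>\<^bsub>k\<^esub> A) (lam u0) (\<lambda>m z. pure k K A (env_pure k H m (Sinv u1)) z) =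
      Y.lact c1 c0 u0 \<otimes>\<^bsub>K \<boxtimes>\<^bsub>k\<^esub> A\<^esub> c2 u1"
    using u0 by simp
qed

lemma lam2_eq: "u \<in> carrier A \<Longrightarrow> lam2 u = Y.lact c1 (Y.ract c0 c2) u"
  unfolding lambda2_def Let_def Y.lact_def pairing_def[of k H]
proof (rule tsum_cong)
  fix m u0 assume m: "m \<in> carrier H" and u0: "u0 \<in> carrier A"
  have "tsum k A H (K \<boxtimes>\<^bsub>k\<^esub> A) (\<rho> u0) (\<lambda>z p. pure k K A (env_pure k H m (Sinv p)) z) =
      c1 m \<otimes>\<^bsub>K \<boxtimes>\<^bsub>k\<^esub> A\<^esub> Y.ract c0 c2 u0 \<otimes>\<^bsub>K \<boxtimes>\<^bsub>k\<^esub> A\<^esub> \<one>\<^bsub>K \<boxtimes>\<^bsub>k\<^esub> A\<^esub>"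
    unfolding Y.ract_def by (rule tsum_between[OF A H KA]) (simp_all add: Y.rho_closed u0 m pure_K_A(2))
  then show "tsum k A H (K \<boxtimes>\<^bsub>k\<^esub> A) (\<rho> u0) (\<lambda>z p. pure k K A (env_pure k H m (Sinv p)) z) =
      c1 m \<otimes>\<^bsub>K \<boxtimes>\<^bsub>k\<^esub> A\<^esub> Y.ract c0 c2 u0"
    using u0 m by simp
qed

lemma inv_U_eq: "inv\<^bsub>K \<boxtimes>\<^bsub>k\<^esub> A\<^esub> U = Y.M' c1 c0 c2" and U_Units: "U \<in> Units (K \<boxtimes>\<^bsub>k\<^esub> A)"
proof -
  show "inv\<^bsub>K \<boxtimes>\<^bsub>k\<^esub> A\<^esub> U = Y.M' c1 c0 c2"
    unfolding U_eq by (rule Y.T.inv_char) simp_all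
  show "U \<in> Units (K \<boxtimes>\<^bsub>k\<^esub> A)"
    unfolding U_eq Units_def by simp (metis Y.P_closed(5) Y.P_inverse(1,2) c_commuting(1,2,4) c_hom)
qed

lemma U_conjugates:
  assumes u: "u \<in> carrier A"
  shows "lam2 u = U \<otimes>\<^bsub>K \<boxtimes>\<^bsub>k\<^esub> A\<^esub> lam1 u \<otimes>\<^bsub>K \<boxtimes>\<^bsub>k\<^esub> A\<^esub> inv\<^bsub>K \<boxtimes>\<^bsub>k\<^esub> A\<^esub> U"
  using Y.mixed_coassoc[OF c_hom(1,3,2) c_commuting(2,1,4) u] u
  by (simp add: lam1_eq lam2_eq inv_U_eq[unfolded U_eq] U_eq Y.T.m_assoc)

text \<open>Contraction with the counit of \<open>K\<close> is an algebra map \<open>?F\<close>. It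
  sends both legs in \<open>K\<close> to the counit of \<open>H\<close>, so \<open>U\<close> becomes
  the mixed reassociator with counits at both ends.\<close>

lemma U_counit: "contract_left k K A (counit K) U = \<one>\<^bsub>A\<^esub>"
proof -
  let ?e = "\<lambda>x. counit K x \<odot>\<^bsub>A\<^esub> \<one>\<^bsub>A\<^esub>"
  let ?F = "pairing k K A A ?e (\<lambda>u. u)"
  interpret AM: module k A by (rule assoc_algebra_module[OF A])
  have e: "?e \<in> algebra_maps k K A" by (rule functional_hom[OF A counit_K(1)])
  have cl: "counit K x \<in> carrier k" if "x \<in> carrier K" for x
    using algebra_maps_closed[OF counit_K(1) that] by (simp add: base_algebra_def)
  have "commuting A K A ?e (\<lambda>u. u)"
    by (simp add: commuting_def cl assoc_algebra.smult_mult_left[OF A] assoc_algebra.smult_mult_right[OF A])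
  note F = pairing_hom[OF K A A e algebra_maps_id this]
  have Fl: "?F (inl k K A x) = ?e x" if "x \<in> carrier K" for x
    by (rule pairing_inl[OF K A A algebra_maps_linear[OF e] linear_maps_id _ that]) simp
  have Fr: "?F (c0 u) = u" if "u \<in> carrier A" for u
    by (rule pairing_inr[OF K A A algebra_maps_linear[OF e] linear_maps_id algebra_maps_one[OF e] that])
  note lin = c_hom(1,3,2)[THEN algebra_maps_linear]
  have "contract_left k K A (counit K) U = ?F (Y.M c1 c0 c2)"
    by (simp add: contract_left_eq_pairing[OF A algebra_maps_linear[OF counit_K(1)]] U_eq)
  also have "\<dots> = X.M X.eps (\<lambda>u. u) X.eps"
    unfolding Y.M_def X.M_def hom_pairing3[OF H A H KA A lin F Y.Phi_in(3)]
    by (intro pairing_cong)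
      (simp_all add: c1_def c2_def Fl Fr X.eps_def counit_K algebra_maps_closed[OF kl_hom] algebra_maps_closed[OF kr_hom])
  also have "\<dots> = \<one>\<^bsub>A\<^esub>"
    by (rule X.M_eps) (simp_all add: algebra_maps_id linear_maps_id)
  finally show ?thesis .
qed

end

lemma linear_maps_op [simp]: "linear_maps k (op_qbialg k H) T = linear_maps k H T"
  by (simp add: linear_maps_def)

section \<open>The factors of the twisting formula read in
  \<open>K \<boxtimes> K \<boxtimes> A\<close>\<close>

context bicomodule_over_quasi_hopf
begin

abbreviation "KKA \<equiv> K \<boxtimes>\<^bsub>k\<^esub> K \<boxtimes>\<^bsub>k\<^esub> A"

sublocale Z: bicomodule_calculus k H KKA A lam \<rho> \<Phi>l \<Phi>\<rho> \<Phi>l\<rho>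
  by (rule bicomodule_calculus[OF KKA])

abbreviation "s1 \<equiv> inl k K (K \<boxtimes>\<^bsub>k\<^esub> A)"
abbreviation "s23 \<equiv> inr k K (K \<boxtimes>\<^bsub>k\<^esub> A)"
abbreviation "s2 \<equiv> \<lambda>x. s23 (inl k K A x)"

lemmas s_hom = inl_hom[OF K KA] inr_hom[OF K KA] algebra_maps_comp[OF inl_hom[OF K A] inr_hom[OF K KA]]

text \<open>
  The first factor of \<open>K \<otimes> K \<otimes> A\<close> carries the legs \<open>e1\<close> and \<open>e5\<close>, the second one \<open>e2\<close> and \<open>e4\<close>: in this numbering the
  legs of \<open>H\<^sup>o\<^sup>p\<close>, which are reversed by \<open>S\<^sup>-\<^sup>1\<close>, occur in the order of the mixed pentagons.
\<close>

definition "e1 h = s1 (kl h)"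
definition "e2 h = s23 (c1 h)"
definition "e4 h = s23 (c2 h)"
definition "e5 h = s1 (kr h)"
definition "e0 u = s23 (c0 u)"

lemma e_hom [simp]: "Z.ahom e1" "Z.ahom e2" "Z.ahomA e0" "Z.ahom e4" "Z.ahom e5"
  unfolding e1_def[abs_def] e2_def[abs_def] e4_def[abs_def] e5_def[abs_def] e0_def[abs_def]
  by (rule algebra_maps_comp[OF kl_hom s_hom(1)] algebra_maps_comp[OF kr_hom s_hom(1)] algebra_maps_comp[OF c_hom(1) s_hom(2)]
      algebra_maps_comp[OF c_hom(2) s_hom(2)] algebra_maps_comp[OF c_hom(3) s_hom(2)])+

lemmas e_closed [simp] = e_hom[THEN algebra_maps_closed]

lemma e_commuting:
  "Z.cm e1 e2" "Z.cm e1 e4" "Z.cm e1 e5" "Z.cm e2 e4" "Z.cm e2 e5" "Z.cm e4 e5"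
  "Z.cmHA e1 e0" "Z.cmHA e2 e0" "Z.cmHA e4 e0" "Z.cmHA e5 e0"
proof -
  note l = algebra_maps_linear[OF kl_hom] and r = algebra_maps_linear[OF kr_hom]
  note c = c_hom[THEN algebra_maps_linear]
  show "Z.cm e1 e2" "Z.cm e1 e4" "Z.cm e1 e5" "Z.cm e2 e4" "Z.cm e2 e5" "Z.cm e4 e5"
    "Z.cmHA e1 e0" "Z.cmHA e2 e0" "Z.cmHA e4 e0" "Z.cmHA e5 e0"
    unfolding e1_def[abs_def] e2_def[abs_def] e4_def[abs_def] e5_def[abs_def] e0_def[abs_def]
    by (rule slots_commuting[OF K KA l c(1)] slots_commuting[OF K KA l c(2)] slots_commuting[OF K KA r c(1)]
        slots_commuting[OF K KA r c(2)] slots_commuting[OF K KA l c(3)] slots_commuting[OF K KA r c(3)]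
        commuting_hom[OF s_hom(1) kl_kr_commuting l r] commuting_hom[OF s_hom(2) c_commuting(1) c(1,2)]
        commuting_hom[OF s_hom(2) c_commuting(2) c(1,3)] commuting_hom[OF s_hom(2) c_commuting(3) c(2,3)])+
qed

lemmas e_commute [simp] = e_commuting e_commuting[THEN commuting_sym]

lemma pure3_K_K_A:
  assumes "h \<in> carrier H" "l \<in> carrier H" "h' \<in> carrier H" "l' \<in> carrier H" "u \<in> carrier A"
  shows "pure3 k K K A (env_pure k H h (Sinv l)) (env_pure k H h' (Sinv l')) u =
    e1 h \<otimes>\<^bsub>KKA\<^esub> e5 l \<otimes>\<^bsub>KKA\<^esub> (e2 h' \<otimes>\<^bsub>KKA\<^esub> e4 l' \<otimes>\<^bsub>KKA\<^esub> e0 u)"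
proof -
  interpret K: ring K by (rule assoc_algebra_ring[OF K])
  note cl = algebra_maps_closed[OF kl_hom] algebra_maps_closed[OF kr_hom] algebra_maps_closed[OF s_hom(1)] algebra_maps_closed[OF s_hom(2)]
    algebra_maps_closed[OF inl_hom[OF K A]]
  show ?thesis
    unfolding pure3_eq_slots[OF K K A, of "env_pure k H h (Sinv l)" "env_pure k H h' (Sinv l')" u]
    using assms by (simp add: pure3_eq_slots[OF K K A] env_pure_Sinv cl e1_def e2_def e4_def e5_def e0_def c1_def c2_def
        algebra_maps_mult[OF s_hom(1)] algebra_maps_mult[OF inl_hom[OF K A]] algebra_maps_mult[OF s_hom(2)])
qed

lemma one_tensor_U: "pure k K (K \<boxtimes>\<^bsub>k\<^esub> A) \<one>\<^bsub>K\<^esub> U = Z.M e2 e0 e4"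
  unfolding U_eq Y.M_def Z.M_def inr_def[symmetric]
    hom_pairing3[OF H A H KA KKA c_hom(1,3,2)[THEN algebra_maps_linear] s_hom(2) Y.Phi_in(3)]
  by (intro pairing_cong) (simp_all add: e2_def e4_def e0_def)

lemma inr_lam1: "u \<in> carrier A \<Longrightarrow> s23 (lam1 u) = Z.ract (Z.lact e2 e0) e4 u"
proof -
  assume u: "u \<in> carrier A"
  have "s23 (Y.lact c1 c0 v) = Z.lact e2 e0 v" if "v \<in> carrier A" for v
    unfolding Y.lact_def Z.lact_def hom_pairing[OF H A KA KKA c_hom(1,3)[THEN algebra_maps_linear] s_hom(2) Y.lam_closed[OF that]]
    by (intro pairing_cong) (simp_all add: e2_def e0_def)
  moreover have l: "Y.lact c1 c0 \<in> linear_maps k A (K \<boxtimes>\<^bsub>k\<^esub> A)" by simp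
  ultimately show ?thesis
    unfolding lam1_eq[OF u] Y.ract_def Z.ract_def
      hom_pairing[OF A H KA KKA l c_hom(2)[THEN algebra_maps_linear] s_hom(2) Y.rho_closed[OF u]]
    by (intro pairing_cong) (simp_all add: e4_def)
qed

text \<open>The legs of \<open>U\<close> in \<open>K\<close> stay in the first factor and become
  \<open>e1\<close> and \<open>e5\<close>. Its leg in \<open>A\<close> is spread by
  \<open>\<lambda>\<^sub>1\<close> over the last two factors, which is the action of
  \<open>e2\<close> and \<open>e4\<close> on \<open>e0\<close>.\<close>

lemma map_right_lam1_U: "map_right k K A (K \<boxtimes>\<^bsub>k\<^esub> A) lam1 U = Z.M e1 (Z.ract (Z.lact e2 e0) e4) e5"
proof -
  let ?a = "Z.ract (Z.lact e2 e0) e4"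
  let ?F = "pairing k K A KKA s1 ?a"
  have a: "Z.ahomA ?a" by simp
  have "Y.ract (Y.lact c1 c0) c2 \<in> linear_maps k A (K \<boxtimes>\<^bsub>k\<^esub> A)" by simp
  then have l: "lam1 \<in> linear_maps k A (K \<boxtimes>\<^bsub>k\<^esub> A)"
    by (rule linear_maps_cong[OF _ assoc_algebra_module[OF A] lam1_eq])
  have "commuting KKA K A s1 (\<lambda>u. s23 (lam1 u))"
    by (rule slots_commuting(1)[OF K KA linear_maps_id l])
  then have "commuting KKA K A s1 ?a"
    by (simp add: commuting_def inr_lam1)
  note F = pairing_hom[OF K A KKA s_hom(1) a this]
  have "map_right k K A (K \<boxtimes>\<^bsub>k\<^esub> A) lam1 U = ?F (Y.M c1 c0 c2)"
    unfolding map_right_eq_pairing[OF K KA l] U_eq by (rule pairing_cong) (simp_all add: inr_lam1)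
  also have "\<dots> = Z.M e1 ?a e5"
    unfolding Y.M_def Z.M_def hom_pairing3[OF H A H KA KKA c_hom(1,3,2)[THEN algebra_maps_linear] F Y.Phi_in(3)]
  proof (intro pairing_cong)
    note sl = algebra_maps_linear[OF s_hom(1)] algebra_maps_linear[OF a]
    note one = algebra_maps_one[OF a] algebra_maps_one[OF s_hom(1)]
    show "?F (c1 h) = e1 h" "?F (c2 h) = e5 h" if "h \<in> carrier H" for h
      unfolding c1_def c2_def e1_def e5_def using that
      by (simp_all add: pairing_inl[OF K A KKA sl one(1)] algebra_maps_closed[OF kl_hom] algebra_maps_closed[OF kr_hom])
    show "?F (c0 u) = ?a u" if "u \<in> carrier A" for u
      by (rule pairing_inr[OF K A KKA sl one(2) that])
  qed
  finally show ?thesis .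
qed

abbreviation "p45 \<equiv> pairing k H H KKA e4 e5"
text \<open>The first leg of the twist is read in the second factor, along \<open>e4\<close>, and
  the second leg in the first factor, along \<open>e5\<close>. In both reassociators
  \<open>g^1\<close> and \<open>g^2\<close> occur in just these places.\<close>

definition "f45 = p45 (drinfeld_twist k H)"
definition "g45 = p45 (inv\<^bsub>H \<boxtimes>\<^bsub>k\<^esub> H\<^esub> drinfeld_twist k H)"

lemma twist_closed: "drinfeld_twist k H \<in> carrier (H \<boxtimes>\<^bsub>k\<^esub> H)" "inv\<^bsub>H \<boxtimes>\<^bsub>k\<^esub> H\<^esub> drinfeld_twist k H \<in> carrier (H \<boxtimes>\<^bsub>k\<^esub> H)"
  using X.Units_in[OF HH drinfeld_twist_unit] by simp_all

lemma p45_hom: "p45 \<in> algebra_maps k (H \<boxtimes>\<^bsub>k\<^esub> H) KKA"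
  by (rule pairing_hom[OF H H KKA]) simp_all

lemma fg_closed [simp]: "f45 \<in> carrier KKA" "g45 \<in> carrier KKA"
  unfolding f45_def g45_def by (rule algebra_maps_closed[OF p45_hom] twist_closed)+

lemma fg_inverse: "f45 \<otimes>\<^bsub>KKA\<^esub> g45 = \<one>\<^bsub>KKA\<^esub>" "g45 \<otimes>\<^bsub>KKA\<^esub> f45 = \<one>\<^bsub>KKA\<^esub>"
  unfolding f45_def g45_def by (rule algebra_maps_inverse[OF p45_hom HH drinfeld_twist_unit])+

abbreviation "\<Phi>1 \<equiv> Phi_lambda1 k H A lam \<Phi>l \<Phi>\<rho> \<Phi>l\<rho>"
abbreviation "\<Phi>2 \<equiv> Phi_lambda2 k H A \<rho> \<Phi>l \<Phi>\<rho> \<Phi>l\<rho>"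

lemma Phi_lambda1_eq:
  "\<Phi>1 = Z.M e1 (Z.lact e2 e0) e4 \<otimes>\<^bsub>KKA\<^esub> (Z.Pl e1 e2 e0 \<otimes>\<^bsub>KKA\<^esub> (Z.Pr' (Z.lact (Z.conv e1 e2) e0) e4 e5 \<otimes>\<^bsub>KKA\<^esub> g45))"
  unfolding g45_def Z.Phi1_eval[OF e_hom e_commuting twist_closed(2), symmetric] Phi_lambda1_def Let_def tsum3_def
  by (intro tsum_cong pure3_K_K_A I.T.m_closed X.T.m_closed)

lemma Phi_lambda2_eq:
  "\<Phi>2 = Z.M' e2 (Z.ract e0 e4) e5 \<otimes>\<^bsub>KKA\<^esub> (Z.Pr' e0 e4 e5 \<otimes>\<^bsub>KKA\<^esub> (Z.Pl e1 e2 (Z.ract e0 (Z.conv e4 e5)) \<otimes>\<^bsub>KKA\<^esub> g45))"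
  unfolding g45_def Z.Phi2_eval[OF e_hom e_commuting twist_closed(2), symmetric] Phi_lambda2_def Let_def tsum3_def
  by (intro tsum_cong pure3_K_K_A I.T.m_closed X.T.m_closed)

end

section \<open>The comultiplication of \<open>K\<close> and the part played by the Drinfeld
  twist\<close>

context bicomodule_over_quasi_hopf
begin

definition "k1 = inl k K K"
definition "k2 = inr k K K"
definition "cl h = pairing k H H (K \<boxtimes>\<^bsub>k\<^esub> K) (\<lambda>x. k1 (kl x)) (\<lambda>x. k2 (kl x)) (comult H h)"
definition "cr h = pairing k H H (K \<boxtimes>\<^bsub>k\<^esub> K) (\<lambda>x. k1 (kop x)) (\<lambda>x. k2 (kop x)) (comult H h)"

lemmas KK = assoc_algebra_tensor[OF K K]

lemma k12_hom: "k1 \<in> algebra_maps k K (K \<boxtimes>\<^bsub>k\<^esub> K)" "k2 \<in> algebra_maps k K (K \<boxtimes>\<^bsub>k\<^esub> K)"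
  unfolding k1_def k2_def by (rule inl_hom[OF K K] inr_hom[OF K K])+

lemma kop_linear: "kop \<in> linear_maps k H K" and kl_linear: "kl \<in> linear_maps k H K"
  using algebra_maps_linear[OF kop_hom] algebra_maps_linear[OF kl_hom] by simp_all

lemmas k12_linear = linear_maps_comp[OF kl_linear algebra_maps_linear[OF k12_hom(1)]]
  linear_maps_comp[OF kl_linear algebra_maps_linear[OF k12_hom(2)]]
  linear_maps_comp[OF kop_linear algebra_maps_linear[OF k12_hom(1)]]
  linear_maps_comp[OF kop_linear algebra_maps_linear[OF k12_hom(2)]]

lemma cl_linear: "cl \<in> linear_maps k H (K \<boxtimes>\<^bsub>k\<^esub> K)" and cr_linear: "cr \<in> linear_maps k H (K \<boxtimes>\<^bsub>k\<^esub> K)"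
  unfolding cl_def[abs_def] cr_def[abs_def]
  by (rule linear_maps_comp[OF I.comult_linear pairing_linear[OF H H KK k12_linear(1,2)]]
      linear_maps_comp[OF I.comult_linear pairing_linear[OF H H KK k12_linear(3,4)]])+

text \<open>As a reading with one map for each factor of \<open>K\<close>, the comultiplication
  becomes linear for free and can be composed with further readings.\<close>

lemma comult_K: "comult K x = pairing k H Hop (K \<boxtimes>\<^bsub>k\<^esub> K) cl cr x"
  unfolding env_comult pairing_def
proof (rule tsum_cong)
  interpret K: ring K by (rule assoc_algebra_ring[OF K])
  interpret KK: ring "K \<boxtimes>\<^bsub>k\<^esub> K" by (rule assoc_algebra_ring[OF KK])
  fix h l assume h: "h \<in> carrier H" and l': "l \<in> carrier Hop"
  then have l: "l \<in> carrier H" by simp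
  note cl = linear_maps_closed[OF k12_linear(1)] linear_maps_closed[OF k12_linear(2)]
    linear_maps_closed[OF k12_linear(3)] linear_maps_closed[OF k12_linear(4)]
  note cl' = algebra_maps_closed[OF k12_hom(1)] algebra_maps_closed[OF k12_hom(2)] linear_maps_closed[OF kl_linear]
    linear_maps_closed[OF kop_linear]
  have body: "pure k K K (env_pure k H h1 l1) (env_pure k H h2 l2) =
      k1 (kl h1) \<otimes>\<^bsub>K \<boxtimes>\<^bsub>k\<^esub> K\<^esub> k2 (kl h2) \<otimes>\<^bsub>K \<boxtimes>\<^bsub>k\<^esub> K\<^esub> (k1 (kop l1) \<otimes>\<^bsub>K \<boxtimes>\<^bsub>k\<^esub> K\<^esub> k2 (kop l2)) \<otimes>\<^bsub>K \<boxtimes>\<^bsub>k\<^esub> K\<^esub> \<one>\<^bsub>K \<boxtimes>\<^bsub>k\<^esub> K\<^esub>"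
    if "h1 \<in> carrier H" "h2 \<in> carrier H" "l1 \<in> carrier H" "l2 \<in> carrier H" for h1 h2 l1 l2
    using that by (simp add: env_pure_eq k1_def k2_def inl_def inr_def pure_mult_pure[OF K K] pure_carrier[OF K K] cl')
  have inner: "tsum k H H (K \<boxtimes>\<^bsub>k\<^esub> K) (comult H l) (\<lambda>l1 l2. pure k K K (env_pure k H h1 l1) (env_pure k H h2 l2)) =
      \<one>\<^bsub>K \<boxtimes>\<^bsub>k\<^esub> K\<^esub> \<otimes>\<^bsub>K \<boxtimes>\<^bsub>k\<^esub> K\<^esub> (k1 (kl h1) \<otimes>\<^bsub>K \<boxtimes>\<^bsub>k\<^esub> K\<^esub> k2 (kl h2)) \<otimes>\<^bsub>K \<boxtimes>\<^bsub>k\<^esub> K\<^esub> cr l"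
    if "h1 \<in> carrier H" "h2 \<in> carrier H" for h1 h2
    using tsum_between[OF H H KK k12_linear(3,4) _ KK.one_closed I.comult_closed[OF l] body[OF that]] that
    by (simp add: cl cl' linear_maps_closed[OF cr_linear l] flip: cr_def)
  show "tsum k H H (K \<boxtimes>\<^bsub>k\<^esub> K) (comult H h) (\<lambda>h1 h2. tsum k H H (K \<boxtimes>\<^bsub>k\<^esub> K) (comult H l)
      (\<lambda>l1 l2. pure k K K (env_pure k H h1 l1) (env_pure k H h2 l2))) = cl h \<otimes>\<^bsub>K \<boxtimes>\<^bsub>k\<^esub> K\<^esub> cr l"
    using tsum_between[OF H H KK k12_linear(1,2) KK.one_closed linear_maps_closed[OF cr_linear l] I.comult_closed[OF h] inner] h
    by (simp add: linear_maps_closed[OF cl_linear] linear_maps_closed[OF cr_linear l] flip: cl_def)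
qed

lemma comult_K_linear: "comult K \<in> linear_maps k K (K \<boxtimes>\<^bsub>k\<^esub> K)"
  using pairing_linear[OF H Hop KK cl_linear, of cr] cr_linear
  by (simp add: comult_K[abs_def] linear_maps_def env_qbialg_fields)

definition "G = pairing k K K KKA s1 s2"
definition "N x = G (comult K x)"

lemma G_hom: "G \<in> algebra_maps k (K \<boxtimes>\<^bsub>k\<^esub> K) KKA"
  unfolding G_def
  by (rule pairing_hom[OF K K KKA s_hom(1,3) slots_commuting(1)[OF K KA linear_maps_id algebra_maps_linear[OF inl_hom[OF K A]]]])

lemma G_k: "x \<in> carrier K \<Longrightarrow> G (k1 x) = s1 x" "x \<in> carrier K \<Longrightarrow> G (k2 x) = s2 x"
  unfolding G_def k1_def k2_def
  by (rule pairing_inl[OF K K KKA s_hom(1,3)[THEN algebra_maps_linear] algebra_maps_one[OF s_hom(3)]]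
      pairing_inr[OF K K KKA s_hom(1,3)[THEN algebra_maps_linear] algebra_maps_one[OF s_hom(1)]]; assumption)+

text \<open>What the comultiplication of \<open>K\<close> makes of the opposite factor. Since
  \<open>kop l\<close> is \<open>kr (S l)\<close>, the legs of \<open>l\<close> appear under
  antipodes, the first one along \<open>e5\<close>.\<close>

definition "W h = Z.conv (\<lambda>x. e5 (S x)) (\<lambda>x. e4 (S x)) h"

lemma G_cl: "h \<in> carrier H \<Longrightarrow> G (cl h) = Z.conv e1 e2 h"
  unfolding cl_def Z.conv_def
  by (simp add: hom_pairing[OF H H KK KKA k12_linear(1,2) G_hom I.comult_closed] G_k linear_maps_closed[OF kl_linear]
      e1_def[abs_def] e2_def[abs_def] c1_def cong: pairing_cong)

lemma G_cr: "h \<in> carrier H \<Longrightarrow> G (cr h) = W h"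
  unfolding cr_def W_def Z.conv_def
  by (simp add: hom_pairing[OF H H KK KKA k12_linear(3,4) G_hom I.comult_closed] G_k linear_maps_closed[OF kop_linear]
      e4_def[abs_def] e5_def[abs_def] c2_def kr_def S(4) cong: pairing_cong)

lemma N_env_pure:
  assumes h: "h \<in> carrier H" and l: "l \<in> carrier H"
  shows "N (env_pure k H h l) = Z.conv e1 e2 h \<otimes>\<^bsub>KKA\<^esub> W l"
  unfolding N_def comult_K env_pure_def
  using h l cr_linear pairing_pure[OF H Hop KK cl_linear, of cr h l]
  by (simp add: algebra_maps_mult[OF G_hom] linear_maps_closed[OF cl_linear] linear_maps_closed[OF cr_linear] G_cl G_cr)

lemma N_linear: "N \<in> linear_maps k K KKA"
  unfolding N_def[abs_def] by (rule linear_maps_comp[OF comult_K_linear algebra_maps_linear[OF G_hom]])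

lemma antipodes_linear: "(\<lambda>x. right (S x)) \<in> linear_maps k H (H \<boxtimes>\<^bsub>k\<^esub> H)" "(\<lambda>x. left (S x)) \<in> linear_maps k H (H \<boxtimes>\<^bsub>k\<^esub> H)"
  by (rule linear_maps_comp[OF S(1) algebra_maps_linear[OF inr_hom[OF H H]]]
      linear_maps_comp[OF S(1) algebra_maps_linear[OF inl_hom[OF H H]]])+

text \<open>\<open>S2\<close> sends the first leg to the right factor of
  \<open>H \<otimes> H\<close>, which \<open>p45\<close> reads along \<open>e5\<close>. So
  \<open>W\<close> comes from the map that the Drinfeld twist relates to
  \<open>\<Delta> \<circ> S\<close>.\<close>

lemma p45_S2: "h \<in> carrier H \<Longrightarrow> p45 (S2 h) = W h"
  unfolding S2_def W_def hom_conv[OF B.hom_calculus_axioms Z.hom_calculus_axioms p45_hom antipodes_linear]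
  unfolding Z.conv_def
  by (intro pairing_cong)
    (simp_all add: pairing_inl[OF H H KKA] pairing_inr[OF H H KKA] algebra_maps_one[OF e_hom(4)] algebra_maps_one[OF e_hom(5)] S(4))

text \<open>The conjugation property of the Drinfeld twist at \<open>S^{-1} h\<close>, where
  \<open>S\<close> cancels and leaves \<Delta> itself; read along \<open>e4\<close> and
  \<open>e5\<close> this is the plain convolution.\<close>

lemma W_Sinv:
  assumes h: "h \<in> carrier H"
  shows "f45 \<otimes>\<^bsub>KKA\<^esub> Z.conv e4 e5 h \<otimes>\<^bsub>KKA\<^esub> g45 = W (Sinv h)"
proof -
  have S2: "S2 (Sinv h) \<in> carrier (H \<boxtimes>\<^bsub>k\<^esub> H)"
    unfolding S2_def using linear_maps_closed[OF B.conv_linear[OF antipodes_linear]] h by simp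
  have "p45 (drinfeld_twist k H \<otimes>\<^bsub>H \<boxtimes>\<^bsub>k\<^esub> H\<^esub> comult H h) = p45 (S2 (Sinv h) \<otimes>\<^bsub>H \<boxtimes>\<^bsub>k\<^esub> H\<^esub> drinfeld_twist k H)"
    using drinfeld_twist_antipode[OF Sinv_closed[OF h]] h by simp
  then have "f45 \<otimes>\<^bsub>KKA\<^esub> Z.conv e4 e5 h = W (Sinv h) \<otimes>\<^bsub>KKA\<^esub> f45"
    using h S2 by (simp add: algebra_maps_mult[OF p45_hom] twist_closed I.comult_closed p45_S2 Z.conv_def flip: f45_def)
  moreover have "W (Sinv h) \<in> carrier KKA"
    using algebra_maps_closed[OF p45_hom S2] h by (simp add: p45_S2)
  ultimately show ?thesis
    by (simp add: Z.T.m_assoc fg_inverse)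
qed

lemma fg_commute:
  assumes "commuting KKA X H i e4" "commuting KKA X H i e5" "i \<in> linear_maps k X KKA" "x \<in> carrier X"
  shows "f45 \<otimes>\<^bsub>KKA\<^esub> i x = i x \<otimes>\<^bsub>KKA\<^esub> f45" "g45 \<otimes>\<^bsub>KKA\<^esub> i x = i x \<otimes>\<^bsub>KKA\<^esub> g45"
  using commuting_pairing[OF H H KKA e_hom(4,5)[THEN algebra_maps_linear] assms(3) commuting_sym[OF assms(1)] commuting_sym[OF assms(2)]]
    assms(4) by (simp_all add: commuting_def f45_def g45_def twist_closed)

text \<open>The comultiplication turns the legs of \<open>U^{-1}\<close> in \<open>K\<close> into
  \<open>e1 \<star> e2\<close> and, by \<open>W_Sinv\<close>, into \<open>e4 \<star> e5\<close>
  conjugated by the twist. Since \<open>f45\<close> commutes with \<open>e1 \<star> e2\<close> and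
  \<open>g45\<close> with \<open>e0\<close>, both move to the outside.\<close>

lemma expand_left_inv_U:
  "expand_left k K A K K (comult K) (inv\<^bsub>K \<boxtimes>\<^bsub>k\<^esub> A\<^esub> U) =
    f45 \<otimes>\<^bsub>KKA\<^esub> (Z.M' (Z.conv e1 e2) e0 (Z.conv e4 e5) \<otimes>\<^bsub>KKA\<^esub> g45)"
proof -
  let ?x = "expand_left k K A K K (comult K) (inv\<^bsub>K \<boxtimes>\<^bsub>k\<^esub> A\<^esub> U)"
  let ?i = "Z.conv e1 e2" and ?l = "Z.conv e4 e5"
  let ?P = "pairing k K A KKA N e0"
  note e0 = algebra_maps_linear[OF e_hom(3)]
  note U = Y.P_closed(5)[OF c_hom(1,2,3), folded inv_U_eq]
  note x = linear_maps_closed[OF expand_left_linear[OF K A K K comult_K_linear] U]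
  note P = pairing_linear[OF K A KKA N_linear e0]
  have il: "?i \<in> linear_maps k H KKA" "?l \<in> linear_maps k H KKA" "Z.ahom ?i" "Z.ahom ?l" by simp_all
  note cl = linear_maps_closed[OF il(1)] linear_maps_closed[OF il(2)]
  \<comment> \<open>\<open>?x\<close> is its own value along the three slots; the expansion by
    \<open>comult K\<close> is then absorbed into the first reading \<open>N\<close>.\<close>
  have "?x = pairing3 k K K A KKA s1 s2 (\<lambda>u. s23 (c0 u)) ?x"
    by (rule pairing3_slots[OF K K A x, symmetric])
  also have "\<dots> = ?P (inv\<^bsub>K \<boxtimes>\<^bsub>k\<^esub> A\<^esub> U)"
    unfolding pairing_expand_left[OF K A K K comult_K_linear KKA s_hom(1,3)[THEN algebra_maps_linear] e0[unfolded e0_def[abs_def]] U]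
      N_def[abs_def] G_def e0_def[abs_def] ..
  also have "\<dots> = f45 \<otimes>\<^bsub>KKA\<^esub> pairing3 k H A H KKA ?i e0 ?l (inv\<^bsub>H \<boxtimes>\<^bsub>k\<^esub> A \<boxtimes>\<^bsub>k\<^esub> H\<^esub> \<Phi>l\<rho>) \<otimes>\<^bsub>KKA\<^esub> g45"
    unfolding inv_U_eq Y.M'_def
  proof (rule tensor_ext3[OF H A H linear_maps_comp[OF pairing3_linear[OF H A H KA c_hom(1,3,2)[THEN algebra_maps_linear]] P]
        linear_maps_rmult[OF KKA linear_maps_lmult[OF KKA pairing3_linear[OF H A H KKA il(1) e0 il(2)] fg_closed(1)] fg_closed(2)] _ Y.Phi_in(5)])
    fix h u l assume h: "h \<in> carrier H" and u: "u \<in> carrier A" and l: "l \<in> carrier H"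
    have W: "W (Sinv l) = f45 \<otimes>\<^bsub>KKA\<^esub> ?l l \<otimes>\<^bsub>KKA\<^esub> g45" by (rule W_Sinv[OF l, symmetric])
    have "?P (pairing3 k H A H (K \<boxtimes>\<^bsub>k\<^esub> A) c1 c0 c2 (pure k H (A \<boxtimes>\<^bsub>k\<^esub> H) h (pure k A H u l))) =
        ?P (pure k K A (env_pure k H h (Sinv l)) u)"
      using h u l by (simp add: pairing3_pure3[OF H A H KA c_hom(1,3,2)[THEN algebra_maps_linear], unfolded pure3_def] pure_K_A(2))
    also have "\<dots> = ?i h \<otimes>\<^bsub>KKA\<^esub> W (Sinv l) \<otimes>\<^bsub>KKA\<^esub> e0 u"
      using h u l pure_carrier[OF H Hop, of h "Sinv l"]
      by (simp add: pairing_pure[OF K A KKA N_linear e0] N_env_pure env_pure_def env_qbialg_fields flip: env_pure_def)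
    also have "\<dots> = f45 \<otimes>\<^bsub>KKA\<^esub> (?i h \<otimes>\<^bsub>KKA\<^esub> (e0 u \<otimes>\<^bsub>KKA\<^esub> ?l l)) \<otimes>\<^bsub>KKA\<^esub> g45"
    proof -
      have f: "f45 \<otimes>\<^bsub>KKA\<^esub> ?i h = ?i h \<otimes>\<^bsub>KKA\<^esub> f45"
        by (rule fg_commute(1)[OF _ _ il(1) h]) simp_all
      have g: "g45 \<otimes>\<^bsub>KKA\<^esub> e0 u = e0 u \<otimes>\<^bsub>KKA\<^esub> g45"
        by (rule fg_commute(2)[OF _ _ e0 u]) simp_all
      have "commuting KKA H A ?l e0" by simp
      then have y: "?l l \<otimes>\<^bsub>KKA\<^esub> e0 u = e0 u \<otimes>\<^bsub>KKA\<^esub> ?l l" using l u by (rule commutingD)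
      note c = cl(1)[OF h] cl(2)[OF l] e_closed(3)[OF u]
      have "?i h \<otimes>\<^bsub>KKA\<^esub> (f45 \<otimes>\<^bsub>KKA\<^esub> ?l l \<otimes>\<^bsub>KKA\<^esub> g45) \<otimes>\<^bsub>KKA\<^esub> e0 u =
          (?i h \<otimes>\<^bsub>KKA\<^esub> f45) \<otimes>\<^bsub>KKA\<^esub> (?l l \<otimes>\<^bsub>KKA\<^esub> (g45 \<otimes>\<^bsub>KKA\<^esub> e0 u))"
        using c by (simp add: Z.T.m_assoc)
      also have "\<dots> = (f45 \<otimes>\<^bsub>KKA\<^esub> ?i h) \<otimes>\<^bsub>KKA\<^esub> ((?l l \<otimes>\<^bsub>KKA\<^esub> e0 u) \<otimes>\<^bsub>KKA\<^esub> g45)"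
        unfolding f g using c by (simp add: Z.T.m_assoc)
      also have "\<dots> = f45 \<otimes>\<^bsub>KKA\<^esub> (?i h \<otimes>\<^bsub>KKA\<^esub> (e0 u \<otimes>\<^bsub>KKA\<^esub> ?l l)) \<otimes>\<^bsub>KKA\<^esub> g45"
        unfolding y using c by (simp add: Z.T.m_assoc)
      finally show ?thesis unfolding W .
    qed
    also have "\<dots> = f45 \<otimes>\<^bsub>KKA\<^esub> pairing3 k H A H KKA ?i e0 ?l (pure k H (A \<boxtimes>\<^bsub>k\<^esub> H) h (pure k A H u l)) \<otimes>\<^bsub>KKA\<^esub> g45"
      using h u l by (simp add: pairing3_pure3[OF H A H KKA il(1) e0 il(2), unfolded pure3_def])
    finally show "?P (pairing3 k H A H (K \<boxtimes>\<^bsub>k\<^esub> A) c1 c0 c2 (pure k H (A \<boxtimes>\<^bsub>k\<^esub> H) h (pure k A H u l))) =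
        f45 \<otimes>\<^bsub>KKA\<^esub> pairing3 k H A H KKA ?i e0 ?l (pure k H (A \<boxtimes>\<^bsub>k\<^esub> H) h (pure k A H u l)) \<otimes>\<^bsub>KKA\<^esub> g45" .
  qed
  finally show ?thesis
    unfolding Z.M'_def
    using linear_maps_closed[OF pairing3_linear[OF H A H KKA il(1) e0 il(2)] Y.Phi_in(5)]
    by (simp add: Z.T.m_assoc)
qed

theorem Phi_twisted:
  "\<Phi>2 = pure k K (K \<boxtimes>\<^bsub>k\<^esub> A) \<one>\<^bsub>K\<^esub> U \<otimes>\<^bsub>KKA\<^esub> map_right k K A (K \<boxtimes>\<^bsub>k\<^esub> A) lam1 U \<otimes>\<^bsub>KKA\<^esub> \<Phi>1
    \<otimes>\<^bsub>KKA\<^esub> expand_left k K A K K (comult K) (inv\<^bsub>K \<boxtimes>\<^bsub>k\<^esub> A\<^esub> U)"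
  unfolding one_tensor_U map_right_lam1_U Phi_lambda1_eq expand_left_inv_U
    Z.twist_equation[OF e_hom e_commuting fg_closed fg_inverse(2)]
  by (rule Phi_lambda2_eq)

end

theorem proposition4p6:
  fixes k :: "('k, 'c) ring_scheme"
    and H :: "('k, 'h, 'm) qhopf_scheme"
    and A :: "('k, 'a, 'n) module_scheme"
    and lam :: "'a \<Rightarrow> ('k, 'h, 'a) tens"
    and \<rho> :: "'a \<Rightarrow> ('k, 'a, 'h) tens"
    and \<Phi>l :: "('k, 'h, ('k, 'h, 'a) tens) tens"
    and \<Phi>\<rho> :: "('k, 'a, ('k, 'h, 'h) tens) tens"
    and \<Phi>l\<rho> :: "('k, 'h, ('k, 'a, 'h) tens) tens"
  defines "K \<equiv> env_qbialg k H"
    and "lam1 \<equiv> lambda1 k H A lam \<rho>"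
    and "lam2 \<equiv> lambda2 k H A lam \<rho>"
    and "\<Phi>1 \<equiv> Phi_lambda1 k H A lam \<Phi>l \<Phi>\<rho> \<Phi>l\<rho>"
    and "\<Phi>2 \<equiv> Phi_lambda2 k H A \<rho> \<Phi>l \<Phi>\<rho> \<Phi>l\<rho>"
    and "U \<equiv> bicomodule_twist k H A \<Phi>l\<rho>"
  assumes "quasi_hopf_algebra k H"
    and "bicomodule_algebra k H A lam \<rho> \<Phi>l \<Phi>\<rho> \<Phi>l\<rho>"
  shows "twist_equivalent k K A lam1 \<Phi>1 lam2 \<Phi>2 \<and>
    U \<in> Units (K \<boxtimes>\<^bsub>k\<^esub> A) \<and>
    contract_left k K A (counit K) U = \<one>\<^bsub>A\<^esub> \<and>
    (\<forall>u\<in>carrier A.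
       lam2 u = U \<otimes>\<^bsub>K \<boxtimes>\<^bsub>k\<^esub> A\<^esub> lam1 u \<otimes>\<^bsub>K \<boxtimes>\<^bsub>k\<^esub> A\<^esub> inv\<^bsub>K \<boxtimes>\<^bsub>k\<^esub> A\<^esub> U) \<and>
    \<Phi>2 = pure k K (K \<boxtimes>\<^bsub>k\<^esub> A) \<one>\<^bsub>K\<^esub> U
      \<otimes>\<^bsub>K \<boxtimes>\<^bsub>k\<^esub> K \<boxtimes>\<^bsub>k\<^esub> A\<^esub> map_right k K A (K \<boxtimes>\<^bsub>k\<^esub> A) lam1 U
      \<otimes>\<^bsub>K \<boxtimes>\<^bsub>k\<^esub> K \<boxtimes>\<^bsub>k\<^esub> A\<^esub> \<Phi>1
      \<otimes>\<^bsub>K \<boxtimes>\<^bsub>k\<^esub> K \<boxtimes>\<^bsub>k\<^esub> A\<^esub> expand_left k K A K K (comult K) (inv\<^bsub>K \<boxtimes>\<^bsub>k\<^esub> A\<^esub> U)"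
proof -
  interpret bicomodule_over_quasi_hopf k H A lam \<rho> \<Phi>l \<Phi>\<rho> \<Phi>l\<rho>
    by (intro bicomodule_over_quasi_hopf.intro quasi_hopf.intro bicomodule_over_quasi_hopf_axioms.intro assms(7,8))
  \<comment> \<open>\<open>U\<close> is the witness for twist equivalence, and unfolding
    \<open>twists_to\<close> yields the remaining conjuncts.\<close>
  have "twists_to k K A U lam1 \<Phi>1 lam2 \<Phi>2"
    unfolding twists_to_def K_def lam1_def lam2_def \<Phi>1_def \<Phi>2_def U_def
    by (intro conjI ballI U_Units U_counit U_conjugates Phi_twisted)
  then show ?thesis
    unfolding twist_equivalent_def twists_to_def by blast
qed

end
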